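(* Let $w=w_{15}$ be the Atkin-Lehner involution of $X_0(60)$ attached to $15$. There exist $x,y,t\in\mathbb{Q}(X_0(60))$ such that $\mathbb{Q}(X_0(60))=\mathbb{Q}(x,y,t)$, the subfield of functions invariant under $w^*$ is $\mathbb{Q}(x,y)$, $w^*(t)=-t$, and $$y^2=x^3+x^2-x,\qquad t^2=(-1+x+x^2)(-1+4x+x^2)(1-x+2x^2+x^3+x^4).$$ In particular these two equations are equations for $X_0(60)$ over $\mathbb{Q}$ (up to birational equivalence over $\mathbb{Q}$).
   Context: $X_0(N)$ denotes the smooth projective curve over $\mathbb{Q}$ attached to $\Gamma_0(N)$, where $\mathbb{Q}(X_0(N))$ is the subfield of $\mathbb{C}(X_0(N))$ of functions with rational $q$-expansion at the cusp $\infty$, $q=e^{2\pi i z}$. For a positive divisor $d$ of $N$ coprime to $N/d$, the Atkin-Lehner involution $w_d$ of $X_0(N)$ is induced by any matrix $\frac{1}{\sqrt d}\begin{pmatrix} A d & B\\ N C & D d\end{pmatrix}$ of determinant $1$ with $A,B,C,D\in\mathbb{Z}$; it is defined over $\mathbb{Q}$. *)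

theory Defs
  imports
    "HOL-Complex_Analysis.Complex_Analysis"
    "HOL-Algebra.Generated_Fields"
    "HOL-Algebra.QuotRing"
    "HOL-Algebra.Algebraic_Closure_Type"
begin

no_notation fps_nth (infixl \<open>$\<close> 75)

section \<open>The field of meromorphic functions on the upper half-plane\<close>

abbreviation uhp :: "complex set"
  where "uhp \<equiv> {z. Im z > 0}"

lemma open_uhp: "open uhp"
  by (rule open_halfspace_Im_gt)

lemma connected_uhp: "connected uhp"
  by (intro convex_connected convex_halfspace_Im_gt)

text \<open>
  A meromorphic function on the upper half-plane is represented by the function that has no
  removable singularities, takes the value 0 at its poles, and is 0 outside the half-plane.
\<close>

typedef mero_uhp = "{f. f nicely_meromorphic_on uhp \<and> (\<forall>z. z \<notin> uhp \<longrightarrow> f z = 0)}"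
  morphisms eval_mero Abs_mero
  by (rule exI[of _ "\<lambda>_. 0"]) auto

setup_lifting type_definition_mero_uhp

lift_definition mero_of :: "(complex \<Rightarrow> complex) \<Rightarrow> mero_uhp" is
  "\<lambda>f z. if f meromorphic_on uhp \<and> z \<in> uhp then remove_sings f z else 0"
proof -
  fix f :: "complex \<Rightarrow> complex"
  let ?g = "\<lambda>z. if f meromorphic_on uhp \<and> z \<in> uhp then remove_sings f z else 0"
  have "?g nicely_meromorphic_on uhp"
  proof (cases "f meromorphic_on uhp")
    case True
    have R: "remove_sings f nicely_meromorphic_on uhp"
      using True by (rule remove_sings_nicely_meromorphic)
    have ev: "eventually (\<lambda>w. ?g w = remove_sings f w) (at z)" if "z \<in> uhp" for z
      using eventually_at_in_open'[OF open_uhp that] by eventually_elim (use True in auto)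
    have "?g meromorphic_on uhp \<longleftrightarrow> remove_sings f meromorphic_on uhp"
      by (rule meromorphic_on_cong) (use ev in auto)
    hence "?g meromorphic_on uhp"
      using R by (auto simp: nicely_meromorphic_on_def)
    moreover have "is_pole ?g z \<and> ?g z = 0 \<or> ?g \<midarrow>z\<rightarrow> ?g z" if z: "z \<in> uhp" for z
    proof -
      have "is_pole ?g z \<longleftrightarrow> is_pole (remove_sings f) z"
        by (rule is_pole_cong) (use ev z in auto)
      moreover have "?g \<midarrow>z\<rightarrow> c \<longleftrightarrow> remove_sings f \<midarrow>z\<rightarrow> c" for c
        by (rule tendsto_cong) (use ev z in auto)
      moreover have "?g z = remove_sings f z"
        using True z by auto
      ultimately show ?thesis
        using R z unfolding nicely_meromorphic_on_def by simp
    qed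
    ultimately show ?thesis
      unfolding nicely_meromorphic_on_def by blast
  qed auto
  thus "?g nicely_meromorphic_on uhp \<and> (\<forall>z. z \<notin> uhp \<longrightarrow> ?g z = 0)"
    by auto
qed

lemma eval_mero_nicely: "eval_mero f nicely_meromorphic_on uhp"
  by transfer auto

lemma eval_mero_meromorphic [meromorphic_intros]: "eval_mero f meromorphic_on uhp"
  using eval_mero_nicely[of f] by (auto simp: nicely_meromorphic_on_def)

lemma eval_mero_of:
  assumes "f meromorphic_on uhp"
  shows   "\<forall>\<^sub>\<approx>z\<in>uhp. eval_mero (mero_of f) z = f z"
proof -
  have "\<forall>\<^sub>\<approx>z\<in>uhp. z \<in> uhp"
    by (rule eventually_in_cosparse) (use open_uhp in auto)
  with eventually_remove_sings_eq[OF assms] show ?thesis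
    by eventually_elim (use assms in \<open>simp add: mero_of.rep_eq\<close>)
qed

lemma mero_eqI:
  assumes "\<forall>\<^sub>\<approx>z\<in>uhp. eval_mero f z = eval_mero g z"
  shows   "f = g"
proof -
  have "eval_mero f z = eval_mero g z" if z: "z \<in> uhp" for z
  proof -
    have ev: "eventually (\<lambda>w. eval_mero f w = eval_mero g w) (at z)"
      using assms z by (simp add: eventually_cosparse_open_eq[OF open_uhp])
    have "is_pole (eval_mero f) z \<longleftrightarrow> is_pole (eval_mero g) z"
      by (rule is_pole_cong) (use ev in auto)
    moreover have "eval_mero f \<midarrow>z\<rightarrow> c \<longleftrightarrow> eval_mero g \<midarrow>z\<rightarrow> c" for c
      by (rule tendsto_cong) (use ev in auto)
    moreover have "is_pole (eval_mero h) z \<and> eval_mero h z = 0 \<or> eval_mero h \<midarrow>z\<rightarrow> eval_mero h z" for h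
      using eval_mero_nicely[of h] z by (auto simp: nicely_meromorphic_on_def)
    moreover have "\<not>is_pole (eval_mero h) z" if "eval_mero h \<midarrow>z\<rightarrow> c" for h c
      using that not_tendsto_and_filterlim_at_infinity[of "at z"] by (auto simp: is_pole_def)
    ultimately show ?thesis
      by (metis LIM_unique)
  qed
  moreover have "eval_mero f z = eval_mero g z" if "z \<notin> uhp" for z
    using that by (transfer, auto)
  ultimately show ?thesis
    by (metis eval_mero_inject ext)
qed

instantiation mero_uhp :: field
begin

definition zero_mero_uhp :: mero_uhp where "0 = mero_of (\<lambda>_. 0)"
definition one_mero_uhp :: mero_uhp where "1 = mero_of (\<lambda>_. 1)"
definition plus_mero_uhp :: "mero_uhp \<Rightarrow> mero_uhp \<Rightarrow> mero_uhp"
  where "f + g = mero_of (\<lambda>z. eval_mero f z + eval_mero g z)"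
definition uminus_mero_uhp :: "mero_uhp \<Rightarrow> mero_uhp"
  where "- f = mero_of (\<lambda>z. - eval_mero f z)"
definition minus_mero_uhp :: "mero_uhp \<Rightarrow> mero_uhp \<Rightarrow> mero_uhp"
  where "f - g = mero_of (\<lambda>z. eval_mero f z - eval_mero g z)"
definition times_mero_uhp :: "mero_uhp \<Rightarrow> mero_uhp \<Rightarrow> mero_uhp"
  where "f * g = mero_of (\<lambda>z. eval_mero f z * eval_mero g z)"
definition inverse_mero_uhp :: "mero_uhp \<Rightarrow> mero_uhp"
  where "inverse f = mero_of (\<lambda>z. inverse (eval_mero f z))"
definition divide_mero_uhp :: "mero_uhp \<Rightarrow> mero_uhp \<Rightarrow> mero_uhp"
  where "f div g = mero_of (\<lambda>z. eval_mero f z / eval_mero g z)"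

lemma eval_zero: "\<forall>\<^sub>\<approx>z\<in>uhp. eval_mero 0 z = 0"
  unfolding zero_mero_uhp_def by (intro eval_mero_of meromorphic_intros)
lemma eval_one: "\<forall>\<^sub>\<approx>z\<in>uhp. eval_mero 1 z = 1"
  unfolding one_mero_uhp_def by (intro eval_mero_of meromorphic_intros)
lemma eval_plus: "\<forall>\<^sub>\<approx>z\<in>uhp. eval_mero (f + g) z = eval_mero f z + eval_mero g z"
  unfolding plus_mero_uhp_def by (intro eval_mero_of meromorphic_intros)
lemma eval_uminus: "\<forall>\<^sub>\<approx>z\<in>uhp. eval_mero (- f) z = - eval_mero f z"
  unfolding uminus_mero_uhp_def by (intro eval_mero_of meromorphic_intros)
lemma eval_minus: "\<forall>\<^sub>\<approx>z\<in>uhp. eval_mero (f - g) z = eval_mero f z - eval_mero g z"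
  unfolding minus_mero_uhp_def by (intro eval_mero_of meromorphic_intros)
lemma eval_times: "\<forall>\<^sub>\<approx>z\<in>uhp. eval_mero (f * g) z = eval_mero f z * eval_mero g z"
  unfolding times_mero_uhp_def by (intro eval_mero_of meromorphic_intros)
lemma eval_inverse: "\<forall>\<^sub>\<approx>z\<in>uhp. eval_mero (inverse f) z = inverse (eval_mero f z)"
  unfolding inverse_mero_uhp_def by (intro eval_mero_of meromorphic_intros)
lemma eval_divide: "\<forall>\<^sub>\<approx>z\<in>uhp. eval_mero (f div g) z = eval_mero f z / eval_mero g z"
  unfolding divide_mero_uhp_def by (intro eval_mero_of meromorphic_intros)

instance
proof
  fix a b c :: mero_uhp
  show "a * b * c = a * (b * c)"
    by (rule mero_eqI)
      (use eval_times[of "a * b" c] eval_times[of a b] eval_times[of a "b * c"] eval_times[of b c]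
        in eventually_elim, simp)
  show "a * b = b * a"
    by (rule mero_eqI) (use eval_times[of a b] eval_times[of b a] in eventually_elim, simp)
  show "1 * a = a"
    by (rule mero_eqI) (use eval_times[of 1 a] eval_one in eventually_elim, simp)
  show "a + b + c = a + (b + c)"
    by (rule mero_eqI)
      (use eval_plus[of "a + b" c] eval_plus[of a b] eval_plus[of a "b + c"] eval_plus[of b c]
        in eventually_elim, simp)
  show "a + b = b + a"
    by (rule mero_eqI) (use eval_plus[of a b] eval_plus[of b a] in eventually_elim, simp)
  show "0 + a = a"
    by (rule mero_eqI) (use eval_plus[of 0 a] eval_zero in eventually_elim, simp)
  show "- a + a = 0"
    by (rule mero_eqI) (use eval_plus[of "- a" a] eval_uminus[of a] eval_zero in eventually_elim, simp)
  show "a - b = a + - b"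
    by (rule mero_eqI)
      (use eval_plus[of a "- b"] eval_uminus[of b] eval_minus[of a b] in eventually_elim, simp)
  show "(a + b) * c = a * c + b * c"
    by (rule mero_eqI)
      (use eval_times[of "a + b" c] eval_plus[of a b] eval_plus[of "a * c" "b * c"]
           eval_times[of a c] eval_times[of b c] in eventually_elim, simp add: algebra_simps)
  show "(0 :: mero_uhp) \<noteq> 1"
  proof
    assume "(0 :: mero_uhp) = 1"
    hence "\<forall>\<^sub>\<approx>z\<in>uhp. False"
      using eval_zero eval_one by (auto elim: eventually_elim2)
    moreover have "\<i> \<in> uhp"
      by simp
    ultimately show False
      by (auto simp: eventually_cosparse_open_eq[OF open_uhp])
  qed
  show "a div b = a * inverse b"
    by (rule mero_eqI)
      (use eval_divide[of a b] eval_inverse[of b] eval_times[of a "inverse b"]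
        in eventually_elim, simp add: field_simps)
  show "inverse (0 :: mero_uhp) = 0"
    by (rule mero_eqI) (use eval_inverse[of 0] eval_zero in eventually_elim, simp)
  show "inverse a * a = 1" if "a \<noteq> 0"
  proof -
    have "\<not>(\<forall>\<^sub>\<approx>z\<in>uhp. eval_mero a z = 0)"
    proof
      assume "\<forall>\<^sub>\<approx>z\<in>uhp. eval_mero a z = 0"
      hence "\<forall>\<^sub>\<approx>z\<in>uhp. eval_mero a z = eval_mero 0 z"
        using eval_zero by eventually_elim simp
      hence "a = 0"
        by (rule mero_eqI)
      with that show False ..
    qed
    hence "\<forall>\<^sub>\<approx>z\<in>uhp. eval_mero a z \<noteq> 0"
      using meromorphic_imp_constant_or_avoid[OF eval_mero_meromorphic open_uhp connected_uhp, of a 0]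
      by blast
    hence "\<forall>\<^sub>\<approx>z\<in>uhp. eval_mero (inverse a * a) z = eval_mero 1 z"
      using eval_inverse[of a] eval_times[of "inverse a" a] eval_one by eventually_elim simp
    thus ?thesis
      by (rule mero_eqI)
  qed
qed

end


section \<open>Action of matrices\<close>

abbreviation mat2 :: "real \<Rightarrow> real \<Rightarrow> real \<Rightarrow> real \<Rightarrow> real^2^2"
  where "mat2 a b c d \<equiv> vector [vector [a, b], vector [c, d]]"

definition moebius_map :: "real^2^2 \<Rightarrow> complex \<Rightarrow> complex"
  where "moebius_map M z = (of_real (M $ 1 $ 1) * z + of_real (M $ 1 $ 2)) /
                       (of_real (M $ 2 $ 1) * z + of_real (M $ 2 $ 2))"

definition pullback :: "real^2^2 \<Rightarrow> mero_uhp \<Rightarrow> mero_uhp"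
  where "pullback M f = mero_of (\<lambda>z. eval_mero f (moebius_map M z))"

definition SL2Z :: "(real^2^2) set"
  where "SL2Z = {M. (\<forall>i j. M $ i $ j \<in> \<int>) \<and> det M = 1}"

definition Gamma0 :: "nat \<Rightarrow> (real^2^2) set"
  where "Gamma0 N = {M \<in> SL2Z. \<exists>k::int. M $ 2 $ 1 = of_nat N * of_int k}"

lemma moebius_denom_nonzero:
  fixes M :: "real^2^2" and z :: complex
  assumes "det M > 0" "z \<in> uhp"
  shows   "of_real (M $ 2 $ 1) * z + of_real (M $ 2 $ 2) \<noteq> (0 :: complex)"
proof
  assume 0: "of_real (M $ 2 $ 1) * z + of_real (M $ 2 $ 2) = (0 :: complex)"
  hence "Im (of_real (M $ 2 $ 1) * z + of_real (M $ 2 $ 2)) = 0"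
    by simp
  with assms have c: "M $ 2 $ 1 = 0"
    by simp
  with 0 have "M $ 2 $ 2 = 0"
    by simp
  with c assms show False
    by (simp add: det_2)
qed

lemma moebius_mult:
  assumes "det A > 0" "det B > 0" "z \<in> uhp"
  shows   "moebius_map (A ** B) z = moebius_map A (moebius_map B z)"
proof -
  define p where "p = of_real (B $ 1 $ 1) * z + (of_real (B $ 1 $ 2) :: complex)"
  define q where "q = of_real (B $ 2 $ 1) * z + (of_real (B $ 2 $ 2) :: complex)"
  have q: "q \<noteq> 0"
    unfolding q_def using assms by (intro moebius_denom_nonzero)
  have "moebius_map A (moebius_map B z) =
          (of_real (A $ 1 $ 1) * (p / q) + of_real (A $ 1 $ 2)) /
          (of_real (A $ 2 $ 1) * (p / q) + of_real (A $ 2 $ 2))"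
    by (simp add: moebius_map_def p_def q_def)
  also have "of_real (A $ 1 $ 1) * (p / q) + of_real (A $ 1 $ 2) =
               (of_real (A $ 1 $ 1) * p + of_real (A $ 1 $ 2) * q) / q"
    using q by (simp add: add_divide_distrib)
  also have "of_real (A $ 2 $ 1) * (p / q) + of_real (A $ 2 $ 2) =
               (of_real (A $ 2 $ 1) * p + of_real (A $ 2 $ 2) * q) / q"
    using q by (simp add: add_divide_distrib)
  also have "(of_real (A $ 1 $ 1) * p + of_real (A $ 1 $ 2) * q) / q /
               ((of_real (A $ 2 $ 1) * p + of_real (A $ 2 $ 2) * q) / q) =
             (of_real (A $ 1 $ 1) * p + of_real (A $ 1 $ 2) * q) /
               (of_real (A $ 2 $ 1) * p + of_real (A $ 2 $ 2) * q)"
    using q by (simp only: divide_divide_times_eq mult_divide_mult_cancel_right[OF q] mult.commute[of q])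
  also have "\<dots> = moebius_map (A ** B) z"
    by (simp add: moebius_map_def p_def q_def matrix_matrix_mult_def sum_2 algebra_simps)
  finally show ?thesis ..
qed

lemma moebius_in_uhp:
  assumes "det M > 0" "z \<in> uhp"
  shows   "moebius_map M z \<in> uhp"
proof -
  define a b c d where abcd: "a = M $ 1 $ 1" "b = M $ 1 $ 2" "c = M $ 2 $ 1" "d = M $ 2 $ 2"
  have "of_real c * z + of_real d \<noteq> (0 :: complex)"
    unfolding abcd by (rule moebius_denom_nonzero) fact+
  hence nz: "(c * Re z + d)\<^sup>2 + (c * Im z)\<^sup>2 > 0"
    by (auto simp: complex_eq_iff sum_power2_gt_zero_iff)
  have "Im (moebius_map M z) =
     (a * Im z * (c * Re z + d) - (a * Re z + b) * (c * Im z)) / ((c * Re z + d)\<^sup>2 + (c * Im z)\<^sup>2)"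
    unfolding moebius_map_def abcd[symmetric] by (simp add: Im_divide)
  also have "a * Im z * (c * Re z + d) - (a * Re z + b) * (c * Im z) = det M * Im z"
    by (simp add: det_2 abcd algebra_simps)
  finally show ?thesis
    using nz assms by simp
qed

lemma moebius_analytic:
  assumes "det M > 0"
  shows   "moebius_map M analytic_on uhp"
  unfolding moebius_map_def[abs_def]
  by (intro analytic_intros) (use moebius_denom_nonzero[OF assms] in auto)

lemma pullback_meromorphic:
  assumes "det M > 0"
  shows   "(\<lambda>z. eval_mero f (moebius_map M z)) meromorphic_on uhp"
  by (rule meromorphic_on_compose[OF eval_mero_meromorphic moebius_analytic[OF assms]])
     (use moebius_in_uhp[OF assms] in auto)

lemma moebius_matrix_inv:
  assumes "det M > 0" "z \<in> uhp"
  shows   "moebius_map (matrix_inv M) (moebius_map M z) = z" "moebius_map M (moebius_map (matrix_inv M) z) = z"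
          "det (matrix_inv M) > 0"
proof -
  have inv: "invertible M"
    using assms by (simp add: invertible_det_nz)
  hence I: "M ** matrix_inv M = mat 1" "matrix_inv M ** M = mat 1"
    unfolding invertible_def matrix_inv_def by (rule someI2_ex, blast)+
  have "det M * det (matrix_inv M) = 1"
    using I by (metis det_I det_mul)
  thus *: "det (matrix_inv M) > 0"
    using assms by (metis zero_less_mult_pos zero_less_one)
  have id: "moebius_map (mat 1) z = z"
    by (simp add: moebius_map_def mat_def)
  show "moebius_map (matrix_inv M) (moebius_map M z) = z" "moebius_map M (moebius_map (matrix_inv M) z) = z"
    using moebius_mult[OF * assms] moebius_mult[OF assms(1) * assms(2)] I id by simp_all
qed

lemma eval_pullback:
  assumes "det M > 0" "z \<in> uhp"
  shows   "eval_mero (pullback M f) z = eval_mero f (moebius_map M z)"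
proof -
  let ?I = "moebius_map (matrix_inv M)"
  note inv = moebius_matrix_inv[OF assms(1)]
  have lim: "filterlim (moebius_map A) (at (moebius_map A w)) (at w)"
    if A: "det A > 0" and w: "w \<in> uhp" for A w
  proof -
    have "moebius_map A analytic_on {w}"
      using moebius_analytic[OF A] by (rule analytic_on_subset) (use w in auto)
    hence "moebius_map A \<midarrow>w\<rightarrow> moebius_map A w"
      by (intro isContD analytic_at_imp_isCont)
    moreover have "eventually (\<lambda>u. u \<in> uhp - {w}) (at w)"
      using open_uhp w by (rule eventually_at_in_open)
    hence "eventually (\<lambda>u. moebius_map A u \<noteq> moebius_map A w) (at w)"
      by eventually_elim (metis A Diff_iff moebius_matrix_inv(1) singletonI w)
    ultimately show ?thesis
      by (simp add: filterlim_at)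
  qed
  have Mz: "moebius_map M z \<in> uhp"
    using assms by (rule moebius_in_uhp)
  have "filtermap (moebius_map M) (at z) = at (moebius_map M z)"
  proof (rule filtermap_fun_inverse)
    show "filterlim ?I (at z) (at (moebius_map M z))"
      using lim[OF inv(3)[OF assms(2)] Mz] inv(1)[OF assms(2)] by simp
    show "filterlim (moebius_map M) (at (moebius_map M z)) (at z)"
      using lim assms by blast
    have "eventually (\<lambda>u. u \<in> uhp) (at (moebius_map M z))"
      using open_uhp Mz by (rule eventually_at_in_open')
    thus "eventually (\<lambda>u. moebius_map M (?I u) = u) (at (moebius_map M z))"
      by eventually_elim (rule inv(2))
  qed
  hence "remove_sings (\<lambda>z. eval_mero f (moebius_map M z)) z = remove_sings (eval_mero f) (moebius_map M z)"
    using remove_sings_compose[of "moebius_map M" z "moebius_map M z" "eval_mero f"] by (simp add: o_def)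
  also have "remove_sings (eval_mero f) w = eval_mero f w" if w: "w \<in> uhp" for w
  proof (cases "is_pole (eval_mero f) w")
    case True
    thus ?thesis
      using eval_mero_nicely[of f] w not_tendsto_and_filterlim_at_infinity[of "at w" "eval_mero f"]
      by (auto simp: nicely_meromorphic_on_def is_pole_def[of "eval_mero f" w])
  next
    case False
    thus ?thesis
      using eval_mero_nicely[of f] w by (auto simp: nicely_meromorphic_on_def)
  qed
  hence "remove_sings (eval_mero f) (moebius_map M z) = eval_mero f (moebius_map M z)"
    using Mz by blast
  finally show ?thesis
    using pullback_meromorphic[OF assms(1)] assms(2) by (simp add: pullback_def mero_of.rep_eq)
qed

lemma pullback_mult:
  assumes "det A > 0" "det B > 0"
  shows   "pullback (A ** B) f = pullback B (pullback A f)"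
proof (rule mero_eqI)
  have "\<forall>\<^sub>\<approx>z\<in>uhp. z \<in> uhp"
    by (rule eventually_in_cosparse) (use open_uhp in auto)
  thus "\<forall>\<^sub>\<approx>z\<in>uhp. eval_mero (pullback (A ** B) f) z = eval_mero (pullback B (pullback A f)) z"
  proof eventually_elim
    case (elim z)
    have "det (A ** B) > 0"
      using assms by (simp add: det_mul)
    thus ?case
      using elim assms moebius_in_uhp[OF assms(2), of z]
      by (simp add: eval_pullback moebius_mult)
  qed
qed


section \<open>The function field of the modular curve\<close>

text \<open>
  \<open>has_q_expansion h f F\<close> means that \<open>f(z)\<close> is the convergent Laurent series \<open>F\<close>
  in \<open>exp (2 \<pi> i z / h)\<close> when the imaginary part of \<open>z\<close> is large. A formal Laurent series
  has only finitely many negative terms, so this says that \<open>f\<close> is meromorphic at \<open>i \<infinity>\<close>.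
\<close>

definition has_q_expansion :: "nat \<Rightarrow> mero_uhp \<Rightarrow> complex fls \<Rightarrow> bool"
  where "has_q_expansion h f F \<longleftrightarrow> fls_conv_radius F > 0 \<and>
           (\<forall>\<^sub>F z in filtercomap Im at_top.
              eval_mero f z = eval_fls F (exp (2 * of_real pi * \<i> * z / of_nat h)))"

text \<open>
  The complex function field. Every cusp is of the form \<open>M \<infinity>\<close> with \<open>M\<close> in \<open>SL2Z\<close>.
\<close>

definition complex_function_field_X0 :: "nat \<Rightarrow> mero_uhp set"
  where "complex_function_field_X0 N = {f. (\<forall>M\<in>Gamma0 N. pullback M f = f) \<and>
           (\<forall>M\<in>SL2Z. \<exists>h>0. \<exists>F. has_q_expansion h (pullback M f) F)}"

definition function_field_X0 :: "nat \<Rightarrow> mero_uhp set"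
  where "function_field_X0 N = {f \<in> complex_function_field_X0 N.
           \<exists>F. has_q_expansion 1 f F \<and> (\<forall>n. fls_nth F n \<in> \<rat>)}"

definition atkin_lehner_matrices :: "nat \<Rightarrow> nat \<Rightarrow> (real^2^2) set"
  where "atkin_lehner_matrices N d = {M. \<exists>A B C D :: int.
           M = (1 / sqrt (of_nat d)) *\<^sub>R
                 mat2 (of_int A * of_nat d) (of_int B) (of_nat N * of_int C) (of_int D * of_nat d) \<and>
           det M = 1}"

text \<open>
  Pullback along the Atkin-Lehner involution. The lemmas \<open>atkin_lehner_matrices_nonempty\<close> and
  \<open>atkin_lehner_eq\<close> below show that a matrix exists and that the choice of matrix is immaterial.
\<close>

definition atkin_lehner :: "nat \<Rightarrow> nat \<Rightarrow> mero_uhp \<Rightarrow> mero_uhp"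
  where "atkin_lehner N d f = pullback (SOME M. M \<in> atkin_lehner_matrices N d) f"

lemma det_mat2_scaled:
  assumes "d > 0"
  shows "det ((1 / sqrt (of_nat d)) *\<^sub>R mat2 a b c e) = (a * e - b * c) / of_nat d"
  using assms by (simp add: det_2 field_simps)

lemma atkin_lehner_matrices_nonempty:
  assumes "d > 0" "d dvd N" "coprime d (N div d)"
  shows   "atkin_lehner_matrices N d \<noteq> {}"
proof -
  obtain e where e: "N = d * e"
    using assms by auto
  have "coprime (int d) (int e)"
    using assms e by simp
  then obtain u v where uv: "u * int d + v * int e = 1"
    by (metis bezout_int coprime_iff_gcd_eq_1)
  let ?M = "(1 / sqrt (of_nat d)) *\<^sub>R
      mat2 (of_int u * of_nat d) (of_int (- v)) (of_nat N * of_int 1) (of_int 1 * of_nat d)"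
  have "det ?M = of_int (u * int d + v * int e)"
    using assms by (subst det_mat2_scaled) (auto simp: e field_simps)
  hence "det ?M = 1"
    using uv by simp
  hence "?M \<in> atkin_lehner_matrices N d"
    unfolding atkin_lehner_matrices_def
    by (intro CollectI exI[of _ u] exI[of _ "- v"] exI[of _ 1] conjI refl)
  thus ?thesis
    by blast
qed

lemma pullback_atkin_lehner_unique:
  assumes "d > 0" "d dvd N" "\<forall>M\<in>Gamma0 N. pullback M f = f"
  assumes M: "M \<in> atkin_lehner_matrices N d" and M': "M' \<in> atkin_lehner_matrices N d"
  shows   "pullback M' f = pullback M f"
proof -
  obtain e where e: "N = d * e"
    using assms by auto
  from M obtain A B C D :: int where ABCD:
    "M = (1 / sqrt (of_nat d)) *\<^sub>R
           mat2 (of_int A * of_nat d) (of_int B) (of_nat N * of_int C) (of_int D * of_nat d)"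
    and M1: "det M = 1"
    by (auto simp: atkin_lehner_matrices_def)
  from M' obtain A' B' C' D' :: int where ABCD':
    "M' = (1 / sqrt (of_nat d)) *\<^sub>R
           mat2 (of_int A' * of_nat d) (of_int B') (of_nat N * of_int C') (of_int D' * of_nat d)"
    and M1': "det M' = 1"
    by (auto simp: atkin_lehner_matrices_def)
  define G where "G = mat2 (of_int (A' * D * int d - B' * C * int e)) (of_int (B' * A - A' * B))
     (of_int (int N * (C' * D - D' * C))) (of_int (D' * A * int d - C' * B * int e))"
  have det1: "of_int A * of_int D * of_nat d - of_int B * of_int C * of_nat e = (1::real)"
    using M1 assms unfolding ABCD by (subst (asm) det_mat2_scaled) (auto simp: e field_simps)
  have GM: "G ** M = M'"
  proof -
    define D0 :: real where "D0 = of_int A * of_int D * of_nat d - of_int B * of_int C * of_nat e"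
    let ?M0 = "mat2 (of_int A * of_nat d) (of_int B) (of_nat N * of_int C) (of_int D * of_nat d)"
    let ?M0' = "mat2 (of_int A' * of_nat d) (of_int B') (of_nat N * of_int C') (of_int D' * of_nat d)"
    have "(G ** ?M0) $ i $ j = D0 * ?M0' $ i $ j" for i j
      by (rule disjE[OF exhaust_2[of i]]; rule disjE[OF exhaust_2[of j]];
          simp add: G_def D0_def matrix_matrix_mult_def sum_2 e algebra_simps)
    hence "G ** ?M0 = ?M0'"
      using det1 by (simp add: vec_eq_iff D0_def)
    moreover have "G ** (c *\<^sub>R Q) = c *\<^sub>R (G ** Q)" for c :: real and Q :: "real^2^2"
      by (simp add: matrix_matrix_mult_def vec_eq_iff sum_2 algebra_simps)
    ultimately show ?thesis
      unfolding ABCD ABCD' by simp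
  qed
  hence G1: "det G = 1"
    using M1 M1' by (metis det_mul mult.right_neutral)
  have "G \<in> Gamma0 N"
    unfolding Gamma0_def SL2Z_def
  proof (intro CollectI conjI allI)
    show "G $ i $ j \<in> \<int>" for i j
    proof -
      have "i = 1 \<or> i = 2" "j = 1 \<or> j = 2"
        by (rule exhaust_2)+
      thus ?thesis
        unfolding G_def by (auto simp del: of_int_diff of_int_mult)
    qed
    show "\<exists>k::int. G $ 2 $ 1 = real N * of_int k"
      by (rule exI[of _ "C' * D - D' * C"]) (simp add: G_def)
  qed (fact G1)
  hence "pullback G f = f"
    using assms by blast
  moreover have "pullback (G ** M) f = pullback M (pullback G f)"
    by (rule pullback_mult) (use M1 G1 in auto)
  ultimately show ?thesis
    using GM by simp
qed

lemma atkin_lehner_eq: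
  assumes "d > 0" "d dvd N" "f \<in> complex_function_field_X0 N" "M \<in> atkin_lehner_matrices N d"
  shows   "atkin_lehner N d f = pullback M f"
  unfolding atkin_lehner_def
proof (rule pullback_atkin_lehner_unique)
  show "\<forall>M\<in>Gamma0 N. pullback M f = f"
    using assms by (auto simp: complex_function_field_X0_def)
  show "(SOME M. M \<in> atkin_lehner_matrices N d) \<in> atkin_lehner_matrices N d"
    using assms(4) by (rule someI)
qed (use assms in auto)


section \<open>Generated subfields and equations\<close>

text \<open>
  The least subfield containing \<open>S\<close>; for the field \<open>mero_uhp\<close>, which has characteristic 0,
  this is \<open>\<rat>(S)\<close>.
\<close>

definition field_gen :: "'a::field set \<Rightarrow> 'a set"
  where "field_gen S = generate_field ring_of_type_algebra S"

text \<open>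
  \<open>rat poly poly poly\<close> is the polynomial ring \<open>\<rat>[X,Y,T]\<close> in the three variables below.
\<close>

abbreviation indetX :: "rat poly poly poly" where "indetX \<equiv> [:[:[:0, 1:]:]:]"
abbreviation indetY :: "rat poly poly poly" where "indetY \<equiv> [:[:0, 1:]:]"
abbreviation indetT :: "rat poly poly poly" where "indetT \<equiv> [:0, 1:]"

abbreviation QXYT :: "rat poly poly poly ring"
  where "QXYT \<equiv> ring_of_type_algebra"

definition coordinate_ring :: "rat poly poly poly set \<Rightarrow> rat poly poly poly set ring"
  where "coordinate_ring E = QXYT Quot (genideal QXYT E)"

text \<open>
  \<open>K\<close> is the field of fractions of the coordinate ring of the affine scheme over \<open>\<rat>\<close>
  defined by \<open>E\<close>, with coordinate functions \<open>x\<close>, \<open>y\<close>, \<open>t\<close>. So \<open>E\<close> is a set of equations, up to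
  birational equivalence over \<open>\<rat>\<close>, for the curve with function field \<open>K\<close>.
\<close>

definition equations_for :: "rat poly poly poly set \<Rightarrow> 'a::field set \<Rightarrow> 'a \<Rightarrow> 'a \<Rightarrow> 'a \<Rightarrow> bool"
  where "equations_for E K x y t \<longleftrightarrow>
     domain (coordinate_ring E) \<and>
     (\<exists>\<phi> \<in> ring_hom (coordinate_ring E) (ring_of_type_algebra\<lparr>carrier := K\<rparr>).
        inj_on \<phi> (carrier (coordinate_ring E)) \<and>
        \<phi> (genideal QXYT E +>\<^bsub>QXYT\<^esub> indetX) = x \<and>
        \<phi> (genideal QXYT E +>\<^bsub>QXYT\<^esub> indetY) = y \<and>
        \<phi> (genideal QXYT E +>\<^bsub>QXYT\<^esub> indetT) = t \<and>
        K = {\<phi> a / \<phi> b | a b. a \<in> carrier (coordinate_ring E) \<and> b \<in> carrier (coordinate_ring E) \<and>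
                              \<phi> b \<noteq> 0})"

end

theory Submission
  imports Defs
begin

text \<open>
  The functions are eta quotients. With
  \<open>\<eta>\<^sub>d(z) = \<eta>(d z)\<close>, put \<open>x = \<eta>\<^sub>6 \<eta>\<^sub>1\<^sub>0 / (\<eta>\<^sub>4 \<eta>\<^sub>6\<^sub>0) - 1\<close>,
  let \<open>y - 1\<close> be an eta quotient invariant under \<open>w\<close>, and let \<open>t = u - w(u)\<close> for an eta quotient \<open>u\<close> with
  a pole of order 8 at infinity. The functions \<open>x\<close> and \<open>y\<close> have poles of order 2 and 3 at the cusp \<open>\<infinity>\<close>
  of the quotient by \<open>w\<close> and no others. A \<open>w\<close>-invariant function without poles outside the class of \<open>\<infinity>\<close>
  that vanishes at \<open>\<infinity>\<close> is 0, so every relation between such functions is a finite computation with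
  \<open>q\<close>-expansions: this gives the equation of \<open>y\<close>, the values \<open>u + w(u) = x\<^sup>4 + 3 x\<^sup>3 + 3 x - 1\<close> and
  \<open>u w(u) = 5 x\<^sup>4\<close>, and hence the equation of \<open>t\<close>.

  Over \<open>\<complex>\<close>, poles away from \<open>\<infinity>\<close> are cleared by a polynomial in \<open>x\<close>, and leading terms are then
  removed with \<open>x\<^sup>i\<close> and \<open>x\<^sup>i y\<close>; so the invariant functions are \<open>\<complex>(x, y)\<close>, and a general \<open>f\<close> is treated
  through \<open>f + w(f)\<close> and \<open>(f - w(f)) t\<close>. A \<open>\<rat>\<close>-linear functional \<open>\<complex> \<rightarrow> \<rat>\<close>, applied to the coefficients of
  a linear relation between functions with rational expansions, brings the result down to \<open>\<rat>\<close>.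

  That the eta quotients are modular follows from Klein forms: the theta function is determined by its zeros and
  quasi-periods, so Klein forms are permuted by \<open>SL\<^sub>2(\<int>)\<close> without any multiplier, and suitable products of them
  are eta quotients.
\<close>

section \<open>Infinite products\<close>

text \<open>Two obstacles shape the proof. The eta function transforms with a multiplier built from
  24th roots of unity, so its own transformation law is used only for absolute values. That is
  enough for the orders at the cusps and, by the maximum modulus principle, for the action of
  \<open>w\<close> up to a constant factor; exact invariance under
  \<open>\<Gamma>\<^sub>0(60)\<close> is obtained on the side of Klein forms, where only explicit
  roots of unity and quadratic characters have to cancel. The other obstacle is the absence of
  Riemann-Roch. The monomials \<open>x^i\<close> and \<open>x^i y\<close> have the pole orders 0, 2,
  3, 4, ..., and a possible simple pole is not excluded by a genus argument: the remainders of
  \<open>g\<close> and of \<open>x g\<close> are compared instead. All poles sit over one point of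
  the quotient because \<open>w\<close> exchanges the cusps \<infinity> and 1/4, and every eta
  quotient that occurs has poles in these two classes only. Expansions are computed to eleven terms:
  the deepest pole has order 8, and the coefficient of \<open>q^2\<close> is used once, to find a
  constant.\<close>

lemma holomorphic_prodinf_1_plus:
  fixes f :: "nat \<Rightarrow> complex \<Rightarrow> complex"
  assumes "open A" and hol: "\<And>n. f n holomorphic_on A"
    and bound: "\<And>x. x \<in> A \<Longrightarrow> \<exists>d>0. \<exists>M. cball x d \<subseteq> A \<and> summable M \<and> (\<forall>n. \<forall>z\<in>cball x d. norm (f n z) \<le> M n)"
  shows "(\<lambda>z. \<Prod>n. 1 + f n z) holomorphic_on A"
proof (rule holomorphic_uniform_sequence[OF \<open>open A\<close>])
  show "(\<lambda>z. \<Prod>n<N. 1 + f n z) holomorphic_on A" for N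
    by (intro holomorphic_intros hol)
  fix x assume x: "x \<in> A"
  obtain d M where d: "d > 0" "cball x d \<subseteq> A" "summable M"
      and M: "\<And>n z. z \<in> cball x d \<Longrightarrow> norm (f n z) \<le> M n"
    using bound[OF x] by blast
  have "uniformly_convergent_on (cball x d) (\<lambda>N z. \<Sum>n<N. norm (f n z))"
    by (rule Weierstrass_m_test'[where M = M]) (simp_all add: M d(3))
  moreover have "continuous_on (cball x d) (f n)" for n
    using holomorphic_on_subset[OF hol[of n] d(2)] by (rule holomorphic_on_imp_continuous_on)
  ultimately have "uniformly_convergent_on (cball x d) (\<lambda>N z. \<Prod>n<N. 1 + f n z)"
    by (intro uniformly_convergent_on_prod) auto
  then obtain g where g: "uniform_limit (cball x d) (\<lambda>N z. \<Prod>n<N. 1 + f n z) g sequentially"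
    by (auto simp: uniformly_convergent_on_def)
  also have "?this \<longleftrightarrow> uniform_limit (cball x d) (\<lambda>N z. \<Prod>n<N. 1 + f n z) (\<lambda>z. \<Prod>n. 1 + f n z) sequentially"
  proof (intro uniform_limit_cong)
    fix z assume z: "z \<in> cball x d"
    have "summable (\<lambda>n. norm (f n z))"
      by (rule summable_comparison_test'[OF d(3), of 0]) (use M[OF z] in simp)
    hence "abs_convergent_prod (\<lambda>n. 1 + f n z)"
      by (intro summable_imp_abs_convergent_prod) auto
    hence "convergent_prod (\<lambda>n. 1 + f n z)"
      by (rule abs_convergent_prod_imp_convergent_prod)
    from convergent_prod_LIMSEQ[OF this]
    have "(\<lambda>N. \<Prod>n<N. 1 + f n z) \<longlonglongrightarrow> (\<Prod>n. 1 + f n z)"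
      by (subst filterlim_sequentially_Suc[symmetric]) (simp add: lessThan_Suc_atMost)
    moreover have "(\<lambda>N. \<Prod>n<N. 1 + f n z) \<longlonglongrightarrow> g z"
      using g z by (rule tendsto_uniform_limitI)
    ultimately show "g z = (\<Prod>n. 1 + f n z)"
      using LIMSEQ_unique by blast
  qed auto
  finally show "\<exists>d>0. cball x d \<subseteq> A \<and> uniform_limit (cball x d) (\<lambda>N z. \<Prod>n<N. 1 + f n z) (\<lambda>z. \<Prod>n. 1 + f n z) sequentially"
    using d by blast
qed

section \<open>The q-Pochhammer symbol and Euler's product\<close>

definition qpoch :: "complex \<Rightarrow> complex \<Rightarrow> complex"
  where "qpoch a q = (\<Prod>n. 1 - a * q ^ n)"

lemma convergent_qpoch:
  fixes a q :: complex
  assumes "norm q < 1"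
  shows "convergent_prod (\<lambda>n. 1 - a * q ^ n)"
proof -
  have "summable (\<lambda>n. norm a * norm q ^ n)"
    using assms by (intro summable_mult summable_geometric) auto
  moreover have "norm (1 - a * q ^ n - 1) = norm a * norm q ^ n" for n
    by (simp add: norm_mult norm_power)
  ultimately have "abs_convergent_prod (\<lambda>n. 1 - a * q ^ n)"
    unfolding abs_convergent_prod_conv_summable by simp
  thus ?thesis
    by (rule abs_convergent_prod_imp_convergent_prod)
qed

lemma qpoch_LIMSEQ:
  assumes "norm q < 1"
  shows "(\<lambda>N. \<Prod>n<N. 1 - a * q ^ n) \<longlonglongrightarrow> qpoch a q"
  unfolding qpoch_def
  by (subst filterlim_sequentially_Suc[symmetric])
     (use convergent_prod_LIMSEQ[OF convergent_qpoch[OF assms]] in \<open>simp add: lessThan_Suc_atMost\<close>)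

lemma qpoch_eq_0_iff:
  assumes "norm q < 1"
  shows "qpoch a q = 0 \<longleftrightarrow> (\<exists>n. a * q ^ n = 1)"
proof -
  have "(\<lambda>n. 1 - a * q ^ n) has_prod qpoch a q"
    unfolding qpoch_def by (intro convergent_prod_has_prod convergent_qpoch assms)
  from has_prod_eq_0_iff[OF this] show ?thesis
    by auto
qed

lemma qpoch_rec:
  assumes "norm q < 1"
  shows "qpoch a q = (1 - a) * qpoch (a * q) q"
proof -
  have "(\<lambda>N. \<Prod>n<Suc N. 1 - a * q ^ n) \<longlonglongrightarrow> qpoch a q"
    using qpoch_LIMSEQ[OF assms] by (subst filterlim_sequentially_Suc)
  moreover have "(\<Prod>n<Suc N. 1 - a * q ^ n) = (1 - a) * (\<Prod>n<N. 1 - (a * q) * q ^ n)" for N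
    by (subst prod.lessThan_Suc_shift) (simp add: mult_ac)
  moreover have "(\<lambda>N. (1 - a) * (\<Prod>n<N. 1 - (a * q) * q ^ n)) \<longlonglongrightarrow> (1 - a) * qpoch (a * q) q"
    by (intro tendsto_intros qpoch_LIMSEQ assms)
  ultimately show ?thesis
    by (metis (no_types, lifting) LIMSEQ_unique ext)
qed

lemma qpoch_0 [simp]: "qpoch 0 q = 1"
  by (simp add: qpoch_def)

lemma holomorphic_qpoch_left:
  assumes "norm q < 1"
  shows "(\<lambda>a. qpoch a q) holomorphic_on A"
proof (rule holomorphic_on_subset[of _ UNIV])
  have "(\<lambda>a. \<Prod>n. 1 + (- a * q ^ n)) holomorphic_on UNIV"
  proof (rule holomorphic_prodinf_1_plus)
    fix x :: complex
    show "\<exists>d>0. \<exists>M. cball x d \<subseteq> UNIV \<and> summable M \<and> (\<forall>n. \<forall>z\<in>cball x d. norm (- z * q ^ n) \<le> M n)"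
    proof (intro exI[of _ 1] conjI allI ballI exI[of _ "\<lambda>n. (norm x + 1) * norm q ^ n"])
      show "summable (\<lambda>n. (norm x + 1) * norm q ^ n)"
        using assms by (intro summable_mult summable_geometric) auto
      fix n z assume "z \<in> cball x 1"
      hence "norm z \<le> norm x + 1"
        by (auto simp: dist_norm) (smt (verit) norm_triangle_ineq2 norm_minus_commute)
      thus "norm (- z * q ^ n) \<le> (norm x + 1) * norm q ^ n"
        by (simp add: norm_mult norm_power mult_right_mono)
    qed auto
  qed (auto intro!: holomorphic_intros)
  thus "(\<lambda>a. qpoch a q) holomorphic_on UNIV"
    by (simp add: qpoch_def)
qed auto

definition euler_phi :: "complex \<Rightarrow> complex"
  where "euler_phi q = qpoch q q"

lemma holomorphic_euler_phi: "euler_phi holomorphic_on ball 0 1"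
proof -
  have "(\<lambda>q. \<Prod>n. 1 + (- (q ^ Suc n))) holomorphic_on ball 0 1"
  proof (rule holomorphic_prodinf_1_plus)
    fix x :: complex assume "x \<in> ball 0 1"
    hence x: "norm x < 1" by simp
    define r where "r = (1 + norm x) / 2"
    have r: "norm x < r" "r < 1"
      using x by (auto simp: r_def)
    have nz: "norm z \<le> r" if "z \<in> cball x (r - norm x)" for z
      using that by (auto simp: dist_norm) (smt (verit) norm_triangle_ineq2 norm_minus_commute)
    show "\<exists>d>0. \<exists>M. cball x d \<subseteq> ball 0 1 \<and> summable M \<and> (\<forall>n. \<forall>z\<in>cball x d. norm (- (z ^ Suc n)) \<le> M n)"
    proof (intro exI[of _ "r - norm x"] conjI allI ballI exI[of _ "\<lambda>n. r ^ Suc n"])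
      show "summable (\<lambda>n. r ^ Suc n)"
        by (subst summable_Suc_iff, rule summable_geometric) (use r in \<open>auto simp: r_def\<close>)
      show "norm (- (z ^ Suc n)) \<le> r ^ Suc n" if "z \<in> cball x (r - norm x)" for z n
        unfolding norm_minus_cancel norm_power by (intro power_mono nz that) auto
      show "cball x (r - norm x) \<subseteq> ball 0 1"
        using nz r by force
    qed (use r in auto)
  qed (auto intro!: holomorphic_intros)
  thus ?thesis
    by (simp add: qpoch_def euler_phi_def[abs_def])
qed

lemma power_ne_1:
  assumes "norm (q :: complex) < 1" "n > 0"
  shows "q ^ n \<noteq> 1"
proof
  assume "q ^ n = 1"
  hence "norm q ^ n = 1"
    by (metis norm_one norm_power)
  moreover have "norm q ^ n < 1"
    using assms by (simp add: power_less_one_iff)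
  ultimately show False
    by simp
qed

lemma euler_phi_nonzero:
  assumes "norm q < 1"
  shows "euler_phi q \<noteq> 0"
  using power_ne_1[OF assms, of "Suc n" for n] by (auto simp: euler_phi_def qpoch_eq_0_iff[OF assms])

lemma euler_phi_0 [simp]: "euler_phi 0 = 1"
  by (simp add: euler_phi_def)

lemma euler_phi_tendsto_1:
  assumes "(f \<longlongrightarrow> 0) F"
  shows "((\<lambda>x. euler_phi (f x)) \<longlongrightarrow> 1) F"
proof -
  have "isCont euler_phi 0"
    using holomorphic_on_imp_continuous_on[OF holomorphic_euler_phi]
    by (auto simp: continuous_on_eq_continuous_at)
  from isCont_tendsto_compose[OF this assms] show ?thesis
    by simp
qed

lemma qpoch_split_even_odd:
  assumes "norm q < 1"
  shows "qpoch a q = qpoch a (q\<^sup>2) * qpoch (a * q) (q\<^sup>2)"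
proof -
  have q2: "norm (q\<^sup>2) < 1"
    using assms by (simp add: norm_power power_less_one_iff)
  have "(\<Prod>n<2*N. 1 - a * q ^ n) = (\<Prod>n<N. 1 - a * (q\<^sup>2) ^ n) * (\<Prod>n<N. 1 - a * q * (q\<^sup>2) ^ n)" for N
    by (induction N) (simp_all add: power_mult [symmetric] mult_ac)
  hence "(\<lambda>N. \<Prod>n<2*N. 1 - a * q ^ n) \<longlonglongrightarrow> qpoch a (q\<^sup>2) * qpoch (a * q) (q\<^sup>2)"
    using tendsto_mult[OF qpoch_LIMSEQ[OF q2, of a] qpoch_LIMSEQ[OF q2, of "a * q"]] by simp
  moreover have "(\<lambda>N. \<Prod>n<2*N. 1 - a * q ^ n) \<longlonglongrightarrow> qpoch a q"
    by (rule filterlim_compose[OF qpoch_LIMSEQ[OF assms]]) (rule mult_nat_left_at_top, simp)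
  ultimately show ?thesis
    using LIMSEQ_unique by blast
qed

lemma qpoch_mult_minus:
  assumes "norm q < 1"
  shows "qpoch a q * qpoch (- a) q = qpoch (a\<^sup>2) (q\<^sup>2)"
proof -
  have q2: "norm (q\<^sup>2) < 1"
    using assms by (simp add: norm_power power_less_one_iff)
  have "(\<lambda>N. (\<Prod>n<N. 1 - a * q ^ n) * (\<Prod>n<N. 1 - (- a) * q ^ n)) \<longlonglongrightarrow> qpoch a q * qpoch (- a) q"
    by (intro tendsto_mult qpoch_LIMSEQ assms)
  also have "(\<lambda>N. (\<Prod>n<N. 1 - a * q ^ n) * (\<Prod>n<N. 1 - (- a) * q ^ n)) = (\<lambda>N. \<Prod>n<N. 1 - a\<^sup>2 * (q\<^sup>2) ^ n)"
    unfolding prod.distrib[symmetric] by (intro ext prod.cong) (auto simp: algebra_simps power_mult_distrib power2_eq_square)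
  finally show ?thesis
    using qpoch_LIMSEQ[OF q2, of "a\<^sup>2"] LIMSEQ_unique by blast
qed

text \<open>Termwise, this is \<open>(1 - x) \<Prod>\<^sub>j (1 - \<zeta>\<^sup>j x) (1 - \<zeta>\<^sup>-\<^sup>j x) = 1 - x\<^sup>N\<close>.\<close>

lemma qpoch_prod_roots:
  assumes q: "norm q < 1" and "N > 0"
    and roots: "\<And>x::complex. (1 - x) * (\<Prod>\<zeta>\<in>#Z. 1 - \<zeta> * x) = 1 - x ^ N"
  shows "euler_phi q * (\<Prod>\<zeta>\<in>#Z. qpoch (\<zeta> * q) q) = euler_phi (q ^ N)"
proof -
  have qN: "norm (q ^ N) < 1"
    using assms by (simp add: norm_power power_less_one_iff)
  have "(\<lambda>M. (\<Prod>n<M. 1 - q * q ^ n) * (\<Prod>\<zeta>\<in>#Z. \<Prod>n<M. 1 - (\<zeta> * q) * q ^ n)) \<longlonglongrightarrow>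
          euler_phi q * (\<Prod>\<zeta>\<in>#Z. qpoch (\<zeta> * q) q)"
  proof (intro tendsto_mult)
    show "(\<lambda>M. \<Prod>\<zeta>\<in>#Z. \<Prod>n<M. 1 - (\<zeta> * q) * q ^ n) \<longlonglongrightarrow> (\<Prod>\<zeta>\<in>#Z. qpoch (\<zeta> * q) q)"
      by (induction Z) (auto intro!: tendsto_mult qpoch_LIMSEQ q)
    show "(\<lambda>M. \<Prod>n<M. 1 - q * q ^ n) \<longlonglongrightarrow> euler_phi q"
      unfolding euler_phi_def by (rule qpoch_LIMSEQ[OF q])
  qed
  moreover have *: "(\<Prod>\<zeta>\<in>#Z. \<Prod>n<M. 1 - (\<zeta> * q) * q ^ n) = (\<Prod>n<M. \<Prod>\<zeta>\<in>#Z. 1 - \<zeta> * q ^ Suc n)" for M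
    by (induction Z) (simp_all add: prod.distrib mult_ac)
  have "(\<Prod>n<M. 1 - q * q ^ n) * (\<Prod>\<zeta>\<in>#Z. \<Prod>n<M. 1 - (\<zeta> * q) * q ^ n) = (\<Prod>n<M. 1 - q ^ N * (q ^ N) ^ n)" for M
  proof -
    have "(\<Prod>n<M. 1 - q * q ^ n) * (\<Prod>\<zeta>\<in>#Z. \<Prod>n<M. 1 - (\<zeta> * q) * q ^ n) =
            (\<Prod>n<M. (1 - q ^ Suc n) * (\<Prod>\<zeta>\<in>#Z. 1 - \<zeta> * q ^ Suc n))"
      by (simp add: prod.distrib *)
    also have "\<dots> = (\<Prod>n<M. 1 - q ^ N * (q ^ N) ^ n)"
      unfolding roots by (intro prod.cong refl) (simp add: power_mult power_mult_distrib mult.commute flip: power_mult power_add)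
    finally show ?thesis .
  qed
  ultimately show ?thesis
    using qpoch_LIMSEQ[OF qN, of "q ^ N"] LIMSEQ_unique by (simp add: euler_phi_def)
qed

section \<open>The nome and a normalised theta function\<close>

definition to_q :: "complex \<Rightarrow> complex"
  where "to_q z = exp (2 * of_real pi * \<i> * z)"

lemma to_q_add: "to_q (a + b) = to_q a * to_q b"
  by (simp add: to_q_def exp_add ring_distribs)

lemma to_q_diff: "to_q (a - b) = to_q a / to_q b"
  by (simp add: to_q_def exp_diff ring_distribs)

lemma to_q_uminus: "to_q (- a) = 1 / to_q a"
  by (simp add: to_q_def exp_minus field_simps)

lemma to_q_0 [simp]: "to_q 0 = 1"
  by (simp add: to_q_def)

lemma to_q_nonzero [simp]: "to_q z \<noteq> 0"
  by (simp add: to_q_def)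

lemma to_q_eq_1_iff: "to_q z = 1 \<longleftrightarrow> z \<in> \<int>"
proof -
  have "to_q z = 1 \<longleftrightarrow> Im z = 0 \<and> (\<exists>n::int. Re z = of_int n)"
    by (auto simp: to_q_def exp_eq_1)
  thus ?thesis
    by (auto simp: complex_is_Int_iff elim!: Ints_cases)
qed

lemma to_q_of_int [simp]: "to_q (of_int n) = 1"
  by (simp add: to_q_eq_1_iff)

lemma to_q_1 [simp]: "to_q 1 = 1"
  using to_q_of_int[of 1] by simp

lemma to_q_power: "to_q z ^ n = to_q (of_nat n * z)"
  by (simp add: to_q_def exp_of_nat_mult [symmetric] mult_ac)

lemma norm_to_q: "norm (to_q z) = exp (- 2 * pi * Im z)"
  by (simp add: to_q_def)

lemma norm_to_q_less_1 [simp]: "Im z > 0 \<Longrightarrow> norm (to_q z) < 1"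
  by (simp add: norm_to_q)

lemma holomorphic_to_q [holomorphic_intros]:
  "f holomorphic_on A \<Longrightarrow> (\<lambda>z. to_q (f z)) holomorphic_on A"
  unfolding to_q_def by (intro holomorphic_intros)

text \<open>For fixed \<tau> this is a multiple of Jacobi's odd theta function. The division by the
  square of \<open>euler_phi\<close> makes the derivative at 0 equal to 2 \<pi> i for every \<tau>,
  so that a comparison between two values of \<tau> produces no constant.\<close>

definition theta_s :: "complex \<Rightarrow> complex \<Rightarrow> complex"
  where "theta_s z \<tau> = (exp (of_real pi * \<i> * z) - exp (- (of_real pi * \<i> * z))) *
           qpoch (to_q (\<tau> + z)) (to_q \<tau>) * qpoch (to_q (\<tau> - z)) (to_q \<tau>) / euler_phi (to_q \<tau>) ^ 2"

lemma theta_s_uminus: "theta_s (- z) \<tau> = - theta_s z \<tau>"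
  by (simp add: theta_s_def diff_divide_distrib algebra_simps)

lemma theta_s_0 [simp]: "theta_s 0 \<tau> = 0"
  by (simp add: theta_s_def)

lemma theta_s_plus_1: "theta_s (z + 1) \<tau> = - theta_s z \<tau>"
proof -
  have "exp (of_real pi * \<i> * (z + 1)) = - exp (of_real pi * \<i> * z)"
    "exp (- (of_real pi * \<i> * (z + 1))) = - exp (- (of_real pi * \<i> * z))"
    by (simp_all add: ring_distribs exp_add exp_diff exp_minus)
  moreover have "to_q (\<tau> + (z + 1)) = to_q (\<tau> + z)" "to_q (\<tau> - (z + 1)) = to_q (\<tau> - z)"
    by (simp_all add: to_q_add to_q_diff)
  ultimately show ?thesis
    unfolding theta_s_def by (simp only:) (simp add: diff_divide_distrib algebra_simps)
qed

text \<open>The shift by \<tau> takes one factor out of the first product and puts one into the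
  second, and these two factors turn the old sine factor into the new one. The square roots
  \<open>w\<close> and \<open>u\<close> of the two nomes avoid fractional powers.\<close>

lemma theta_s_plus_tau:
  assumes "Im \<tau> > 0"
  shows "theta_s (z + \<tau>) \<tau> = - exp (- 2 * of_real pi * \<i> * z - of_real pi * \<i> * \<tau>) * theta_s z \<tau>"
proof -
  define w u where "w = exp (of_real pi * \<i> * z)" and "u = exp (of_real pi * \<i> * \<tau>)"
  have nz: "w \<noteq> 0" "u \<noteq> 0"
    by (auto simp: w_def u_def)
  have sq: "to_q z = w ^ 2" "to_q \<tau> = u ^ 2"
    by (auto simp: to_q_def w_def u_def mult_ac simp flip: exp_double)
  have q: "norm (to_q \<tau>) < 1"
    using assms by simp
  have 1: "qpoch (to_q (\<tau> + z)) (to_q \<tau>) = (1 - u\<^sup>2 * w\<^sup>2) * qpoch (to_q (\<tau> + (z + \<tau>))) (to_q \<tau>)"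
    by (subst qpoch_rec[OF q]) (simp only: to_q_add sq mult_ac)
  have 2: "qpoch (to_q (\<tau> - (z + \<tau>))) (to_q \<tau>) = (1 - 1 / w\<^sup>2) * qpoch (to_q (\<tau> - z)) (to_q \<tau>)"
  proof -
    have "to_q (\<tau> - (z + \<tau>)) = 1 / w\<^sup>2" "to_q (\<tau> - z) = 1 / w\<^sup>2 * to_q \<tau>"
      by (simp_all add: to_q_uminus to_q_diff sq)
    thus ?thesis
      using qpoch_rec[OF q, of "1 / w\<^sup>2"] by simp
  qed
  have 3: "exp (of_real pi * \<i> * (z + \<tau>)) = w * u" "exp (- (of_real pi * \<i> * (z + \<tau>))) = 1 / (w * u)"
     "exp (- (of_real pi * \<i> * z)) = 1 / w"
    by (auto simp: w_def u_def ring_distribs exp_add exp_diff exp_minus field_simps)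
  have 4: "exp (- 2 * of_real pi * \<i> * z - of_real pi * \<i> * \<tau>) = 1 / (w ^ 2 * u)"
  proof -
    have "exp (- 2 * of_real pi * \<i> * z - of_real pi * \<i> * \<tau>) = exp (- (2 * (of_real pi * \<i> * z)) - of_real pi * \<i> * \<tau>)"
      by (simp add: mult_ac)
    thus ?thesis
      unfolding exp_diff exp_minus exp_double w_def u_def by (simp add: field_simps)
  qed
  have *: "(w * u - 1 / (w * u)) * Q * ((1 - 1 / w\<^sup>2) * R) = - (1 / (w ^ 2 * u)) * ((w - 1 / w) * ((1 - u\<^sup>2 * w\<^sup>2) * Q) * R)" for Q R
    using nz by (simp add: field_simps power2_eq_square)
  show ?thesis
    unfolding theta_s_def 1 2 3 4 w_def[symmetric] unfolding * by simp
qed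

lemma theta_s_plus_of_nat_tau:
  assumes "Im \<tau> > 0"
  shows "theta_s (z + of_nat n * \<tau>) \<tau> =
    exp (of_real pi * \<i> * of_nat n - 2 * of_real pi * \<i> * of_nat n * z - of_real pi * \<i> * of_nat n ^ 2 * \<tau>) * theta_s z \<tau>"
proof (induction n)
  case (Suc n)
  have "theta_s (z + of_nat (Suc n) * \<tau>) \<tau> = theta_s ((z + of_nat n * \<tau>) + \<tau>) \<tau>"
    by (simp add: algebra_simps)
  also have "\<dots> = exp (of_real pi * \<i> - 2 * of_real pi * \<i> * (z + of_nat n * \<tau>) - of_real pi * \<i> * \<tau>) *
     theta_s (z + of_nat n * \<tau>) \<tau>"
    by (subst theta_s_plus_tau[OF assms]) (simp add: exp_diff exp_add exp_minus field_simps)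
  also have "\<dots> = exp (of_real pi * \<i> * of_nat (Suc n) - 2 * of_real pi * \<i> * of_nat (Suc n) * z - of_real pi * \<i> * of_nat (Suc n) ^ 2 * \<tau>) * theta_s z \<tau>"
    unfolding Suc.IH mult.assoc[symmetric] exp_add[symmetric]
    by (simp add: algebra_simps power2_eq_square)
  finally show ?case .
qed auto

lemma theta_s_plus_of_nat:
  "theta_s (z + of_nat m) \<tau> = exp (of_real pi * \<i> * of_nat m) * theta_s z \<tau>"
proof (induction m)
  case (Suc m)
  thus ?case
    using theta_s_plus_1[of "z + of_nat m" \<tau>]
    by (simp add: algebra_simps exp_add)
qed auto

lemma theta_s_quasiperiodic:
  assumes "Im \<tau> > 0"
  shows "theta_s (z + of_int m + of_int n * \<tau>) \<tau> =
    exp (of_real pi * \<i> * (of_int m + of_int n - 2 * of_int n * z - of_int n ^ 2 * \<tau>)) * theta_s z \<tau>"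
proof -
  have 1: "theta_s (z + of_int m) \<tau> = exp (of_real pi * \<i> * of_int m) * theta_s z \<tau>" for z
  proof (cases "m \<ge> 0")
    case True
    then obtain k where "m = int k"
      using nonneg_int_cases by blast
    thus ?thesis
      using theta_s_plus_of_nat[of z k \<tau>] by simp
  next
    case False
    then obtain k where k: "m = - int k"
      by (metis int_cases4 linorder_not_le neg_0_le_iff_le of_nat_0_le_iff order_less_imp_le)
    have "theta_s z \<tau> = exp (of_real pi * \<i> * of_nat k) * theta_s (z - of_nat k) \<tau>"
      using theta_s_plus_of_nat[of "z - of_nat k" k \<tau>] by simp
    thus ?thesis
      by (simp add: k exp_minus field_simps)
  qed
  have 2: "theta_s (z + of_int n * \<tau>) \<tau> = exp (of_real pi * \<i> * (of_int n - 2 * of_int n * z - of_int n ^ 2 * \<tau>)) * theta_s z \<tau>" for z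
  proof (cases "n \<ge> 0")
    case True
    then obtain k where "n = int k"
      using nonneg_int_cases by blast
    thus ?thesis
      using theta_s_plus_of_nat_tau[OF assms, of z k] by (simp add: algebra_simps)
  next
    case False
    then obtain k where k: "n = - int k"
      by (metis int_cases4 linorder_not_le neg_0_le_iff_le of_nat_0_le_iff order_less_imp_le)
    define E where "E = of_real pi * \<i> * of_nat k - 2 * of_real pi * \<i> * of_nat k * (z - of_nat k * \<tau>) - of_real pi * \<i> * of_nat k ^ 2 * \<tau>"
    have "theta_s z \<tau> = exp E * theta_s (z - of_nat k * \<tau>) \<tau>"
      using theta_s_plus_of_nat_tau[OF assms, of "z - of_nat k * \<tau>" k] by (simp add: E_def)
    hence "theta_s (z + of_int n * \<tau>) \<tau> = exp (- E) * theta_s z \<tau>"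
      by (simp add: k exp_minus field_simps)
    also have "- E = of_real pi * \<i> * (of_int n - 2 * of_int n * z - of_int n ^ 2 * \<tau>)"
      by (simp add: E_def k algebra_simps power2_eq_square)
    finally show ?thesis .
  qed
  have "theta_s (z + of_int m + of_int n * \<tau>) \<tau> =
     exp (of_real pi * \<i> * (of_int n - 2 * of_int n * (z + of_int m) - of_int n ^ 2 * \<tau>)) * (exp (of_real pi * \<i> * of_int m) * theta_s z \<tau>)"
    unfolding 2 unfolding 1 ..
  \<comment> \<open>The mixed term in \<open>m\<close> and \<open>n\<close> is an even multiple of
    \<pi> i, so the two translations commute.\<close>
  also have "of_real pi * \<i> * (of_int n - 2 * of_int n * (z + of_int m) - of_int n ^ 2 * \<tau>) + of_real pi * \<i> * of_int m =
     of_real pi * \<i> * (of_int m + of_int n - 2 * of_int n * z - of_int n ^ 2 * \<tau>) + 2 * of_real pi * \<i> * of_int (- n * m)"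
    by (simp add: algebra_simps)
  hence "exp (of_real pi * \<i> * (of_int n - 2 * of_int n * (z + of_int m) - of_int n ^ 2 * \<tau>)) * exp (of_real pi * \<i> * of_int m) =
     exp (of_real pi * \<i> * (of_int m + of_int n - 2 * of_int n * z - of_int n ^ 2 * \<tau>)) * to_q (of_int (- n * m))"
    unfolding to_q_def exp_add[symmetric] by simp
  hence "exp (of_real pi * \<i> * (of_int n - 2 * of_int n * (z + of_int m) - of_int n ^ 2 * \<tau>)) * (exp (of_real pi * \<i> * of_int m) * theta_s z \<tau>) =
     exp (of_real pi * \<i> * (of_int m + of_int n - 2 * of_int n * z - of_int n ^ 2 * \<tau>)) * theta_s z \<tau>"
    unfolding to_q_of_int by (simp add: mult.assoc[symmetric])
  finally show ?thesis .
qed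

lemma holomorphic_theta_s [holomorphic_intros]:
  assumes "Im \<tau> > 0" "f holomorphic_on A"
  shows "(\<lambda>z. theta_s (f z) \<tau>) holomorphic_on A"
proof -
  have *: "(\<lambda>z. qpoch (to_q (g z)) (to_q \<tau>)) holomorphic_on A" if "g holomorphic_on A" for g
    using holomorphic_on_compose_gen[OF holomorphic_to_q[OF that] holomorphic_qpoch_left[of "to_q \<tau>" UNIV]] assms(1)
    by (auto simp: o_def)
  have "euler_phi (to_q \<tau>) \<noteq> 0"
    using assms by (intro euler_phi_nonzero) auto
  thus ?thesis
    unfolding theta_s_def by (intro holomorphic_intros * assms(2)) auto
qed

lemma theta_s_eq_0_iff:
  assumes "Im \<tau> > 0"
  shows "theta_s z \<tau> = 0 \<longleftrightarrow> (\<exists>m n. z = of_int m + of_int n * \<tau>)"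
proof
  assume "\<exists>m n. z = of_int m + of_int n * \<tau>"
  then obtain m n where "z = of_int m + of_int n * \<tau>"
    by blast
  thus "theta_s z \<tau> = 0"
    using theta_s_quasiperiodic[OF assms, of 0 m n] by simp
next
  assume 0: "theta_s z \<tau> = 0"
  have q: "norm (to_q \<tau>) < 1" and phi: "euler_phi (to_q \<tau>) \<noteq> 0"
    using assms by (auto intro!: euler_phi_nonzero)
  from 0 phi consider "exp (of_real pi * \<i> * z) = exp (- (of_real pi * \<i> * z))"
     | k where "to_q (\<tau> + z) * to_q \<tau> ^ k = 1" | k where "to_q (\<tau> - z) * to_q \<tau> ^ k = 1"
    by (auto simp: theta_s_def qpoch_eq_0_iff[OF q])
  thus "\<exists>m n. z = of_int m + of_int n * \<tau>"
  proof cases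
    case 1
    hence "exp (of_real pi * \<i> * z) * exp (of_real pi * \<i> * z) = exp (of_real pi * \<i> * z) * exp (- (of_real pi * \<i> * z))"
      by simp
    also have "\<dots> = 1"
      by (simp flip: exp_add)
    finally have "exp (of_real pi * \<i> * z) * exp (of_real pi * \<i> * z) = 1" .
    hence "to_q z = 1"
      by (simp add: to_q_def mult_ac flip: exp_add)
    then obtain m where "z = of_int m"
      by (auto simp: to_q_eq_1_iff elim!: Ints_cases)
    thus ?thesis
      by (intro exI[of _ m] exI[of _ 0]) auto
  next
    case (2 k)
    hence "to_q (\<tau> + z + of_nat k * \<tau>) = 1"
      by (simp add: to_q_add to_q_power)
    then obtain m where "\<tau> + z + of_nat k * \<tau> = of_int m"
      by (auto simp: to_q_eq_1_iff elim!: Ints_cases)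
    thus ?thesis
      by (intro exI[of _ m] exI[of _ "- int k - 1"]) (auto simp: algebra_simps)
  next
    case (3 k)
    hence "to_q (\<tau> - z + of_nat k * \<tau>) = 1"
      by (simp add: to_q_add to_q_power)
    then obtain m where "\<tau> - z + of_nat k * \<tau> = of_int m"
      by (auto simp: to_q_eq_1_iff elim!: Ints_cases)
    thus ?thesis
      by (intro exI[of _ "-m"] exI[of _ "int k + 1"]) (auto simp: algebra_simps)
  qed
qed

lemma theta_s_tendsto:
  assumes "Im \<tau> > 0"
  shows "((\<lambda>z. theta_s z \<tau> / z) \<longlongrightarrow> 2 * of_real pi * \<i>) (at 0)"
proof -
  define H where "H = (\<lambda>z. qpoch (to_q (\<tau> + z)) (to_q \<tau>) * qpoch (to_q (\<tau> - z)) (to_q \<tau>) / euler_phi (to_q \<tau>) ^ 2)"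
  have q: "norm (to_q \<tau>) < 1" and phi: "euler_phi (to_q \<tau>) \<noteq> 0"
    using assms by (auto intro!: euler_phi_nonzero)
  have *: "(\<lambda>z. qpoch (to_q (g z)) (to_q \<tau>)) holomorphic_on UNIV" if "g holomorphic_on UNIV" for g
    using holomorphic_on_compose_gen[OF holomorphic_to_q[OF that] holomorphic_qpoch_left[OF q, of UNIV]]
    by (auto simp: o_def)
  have "H holomorphic_on UNIV"
    unfolding H_def using phi by (intro holomorphic_intros *) auto
  hence "continuous_on UNIV H"
    by (rule holomorphic_on_imp_continuous_on)
  hence "H \<midarrow>0\<rightarrow> H 0"
    by (simp add: continuous_on_eq_continuous_at isCont_def)
  moreover have "H 0 = 1"
    using phi by (simp add: H_def power2_eq_square euler_phi_def)
  moreover have "((\<lambda>z. (exp (of_real pi * \<i> * z) - exp (- (of_real pi * \<i> * z))) / z) \<longlongrightarrow> 2 * of_real pi * \<i>) (at 0)"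
  proof -
    have "((\<lambda>z. exp (of_real pi * \<i> * z) - exp (- (of_real pi * \<i> * z))) has_field_derivative 2 * of_real pi * \<i>) (at 0)"
      by (auto intro!: derivative_eq_intros)
    thus ?thesis
      by (simp add: has_field_derivative_iff)
  qed
  ultimately have "((\<lambda>z. (exp (of_real pi * \<i> * z) - exp (- (of_real pi * \<i> * z))) / z * H z) \<longlongrightarrow> 2 * of_real pi * \<i> * 1) (at 0)"
    by (intro tendsto_mult) auto
  thus ?thesis
    by (simp add: theta_s_def H_def mult_ac)
qed

lemma lattice_decomp:
  assumes "Im \<tau> > 0"
  obtains m n :: int and a b :: real where "z = (of_real a + of_real b * \<tau>) + of_int m + of_int n * \<tau>"
    "0 \<le> a" "a \<le> 1" "0 \<le> b" "b \<le> 1"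
proof -
  define y where "y = Im z / Im \<tau>"
  define x where "x = Re z - y * Re \<tau>"
  have "z = of_real x + of_real y * \<tau>"
    using assms by (simp add: complex_eq_iff x_def y_def)
  hence "z = (of_real (frac x) + of_real (frac y) * \<tau>) + of_int \<lfloor>x\<rfloor> + of_int \<lfloor>y\<rfloor> * \<tau>"
    by (simp add: frac_def algebra_simps)
  thus ?thesis
    using that[of "frac x" "frac y" "\<lfloor>x\<rfloor>" "\<lfloor>y\<rfloor>"] frac_lt_1[of x] frac_lt_1[of y] by auto
qed

text \<open>
  Liouville's theorem, applied to the quotient of \<open>G\<close> by \<open>theta_s\<close>, which is elliptic.
\<close>

lemma theta_s_unique:
  assumes \<tau>: "Im \<tau> > 0" and hol: "G holomorphic_on UNIV"
    and G1: "\<And>z. G (z + 1) = - G z"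
    and G2: "\<And>z. G (z + \<tau>) = - exp (- 2 * of_real pi * \<i> * z - of_real pi * \<i> * \<tau>) * G z"
    and lim: "((\<lambda>z. G z / z) \<longlongrightarrow> 2 * of_real pi * \<i>) (at 0)"
  shows "G z = theta_s z \<tau>"
proof -
  define L where "L = {z. \<exists>m n. z = of_int m + of_int n * \<tau>}"
  \<comment> \<open>On the lattice the quotient is 0 / 0. The value 1 is its limit at 0, and
    periodicity carries the removable singularity from 0 to every lattice point.\<close>
  define R where "R = (\<lambda>z. if z \<in> L then 1 else G z / theta_s z \<tau>)"
  have theta_L: "theta_s z \<tau> = 0 \<longleftrightarrow> z \<in> L" for z
    unfolding L_def mem_Collect_eq by (rule theta_s_eq_0_iff[OF \<tau>])
  have L1: "z + 1 \<in> L \<longleftrightarrow> z \<in> L" for z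
  proof
    assume "z + 1 \<in> L"
    then obtain m n where "z + 1 = of_int m + of_int n * \<tau>"
      by (auto simp: L_def)
    hence "z = of_int (m - 1) + of_int n * \<tau>"
      by (simp add: algebra_simps)
    thus "z \<in> L"
      unfolding L_def by blast
  next
    assume "z \<in> L"
    then obtain m n where "z = of_int m + of_int n * \<tau>"
      by (auto simp: L_def)
    hence "z + 1 = of_int (m + 1) + of_int n * \<tau>"
      by (simp add: algebra_simps)
    thus "z + 1 \<in> L"
      unfolding L_def by blast
  qed
  have L2: "z + \<tau> \<in> L \<longleftrightarrow> z \<in> L" for z
  proof
    assume "z + \<tau> \<in> L"
    then obtain m n where "z + \<tau> = of_int m + of_int n * \<tau>"
      by (auto simp: L_def)
    hence "z = of_int m + of_int (n - 1) * \<tau>"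
      by (simp add: algebra_simps)
    thus "z \<in> L"
      unfolding L_def by blast
  next
    assume "z \<in> L"
    then obtain m n where "z = of_int m + of_int n * \<tau>"
      by (auto simp: L_def)
    hence "z + \<tau> = of_int m + of_int (n + 1) * \<tau>"
      by (simp add: algebra_simps)
    thus "z + \<tau> \<in> L"
      unfolding L_def by blast
  qed
  have R1: "R (z + 1) = R z" for z
    using L1[of z] by (simp add: R_def G1 theta_s_plus_1)
  have R2: "R (z + \<tau>) = R z" for z
    using L2[of z] by (simp add: R_def G2 theta_s_plus_tau[OF \<tau>])
  have Rn1: "R (z + of_nat m) = R z" for z m
  proof (induction m)
    case (Suc m)
    have "z + of_nat (Suc m) = (z + of_nat m) + 1"
      by simp
    thus ?case
      using Suc R1 by presburger
  qed auto
  have Rn2: "R (z + of_nat m * \<tau>) = R z" for z m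
  proof (induction m)
    case (Suc m)
    have "z + of_nat (Suc m) * \<tau> = (z + of_nat m * \<tau>) + \<tau>"
      by (simp add: algebra_simps)
    thus ?case
      using Suc R2 by presburger
  qed auto
  have Ri1: "R (z + of_int m) = R z" for z m
    using Rn1[of z "nat m"] Rn1[of "z + of_int m" "nat (-m)"] by (cases "m \<ge> 0") auto
  have Ri2: "R (z + of_int m * \<tau>) = R z" for z m
    using Rn2[of z "nat m"] Rn2[of "z + of_int m * \<tau>" "nat (-m)"] by (cases "m \<ge> 0") (auto simp: algebra_simps)
  have period: "R (z + of_int m + of_int n * \<tau>) = R z" for z m n
    by (simp add: Ri1 Ri2)
  have lim_R: "((\<lambda>z. G z / theta_s z \<tau>) \<longlongrightarrow> 1) (at 0)"
  proof -
    have "((\<lambda>z. (G z / z) / (theta_s z \<tau> / z)) \<longlongrightarrow> (2 * of_real pi * \<i>) / (2 * of_real pi * \<i>)) (at 0)"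
      by (intro tendsto_divide lim theta_s_tendsto \<tau>) auto
    moreover have "eventually (\<lambda>z. (G z / z) / (theta_s z \<tau> / z) = G z / theta_s z \<tau>) (at 0)"
      by (auto simp: eventually_at_filter)
    ultimately show ?thesis
      by (auto intro: Lim_transform_eventually)
  qed
  have nz: "eventually (\<lambda>z. z \<notin> L) (at 0)"
  proof -
    have "eventually (\<lambda>z. theta_s z \<tau> / z \<noteq> 0) (at 0)"
      by (rule tendsto_imp_eventually_ne[OF theta_s_tendsto[OF \<tau>]]) auto
    thus ?thesis
    proof eventually_elim
      case (elim z)
      hence "theta_s z \<tau> \<noteq> 0"
        by auto
      thus ?case
        using theta_L[of z] by blast
    qed
  qed
  have R0: "R analytic_on {0}"
  proof -
    from nz obtain e where e: "e > 0" "\<And>z. z \<noteq> 0 \<Longrightarrow> dist z 0 < e \<Longrightarrow> z \<notin> L"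
      by (auto simp: eventually_at)
    have "R holomorphic_on ball 0 e"
    proof (rule no_isolated_singularity[where K = "{0}"])
      show "R holomorphic_on ball 0 e - {0}"
      proof (rule holomorphic_transform)
        show "(\<lambda>z. G z / theta_s z \<tau>) holomorphic_on ball 0 e - {0}"
          using e(2) by (intro holomorphic_intros holomorphic_on_subset[OF hol] \<tau>) (auto simp: theta_L)
      qed (use e(2) in \<open>auto simp: R_def\<close>)
      have "(R \<longlongrightarrow> 1) (at 0)"
        by (rule Lim_transform_eventually[OF lim_R]) (use nz in eventually_elim, auto simp: R_def)
      moreover have "R 0 = 1"
        unfolding R_def L_def by (auto intro!: exI[of _ 0])
      ultimately have cont0: "isCont R 0"
        by (simp add: isCont_def)
      have "continuous_on (ball 0 e - {0}) R"
        by (rule holomorphic_on_imp_continuous_on) fact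
      hence "isCont R z" if "z \<in> ball 0 e - {0}" for z
        using that by (subst (asm) continuous_on_eq_continuous_at) auto
      thus "continuous_on (ball 0 e) R"
        using cont0 by (intro continuous_at_imp_continuous_on ballI) blast
    qed auto
    thus ?thesis
      using e(1) by (auto simp: analytic_at intro!: exI[of _ "ball 0 e"])
  qed
  have "R analytic_on {z}" for z
  proof (cases "z \<in> L")
    case True
    then obtain m n where mn: "z = of_int m + of_int n * \<tau>"
      by (auto simp: L_def)
    have "(R \<circ> (\<lambda>w. w - z)) analytic_on {z}"
      by (rule analytic_on_compose) (use R0 in \<open>auto intro!: analytic_intros\<close>)
    also have "R \<circ> (\<lambda>w. w - z) = R"
    proof
      show "(R \<circ> (\<lambda>w. w - z)) w = R w" for w
        using period[of "w - z" m n] by (simp add: mn algebra_simps)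
    qed
    finally show ?thesis .
  next
    case False
    have hs: "(\<lambda>w. theta_s w \<tau>) holomorphic_on UNIV"
      by (intro holomorphic_intros \<tau>)
    have "open ((\<lambda>w. theta_s w \<tau>) -` (- {0}))"
      using holomorphic_on_imp_continuous_on[OF hs] by (intro open_vimage) auto
    also have "(\<lambda>w. theta_s w \<tau>) -` (- {0}) = - L"
      by (auto simp: theta_L)
    finally have "open (- L)" .
    moreover have "R holomorphic_on - L"
    proof (rule holomorphic_transform)
      show "(\<lambda>z. G z / theta_s z \<tau>) holomorphic_on - L"
        by (intro holomorphic_intros holomorphic_on_subset[OF hol] \<tau>) (auto simp: theta_L)
    qed (auto simp: R_def)
    ultimately show ?thesis
      using False by (auto simp: analytic_at)
  qed
  hence "R analytic_on UNIV"
    by (subst analytic_on_analytic_at) auto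
  hence R: "R holomorphic_on UNIV"
    by (rule analytic_imp_holomorphic)
  define P where "P = (\<lambda>(a, b). of_real a + of_real b * \<tau>) ` ({0..1} \<times> {0..1})"
  have "compact P"
    unfolding P_def by (intro compact_continuous_image compact_Times) (auto intro!: continuous_intros simp: case_prod_unfold)
  hence "bounded (R ` P)"
    by (intro compact_imp_bounded compact_continuous_image holomorphic_on_imp_continuous_on holomorphic_on_subset[OF R]) auto
  moreover have "range R \<subseteq> R ` P"
  proof clarify
    fix z
    obtain m n a b where *: "z = (of_real a + of_real b * \<tau>) + of_int m + of_int n * \<tau>"
      "0 \<le> a" "a \<le> 1" "0 \<le> b" "b \<le> 1"
      using lattice_decomp[OF \<tau>] .
    have "R z = R (of_real a + of_real b * \<tau>)"
      unfolding *(1) by (rule period)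
    moreover have "of_real a + of_real b * \<tau> \<in> P"
      unfolding P_def using *(2-5) by (auto intro!: image_eqI[of _ _ "(a, b)"])
    ultimately show "R z \<in> R ` P"
      by blast
  qed
  ultimately have "bounded (range R)"
    by (rule bounded_subset)
  from Liouville_theorem[OF R this] obtain c where c: "\<And>z. R z = c"
    by (auto simp: constant_on_def)
  have "0 \<in> L"
    unfolding L_def by (auto intro!: exI[of _ 0])
  with c[of 0] have "c = 1"
    by (simp add: R_def)
  show ?thesis
  proof (cases "z \<in> L")
    case False
    thus ?thesis
      using c[of z] \<open>c = 1\<close> by (auto simp: R_def theta_L)
  next
    case True
    \<comment> \<open>At a lattice point \<open>R\<close> is 1 by definition and says nothing about
      \<open>G\<close>; there the equality is a limit of the equality at nearby points.\<close>
    have "continuous_on UNIV G" "continuous_on UNIV (\<lambda>z. theta_s z \<tau>)"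
      by (auto intro!: holomorphic_on_imp_continuous_on hol holomorphic_intros \<tau>)
    hence "isCont (\<lambda>w. G w - theta_s w \<tau>) z"
      by (auto intro!: continuous_intros simp: continuous_on_eq_continuous_at)
    moreover have "eventually (\<lambda>w. w \<notin> L) (at z)"
    proof -
      obtain m n where mn: "z = of_int m + of_int n * \<tau>"
        using True by (auto simp: L_def)
      have "eventually (\<lambda>w. z + w \<notin> L) (at 0)"
        using nz
      proof eventually_elim
        case (elim w)
        have "z + w \<in> L \<Longrightarrow> w \<in> L"
        proof -
          assume "z + w \<in> L"
          then obtain m' n' where "z + w = of_int m' + of_int n' * \<tau>"
            by (auto simp: L_def)
          hence "w = of_int (m' - m) + of_int (n' - n) * \<tau>"
            by (simp add: mn algebra_simps)
          thus "w \<in> L"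
            unfolding L_def by blast
        qed
        thus ?case
          using elim by blast
      qed
      thus ?thesis
        by (subst at_to_0) (simp add: eventually_filtermap add.commute)
    qed
    hence "eventually (\<lambda>w. 0 = G w - theta_s w \<tau>) (at z)"
    proof eventually_elim
      case (elim w)
      thus ?case
        using c[of w] \<open>c = 1\<close> by (auto simp: R_def theta_L)
    qed
    hence "((\<lambda>w. G w - theta_s w \<tau>) \<longlongrightarrow> 0) (at z)"
      by (rule Lim_transform_eventually[OF tendsto_const])
    ultimately show ?thesis
      using LIM_unique[of "\<lambda>w. G w - theta_s w \<tau>" "G z - theta_s z \<tau>" z 0] by (simp add: isCont_def)
  qed
qed

lemma exp_parity:
  "exp (of_real pi * \<i> * of_int m) = (if even m then 1 else - 1)"
proof (cases "even m")
  case True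
  then obtain k where "m = 2 * k"
    by (elim evenE)
  thus ?thesis
    using to_q_of_int[of k] by (simp add: to_q_def mult_ac)
next
  case False
  then obtain k where "m = 2 * k + 1"
    by (elim oddE)
  thus ?thesis
    using to_q_of_int[of k] by (simp add: to_q_def mult_ac exp_add ring_distribs)
qed

text \<open>As a function of \<open>z\<close>, the left side times the inverse Gaussian has the
  quasi-periods of \<open>theta_s\<close> for \<tau>, since 1 / j and \<tau> / j are lattice vectors
  for \<tau>', and it has the same leading term at 0. Uniqueness then leaves no multiplier.\<close>

lemma theta_s_modular:
  fixes a b c d :: int
  assumes \<tau>: "Im \<tau> > 0" and det: "a * d - b * c = 1"
  defines "j \<equiv> of_int c * \<tau> + of_int d" and "\<tau>' \<equiv> (of_int a * \<tau> + of_int b) / (of_int c * \<tau> + of_int d)"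
  assumes \<tau>': "Im \<tau>' > 0" and j: "j \<noteq> 0"
  shows "j * theta_s (z / j) \<tau>' = exp (of_real pi * \<i> * of_int c * z ^ 2 / j) * theta_s z \<tau>"
proof -
  define E where "E = (\<lambda>z. exp (- (of_real pi * \<i> * of_int c * z ^ 2 / j)))"
  define G where "G = (\<lambda>z. j * theta_s (z / j) \<tau>' * E z)"
  have det': "of_int a * of_int d - of_int b * of_int c = (1 :: complex)"
    by (metis det of_int_1 of_int_diff of_int_mult)
  have j\<tau>': "\<tau>' = (of_int a * \<tau> + of_int b) / j"
    by (simp add: \<tau>'_def j_def)
  have inv1: "1 / j = of_int a + of_int (- c) * \<tau>'"
  proof -
    have "j * (of_int a + of_int (- c) * \<tau>') = of_int a * j - of_int c * (of_int a * \<tau> + of_int b)"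
      using j by (simp add: j\<tau>' field_simps)
    also have "\<dots> = of_int a * of_int d - of_int b * of_int c"
      by (simp add: j_def algebra_simps)
    finally show ?thesis
      using j det' by (simp add: field_simps)
  qed
  have inv2: "\<tau> / j = of_int (- b) + of_int d * \<tau>'"
  proof -
    have "j * (of_int (- b) + of_int d * \<tau>') = of_int d * (of_int a * \<tau> + of_int b) - of_int b * j"
      using j by (simp add: j\<tau>' field_simps)
    also have "\<dots> = (of_int a * of_int d - of_int b * of_int c) * \<tau>"
      by (simp add: j_def algebra_simps)
    also have "\<dots> = \<tau>"
      unfolding det' by simp
    finally show ?thesis
      using j by (metis nonzero_mult_div_cancel_left)
  qed
  \<comment> \<open>Neither \<open>a\<close>, \<open>c\<close> nor \<open>b\<close>,
    \<open>d\<close> can both be even, since the determinant is odd. These two parities make the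
    multipliers for the translations by 1 and \<tau> equal to -1.\<close>
  have par1: "odd (a - c + a * c)" and par2: "odd (d - b + b * d)"
    using det by (metis even_add even_diff even_mult_iff odd_one)+
  have "G z = theta_s z \<tau>" for z
  proof (rule theta_s_unique[OF \<tau>])
    show "G holomorphic_on UNIV"
      unfolding G_def E_def using j by (intro holomorphic_intros \<tau>') auto
  next
    fix z
    have "G (z + 1) = j * theta_s (z / j + of_int a + of_int (- c) * \<tau>') \<tau>' * E (z + 1)"
      unfolding G_def add_divide_distrib inv1 by (simp only: add.assoc)
    also have "\<dots> = (exp (of_real pi * \<i> * (of_int a + of_int (- c) - 2 * of_int (- c) * (z / j) - of_int (- c) ^ 2 * \<tau>')) *
        exp (- (of_real pi * \<i> * of_int c * (2 * z + 1) / j))) * G z"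
    proof -
      have "E (z + 1) = exp (- (of_real pi * \<i> * of_int c * (2 * z + 1) / j)) * E z"
        unfolding E_def exp_add[symmetric] by (simp add: power2_eq_square add_divide_distrib diff_divide_distrib algebra_simps)
      thus ?thesis
        unfolding theta_s_quasiperiodic[OF \<tau>'] G_def by simp
    qed
    also have "exp (of_real pi * \<i> * (of_int a + of_int (- c) - 2 * of_int (- c) * (z / j) - of_int (- c) ^ 2 * \<tau>')) *
        exp (- (of_real pi * \<i> * of_int c * (2 * z + 1) / j)) =
        exp (of_real pi * \<i> * (of_int a - of_int c - of_int c * (of_int c * \<tau>' + 1 / j)))"
      unfolding exp_add[symmetric] by (simp add: power2_eq_square ring_distribs add_divide_distrib algebra_simps)
    also have "of_int c * \<tau>' + 1 / j = of_int a"
      unfolding inv1 by simp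
    also have "exp (of_real pi * \<i> * (of_int a - of_int c - of_int c * of_int a)) = exp (of_real pi * \<i> * of_int (a - c + a * c)) * to_q (of_int (- (a * c)))"
      unfolding to_q_def exp_add[symmetric] by (simp add: algebra_simps)
    also have "\<dots> = -1"
      unfolding exp_parity to_q_of_int using par1 by simp
    finally show "G (z + 1) = - G z"
      by simp
  next
    fix z
    have "G (z + \<tau>) = j * theta_s (z / j + of_int (- b) + of_int d * \<tau>') \<tau>' * E (z + \<tau>)"
      unfolding G_def add_divide_distrib inv2 by (simp only: add.assoc)
    also have "\<dots> = (exp (of_real pi * \<i> * (of_int (- b) + of_int d - 2 * of_int d * (z / j) - of_int d ^ 2 * \<tau>')) *
        exp (- (of_real pi * \<i> * of_int c * (2 * z * \<tau> + \<tau> ^ 2) / j))) * G z"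
    proof -
      have "E (z + \<tau>) = exp (- (of_real pi * \<i> * of_int c * (2 * z * \<tau> + \<tau> ^ 2) / j)) * E z"
        unfolding E_def exp_add[symmetric] by (simp add: power2_eq_square add_divide_distrib diff_divide_distrib algebra_simps)
      thus ?thesis
        unfolding theta_s_quasiperiodic[OF \<tau>'] G_def by simp
    qed
    also have "exp (of_real pi * \<i> * (of_int (- b) + of_int d - 2 * of_int d * (z / j) - of_int d ^ 2 * \<tau>')) *
        exp (- (of_real pi * \<i> * of_int c * (2 * z * \<tau> + \<tau> ^ 2) / j)) =
        exp (of_real pi * \<i> * (of_int d - of_int b - (2 * z * (j / j) + (of_int d ^ 2 * \<tau>' + of_int c * \<tau> * (\<tau> / j)))))"
    proof -
      have "j / j = (of_int c * \<tau> + of_int d) / j"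
        by (simp add: j_def)
      thus ?thesis
        unfolding exp_add[symmetric] by (simp add: power2_eq_square ring_distribs add_divide_distrib algebra_simps)
    qed
    also have "of_int d ^ 2 * \<tau>' + of_int c * \<tau> * (\<tau> / j) = of_int d * (j * \<tau>') - of_int b * of_int c * \<tau>"
      unfolding inv2 by (simp add: j_def algebra_simps power2_eq_square)
    also have "j * \<tau>' = of_int a * \<tau> + of_int b"
      using j by (simp add: j\<tau>')
    also have "of_int d * (of_int a * \<tau> + of_int b) - of_int b * of_int c * \<tau> = (of_int a * of_int d - of_int b * of_int c) * \<tau> + of_int b * of_int d"
      by (simp add: algebra_simps)
    also have "exp (of_real pi * \<i> * (of_int d - of_int b - (2 * z * (j / j) + ((of_int a * of_int d - of_int b * of_int c) * \<tau> + of_int b * of_int d)))) =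
       exp (of_real pi * \<i> * of_int (d - b + b * d)) * to_q (of_int (- (b * d))) * exp (- 2 * of_real pi * \<i> * z - of_real pi * \<i> * \<tau>)"
      unfolding det' to_q_def exp_add[symmetric] using j by (simp add: algebra_simps)
    also have "\<dots> = - exp (- 2 * of_real pi * \<i> * z - of_real pi * \<i> * \<tau>)"
      unfolding exp_parity to_q_of_int using par2 by simp
    finally show "G (z + \<tau>) = - exp (- 2 * of_real pi * \<i> * z - of_real pi * \<i> * \<tau>) * G z" .
  next
    have "((\<lambda>z. theta_s (z / j) \<tau>' / (z / j)) \<longlongrightarrow> 2 * of_real pi * \<i>) (at 0)"
      by (rule filterlim_compose[OF theta_s_tendsto[OF \<tau>']])
         (use j in \<open>auto simp: filterlim_at eventually_at_filter intro!: tendsto_eq_intros\<close>)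
    moreover have "isCont E 0"
      unfolding E_def using j by (intro continuous_intros) auto
    hence "(E \<longlongrightarrow> 1) (at 0)"
      by (simp add: isCont_def E_def)
    ultimately have "((\<lambda>z. theta_s (z / j) \<tau>' / (z / j) * E z) \<longlongrightarrow> 2 * of_real pi * \<i> * 1) (at 0)"
      by (rule tendsto_mult)
    thus "((\<lambda>z. G z / z) \<longlongrightarrow> 2 * of_real pi * \<i>) (at 0)"
      by (simp add: G_def mult_ac)
  qed
  from this[of z] show ?thesis
    unfolding G_def E_def by (simp add: exp_minus field_simps)
qed

section \<open>Klein forms\<close>

definition klein_form :: "real \<Rightarrow> real \<Rightarrow> complex \<Rightarrow> complex"
  where "klein_form r s \<tau> = exp (of_real pi * \<i> * of_real r * (of_real r * \<tau> + of_real s)) * theta_s (of_real r * \<tau> + of_real s) \<tau>"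

lemma moebius_int:
  fixes a b c d :: int
  assumes "Im \<tau> > 0" "a * d - b * c = 1"
  shows "of_int c * \<tau> + of_int d \<noteq> 0" "Im ((of_int a * \<tau> + of_int b) / (of_int c * \<tau> + of_int d)) > 0"
proof -
  let ?M = "mat2 (of_int a) (of_int b) (of_int c) (of_int d)"
  have "det ?M = of_int (a * d - b * c)"
    by (simp add: det_2)
  hence M: "det ?M > 0"
    using assms by simp
  have *: "moebius_map ?M \<tau> = (of_int a * \<tau> + of_int b) / (of_int c * \<tau> + of_int d)"
    by (simp add: moebius_map_def)
  show "of_int c * \<tau> + of_int d \<noteq> 0"
    using moebius_denom_nonzero[OF M, of \<tau>] assms by simp
  show "Im ((of_int a * \<tau> + of_int b) / (of_int c * \<tau> + of_int d)) > 0"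
    using moebius_in_uhp[OF M, of \<tau>] assms unfolding * by simp
qed

text \<open>The exponential prefactor of \<open>klein_form\<close> is designed to absorb the
  Gaussian of \<open>theta_s_modular\<close>: for z = r' \<tau> + s' one has r + c z = r' j. What
  remains is weight -1 and the right action of the matrix on the index vector (r, s).\<close>

lemma klein_form_modular:
  fixes a b c d :: int
  assumes \<tau>: "Im \<tau> > 0" and det: "a * d - b * c = 1"
  shows "(of_int c * \<tau> + of_int d) * klein_form r s ((of_int a * \<tau> + of_int b) / (of_int c * \<tau> + of_int d)) =
         klein_form (r * of_int a + s * of_int c) (r * of_int b + s * of_int d) \<tau>"
proof -
  define j where "j = of_int c * \<tau> + of_int d"
  define \<tau>' where "\<tau>' = (of_int a * \<tau> + of_int b) / j"
  define r' s' where "r' = r * of_int a + s * of_int c" and "s' = r * of_int b + s * of_int d"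
  define z where "z = of_real r' * \<tau> + of_real s'"
  have j: "j \<noteq> 0" and \<tau>': "Im \<tau>' > 0"
    using moebius_int[OF assms] by (simp_all add: j_def \<tau>'_def)
  have z: "of_real r * \<tau>' + of_real s = z / j"
  proof -
    have "z = of_real r * (of_int a * \<tau> + of_int b) + of_real s * j"
      by (simp add: z_def r'_def s'_def j_def algebra_simps)
    thus ?thesis
      unfolding \<tau>'_def using j by (simp only: add_divide_distrib[of "_ * _" "_ * j"]) simp
  qed
  have *: "of_real r + of_int c * z = of_real r' * j"
  proof -
    have "of_real r' * j - of_int c * z - of_real r = of_real r * (of_int (a * d - b * c) - 1)"
      by (simp add: j_def z_def r'_def s'_def algebra_simps)
    thus ?thesis
      using det by (simp add: algebra_simps)
  qed
  have "j * klein_form r s \<tau>' = exp (of_real pi * \<i> * of_real r * (z / j)) * (j * theta_s (z / j) \<tau>')"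
    unfolding klein_form_def z by simp
  also have "j * theta_s (z / j) \<tau>' = exp (of_real pi * \<i> * of_int c * z ^ 2 / j) * theta_s z \<tau>"
    using theta_s_modular[OF \<tau> det, of z] j \<tau>' by (simp add: j_def \<tau>'_def)
  also have "exp (of_real pi * \<i> * of_real r * (z / j)) * (exp (of_real pi * \<i> * of_int c * z ^ 2 / j) * theta_s z \<tau>) =
     exp (of_real pi * \<i> * z * (of_real r + of_int c * z) / j) * theta_s z \<tau>"
    unfolding mult.assoc[symmetric] exp_add[symmetric] by (simp add: power2_eq_square algebra_simps add_divide_distrib)
  also have "of_real pi * \<i> * z * (of_real r + of_int c * z) / j = of_real pi * \<i> * of_real r' * z"
    unfolding * using j by simp
  also have "exp (of_real pi * \<i> * of_real r' * z) * theta_s z \<tau> = klein_form r' s' \<tau>"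
    by (simp add: klein_form_def z_def)
  finally show ?thesis
    by (simp add: j_def \<tau>'_def r'_def s'_def)
qed

lemma klein_form_uminus: "klein_form (- r) (- s) \<tau> = - klein_form r s \<tau>"
proof -
  have *: "of_real (- r) * \<tau> + of_real (- s) = - (of_real r * \<tau> + of_real s)"
    by simp
  show ?thesis
    unfolding klein_form_def * theta_s_uminus by (simp add: algebra_simps)
qed

text \<open>For a rational index the factor is a root of unity. Every multiplier below arises here,
  when an index transformed by a matrix is brought back to its original range.\<close>

lemma klein_form_add_int:
  assumes "Im \<tau> > 0"
  shows "klein_form (r + of_int m) (s + of_int n) \<tau> =
    exp (of_real pi * \<i> * of_real (of_int (m + n + m * n) + r * of_int n - s * of_int m)) * klein_form r s \<tau>"
proof -
  define z where "z = of_real r * \<tau> + of_real s"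
  have *: "of_real (r + of_int m) * \<tau> + of_real (s + of_int n) = z + of_int n + of_int m * \<tau>"
    by (simp add: z_def algebra_simps)
  show ?thesis
    unfolding klein_form_def * theta_s_quasiperiodic[OF assms] z_def[symmetric] mult.assoc[symmetric] exp_add[symmetric]
    by (simp add: z_def algebra_simps power2_eq_square)
qed

section \<open>The eta function\<close>

definition eta :: "complex \<Rightarrow> complex"
  where "eta \<tau> = exp (of_real pi * \<i> * \<tau> / 12) * euler_phi (to_q \<tau>)"

lemma eta_nonzero: "Im \<tau> > 0 \<Longrightarrow> eta \<tau> \<noteq> 0"
  by (simp add: eta_def euler_phi_nonzero)

lemma holomorphic_eta [holomorphic_intros]:
  assumes "f holomorphic_on A" "\<And>z. z \<in> A \<Longrightarrow> Im (f z) > 0"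
  shows "(\<lambda>z. eta (f z)) holomorphic_on A"
proof -
  have "(\<lambda>z. euler_phi (to_q (f z))) holomorphic_on A"
    using holomorphic_on_compose_gen[OF holomorphic_to_q[OF assms(1)] holomorphic_euler_phi] assms(2)
    by (auto simp: o_def image_subset_iff)
  thus ?thesis
    unfolding eta_def by (intro holomorphic_intros assms(1)) auto
qed

lemma euler_phi_dissect:
  assumes "norm q < 1"
  shows "euler_phi q = qpoch q (q\<^sup>2) * euler_phi (q\<^sup>2)"
  using qpoch_split_even_odd[OF assms, of q] by (simp add: euler_phi_def power2_eq_square)

context
  fixes \<tau> :: complex
  assumes \<tau>: "Im \<tau> > 0"
begin

text \<open>In terms of the nome \<open>q\<close>, \<open>u\<close> is q^(1/8) and \<open>p\<close>
  is q^(1/2).\<close>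

private definition "u = exp (of_real pi * \<i> * \<tau> / 4)"
private definition "p = to_q (\<tau> / 2)"

private lemma p: "norm p < 1" "norm (p ^ 2) < 1" "norm ((p ^ 2) ^ 2) < 1"
  using \<tau> by (simp_all add: p_def norm_power power_less_one_iff)

private lemma u [simp]: "u \<noteq> 0"
  by (simp add: u_def)

private lemma p_u: "p = u ^ 4"
  unfolding p_def u_def to_q_def exp_of_nat_mult[symmetric] by (simp add: algebra_simps)

private lemma q_p: "to_q \<tau> = p ^ 2"
  by (simp add: p_def to_q_power)

private lemma eu: "exp (of_real pi * \<i> * (\<tau> / 2)) = u ^ 2"
  unfolding u_def exp_of_nat_mult[symmetric] by (simp add: algebra_simps)

private lemma klein_1:
  "klein_form 0 (1/2) \<tau> = 2 * \<i> * euler_phi (to_q (2 * \<tau>)) ^ 2 / euler_phi (to_q \<tau>) ^ 4"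
proof -
  have "euler_phi (to_q \<tau>) * qpoch (- to_q \<tau>) (to_q \<tau>) = euler_phi (to_q \<tau> ^ 2)"
    using qpoch_mult_minus[of "to_q \<tau>" "to_q \<tau>"] \<tau> by (simp add: euler_phi_def)
  hence 1: "qpoch (- to_q \<tau>) (to_q \<tau>) = euler_phi (to_q (2 * \<tau>)) / euler_phi (to_q \<tau>)"
    using euler_phi_nonzero[of "to_q \<tau>"] \<tau> by (simp add: to_q_power field_simps)
  have h: "to_q (1 / 2) = - 1"
    by (simp add: to_q_def)
  have "to_q (\<tau> + 1 / 2) = - to_q \<tau>" "to_q (\<tau> - 1 / 2) = - to_q \<tau>"
    unfolding to_q_add to_q_diff h by simp_all
  moreover have "exp (of_real pi * \<i> * (1 / 2)) = \<i>"
    by (simp add: exp_eq_polar flip: cis_conv_exp)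
  ultimately show ?thesis
    by (simp add: klein_form_def theta_s_def 1 exp_minus power2_eq_square power4_eq_xxxx mult_ac)
qed

private lemma klein_2:
  "klein_form (1/2) 0 \<tau> = - (1 / u) * (qpoch p (p ^ 2) / euler_phi (p ^ 2)) ^ 2"
proof -
  have 1: "to_q (\<tau> + \<tau> / 2) = p * p ^ 2" "to_q (\<tau> - \<tau> / 2) = p"
  proof -
    have "\<tau> - \<tau> / 2 = \<tau> / 2"
      by simp
    thus "to_q (\<tau> - \<tau> / 2) = p"
      by (simp only: p_def)
    show "to_q (\<tau> + \<tau> / 2) = p * p ^ 2"
      unfolding to_q_add q_p p_def[symmetric] by simp
  qed
  have 2: "qpoch p (p ^ 2) = (1 - p) * qpoch (p * p ^ 2) (p ^ 2)"
    by (rule qpoch_rec) (rule p)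
  have "klein_form (1/2) 0 \<tau> = u * ((u ^ 2 - 1 / u ^ 2) * qpoch (p * p ^ 2) (p ^ 2) * qpoch p (p ^ 2) / euler_phi (p ^ 2) ^ 2)"
  proof -
    have "klein_form (1/2) 0 \<tau> = u * theta_s (\<tau> / 2) \<tau>"
      by (simp add: klein_form_def u_def)
    thus ?thesis
      unfolding theta_s_def eu exp_minus 1 q_p by (simp add: inverse_eq_divide)
  qed
  also have "u * (u ^ 2 - 1 / u ^ 2) = - (1 / u) * (1 - p)"
    unfolding p_u by (simp add: field_simps) (simp add: eval_nat_numeral)
  hence "u * ((u ^ 2 - 1 / u ^ 2) * qpoch (p * p ^ 2) (p ^ 2) * qpoch p (p ^ 2) / euler_phi (p ^ 2) ^ 2) =
     - (1 / u) * ((1 - p) * qpoch (p * p ^ 2) (p ^ 2)) * qpoch p (p ^ 2) / euler_phi (p ^ 2) ^ 2"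
    by (simp add: mult.assoc[symmetric])
  also note 2 [symmetric]
  finally show ?thesis
    by (simp add: power2_eq_square)
qed

text \<open>The constant is an eighth root of unity. This form enters only through its absolute
  value, so the constant need not be tracked.\<close>

private lemma klein_3:
  "\<exists>c. norm c = 1 \<and> klein_form (1/2) (1/2) \<tau> = c * (1 / u) * (qpoch (- p) (p ^ 2) / euler_phi (p ^ 2)) ^ 2"
proof -
  have h: "to_q (1 / 2) = - 1"
    by (simp add: to_q_def)
  have "to_q (\<tau> + (1 / 2 + \<tau> / 2)) = to_q \<tau> * (to_q (1 / 2) * to_q (\<tau> / 2))"
    "to_q (\<tau> - (1 / 2 + \<tau> / 2)) = to_q \<tau> / (to_q (1 / 2) * to_q (\<tau> / 2))"
    by (simp_all only: to_q_add to_q_diff)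
  hence 1: "to_q (\<tau> + (1 / 2 + \<tau> / 2)) = (- p) * p ^ 2" "to_q (\<tau> - (1 / 2 + \<tau> / 2)) = - p"
    unfolding h p_def[symmetric] q_p by (simp_all add: power2_eq_square p_def)
  have 2: "qpoch (- p) (p ^ 2) = (1 - (- p)) * qpoch ((- p) * p ^ 2) (p ^ 2)"
    by (rule qpoch_rec) (rule p)
  have "exp (of_real pi * \<i> * (1 / 2)) = \<i>"
    by (simp add: exp_eq_polar flip: cis_conv_exp)
  hence 3: "exp (of_real pi * \<i> * (1 / 2 + \<tau> / 2)) = \<i> * u ^ 2"
    unfolding ring_distribs exp_add eu by simp
  define c where "c = exp (of_real (pi / 4) * \<i>) * \<i>"
  have "klein_form (1/2) (1/2) \<tau> = (u * exp (of_real (pi / 4) * \<i>)) * ((\<i> * u ^ 2 - 1 / (\<i> * u ^ 2)) * qpoch ((- p) * p ^ 2) (p ^ 2) * qpoch (- p) (p ^ 2) / euler_phi (p ^ 2) ^ 2)"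
  proof -
    have a: "of_real (1/2) * \<tau> + of_real (1/2) = 1 / 2 + \<tau> / 2"
      by simp
    have b: "exp (of_real pi * \<i> * of_real (1/2) * (1 / 2 + \<tau> / 2)) = u * exp (of_real (pi / 4) * \<i>)"
      unfolding u_def exp_add[symmetric] by (simp add: algebra_simps)
    show ?thesis
      unfolding klein_form_def theta_s_def a b exp_minus 3 unfolding 1 q_p by (simp add: field_simps)
  qed
  also have "u * (\<i> * u ^ 2 - 1 / (\<i> * u ^ 2)) = \<i> * (1 / u) * (1 - (- p))"
    unfolding p_u by (simp add: field_simps) (simp add: eval_nat_numeral)
  hence "(u * exp (of_real (pi / 4) * \<i>)) * ((\<i> * u ^ 2 - 1 / (\<i> * u ^ 2)) * qpoch ((- p) * p ^ 2) (p ^ 2) * qpoch (- p) (p ^ 2) / euler_phi (p ^ 2) ^ 2) =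
     c * (1 / u) * ((1 - (- p)) * qpoch ((- p) * p ^ 2) (p ^ 2)) * qpoch (- p) (p ^ 2) / euler_phi (p ^ 2) ^ 2"
  proof -
    assume *: "u * (\<i> * u ^ 2 - 1 / (\<i> * u ^ 2)) = \<i> * (1 / u) * (1 - (- p))"
    have gen: "u * e * (x * y * z / v) = e * (u * x) * y * z / v" for e x y z v :: complex
      by (simp add: mult_ac)
    show ?thesis
      unfolding gen * c_def by (simp add: mult_ac)
  qed
  also note 2 [symmetric]
  finally show ?thesis
    by (intro exI[of _ c]) (simp add: power2_eq_square c_def norm_mult)
qed

text \<open>In the product of the three forms the Pochhammer factors cancel by Euler's identity
  \<open>dis\<close>, and a pure power of eta is left. The first two formulas also serve later to
  balance weights, because they involve eta at \<tau> / 2, \<tau> and 2 \<tau> only.\<close>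

lemma klein_half_eta:
  "klein_form 0 (1/2) \<tau> = 2 * \<i> * eta (2 * \<tau>) ^ 2 / eta \<tau> ^ 4"
  "klein_form (1/2) 0 \<tau> = - (eta (\<tau> / 2) ^ 2 / eta \<tau> ^ 4)"
  "norm (klein_form 0 (1/2) \<tau>) * norm (klein_form (1/2) 0 \<tau>) * norm (klein_form (1/2) (1/2) \<tau>) = 2 / norm (eta \<tau>) ^ 6"
proof -
  have phi: "euler_phi (p ^ 2) \<noteq> 0" "euler_phi ((p ^ 2) ^ 2) \<noteq> 0"
    by (intro euler_phi_nonzero p)+
  have ex: "exp (of_real pi * \<i> * \<tau> / 12) ^ 3 = u"
    unfolding u_def exp_of_nat_mult[symmetric] by (simp add: algebra_simps)
  show "klein_form 0 (1/2) \<tau> = 2 * \<i> * eta (2 * \<tau>) ^ 2 / eta \<tau> ^ 4"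
  proof -
    have "exp (of_real pi * \<i> * (2 * \<tau>) / 12) ^ 2 = exp (of_real pi * \<i> * \<tau> / 12) ^ 4"
      unfolding exp_of_nat_mult[symmetric] by (simp add: algebra_simps)
    thus ?thesis
      unfolding klein_1 eta_def power_mult_distrib by simp
  qed
  show "klein_form (1/2) 0 \<tau> = - (eta (\<tau> / 2) ^ 2 / eta \<tau> ^ 4)"
  proof -
    have "exp (of_real pi * \<i> * (\<tau> / 2) / 12) ^ 2 = exp (of_real pi * \<i> * \<tau> / 12)"
      unfolding exp_of_nat_mult[symmetric] by (simp add: algebra_simps)
    moreover have "exp (of_real pi * \<i> * \<tau> / 12) ^ 4 = exp (of_real pi * \<i> * \<tau> / 12) * u"
      unfolding ex[symmetric] by (simp add: eval_nat_numeral)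
    moreover have "euler_phi (to_q (\<tau> / 2)) = qpoch p (p ^ 2) * euler_phi (p ^ 2)"
      using euler_phi_dissect[OF p(1)] by (simp add: p_def)
    ultimately show ?thesis
      unfolding klein_2 eta_def power_mult_distrib using phi
      by (simp add: q_p field_simps power2_eq_square power4_eq_xxxx)
  qed
  obtain c where c: "norm c = 1" "klein_form (1/2) (1/2) \<tau> = c * (1 / u) * (qpoch (- p) (p ^ 2) / euler_phi (p ^ 2)) ^ 2"
    using klein_3 by blast
  have dis: "qpoch p (p ^ 2) * qpoch (- p) (p ^ 2) * euler_phi ((p ^ 2) ^ 2) = euler_phi (p ^ 2)"
    using qpoch_mult_minus[OF p(2), of p] euler_phi_dissect[OF p(2)] by simp
  have "klein_form 0 (1/2) \<tau> * klein_form (1/2) 0 \<tau> * klein_form (1/2) (1/2) \<tau> =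
      - 2 * \<i> * c * (1 / u) ^ 2 * (qpoch p (p ^ 2) * qpoch (- p) (p ^ 2) * euler_phi ((p ^ 2) ^ 2)) ^ 2 / euler_phi (p ^ 2) ^ 8"
  proof -
    have q2: "to_q (2 * \<tau>) = (p ^ 2) ^ 2"
      using to_q_power[of \<tau> 2] by (simp add: q_p)
    show ?thesis
      unfolding klein_1 klein_2 c(2) q2 q_p using phi
      by (simp add: power_mult_distrib power_divide) (simp add: divide_simps eval_nat_numeral)
  qed
  also have "\<dots> = - 2 * \<i> * c / eta \<tau> ^ 6"
  proof -
    have "exp (of_real pi * \<i> * \<tau> / 12) ^ 6 = u ^ 2"
      unfolding ex[symmetric] by (simp flip: power_mult)
    thus ?thesis
      unfolding dis eta_def power_mult_distrib q_p using phi by (simp add: field_simps flip: power_add)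
  qed
  finally have "norm (klein_form 0 (1/2) \<tau> * klein_form (1/2) 0 \<tau> * klein_form (1/2) (1/2) \<tau>) = norm (- 2 * \<i> * c / eta \<tau> ^ 6)"
    by simp
  thus "norm (klein_form 0 (1/2) \<tau>) * norm (klein_form (1/2) 0 \<tau>) * norm (klein_form (1/2) (1/2) \<tau>) = 2 / norm (eta \<tau>) ^ 6"
    using c(1) by (simp add: norm_mult norm_divide norm_power)
qed

end

lemma norm_klein_form_half_mod_2:
  assumes "Im \<tau> > 0"
  shows "norm (klein_form (of_int x / 2) (of_int y / 2) \<tau>) = norm (klein_form (of_int (x mod 2) / 2) (of_int (y mod 2) / 2) \<tau>)"
proof -
  have *: "of_int x / 2 = of_int (x mod 2) / 2 + real_of_int (x div 2)" for x
    using div_mult_mod_eq[of x 2] by (metis (no_types, lifting) add.commute add_divide_distrib mult.commute nonzero_mult_div_cancel_left of_int_add of_int_mult of_int_numeral zero_neq_numeral)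
  show ?thesis
    by (subst (1 2) *, subst klein_form_add_int[OF assms]) (simp add: norm_mult del: of_int_add of_int_mult of_real_add of_real_diff of_real_of_int_eq)
qed

text \<open>
  Modulo \<open>\<plusminus>1\<close> and \<open>\<int>\<^sup>2\<close>, the three classes of half-periods are permuted, and the product of
  the three Klein forms is \<open>\<eta>\<^sup>-\<^sup>6\<close> up to a constant.
\<close>

lemma norm_eta_modular:
  fixes a b c d :: int
  assumes \<tau>: "Im \<tau> > 0" and det: "a * d - b * c = 1"
  shows "norm (eta ((of_int a * \<tau> + of_int b) / (of_int c * \<tau> + of_int d))) ^ 2 = norm (of_int c * \<tau> + of_int d) * norm (eta \<tau>) ^ 2"
proof -
  define j where "j = of_int c * \<tau> + of_int d"
  define \<tau>' where "\<tau>' = (of_int a * \<tau> + of_int b) / j"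
  have j: "j \<noteq> 0" and \<tau>': "Im \<tau>' > 0"
    using moebius_int[OF assms] by (simp_all add: j_def \<tau>'_def)
  define K where "K = (\<lambda>x y :: int. norm (klein_form (of_int x / 2) (of_int y / 2) \<tau>))"
  have K2: "K x y = K (x mod 2) (y mod 2)" for x y
    unfolding K_def by (rule norm_klein_form_half_mod_2[OF \<tau>])
  have law: "norm j * norm (klein_form (of_int x / 2) (of_int y / 2) \<tau>') = K (x * a + y * c) (x * b + y * d)" for x y
    using arg_cong[OF klein_form_modular[OF assms, of "of_int x / 2" "of_int y / 2"], of norm]
    by (simp add: K_def j_def \<tau>'_def norm_mult add_divide_distrib)
  have "(norm j * norm (klein_form 0 (1/2) \<tau>')) * (norm j * norm (klein_form (1/2) 0 \<tau>')) * (norm j * norm (klein_form (1/2) (1/2) \<tau>')) =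
          K c d * K a b * K (a + c) (b + d)"
    using law[of 0 1] law[of 1 0] law[of 1 1] by simp
  also have "\<dots> = K (c mod 2) (d mod 2) * K (a mod 2) (b mod 2) * K ((a mod 2 + c mod 2) mod 2) ((b mod 2 + d mod 2) mod 2)"
    using K2[of c d] K2[of a b] K2[of "a + c" "b + d"] by (simp add: mod_add_eq)
  \<comment> \<open>Modulo 2 the three index vectors are the nonzero vectors of the plane over the
    field with two elements, and an invertible matrix permutes them.\<close>
  also have "\<dots> = K 0 1 * K 1 0 * K 1 1"
  proof -
    have "odd (a * d - b * c)"
      using det by simp
    hence *: "odd (a * d) \<noteq> odd (b * c)"
      by simp
    have m: "x mod 2 = (if even x then 0 else 1)" for x :: int
      by (simp add: mod2_eq_if)
    show ?thesis
      using * unfolding m by (auto split: if_splits)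
  qed
  finally have "norm j ^ 3 * (2 / norm (eta \<tau>') ^ 6) = 2 / norm (eta \<tau>) ^ 6"
    unfolding klein_half_eta(3)[OF \<tau>', symmetric] klein_half_eta(3)[OF \<tau>, symmetric]
    by (simp add: K_def power3_eq_cube mult_ac)
  hence "norm (eta \<tau>') ^ 6 = norm j ^ 3 * norm (eta \<tau>) ^ 6"
    using eta_nonzero[OF \<tau>] eta_nonzero[OF \<tau>'] by (simp add: field_simps)
  hence "(norm (eta \<tau>') ^ 2) ^ 3 = (norm j * norm (eta \<tau>) ^ 2) ^ 3"
    by (simp add: power_mult_distrib flip: power_mult)
  hence "norm (eta \<tau>') ^ 2 = norm j * norm (eta \<tau>) ^ 2"
    by (subst (asm) power_eq_iff_eq_base) auto
  thus ?thesis
    by (simp add: j_def \<tau>'_def)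
qed

section \<open>Products of Klein forms over division points\<close>

lemma prod_roots_of_unity:
  fixes x :: complex
  assumes "N > 0"
  shows "(\<Prod>k<N. 1 - to_q (of_nat k / of_nat N) * x) = 1 - x ^ N"
proof (cases "x = 0")
  case True
  thus ?thesis
    using assms by simp
next
  case False
  define p :: "complex poly" where "p = Polynomial.monom 1 N - 1"
  have deg: "Polynomial.degree p = N"
  proof -
    have "Polynomial.degree (Polynomial.monom 1 N + (- 1 :: complex poly)) = Polynomial.degree (Polynomial.monom (1::complex) N)"
      using assms by (intro degree_add_eq_left) (simp add: degree_monom_eq)
    thus ?thesis
      by (simp add: p_def degree_monom_eq)
  qed
  have roots: "{z. poly p z = 0} = {z. z ^ N = 1}"
    by (auto simp: p_def poly_monom)
  have "rsquarefree p"
    unfolding rsquarefree_roots using assms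
    by (auto simp: p_def poly_monom pderiv_diff pderiv_monom power_0_left)
  hence "Polynomial.smult (Polynomial.lead_coeff p) (\<Prod>z | poly p z = 0. [:- z, 1:]) = p"
    by (rule complex_poly_decompose_rsquarefree)
  moreover have "Polynomial.lead_coeff p = 1"
    unfolding deg using assms by (simp add: p_def)
  ultimately have "p = (\<Prod>z | z ^ N = 1. [:- z, 1:])"
    by (simp add: roots)
  also have "\<dots> = (\<Prod>k<N. [:- to_q (of_nat k / of_nat N), 1:])"
  proof (rule prod.reindex_bij_betw [symmetric])
    have "(\<lambda>k. to_q (of_nat k / of_nat N)) = (\<lambda>k. cis (2 * pi * real k / real N))"
      by (simp add: to_q_def cis_conv_exp mult_ac)
    thus "bij_betw (\<lambda>k. to_q (of_nat k / of_nat N)) {..<N} {z. z ^ N = 1}"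
      using Complex.bij_betw_roots_unity[OF assms] by simp
  qed
  finally have "poly p (1 / x) = (\<Prod>k<N. 1 / x - to_q (of_nat k / of_nat N))"
    by (simp add: poly_prod)
  hence "x ^ N * poly p (1 / x) = (\<Prod>k<N. x) * (\<Prod>k<N. 1 / x - to_q (of_nat k / of_nat N))"
    by simp
  also have "\<dots> = (\<Prod>k<N. 1 - to_q (of_nat k / of_nat N) * x)"
    unfolding prod.distrib[symmetric] using False by (intro prod.cong) (auto simp: field_simps)
  finally show ?thesis
    using False by (simp add: p_def poly_monom field_simps)
qed

definition klein_prod :: "nat \<Rightarrow> complex \<Rightarrow> complex"
  where "klein_prod N \<tau> = (\<Prod>k=1..(N-1) div 2. klein_form 0 (of_nat k / of_nat N) \<tau>)"

text \<open>The nontrivial N-th roots of unity form (N - 1) / 2 inverse pairs, and the Klein form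
  with index k / N contributes both members of one pair. All Pochhammer factors together with
  \<open>euler_phi q\<close> therefore collapse to \<open>euler_phi (q ^ N)\<close>.\<close>

lemma klein_prod_eta:
  assumes "odd N"
  shows "\<exists>C. C \<noteq> 0 \<and> (\<forall>\<tau>. Im \<tau> > 0 \<longrightarrow> klein_prod N \<tau> = C * eta (of_nat N * \<tau>) / eta \<tau> ^ N)"
proof -
  from assms obtain n where n: "N = 2 * n + 1"
    by (elim oddE)
  define C where "C = (\<Prod>k=1..n. exp (of_real pi * \<i> * (of_nat k / of_nat N)) - exp (- (of_real pi * \<i> * (of_nat k / of_nat N))))"
  define Z where "Z = image_mset (\<lambda>k. to_q (of_nat k / of_nat N)) (mset_set {1..n}) + image_mset (\<lambda>k. to_q (- (of_nat k / of_nat N))) (mset_set {1..n})"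
  have C0: "C \<noteq> 0"
  proof -
    have "exp (of_real pi * \<i> * (of_nat k / of_nat N)) - exp (- (of_real pi * \<i> * (of_nat k / of_nat N))) \<noteq> 0" if k: "k \<in> {1..n}" for k
    proof
      assume *: "exp (of_real pi * \<i> * (of_nat k / of_nat N)) - exp (- (of_real pi * \<i> * (of_nat k / of_nat N))) = 0"
      have "to_q (of_nat k / of_nat N) = exp (of_real pi * \<i> * (of_nat k / of_nat N)) * exp (of_real pi * \<i> * (of_nat k / of_nat N))"
        unfolding to_q_def exp_add[symmetric] by (simp add: mult_ac)
      also have "\<dots> = exp (of_real pi * \<i> * (of_nat k / of_nat N)) * exp (- (of_real pi * \<i> * (of_nat k / of_nat N)))"
        using * by simp
      also have "\<dots> = 1"
        by (simp flip: exp_add)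
      finally have "(of_nat k / of_nat N :: complex) \<in> \<int>"
        by (simp add: to_q_eq_1_iff)
      then obtain m :: int where "of_nat k / of_nat N = (of_int m :: complex)"
        by (elim Ints_cases)
      hence "(of_nat k :: complex) = of_int (m * int N)"
        by (simp add: field_simps n del: of_nat_add of_nat_mult of_nat_Suc)
      hence m: "int k = m * int N"
        by (metis of_int_eq_iff of_int_of_nat_eq)
      have "m > 0"
      proof (rule ccontr)
        assume "\<not> m > 0"
        hence "m * int N \<le> 0"
          by (intro mult_nonpos_nonneg) auto
        with m k show False
          by simp
      qed
      hence "1 * int N \<le> m * int N"
        by (intro mult_right_mono) auto
      hence "int N \<le> int k"
        using m by simp
      with k show False
        by (simp add: n)
    qed
    thus ?thesis
      unfolding C_def by simp
  qed
  have Z: "(1 - x) * (\<Prod>\<zeta>\<in>#Z. 1 - \<zeta> * x) = 1 - x ^ N" for x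
  proof -
    define F where "F = (\<lambda>k. 1 - to_q (of_nat k / of_nat N) * x)"
    have "1 - x ^ N = (\<Prod>k<N. F k)"
      unfolding F_def by (rule prod_roots_of_unity [symmetric]) (simp add: n)
    also have "{..<N} = insert 0 ({1..n} \<union> {n+1..2*n})"
      by (auto simp: n)
    also have "(\<Prod>k\<in>insert 0 ({1..n} \<union> {n+1..2*n}). F k) = (1 - x) * ((\<Prod>k=1..n. F k) * (\<Prod>k=n+1..2*n. F k))"
      by (subst prod.insert; simp?; subst prod.union_disjoint; auto simp: F_def)
    also have "(\<Prod>k=n+1..2*n. F k) = (\<Prod>k=1..n. 1 - to_q (- (of_nat k / of_nat N)) * x)"
    proof (rule prod.reindex_bij_witness[of _ "\<lambda>k. N - k" "\<lambda>k. N - k"])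
      fix k assume k: "k \<in> {n+1..2*n}"
      have "to_q (- (of_nat (N - k) / of_nat N)) = to_q (of_nat k / of_nat N - 1)"
      proof -
        have "(of_nat N :: complex) \<noteq> 0" "k \<le> N"
          using k by (auto simp: n simp del: of_nat_Suc of_nat_add)
        thus ?thesis
          by (simp add: of_nat_diff diff_divide_distrib)
      qed
      also have "\<dots> = to_q (of_nat k / of_nat N)"
        by (simp add: to_q_diff)
      finally show "1 - to_q (- (of_nat (N - k) / of_nat N)) * x = F k"
        by (simp add: F_def)
    qed (auto simp: n)
    finally show ?thesis
      by (simp add: Z_def prod_unfold_prod_mset F_def image_mset.compositionality o_def)
  qed
  have "klein_prod N \<tau> = C * eta (of_nat N * \<tau>) / eta \<tau> ^ N" if \<tau>: "Im \<tau> > 0" for \<tau>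
  proof -
    define q where "q = to_q \<tau>"
    have q: "norm q < 1"
      using \<tau> by (simp add: q_def)
    have phi: "euler_phi q \<noteq> 0"
      using q by (rule euler_phi_nonzero)
    have "klein_prod N \<tau> = (\<Prod>k=1..n. (exp (of_real pi * \<i> * (of_nat k / of_nat N)) - exp (- (of_real pi * \<i> * (of_nat k / of_nat N)))) *
       (qpoch (to_q (of_nat k / of_nat N) * q) q * qpoch (to_q (- (of_nat k / of_nat N)) * q) q) / euler_phi q ^ 2)"
      unfolding klein_prod_def
    proof (rule prod.cong)
      fix k
      have "to_q (\<tau> + of_nat k / of_nat N) = to_q (of_nat k / of_nat N) * q"
        "to_q (\<tau> - of_nat k / of_nat N) = to_q (- (of_nat k / of_nat N)) * q"
        by (simp_all add: to_q_add to_q_diff to_q_uminus q_def)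
      thus "klein_form 0 (of_nat k / of_nat N) \<tau> = (exp (of_real pi * \<i> * (of_nat k / of_nat N)) - exp (- (of_real pi * \<i> * (of_nat k / of_nat N)))) *
       (qpoch (to_q (of_nat k / of_nat N) * q) q * qpoch (to_q (- (of_nat k / of_nat N)) * q) q) / euler_phi q ^ 2"
        by (simp add: klein_form_def theta_s_def q_def mult_ac)
    qed (simp add: n)
    also have "\<dots> = C * ((\<Prod>k=1..n. qpoch (to_q (of_nat k / of_nat N) * q) q) * (\<Prod>k=1..n. qpoch (to_q (- (of_nat k / of_nat N)) * q) q)) / euler_phi q ^ (2 * n)"
      unfolding C_def prod_dividef prod.distrib by (simp add: power_mult)
    also have "(\<Prod>k=1..n. qpoch (to_q (of_nat k / of_nat N) * q) q) * (\<Prod>k=1..n. qpoch (to_q (- (of_nat k / of_nat N)) * q) q) = euler_phi (q ^ N) / euler_phi q"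
    proof -
      have "euler_phi q * (\<Prod>\<zeta>\<in>#Z. qpoch (\<zeta> * q) q) = euler_phi (q ^ N)"
        by (rule qpoch_prod_roots[OF q _ Z]) (simp add: n)
      thus ?thesis
        using phi by (simp add: Z_def prod_unfold_prod_mset image_mset.compositionality o_def field_simps)
    qed
    also have "C * (euler_phi (q ^ N) / euler_phi q) / euler_phi q ^ (2 * n) = C * (euler_phi (to_q (of_nat N * \<tau>)) / euler_phi q ^ N)"
    proof -
      have "q ^ N = to_q (of_nat N * \<tau>)"
        by (simp only: q_def to_q_power)
      moreover have "euler_phi q ^ N = euler_phi q * euler_phi q ^ (2 * n)"
        by (simp add: n)
      ultimately show ?thesis
        by simp
    qed
    also have "euler_phi (to_q (of_nat N * \<tau>)) / euler_phi q ^ N = eta (of_nat N * \<tau>) / eta \<tau> ^ N"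
    proof -
      have "exp (of_real pi * \<i> * (of_nat N * \<tau>) / 12) = exp (of_real pi * \<i> * \<tau> / 12) ^ N"
        unfolding exp_of_nat_mult[symmetric] by (simp add: mult_ac)
      thus ?thesis
        by (simp add: eta_def q_def power_mult_distrib)
    qed
    finally show ?thesis
      by simp
  qed
  with C0 show ?thesis
    by blast
qed

text \<open>The quadratic characters modulo 3 and 5. They are applied only to \<open>d\<close> prime
  to 30, so the value on multiples of 3 or 5 is left at -1.\<close>

definition leg3 :: "int \<Rightarrow> complex" where "leg3 d = (if d mod 3 = 1 then 1 else - 1)"
definition leg5 :: "int \<Rightarrow> complex" where "leg5 d = (if d mod 5 \<in> {1, 4} then 1 else - 1)"

lemma klein_form_0_plus_1:
  assumes "Im \<tau> > 0"
  shows "klein_form 0 (s + 1) \<tau> = - klein_form 0 s \<tau>"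
  using klein_form_add_int[OF assms, of 0 0 s 1] by simp

text \<open>Raising the second index by 1 changes the sign of the form, while reflecting it from s
  to 1 - s does not. The sign is thus the parity of the floor of x / N, as in Eisenstein's version
  of Gauss's lemma.\<close>

definition klein_sgn :: "int \<Rightarrow> int \<Rightarrow> complex"
  where "klein_sgn N x = (if even (x div N) then 1 else - 1)"

definition klein_rep :: "int \<Rightarrow> int \<Rightarrow> int"
  where "klein_rep N x = (if 2 * (x mod N) < N then x mod N else N - x mod N)"

context
  fixes \<tau> :: complex and N :: int
  assumes \<tau>: "Im \<tau> > 0" and N: "N > 0"
begin

private lemma klein_form_0_reduce:
  "klein_form 0 (of_int x / of_int N) \<tau> = (if even (x div N) then 1 else - 1) * klein_form 0 (of_int (x mod N) / of_int N) \<tau>"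
proof -
  have *: "real_of_int x = of_int (x div N) * of_int N + of_int (x mod N)"
    by (metis div_mult_mod_eq of_int_add of_int_mult)
  have "real_of_int x / of_int N = (of_int (x div N) * of_int N + of_int (x mod N)) / of_int N"
    by (rule arg_cong[OF *])
  also have "\<dots> = of_int (x mod N) / of_int N + of_int (x div N)"
    using N by (simp add: add_divide_distrib)
  finally have "real_of_int x / of_int N = of_int (x mod N) / of_int N + of_int (x div N)" .
  thus ?thesis
    using klein_form_add_int[OF \<tau>, of 0 0 "of_int (x mod N) / of_int N" "x div N"] exp_parity[of "x div N"] by simp
qed

private lemma klein_form_0_reflect:
  "klein_form 0 (of_int (N - x) / of_int N) \<tau> = klein_form 0 (of_int x / of_int N) \<tau>"
proof -
  have *: "real_of_int (N - x) / of_int N = - (of_int x / of_int N) + 1"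
    using N by (simp add: field_simps)
  thus ?thesis
    unfolding * klein_form_0_plus_1[OF \<tau>] using klein_form_uminus[of 0 "of_int x / of_int N" \<tau>] by simp
qed

lemma klein_form_0_rep:
  "klein_form 0 (of_int x / of_int N) \<tau> = klein_sgn N x * klein_form 0 (of_int (klein_rep N x) / of_int N) \<tau>"
  unfolding klein_sgn_def klein_rep_def using klein_form_0_reduce[of x] klein_form_0_reflect[of "x mod N"] by auto

end

text \<open>The period in \<open>d\<close> is 2 N and not N, again because a shift of the index by 1
  costs a sign.\<close>

lemma klein_form_0_mod:
  assumes "Im \<tau> > 0" "N > 0"
  shows "klein_form 0 (of_int (k * d) / of_int N) \<tau> = klein_form 0 (of_int (k * (d mod (2 * N))) / of_int N) \<tau>"
proof -
  have "k * d = k * (d mod (2 * N)) + 2 * N * (k * (d div (2 * N)))"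
    by (metis (no_types) distrib_left mod_mult_div_eq mult.left_commute)
  hence "real_of_int (k * d) = real_of_int (k * (d mod (2 * N)) + 2 * N * (k * (d div (2 * N))))"
    by (rule arg_cong)
  also have "\<dots> = of_int (k * (d mod (2 * N))) + of_int N * of_int (2 * (k * (d div (2 * N))))"
    by simp
  finally have *: "real_of_int (k * d) = of_int (k * (d mod (2 * N))) + of_int N * of_int (2 * (k * (d div (2 * N))))" .
  have "real_of_int (k * d) / of_int N = of_int (k * (d mod (2 * N))) / of_int N + of_int (2 * (k * (d div (2 * N))))"
    unfolding * add_divide_distrib using assms(2) by simp
  thus ?thesis
    using klein_form_add_int[OF assms(1), of 0 0 "of_int (k * (d mod (2 * N))) / of_int N" "2 * (k * (d div (2 * N)))"]
      exp_parity[of "2 * (k * (d div (2 * N)))"] by simp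
qed

definition klein_prod_twist :: "nat \<Rightarrow> int \<Rightarrow> complex \<Rightarrow> complex"
  where "klein_prod_twist N d \<tau> = (\<Prod>k=1..(N-1) div 2. klein_form 0 (of_int (int k * d) / of_nat N) \<tau>)"

lemma klein_prod_twist_mod:
  assumes "Im \<tau> > 0" "N > 0"
  shows "klein_prod_twist N d \<tau> = klein_prod_twist N (d mod (2 * int N)) \<tau>"
  unfolding klein_prod_twist_def
proof (rule prod.cong)
  show "klein_form 0 (of_int (int k * d) / of_nat N) \<tau> = klein_form 0 (of_int (int k * (d mod (2 * int N))) / of_nat N) \<tau>" for k
    using klein_form_0_mod[OF assms(1), of "int N" "int k" d] assms(2) by simp
qed auto

lemma coprime_30D:
  fixes d :: int
  assumes "coprime d 30"
  shows "odd d" "\<not> 3 dvd d" "\<not> 5 dvd d"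
  using coprime_common_divisor[OF assms, of 2] coprime_common_divisor[OF assms, of 3] coprime_common_divisor[OF assms, of 5]
  by auto

lemma klein_prod_twist_3:
  assumes "Im \<tau> > 0" "coprime d 30"
  shows "klein_prod_twist 3 d \<tau> = leg3 d * klein_prod 3 \<tau>"
proof -
  have "d mod 6 = 1 \<or> d mod 6 = 5"
    using coprime_30D[OF assms(2)] by presburger
  moreover have "d mod 3 = d mod 6 mod 3"
    by (simp add: mod_mod_cancel)
  moreover have "klein_prod_twist 3 d \<tau> = klein_prod_twist 3 (d mod 6) \<tau>"
    using klein_prod_twist_mod[OF assms(1), of 3 d] by simp
  moreover have "klein_prod_twist 3 x \<tau> = klein_form 0 (of_int x / of_int 3) \<tau>" for x
    by (simp add: klein_prod_twist_def)
  moreover have "klein_prod 3 \<tau> = klein_form 0 (of_int 1 / of_int 3) \<tau>"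
    by (simp add: klein_prod_def)
  ultimately show ?thesis
    using klein_form_0_rep[OF assms(1), of 3 5]
    by (elim disjE) (simp_all add: leg3_def klein_sgn_def klein_rep_def)
qed

lemma klein_prod_twist_5:
  assumes "Im \<tau> > 0" "coprime d 30"
  shows "klein_prod_twist 5 d \<tau> = leg5 d * klein_prod 5 \<tau>"
proof -
  have "d mod 10 = 1 \<or> d mod 10 = 3 \<or> d mod 10 = 7 \<or> d mod 10 = 9"
    using coprime_30D[OF assms(2)] by presburger
  moreover have "d mod 5 = d mod 10 mod 5"
    by (simp add: mod_mod_cancel)
  moreover have "klein_prod_twist 5 d \<tau> = klein_prod_twist 5 (d mod 10) \<tau>"
    using klein_prod_twist_mod[OF assms(1), of 5 d] by simp
  moreover have two: "{1..(5 - 1) div 2 :: nat} = {1, 2}"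
    by auto
  moreover have "klein_prod_twist 5 x \<tau> = klein_form 0 (of_int x / of_int 5) \<tau> * klein_form 0 (of_int (2 * x) / of_int 5) \<tau>" for x
    unfolding klein_prod_twist_def two by simp
  moreover have "klein_prod 5 \<tau> = klein_form 0 (of_int 1 / of_int 5) \<tau> * klein_form 0 (of_int 2 / of_int 5) \<tau>"
    unfolding klein_prod_def two by simp
  ultimately show ?thesis
    using klein_form_0_rep[OF assms(1), of 5 3] klein_form_0_rep[OF assms(1), of 5 6]
      klein_form_0_rep[OF assms(1), of 5 7] klein_form_0_rep[OF assms(1), of 5 14]
      klein_form_0_rep[OF assms(1), of 5 9] klein_form_0_rep[OF assms(1), of 5 18]
    by (elim disjE) (simp_all add: leg5_def klein_sgn_def klein_rep_def)
qed

text \<open>Multiplication by a unit permutes the classes of 1, ..., 14 modulo 15 and sign, but not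
  those prime to 15 alone: all seven indices occur, so the product is reproduced up to a sign. The
  sign is the Jacobi symbol of \<open>d\<close> over 15, found by inspecting the eight classes of
  units modulo 30.\<close>

lemma klein_prod_twist_15:
  assumes "Im \<tau> > 0" "coprime d 30"
  shows "klein_prod_twist 15 d \<tau> = leg3 d * leg5 d * klein_prod 15 \<tau>"
proof -
  define e where "e = d mod 30"
  have "e \<in> {1, 7, 11, 13, 17, 19, 23, 29}"
    using coprime_30D[OF assms(2)] unfolding e_def insert_iff empty_iff by presburger
  hence "klein_prod_twist 15 e \<tau> = leg3 e * leg5 e * klein_prod 15 \<tau>"
  proof -
    have *: "klein_prod_twist 15 x \<tau> = (\<Prod>k\<in>{1,2,3,4,5,6,7}. klein_sgn 15 (k * x) * klein_form 0 (of_int (klein_rep 15 (k * x)) / of_int 15) \<tau>)" for x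
    proof -
      have "{1..(15 - 1) div 2 :: nat} = {1,2,3,4,5,6,7}"
        by auto
      thus ?thesis
        unfolding klein_prod_twist_def using klein_form_0_rep[OF assms(1), of 15, symmetric] by simp
    qed
    have **: "klein_prod 15 \<tau> = (\<Prod>k\<in>{1,2,3,4,5,6,7}. klein_form 0 (of_int k / of_int 15) \<tau>)"
    proof -
      have "{1..(15 - 1) div 2 :: nat} = {1,2,3,4,5,6,7}"
        by auto
      thus ?thesis
        unfolding klein_prod_def by simp
    qed
    from \<open>e \<in> _\<close> show ?thesis
      unfolding * ** insert_iff empty_iff
      by (elim disjE) (simp_all add: leg3_def leg5_def klein_sgn_def klein_rep_def mult_ac)
  qed
  moreover have "leg3 e = leg3 d" "leg5 e = leg5 d"
    by (simp_all add: leg3_def leg5_def e_def mod_mod_cancel)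
  moreover have "klein_prod_twist 15 d \<tau> = klein_prod_twist 15 e \<tau>"
    using klein_prod_twist_mod[OF assms(1), of 15 d] by (simp add: e_def)
  ultimately show ?thesis
    by simp
qed

text \<open>The matrix sends the index (0, k / N) to (k c, k d / N), and removing the integer k c
  costs exp(\<pi> i (k c - k^2 c d / N)). For n = (N - 1) / 2 the sums of k and of k^2 are n (n + 1)
  / 2 and N n (n + 1) / 6, so with S = n (n + 1) / 6 both sums are expressed by one number.\<close>

lemma klein_prod_modular:
  fixes a b c d :: int
  assumes \<tau>: "Im \<tau> > 0" and det: "a * d - b * (int N * c) = 1" and N: "odd N"
    and S: "(\<Sum>k=1..(N-1) div 2. real k) = 3 * S" "(\<Sum>k=1..(N-1) div 2. (real k) ^ 2) = real N * S"
  shows "(of_int (int N * c) * \<tau> + of_int d) ^ ((N - 1) div 2) *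
           klein_prod N ((of_int a * \<tau> + of_int b) / (of_int (int N * c) * \<tau> + of_int d)) =
         exp (of_real pi * \<i> * of_real (of_int c * S * (3 - of_int d))) * klein_prod_twist N d \<tau>"
proof -
  define n where "n = (N - 1) div 2"
  define j where "j = of_int (int N * c) * \<tau> + of_int d"
  have N0: "real N > 0"
    using N by (simp add: odd_pos)
  have "j ^ n * klein_prod N ((of_int a * \<tau> + of_int b) / j) =
     (\<Prod>k=1..n. j * klein_form 0 (of_nat k / of_nat N) ((of_int a * \<tau> + of_int b) / j))"
    by (simp add: klein_prod_def n_def prod.distrib)
  also have "\<dots> = (\<Prod>k=1..n. exp (of_real pi * \<i> * of_real (of_int c * real k - of_int c * (real k ^ 2 / real N) * of_int d)) *
                klein_form 0 (of_int (int k * d) / of_nat N) \<tau>)"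
  proof (rule prod.cong)
    fix k
    have "j * klein_form 0 (of_nat k / of_nat N) ((of_int a * \<tau> + of_int b) / j) =
       klein_form (0 + of_int (int k * c)) (of_int (int k * d) / of_nat N + of_int 0) \<tau>"
      using klein_form_modular[OF \<tau> det, of 0 "of_nat k / of_nat N"] N0 by (simp add: j_def)
    also have "\<dots> = exp (of_real pi * \<i> * of_real (of_int c * real k - of_int c * (real k ^ 2 / real N) * of_int d)) *
                klein_form 0 (of_int (int k * d) / of_nat N) \<tau>"
      by (subst klein_form_add_int[OF \<tau>]) (simp add: power2_eq_square mult_ac)
    finally show "j * klein_form 0 (of_nat k / of_nat N) ((of_int a * \<tau> + of_int b) / j) = \<dots>" .
  qed simp
  also have "\<dots> = exp (of_real pi * \<i> * of_real (\<Sum>k=1..n. of_int c * real k - of_int c * (real k ^ 2 / real N) * of_int d)) * klein_prod_twist N d \<tau>"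
    unfolding prod.distrib klein_prod_twist_def n_def by (subst exp_sum [symmetric]) (simp_all add: sum_distrib_left)
  also have "(\<Sum>k=1..n. of_int c * real k - of_int c * (real k ^ 2 / real N) * of_int d) =
     of_int c * (\<Sum>k=1..n. real k) - of_int c * ((\<Sum>k=1..n. real k ^ 2) / real N) * of_int d"
    by (simp add: sum_subtractf sum_distrib_left sum_distrib_right sum_divide_distrib)
  also have "\<dots> = of_int c * S * (3 - of_int d)"
    using S N0 by (simp add: n_def algebra_simps)
  finally show ?thesis
    by (simp add: j_def n_def)
qed

section \<open>Growth of eta at the cusps\<close>

lemma filterlim_to_q: "(to_q \<longlongrightarrow> 0) (filtercomap Im at_top)"
proof (rule tendsto_norm_zero_cancel)
  have "((\<lambda>x::real. exp (- 2 * pi * x)) \<longlongrightarrow> 0) at_top"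
    by real_asymp
  hence "((\<lambda>z. exp (- 2 * pi * Im z)) \<longlongrightarrow> 0) (filtercomap Im at_top)"
    by (rule filterlim_compose) (rule filterlim_filtercomap)
  thus "((\<lambda>z. norm (to_q z)) \<longlongrightarrow> 0) (filtercomap Im at_top)"
    by (simp add: norm_to_q)
qed

lemma norm_eta_tendsto:
  "((\<lambda>z. norm (eta z) * exp (pi * Im z / 12)) \<longlongrightarrow> 1) (filtercomap Im at_top)"
proof -
  have "((\<lambda>z. norm (euler_phi (to_q z))) \<longlongrightarrow> norm (1::complex)) (filtercomap Im at_top)"
    by (intro tendsto_norm euler_phi_tendsto_1 filterlim_to_q)
  moreover have "norm (eta z) * exp (pi * Im z / 12) = norm (euler_phi (to_q z))" for z
    by (simp add: eta_def norm_mult exp_minus)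
  ultimately show ?thesis
    by simp
qed

text \<open>The matrix of \<tau> -> \<delta> M \<tau> has first column (\<delta> a, c), whose gcd is
  g = gcd(c, \<delta>) because \<open>a\<close> and \<open>c\<close> are coprime. It factors as an
  element of SL2(Z) times an upper triangular matrix with diagonal (g, D), where g D = \<delta>. The
  first factor is handled by \<open>norm_eta_modular\<close>, the second is affine.\<close>

lemma norm_eta_scaled_modular:
  fixes a b c d :: int and \<delta> :: nat
  assumes det: "a * d - b * c = 1" and \<delta>: "\<delta> > 0"
  obtains \<beta> :: int where
    "\<And>\<tau>. Im \<tau> > 0 \<Longrightarrow> norm (eta (of_nat \<delta> * ((of_int a * \<tau> + of_int b) / (of_int c * \<tau> + of_int d)))) ^ 2 =
       norm (of_int c * \<tau> + of_int d) * (of_int (gcd c (int \<delta>)) / of_nat \<delta>) *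
       norm (eta ((of_int (gcd c (int \<delta>) ^ 2) * \<tau> + of_int \<beta>) / of_nat \<delta>)) ^ 2"
proof -
  define g where "g = gcd c (int \<delta>)"
  have g: "g > 0"
    using \<delta> by (simp add: g_def)
  obtain D where D: "int \<delta> = g * D"
    unfolding g_def by (metis dvdE gcd_dvd2)
  obtain r where r: "c = g * r"
    unfolding g_def by (metis dvdE gcd_dvd1)
  have D0: "D > 0"
    using D \<delta> g by (metis of_nat_0_less_iff zero_less_mult_pos)
  have "coprime r D"
  proof -
    have "g * gcd r D = gcd c (int \<delta>)"
      using gcd_mult_distrib_int[of g r D] g by (simp add: D r)
    thus ?thesis
      using g \<delta> by (auto simp: g_def coprime_iff_gcd_eq_1)
  qed
  moreover have "coprime r a"
  proof (rule coprimeI)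
    fix x assume "x dvd r" "x dvd a"
    hence "x dvd a * d - b * c"
      by (simp add: r)
    thus "is_unit x"
      using det by simp
  qed
  ultimately have "coprime (D * a) r"
    by (simp add: coprime_commute)
  then obtain t s' where "D * a * t + r * s' = 1"
    by (metis bezout_int coprime_iff_gcd_eq_1 mult.commute)
  then obtain s where st: "D * a * t - s * r = 1"
    using that by (metis diff_minus_eq_add minus_mult_left mult.commute)
  \<comment> \<open>This is the upper right entry of the triangular factor, obtained by applying the
    inverse of the unimodular matrix (D a, s; r, t) to the column (\<delta> b, d).\<close>
  define \<beta>' where "\<beta>' = t * int \<delta> * b - s * d"
  have m1: "D * a * \<beta>' + s * D = int \<delta> * b"
  proof -
    have "D * a * \<beta>' + s * D = int \<delta> * b * (D * a * t) - s * D * (a * d - 1)"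
      by (simp add: \<beta>'_def algebra_simps)
    also have "a * d - 1 = b * c"
      using det by simp
    also have "int \<delta> * b * (D * a * t) - s * D * (b * c) = int \<delta> * b * (D * a * t - s * r)"
      by (simp add: D r algebra_simps)
    finally show ?thesis
      by (simp add: st)
  qed
  have m2: "r * \<beta>' + t * D = d"
  proof -
    have "r * \<beta>' + t * D = t * D * (b * c + 1) - s * r * d"
      by (simp add: \<beta>'_def D r algebra_simps)
    also have "b * c + 1 = a * d"
      using det by simp
    also have "t * D * (a * d) - s * r * d = d * (D * a * t - s * r)"
      by (simp add: algebra_simps)
    finally show ?thesis
      by (simp add: st)
  qed
  show ?thesis
  proof (rule that[of "g * \<beta>'"])
    fix \<tau> assume \<tau>: "Im \<tau> > 0"
    define \<tau>' where "\<tau>' = (of_int g * \<tau> + of_int \<beta>') / of_int D"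
    have D0': "(of_int D :: complex) \<noteq> 0"
      using D0 by simp
    have dD: "of_nat \<delta> = of_int g * (of_int D :: complex)"
      using arg_cong[OF D, of "of_int :: int \<Rightarrow> complex"] by simp
    have \<tau>'_alt: "\<tau>' = (of_int (g ^ 2) * \<tau> + of_int (g * \<beta>')) / of_nat \<delta>"
      using g D0 dD by (simp add: \<tau>'_def power2_eq_square field_simps)
    have "Im \<tau>' = of_int g * Im \<tau> / of_int D"
    proof -
      have "of_int g * \<tau> + of_int \<beta>' = of_real (of_int g) * \<tau> + of_real (of_int \<beta>')"
        by simp
      hence "\<tau>' = (of_real (of_int g) * \<tau> + of_real (of_int \<beta>')) / of_real (of_int D)"
        by (simp add: \<tau>'_def)
      thus ?thesis
        by (simp only: Im_divide_of_real) simp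
    qed
    hence \<tau>': "Im \<tau>' > 0"
      using \<tau> g D0 by simp
    have gen: "x * (y / of_int D) + z = (x * y + z * of_int D) / of_int D" for x y z :: complex
      using D0' by (simp add: add_divide_distrib)
    have c1: "of_int (D * a) * of_int g = (of_nat \<delta> * of_int a :: complex)"
      using dD by simp
    have "of_int (D * a) * \<tau>' + of_int s = (of_int (D * a) * of_int g * \<tau> + of_int (D * a * \<beta>' + s * D)) / of_int D"
      unfolding \<tau>'_def gen by (rule arg_cong[where f = "\<lambda>x. x / _"]) (simp add: algebra_simps)
    also have "\<dots> = of_nat \<delta> * (of_int a * \<tau> + of_int b) / of_int D"
      unfolding c1 m1 by (simp add: algebra_simps)
    finally have e1: "of_int (D * a) * \<tau>' + of_int s = of_nat \<delta> * (of_int a * \<tau> + of_int b) / of_int D" .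
    have "of_int r * \<tau>' + of_int t = (of_int (g * r) * \<tau> + of_int (r * \<beta>' + t * D)) / of_int D"
      unfolding \<tau>'_def gen by (rule arg_cong[where f = "\<lambda>x. x / _"]) (simp add: algebra_simps)
    hence e2: "of_int r * \<tau>' + of_int t = (of_int c * \<tau> + of_int d) / of_int D"
      unfolding m2 r .
    have "norm (eta (of_nat \<delta> * ((of_int a * \<tau> + of_int b) / (of_int c * \<tau> + of_int d)))) ^ 2 =
            norm (eta ((of_int (D * a) * \<tau>' + of_int s) / (of_int r * \<tau>' + of_int t))) ^ 2"
      unfolding e1 e2 using D0' by simp
    also have "\<dots> = norm (of_int r * \<tau>' + of_int t) * norm (eta \<tau>') ^ 2"
      by (rule norm_eta_modular[OF \<tau>' st])
    also have "norm (of_int r * \<tau>' + of_int t) = norm (of_int c * \<tau> + of_int d) * (1 / of_int D)"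
      unfolding e2 using D0 by (simp add: norm_divide)
    also have "1 / of_int D = of_int g / real \<delta>"
      using g D0 arg_cong[OF D, of real_of_int] by simp
    finally show "norm (eta (of_nat \<delta> * ((of_int a * \<tau> + of_int b) / (of_int c * \<tau> + of_int d)))) ^ 2 =
       norm (of_int c * \<tau> + of_int d) * (of_int (gcd c (int \<delta>)) / of_nat \<delta>) *
       norm (eta ((of_int (gcd c (int \<delta>) ^ 2) * \<tau> + of_int (g * \<beta>')) / of_nat \<delta>)) ^ 2"
      unfolding \<tau>'_alt g_def .
  qed
qed

text \<open>The exponent is Ligozat's order of eta(\<delta> z) at the cusp a / c, measured in exp(2
  \<pi> i \<tau>) and not in the local parameter of the cusp. A positive limit, and not just an
  upper bound, is established because eta will also occur with negative exponents.\<close>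

lemma norm_eta_scaled_growth:
  fixes a b c d :: int and \<delta> :: nat
  assumes det: "a * d - b * c = 1" and \<delta>: "\<delta> > 0"
  shows "\<exists>K>0. ((\<lambda>\<tau>. norm (eta (of_nat \<delta> * ((of_int a * \<tau> + of_int b) / (of_int c * \<tau> + of_int d)))) /
            sqrt (norm (of_int c * \<tau> + of_int d)) *
            exp (2 * pi * (of_int (gcd c (int \<delta>)) ^ 2 / (24 * of_nat \<delta>)) * Im \<tau>)) \<longlongrightarrow> K) (filtercomap Im at_top)"
proof -
  define g where "g = gcd c (int \<delta>)"
  have g: "g > 0"
    using \<delta> by (simp add: g_def)
  obtain \<beta> :: int where \<beta>:
    "\<And>\<tau>. Im \<tau> > 0 \<Longrightarrow> norm (eta (of_nat \<delta> * ((of_int a * \<tau> + of_int b) / (of_int c * \<tau> + of_int d)))) ^ 2 =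
       norm (of_int c * \<tau> + of_int d) * (of_int g / of_nat \<delta>) *
       norm (eta ((of_int (g ^ 2) * \<tau> + of_int \<beta>) / of_nat \<delta>)) ^ 2"
    using norm_eta_scaled_modular[OF assms] unfolding g_def by blast
  define T where "T = (\<lambda>\<tau>. (of_int (g ^ 2) * \<tau> + of_int \<beta>) / of_nat \<delta> :: complex)"
  have Im_T: "Im (T \<tau>) = of_int g ^ 2 / real \<delta> * Im \<tau>" for \<tau>
  proof -
    have "T \<tau> = (of_real (of_int (g ^ 2)) * \<tau> + of_real (of_int \<beta>)) / of_real (of_nat \<delta>)"
      by (simp add: T_def)
    thus ?thesis
      by (simp only: Im_divide_of_real) simp
  qed
  have "filterlim (\<lambda>x. of_int g ^ 2 / real \<delta> * x) at_top at_top"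
    using g \<delta> by (intro filterlim_tendsto_pos_mult_at_top[OF tendsto_const] filterlim_ident) auto
  hence "filterlim T (filtercomap Im at_top) (filtercomap Im at_top)"
    unfolding filterlim_filtercomap_iff o_def Im_T
    by (rule filterlim_compose) (rule filterlim_filtercomap)
  from filterlim_compose[OF norm_eta_tendsto this]
  have "((\<lambda>\<tau>. sqrt (of_int g / real \<delta>) * (norm (eta (T \<tau>)) * exp (pi * Im (T \<tau>) / 12))) \<longlongrightarrow> sqrt (of_int g / real \<delta>) * 1) (filtercomap Im at_top)"
    by (intro tendsto_mult tendsto_const)
  moreover have "eventually (\<lambda>\<tau>. sqrt (of_int g / real \<delta>) * (norm (eta (T \<tau>)) * exp (pi * Im (T \<tau>) / 12)) =
     norm (eta (of_nat \<delta> * ((of_int a * \<tau> + of_int b) / (of_int c * \<tau> + of_int d)))) /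
            sqrt (norm (of_int c * \<tau> + of_int d)) *
            exp (2 * pi * (of_int g ^ 2 / (24 * of_nat \<delta>)) * Im \<tau>)) (filtercomap Im at_top)"
  proof -
    have "eventually (\<lambda>\<tau>. Im \<tau> > 0) (filtercomap Im at_top)"
      by (intro eventually_filtercomapI eventually_gt_at_top)
    thus ?thesis
    proof eventually_elim
      case (elim \<tau>)
      have j: "of_int c * \<tau> + of_int d \<noteq> 0"
        using moebius_int(1)[OF elim det] .
      have "norm (eta (of_nat \<delta> * ((of_int a * \<tau> + of_int b) / (of_int c * \<tau> + of_int d)))) =
        sqrt (norm (eta (of_nat \<delta> * ((of_int a * \<tau> + of_int b) / (of_int c * \<tau> + of_int d)))) ^ 2)"
        by simp
      also have "\<dots> = sqrt (norm (of_int c * \<tau> + of_int d)) * sqrt (of_int g / of_nat \<delta>) * norm (eta (T \<tau>))"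
        unfolding \<beta>[OF elim] T_def by (simp only: real_sqrt_mult real_sqrt_abs) simp
      finally show ?case
        using j by (simp add: Im_T field_simps)
    qed
  qed
  ultimately have "((\<lambda>\<tau>. norm (eta (of_nat \<delta> * ((of_int a * \<tau> + of_int b) / (of_int c * \<tau> + of_int d)))) /
            sqrt (norm (of_int c * \<tau> + of_int d)) *
            exp (2 * pi * (of_int g ^ 2 / (24 * of_nat \<delta>)) * Im \<tau>)) \<longlongrightarrow> sqrt (of_int g / real \<delta>) * 1) (filtercomap Im at_top)"
    by (rule Lim_transform_eventually)
  thus ?thesis
    using g \<delta> unfolding g_def by (intro exI[of _ "sqrt (of_int (gcd c (int \<delta>)) / real \<delta>) * 1"]) auto
qed

section \<open>Eta quotients\<close>

definition eta_quot :: "(nat \<times> int) list \<Rightarrow> complex \<Rightarrow> complex"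
  where "eta_quot r \<tau> = (\<Prod>(\<delta>, e)\<leftarrow>r. eta (of_nat \<delta> * \<tau>) powi e)"

definition eta_quot_ord :: "(nat \<times> int) list \<Rightarrow> int \<Rightarrow> real"
  where "eta_quot_ord r c = (\<Sum>(\<delta>, e)\<leftarrow>r. of_int (e * gcd c (int \<delta>) ^ 2) / (24 * of_nat \<delta>))"

lemma eta_quot_Nil [simp]: "eta_quot [] \<tau> = 1"
  by (simp add: eta_quot_def)

lemma eta_quot_Cons [simp]: "eta_quot ((\<delta>, e) # r) \<tau> = eta (of_nat \<delta> * \<tau>) powi e * eta_quot r \<tau>"
  by (simp add: eta_quot_def)

lemma eta_quot_nonzero:
  assumes "Im \<tau> > 0" "\<forall>\<delta>\<in>fst ` set r. \<delta> > 0"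
  shows "eta_quot r \<tau> \<noteq> 0"
  using assms by (induction r) (auto simp: eta_nonzero)

lemma holomorphic_eta_quot:
  assumes "\<forall>\<delta>\<in>fst ` set r. \<delta> > 0"
  shows "eta_quot r holomorphic_on uhp"
  using assms
proof (induction r)
  case (Cons p r)
  obtain \<delta> e where p: "p = (\<delta>, e)"
    by force
  have "(\<lambda>\<tau>. eta (of_nat \<delta> * \<tau>) powi e) holomorphic_on uhp"
    using Cons.prems by (intro holomorphic_intros) (auto simp: p eta_nonzero)
  thus ?case
    using Cons by (auto simp: p intro!: holomorphic_intros)
qed (auto simp: eta_quot_def[abs_def])

text \<open>The weight is carried along as an exponent: the tails of a list of total weight 0 need
  not have weight 0 themselves.\<close>

lemma norm_eta_quot_growth_weight:
  fixes a b c d :: int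
  assumes det: "a * d - b * c = 1" and "\<forall>\<delta>\<in>fst ` set r. \<delta> > 0"
  shows "\<exists>K>0. ((\<lambda>\<tau>. norm (eta_quot r ((of_int a * \<tau> + of_int b) / (of_int c * \<tau> + of_int d))) /
            sqrt (norm (of_int c * \<tau> + of_int d)) powi sum_list (map snd r) *
            exp (2 * pi * eta_quot_ord r c * Im \<tau>)) \<longlongrightarrow> K) (filtercomap Im at_top)"
  using assms(2)
proof (induction r)
  case Nil
  show ?case
    by (auto simp: eta_quot_ord_def intro!: exI[of _ 1])
next
  case (Cons p r)
  obtain \<delta> e where p: "p = (\<delta>, e)"
    by force
  define h where "h = (\<lambda>\<tau>. norm (eta (of_nat \<delta> * ((of_int a * \<tau> + of_int b) / (of_int c * \<tau> + of_int d)))))"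
  define J where "J = (\<lambda>\<tau>. sqrt (norm (of_int c * \<tau> + of_int d :: complex)))"
  define o1 where "o1 = of_int (gcd c (int \<delta>)) ^ 2 / (24 * real \<delta>)"
  obtain K1 where K1: "K1 > 0" "((\<lambda>\<tau>. h \<tau> / J \<tau> * exp (2 * pi * o1 * Im \<tau>)) \<longlongrightarrow> K1) (filtercomap Im at_top)"
    using norm_eta_scaled_growth[OF det, of \<delta>] Cons.prems unfolding h_def J_def o1_def by (auto simp: p)
  obtain K2 where K2: "K2 > 0" "((\<lambda>\<tau>. norm (eta_quot r ((of_int a * \<tau> + of_int b) / (of_int c * \<tau> + of_int d))) /
            J \<tau> powi sum_list (map snd r) * exp (2 * pi * eta_quot_ord r c * Im \<tau>)) \<longlongrightarrow> K2) (filtercomap Im at_top)"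
    using Cons unfolding J_def by auto
  have "((\<lambda>\<tau>. (h \<tau> / J \<tau> * exp (2 * pi * o1 * Im \<tau>)) powi e * (norm (eta_quot r ((of_int a * \<tau> + of_int b) / (of_int c * \<tau> + of_int d))) /
            J \<tau> powi sum_list (map snd r) * exp (2 * pi * eta_quot_ord r c * Im \<tau>))) \<longlongrightarrow> K1 powi e * K2) (filtercomap Im at_top)"
    using K1 by (intro tendsto_mult K2(2) tendsto_power_int K1(2)) auto
  moreover have "eventually (\<lambda>\<tau>. (h \<tau> / J \<tau> * exp (2 * pi * o1 * Im \<tau>)) powi e * (norm (eta_quot r ((of_int a * \<tau> + of_int b) / (of_int c * \<tau> + of_int d))) /
            J \<tau> powi sum_list (map snd r) * exp (2 * pi * eta_quot_ord r c * Im \<tau>)) =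
     norm (eta_quot (p # r) ((of_int a * \<tau> + of_int b) / (of_int c * \<tau> + of_int d))) /
            J \<tau> powi sum_list (map snd (p # r)) * exp (2 * pi * eta_quot_ord (p # r) c * Im \<tau>)) (filtercomap Im at_top)"
  proof -
    have "eventually (\<lambda>\<tau>. Im \<tau> > 0) (filtercomap Im at_top)"
      by (intro eventually_filtercomapI eventually_gt_at_top)
    thus ?thesis
    proof eventually_elim
      case (elim \<tau>)
      have J: "J \<tau> \<noteq> 0"
        using moebius_int(1)[OF elim det] by (simp add: J_def)
      have o: "eta_quot_ord (p # r) c = of_int e * o1 + eta_quot_ord r c"
        by (simp add: eta_quot_ord_def p o1_def)
      have "exp (2 * pi * eta_quot_ord (p # r) c * Im \<tau>) = exp (2 * pi * o1 * Im \<tau>) powi e * exp (2 * pi * eta_quot_ord r c * Im \<tau>)"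
        unfolding o exp_power_int exp_add[symmetric] by (simp add: algebra_simps)
      moreover have "J \<tau> powi sum_list (map snd (p # r)) = J \<tau> powi e * J \<tau> powi sum_list (map snd r)"
        using J by (simp add: p power_int_add)
      ultimately show ?case
        by (simp add: p h_def norm_mult norm_power_int power_int_mult_distrib power_int_divide_distrib)
    qed
  qed
  ultimately have "((\<lambda>\<tau>. norm (eta_quot (p # r) ((of_int a * \<tau> + of_int b) / (of_int c * \<tau> + of_int d))) /
            J \<tau> powi sum_list (map snd (p # r)) * exp (2 * pi * eta_quot_ord (p # r) c * Im \<tau>)) \<longlongrightarrow> K1 powi e * K2) (filtercomap Im at_top)"
    by (rule Lim_transform_eventually)
  thus ?case
    using K1(1) K2(1) unfolding J_def by (intro exI[of _ "K1 powi e * K2"]) auto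
qed

lemma norm_eta_quot_growth:
  fixes a b c d :: int
  assumes "a * d - b * c = 1" "\<forall>\<delta>\<in>fst ` set r. \<delta> > 0" "sum_list (map snd r) = 0"
  shows "\<exists>K>0. ((\<lambda>\<tau>. norm (eta_quot r ((of_int a * \<tau> + of_int b) / (of_int c * \<tau> + of_int d))) *
            exp (2 * pi * eta_quot_ord r c * Im \<tau>)) \<longlongrightarrow> K) (filtercomap Im at_top)"
  using norm_eta_quot_growth_weight[OF assms(1,2)] unfolding assms(3) by simp

section \<open>The Atkin-Lehner involution on eta quotients\<close>

lemma norm_eta_atkin_lehner:
  assumes \<tau>: "Im \<tau> > 0" and "int x * x' = 15" "int y * y' = 4"
  shows "norm (eta (of_nat (x * y) * ((15 * \<tau> - 4) / (60 * \<tau> - 15)))) ^ 2 =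
           norm (60 * \<tau> - 15) / of_nat x * norm (eta (of_int x' * of_nat y * \<tau>)) ^ 2"
proof -
  have x: "x > 0" and y: "y > 0" and x': "x' > 0"
    using assms(2,3) by (auto intro!: Nat.gr0I) (smt (verit) mult_nonneg_nonpos of_nat_0_le_iff)
  have xx: "of_nat x * of_int x' = (15 :: complex)" and yy: "of_nat y * of_int y' = (4 :: complex)"
    using arg_cong[OF assms(2), of "of_int :: int \<Rightarrow> complex"] arg_cong[OF assms(3), of "of_int :: int \<Rightarrow> complex"] by simp_all
  define \<tau>' where "\<tau>' = of_int x' * of_nat y * \<tau>"
  have "Im \<tau>' = of_int x' * real y * Im \<tau>"
  proof -
    have "\<tau>' = of_real (of_int x' * real y) * \<tau>"
      by (simp add: \<tau>'_def)
    thus ?thesis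
      by simp
  qed
  hence \<tau>': "Im \<tau>' > 0"
    using \<tau> x' y by simp
  \<comment> \<open>The point x y w(\<tau>) is the image of x' y \<tau> under the matrix (x, -4 y;
    y', -x'). Its determinant is -15 + 16 = 1, which is where the entry -4 in the matrix of
    \<open>w\<close> comes from.\<close>
  have det: "int x * (- x') - (- (4 * int y)) * y' = 1"
    using assms(2,3) by (simp add: mult.assoc)
  have e2: "of_int y' * \<tau>' + of_int (- x') = (60 * \<tau> - 15) / of_nat x"
  proof -
    have "of_nat x * (of_int y' * \<tau>' + of_int (- x')) = (of_nat x * of_int x') * (of_nat y * of_int y') * \<tau> - of_nat x * of_int x'"
      by (simp add: \<tau>'_def algebra_simps)
    thus ?thesis
      unfolding xx yy using x by (simp add: field_simps)
  qed
  have e1: "of_int (int x) * \<tau>' + of_int (- (4 * int y)) = of_nat y * (15 * \<tau> - 4)"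
  proof -
    have "of_int (int x) * \<tau>' = (of_nat x * of_int x') * of_nat y * \<tau>"
      by (simp add: \<tau>'_def)
    thus ?thesis
      unfolding xx by (simp add: algebra_simps)
  qed
  have "norm (eta ((of_int (int x) * \<tau>' + of_int (- (4 * int y))) / (of_int y' * \<tau>' + of_int (- x')))) ^ 2 = norm (of_int y' * \<tau>' + of_int (- x')) * norm (eta \<tau>') ^ 2"
    by (rule norm_eta_modular[OF \<tau>' det])
  thus ?thesis
    unfolding e1 e2 by (simp add: \<tau>'_def norm_divide mult_ac)
qed

text \<open>Up to a constant, \<open>w\<^sub>1\<^sub>5\<close> takes \<open>\<eta>(\<delta> z)\<close> to \<open>\<eta>(swap15 \<delta> z)\<close>, times an automorphy factor.\<close>

definition swap15 :: "nat \<Rightarrow> nat"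
  where "swap15 \<delta> = (15 div gcd \<delta> 15) * gcd \<delta> 4"

definition divisors60 :: "nat set"
  where "divisors60 = {1, 2, 3, 4, 5, 6, 10, 12, 15, 20, 30, 60}"

lemma norm_eta_quot_atkin_lehner_weight:
  assumes "fst ` set r \<subseteq> divisors60"
  shows "\<exists>K>0. \<forall>\<tau>. Im \<tau> > 0 \<longrightarrow> norm (eta_quot r ((15 * \<tau> - 4) / (60 * \<tau> - 15))) =
           K * sqrt (norm (60 * \<tau> - 15)) powi sum_list (map snd r) * norm (eta_quot (map (map_prod swap15 id) r) \<tau>)"
  using assms
proof (induction r)
  case Nil
  show ?case
    by (auto intro!: exI[of _ 1])
next
  case (Cons p r)
  obtain \<delta> e where p: "p = (\<delta>, e)"
    by force
  obtain K where K: "K > 0" "\<And>\<tau>. Im \<tau> > 0 \<Longrightarrow> norm (eta_quot r ((15 * \<tau> - 4) / (60 * \<tau> - 15))) =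
           K * sqrt (norm (60 * \<tau> - 15)) powi sum_list (map snd r) * norm (eta_quot (map (map_prod swap15 id) r) \<tau>)"
    using Cons.IH Cons.prems by (metis (no_types, lifting) image_subset_iff list.set_intros(2))
  have \<delta>: "\<delta> \<in> divisors60"
    using Cons.prems by (simp add: p)
  have gcds: "\<delta> = gcd \<delta> 15 * gcd \<delta> 4" "int (gcd \<delta> 15) * int (15 div gcd \<delta> 15) = 15" "int (gcd \<delta> 4) * int (4 div gcd \<delta> 4) = 4"
    using \<delta> unfolding divisors60_def insert_iff empty_iff by (elim disjE; simp add: gcd_non_0_nat)+
  have J0: "60 * \<tau> - 15 \<noteq> 0" if "Im \<tau> > 0" for \<tau> :: complex
  proof
    assume "60 * \<tau> - 15 = 0"
    from arg_cong[OF this, of Im] that show False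
      by simp
  qed
  have *: "norm (eta (of_nat \<delta> * ((15 * \<tau> - 4) / (60 * \<tau> - 15)))) =
          sqrt (norm (60 * \<tau> - 15)) * (1 / sqrt (of_nat (gcd \<delta> 15))) * norm (eta (of_nat (swap15 \<delta>) * \<tau>))" if "Im \<tau> > 0" for \<tau>
  proof -
    have "norm (eta (of_nat \<delta> * ((15 * \<tau> - 4) / (60 * \<tau> - 15)))) ^ 2 =
           norm (60 * \<tau> - 15) / of_nat (gcd \<delta> 15) * norm (eta (of_int (int (15 div gcd \<delta> 15)) * of_nat (gcd \<delta> 4) * \<tau>)) ^ 2"
      using norm_eta_atkin_lehner[OF that gcds(2,3)] unfolding gcds(1)[symmetric] .
    hence "sqrt (norm (eta (of_nat \<delta> * ((15 * \<tau> - 4) / (60 * \<tau> - 15)))) ^ 2) =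
           sqrt (norm (60 * \<tau> - 15) / of_nat (gcd \<delta> 15) * norm (eta (of_nat (swap15 \<delta>) * \<tau>)) ^ 2)"
      by (simp add: swap15_def)
    thus ?thesis
      by (simp add: real_sqrt_mult real_sqrt_divide)
  qed
  define K' where "K' = K * (1 / sqrt (of_nat (gcd \<delta> 15))) powi e"
  have "gcd \<delta> 15 > 0"
    by simp
  hence "K' > 0"
    unfolding K'_def using K(1) by (intro mult_pos_pos zero_less_power_int) auto
  moreover have "norm (eta_quot (p # r) ((15 * \<tau> - 4) / (60 * \<tau> - 15))) =
           K' * sqrt (norm (60 * \<tau> - 15)) powi sum_list (map snd (p # r)) * norm (eta_quot (map (map_prod swap15 id) (p # r)) \<tau>)"
    if \<tau>: "Im \<tau> > 0" for \<tau>
  proof -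
    have "norm (eta_quot (p # r) ((15 * \<tau> - 4) / (60 * \<tau> - 15))) =
      norm (eta (of_nat \<delta> * ((15 * \<tau> - 4) / (60 * \<tau> - 15)))) powi e * norm (eta_quot r ((15 * \<tau> - 4) / (60 * \<tau> - 15)))"
      unfolding p eta_quot_Cons norm_mult norm_power_int ..
    also have "\<dots> = K' * (sqrt (norm (60 * \<tau> - 15)) powi e * sqrt (norm (60 * \<tau> - 15)) powi sum_list (map snd r)) *
        (norm (eta (of_nat (swap15 \<delta>) * \<tau>)) powi e * norm (eta_quot (map (map_prod swap15 id) r) \<tau>))"
      unfolding *[OF \<tau>] K(2)[OF \<tau>] power_int_mult_distrib K'_def by (simp only: mult_ac)
    also have "sqrt (norm (60 * \<tau> - 15)) powi e * sqrt (norm (60 * \<tau> - 15)) powi sum_list (map snd r) =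
        sqrt (norm (60 * \<tau> - 15)) powi sum_list (map snd (p # r))"
      using J0[OF \<tau>] by (simp add: p power_int_add)
    finally have "norm (eta_quot (p # r) ((15 * \<tau> - 4) / (60 * \<tau> - 15))) = K' * sqrt (norm (60 * \<tau> - 15)) powi sum_list (map snd (p # r)) *
        (norm (eta (of_nat (swap15 \<delta>) * \<tau>)) powi e * norm (eta_quot (map (map_prod swap15 id) r) \<tau>))" .
    moreover have "map (map_prod swap15 id) (p # r) = (swap15 \<delta>, e) # map (map_prod swap15 id) r"
      by (simp add: p)
    ultimately show ?thesis
      by (metis eta_quot_Cons norm_mult norm_power_int)
  qed
  ultimately show ?case
    by blast
qed

text \<open>The quotient has constant modulus, hence is constant by the maximum modulus principle.
  This turns a law for absolute values of eta quotients into an identity with one unknown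
  constant.\<close>

lemma holomorphic_norm_eq_imp_const_mult:
  assumes "f holomorphic_on A" "g holomorphic_on A" "open A" "connected A"
    and g: "\<And>z. z \<in> A \<Longrightarrow> g z \<noteq> 0" and norm: "\<And>z. z \<in> A \<Longrightarrow> norm (f z) = K * norm (g z)"
  obtains c where "\<And>z. z \<in> A \<Longrightarrow> f z = c * g z"
proof (cases "A = {}")
  case True
  thus ?thesis
    using that by blast
next
  case False
  then obtain \<xi> where \<xi>: "\<xi> \<in> A"
    by blast
  have K: "norm (f z / g z) = K" if "z \<in> A" for z
    using norm[OF that] g[OF that] by (simp add: norm_divide)
  have "(\<lambda>z. f z / g z) constant_on A"
    by (rule maximum_modulus_principle[OF _ assms(3,4,3) order_refl \<xi>])
       (use assms K \<xi> in \<open>auto intro!: holomorphic_intros\<close>)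
  then obtain c where c: "\<And>z. z \<in> A \<Longrightarrow> f z / g z = c"
    by (auto simp: constant_on_def)
  show ?thesis
  proof (rule that[of c])
    fix z assume "z \<in> A"
    with c[of z] g[of z] show "f z = c * g z"
      by (auto simp: field_simps)
  qed
qed

lemma divisors60_pos: "fst ` set r \<subseteq> divisors60 \<Longrightarrow> \<forall>\<delta>\<in>fst ` set r. \<delta> > 0"
  by (auto simp: divisors60_def)

lemma swap15_divisors60: "\<delta> \<in> divisors60 \<Longrightarrow> swap15 \<delta> \<in> divisors60"
  unfolding divisors60_def insert_iff empty_iff by (elim disjE; simp add: swap15_def gcd_non_0_nat)

lemma eta_quot_atkin_lehner:
  assumes r: "fst ` set r \<subseteq> divisors60" "sum_list (map snd r) = 0"
  obtains c where "\<And>\<tau>. Im \<tau> > 0 \<Longrightarrow> eta_quot r ((15 * \<tau> - 4) / (60 * \<tau> - 15)) = c * eta_quot (map (map_prod swap15 id) r) \<tau>"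
proof -
  obtain K where K: "\<And>\<tau>. Im \<tau> > 0 \<Longrightarrow> norm (eta_quot r ((15 * \<tau> - 4) / (60 * \<tau> - 15))) = K * norm (eta_quot (map (map_prod swap15 id) r) \<tau>)"
    using norm_eta_quot_atkin_lehner_weight[OF r(1)] unfolding r(2) by auto
  have r': "fst ` set (map (map_prod swap15 id) r) \<subseteq> divisors60"
    using r(1) swap15_divisors60 by fastforce
  let ?M = "mat2 15 (- 4) 60 (- 15)"
  have det: "det ?M > 0"
    by (simp add: det_2)
  have M: "moebius_map ?M = (\<lambda>\<tau>. (15 * \<tau> - 4) / (60 * \<tau> - 15))"
    by (simp add: moebius_map_def[abs_def])
  have "(eta_quot r \<circ> moebius_map ?M) holomorphic_on uhp"
    by (rule holomorphic_on_compose_gen[OF analytic_imp_holomorphic[OF moebius_analytic[OF det]] holomorphic_eta_quot[OF divisors60_pos[OF r(1)]]])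
       (use moebius_in_uhp[OF det] in auto)
  hence hol: "(\<lambda>\<tau>. eta_quot r ((15 * \<tau> - 4) / (60 * \<tau> - 15))) holomorphic_on uhp"
    unfolding M o_def .
  show ?thesis
  proof (rule holomorphic_norm_eq_imp_const_mult[OF hol holomorphic_eta_quot[OF divisors60_pos[OF r']] open_uhp connected_uhp])
    show "eta_quot (map (map_prod swap15 id) r) z \<noteq> 0" if "z \<in> uhp" for z
      using eta_quot_nonzero[OF _ divisors60_pos[OF r'], of z] that by simp
    show "norm (eta_quot r ((15 * z - 4) / (60 * z - 15))) = K * norm (eta_quot (map (map_prod swap15 id) r) z)" if "z \<in> uhp" for z
      using K that by simp
    fix c assume "\<And>z. z \<in> uhp \<Longrightarrow> eta_quot r ((15 * z - 4) / (60 * z - 15)) = c * eta_quot (map (map_prod swap15 id) r) z"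
    thus thesis
      by (intro that[of c]) auto
  qed
qed

section \<open>Invariance of three eta quotients under \<open>\<Gamma>\<^sub>0(60)\<close>\<close>

lemma sum_upto_7: "sum f {1..(15 - 1) div 2 :: nat} = (f 1 + f 2 + f 3 + f 4 + f 5 + f 6 + f 7 :: real)"
proof -
  have "{1..(15 - 1) div 2 :: nat} = {1,2,3,4,5,6,7}"
    by auto
  thus ?thesis
    by (simp add: add_ac)
qed

lemma sum_upto_2: "sum f {1..(5 - 1) div 2 :: nat} = (f 1 + f 2 :: real)"
proof -
  have "{1..(5 - 1) div 2 :: nat} = {1,2}"
    by auto
  thus ?thesis
    by simp
qed

lemma weight_cancel:
  fixes L n D J1 J2 J3 B :: complex
  assumes "L \<noteq> 0" "J1 \<noteq> 0" "J3 \<noteq> 0" "J2 = J1 * J3"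
  shows "(L * n / J1) / (L * D / J2) * (B / J3) = n / D * B"
  using assms by (cases "D = 0") (simp_all add: divide_simps)

text \<open>Here \<open>l\<close> and \<open>m\<close> stand for the two characters,
  \<open>j\<close> for the automorphy factor and \<theta> for a common root of unity. The characters
  leave the same product \<open>l m\<close> above and below, the powers of \<open>j\<close> agree at
  19 = 13 + 6, and the powers of \<theta> are 126 = 3 * 42 above and 84 = 2 * 42 below; this is the
  source of the exponent 42.\<close>

lemma klein_quotient_Y_factors:
  fixes k1 k2 k3 k4 k5 k6 k7 k8 al be j \<theta> l m :: complex
  assumes j: "j \<noteq> 0" and \<theta>: "\<theta> ^ 42 = 1" and l: "l * l = 1" and m: "m * m = 1"
  shows "\<theta> ^ 20 * (l * k1) / j * (\<theta> ^ 36 * (m * k2) / j ^ 2) * (\<theta> ^ 56 * (l * m * k3) / j ^ 7) *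
      (\<theta> ^ 5 * (l * k4) / j) * (\<theta> ^ 9 * (m * k5) / j ^ 2) /
      (\<theta> ^ 10 * (l * k6) / j * (\<theta> ^ 18 * (m * k7) / j ^ 2) * (\<theta> ^ 28 * (l * m * k8) / j ^ 7) ^ 2 * (al / j ^ 2)) *
      (be / j ^ 2) ^ 3 = k1 * k2 * k3 * k4 * k5 / (k6 * k7 * k8 ^ 2 * al) * be ^ 3"
proof -
  define P1 where "P1 = \<theta> ^ 20 * \<theta> ^ 36 * \<theta> ^ 56 * \<theta> ^ 5 * \<theta> ^ 9"
  define P2 where "P2 = \<theta> ^ 10 * \<theta> ^ 18 * (\<theta> ^ 28) ^ 2"
  have "P1 = (\<theta> ^ 42) ^ 3" "P2 = (\<theta> ^ 42) ^ 2"
    unfolding P1_def P2_def by (simp_all flip: power_add power_mult)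
  hence P: "P1 = 1" "P2 = 1"
    by (simp_all add: \<theta>)
  have L: "l * m * (l * m) * l * m = l * m" "l * m * (l * m) ^ 2 = l * m" "l * m \<noteq> 0"
  proof -
    have "l * m * (l * m) * l * m = (l * l) * (m * m) * (l * m)" "l * m * (l * m) ^ 2 = (l * l) * (m * m) * (l * m)"
      by (simp_all add: power2_eq_square)
    thus "l * m * (l * m) * l * m = l * m" "l * m * (l * m) ^ 2 = l * m"
      unfolding l m by simp_all
    show "l * m \<noteq> 0"
      using l m by auto
  qed
  have e1: "\<theta> ^ 20 * (l * k1) / j * (\<theta> ^ 36 * (m * k2) / j ^ 2) * (\<theta> ^ 56 * (l * m * k3) / j ^ 7) *
      (\<theta> ^ 5 * (l * k4) / j) * (\<theta> ^ 9 * (m * k5) / j ^ 2) =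
      P1 * (l * m * (l * m) * l * m) * (k1 * k2 * k3 * k4 * k5) / (j * j ^ 2 * j ^ 7 * j * j ^ 2)"
    by (simp only: P1_def divide_inverse inverse_mult_distrib mult_ac)
  have e2: "\<theta> ^ 10 * (l * k6) / j * (\<theta> ^ 18 * (m * k7) / j ^ 2) * (\<theta> ^ 28 * (l * m * k8) / j ^ 7) ^ 2 * (al / j ^ 2) =
      P2 * (l * m * (l * m) ^ 2) * (k6 * k7 * k8 ^ 2 * al) / (j * j ^ 2 * (j ^ 7) ^ 2 * j ^ 2)"
    by (simp only: P2_def divide_inverse inverse_mult_distrib power_mult_distrib power_inverse mult_ac)
  have e3: "j * j ^ 2 * (j ^ 7) ^ 2 * j ^ 2 = (j * j ^ 2 * j ^ 7 * j * j ^ 2) * (j ^ 2) ^ 3"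
    by (simp add: eval_nat_numeral mult_ac)
  show ?thesis
    unfolding e1 e2 unfolding P L(1,2) power_divide mult_1_left
    by (rule weight_cancel[OF L(3) _ _ e3]) (use j in simp_all)
qed

lemma unit_cases: "l * l = 1 \<Longrightarrow> l = 1 \<or> l = (- 1 :: complex)"
  using power2_eq_1_iff[of l] by (simp add: power2_eq_square)

text \<open>The powers of \<theta> agree on the nose, 10 + 18 = 28, and those of \<open>j\<close> by
  3 + 4 = 7.\<close>

lemma klein_quotient_X_factors:
  fixes k1 k2 k3 be j \<theta> l m :: complex
  assumes j: "j \<noteq> 0" and \<theta>: "\<theta> \<noteq> 0" and l: "l * l = 1" and m: "m * m = 1"
  shows "\<theta> ^ 10 * (l * k1) / j * (\<theta> ^ 18 * (m * k2) / j ^ 2) / (\<theta> ^ 28 * (l * m * k3) / j ^ 7) * (be / j ^ 2) ^ 2 =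
      k1 * k2 / k3 * be ^ 2"
proof -
  have P: "\<theta> ^ 10 * \<theta> ^ 18 = \<theta> ^ 28"
    by (simp flip: power_add)
  have L: "\<theta> ^ 28 * (l * m) \<noteq> 0"
    using \<theta> l m by auto
  have e1: "\<theta> ^ 10 * (l * k1) / j * (\<theta> ^ 18 * (m * k2) / j ^ 2) = \<theta> ^ 10 * \<theta> ^ 18 * (l * m) * (k1 * k2) / (j * j ^ 2)"
    by (simp only: divide_inverse inverse_mult_distrib mult_ac)
  have e2: "\<theta> ^ 28 * (l * m * k3) / j ^ 7 = \<theta> ^ 28 * (l * m) * k3 / j ^ 7"
    by (simp only: mult_ac)
  have e3: "j ^ 7 = (j * j ^ 2) * (j ^ 2) ^ 2"
    by (simp add: eval_nat_numeral mult_ac)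
  show ?thesis
    unfolding e1 e2 unfolding P power_divide
    by (rule weight_cancel[OF L _ _ e3]) (use j in simp_all)
qed

text \<open>Both sides of the fraction carry the power 216 of \<theta> and the character
  \<open>l m\<close>; the eight squares of half-period forms make up the difference 47 - 31 in the
  powers of \<open>j\<close>.\<close>

lemma klein_quotient_U_factors:
  fixes k1 k2 k3 k4 k5 k6 be j \<theta> l m :: complex
  assumes j: "j \<noteq> 0" and \<theta>: "\<theta> \<noteq> 0" and l: "l * l = 1" and m: "m * m = 1"
  shows "(\<theta> ^ 56 * (l * m * k1) / j ^ 7) ^ 3 * (\<theta> ^ 5 * (l * k2) / j) ^ 6 * (\<theta> ^ 9 * (m * k3) / j ^ 2) ^ 2 /
      ((\<theta> ^ 10 * (l * k4) / j) ^ 3 * (\<theta> ^ 18 * (m * k5) / j ^ 2) * (\<theta> ^ 28 * (l * m * k6) / j ^ 7) ^ 6) *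
      (be / j ^ 2) ^ 8 = k1 ^ 3 * k2 ^ 6 * k3 ^ 2 / (k4 ^ 3 * k5 * k6 ^ 6) * be ^ 8"
proof -
  have P: "(\<theta> ^ 56) ^ 3 * (\<theta> ^ 5) ^ 6 * (\<theta> ^ 9) ^ 2 = \<theta> ^ 216" "(\<theta> ^ 10) ^ 3 * \<theta> ^ 18 * (\<theta> ^ 28) ^ 6 = \<theta> ^ 216"
    by (simp_all flip: power_add power_mult)
  have L1: "(l * m) ^ 3 * l ^ 6 * m ^ 2 = l * m" "l ^ 3 * m * (l * m) ^ 6 = l * m"
    using unit_cases[OF l] unit_cases[OF m] by (elim disjE; simp)+
  have L: "\<theta> ^ 216 * (l * m) \<noteq> 0"
    using \<theta> l m by auto
  have e1: "(\<theta> ^ 56 * (l * m * k1) / j ^ 7) ^ 3 * (\<theta> ^ 5 * (l * k2) / j) ^ 6 * (\<theta> ^ 9 * (m * k3) / j ^ 2) ^ 2 =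
      ((\<theta> ^ 56) ^ 3 * (\<theta> ^ 5) ^ 6 * (\<theta> ^ 9) ^ 2) * ((l * m) ^ 3 * l ^ 6 * m ^ 2) * (k1 ^ 3 * k2 ^ 6 * k3 ^ 2) / ((j ^ 7) ^ 3 * j ^ 6 * (j ^ 2) ^ 2)"
    by (simp only: divide_inverse inverse_mult_distrib power_mult_distrib power_inverse mult_ac)
  have e2: "(\<theta> ^ 10 * (l * k4) / j) ^ 3 * (\<theta> ^ 18 * (m * k5) / j ^ 2) * (\<theta> ^ 28 * (l * m * k6) / j ^ 7) ^ 6 =
      ((\<theta> ^ 10) ^ 3 * \<theta> ^ 18 * (\<theta> ^ 28) ^ 6) * (l ^ 3 * m * (l * m) ^ 6) * (k4 ^ 3 * k5 * k6 ^ 6) / (j ^ 3 * j ^ 2 * (j ^ 7) ^ 6)"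
    by (simp only: divide_inverse inverse_mult_distrib power_mult_distrib power_inverse mult_ac)
  have e3: "j ^ 3 * j ^ 2 * (j ^ 7) ^ 6 = ((j ^ 7) ^ 3 * j ^ 6 * (j ^ 2) ^ 2) * (j ^ 2) ^ 8"
    by (simp flip: power_add power_mult)
  show ?thesis
    unfolding e1 e2 unfolding P L1 power_divide
    by (rule weight_cancel[OF L _ _ e3]) (use j in simp_all)
qed

context
  fixes a b c d :: int and \<tau> :: complex
  assumes \<tau>: "Im \<tau> > 0" and det: "a * d - b * (60 * c) = 1"
begin

private definition "j = of_int (60 * c) * \<tau> + of_int d"
text \<open>For each of the eight Klein products involved, the exponent delivered by
  \<open>klein_prod_modular\<close> is an integral multiple of c (3 - d) / 3. One root of unity
  therefore expresses all multipliers.\<close>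

private definition "\<theta> = exp (of_real pi * \<i> * of_real (of_int c * (3 - of_int d) / 3))"

private lemma coprime_d: "coprime d 30"
proof (rule coprimeI)
  fix x assume "x dvd d" "x dvd 30"
  have "x dvd a * d - b * (60 * c)"
  proof (rule dvd_diff)
    have "b * (60 * c) = 30 * (2 * b * c)"
      by simp
    thus "x dvd b * (60 * c)"
      using \<open>x dvd 30\<close> by (metis dvd_mult2)
  qed (use \<open>x dvd d\<close> in simp)
  thus "is_unit x"
    using det by simp
qed

private lemma j_nz: "j \<noteq> 0"
  using moebius_int(1)[OF \<tau> det] by (simp add: j_def)

private lemma \<theta>_nz: "\<theta> \<noteq> 0"
  by (simp add: \<theta>_def)

private lemma \<theta>_42: "\<theta> ^ 42 = 1"
proof -
  have "\<theta> ^ 42 = to_q (of_int (7 * c * (3 - d)))"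
    unfolding \<theta>_def to_q_def exp_of_nat_mult[symmetric] by (simp add: algebra_simps diff_divide_distrib)
  thus ?thesis
    by (simp only: to_q_of_int)
qed

text \<open>Conjugation by z -> m z turns the given matrix into (a, m b; N k c, d) with m N k = 60,
  to which \<open>klein_prod_modular\<close> applies with k c in place of \<open>c\<close>. This
  accounts for the exponent K = 3 S k.\<close>

private lemma klein_prod_scaled:
  assumes N: "odd N" and m: "m > 0" "m * N * k = 60" and K: "real K = 3 * S * real k"
    and S: "(\<Sum>i=1..(N-1) div 2. real i) = 3 * S" "(\<Sum>i=1..(N-1) div 2. (real i) ^ 2) = real N * S"
  shows "klein_prod N (of_nat m * ((of_int a * \<tau> + of_int b) / j)) = \<theta> ^ K * klein_prod_twist N d (of_nat m * \<tau>) / j ^ ((N - 1) div 2)"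
proof -
  have \<tau>': "Im (of_nat m * \<tau>) > 0"
    using m \<tau> by simp
  have "int m * (int N * int k) = 60"
    using m(2) by (metis (no_types) mult.assoc of_nat_mult of_nat_numeral)
  hence c: "60 * c = int m * (int N * (int k * c))"
    by (metis mult.assoc)
  have det': "a * d - (int m * b) * (int N * (int k * c)) = 1"
    using det unfolding c by (simp add: mult_ac)
  have j: "of_int (int N * (int k * c)) * (of_nat m * \<tau>) + of_int d = j"
    unfolding j_def c by (simp add: mult_ac)
  have num: "of_int a * (of_nat m * \<tau>) + of_int (int m * b) = of_nat m * (of_int a * \<tau> + of_int b)"
    by (simp add: algebra_simps)
  have \<theta>: "exp (of_real pi * \<i> * of_real (of_int (int k * c) * S * (3 - of_int d))) = \<theta> ^ K"
  proof -
    have "of_int (int k * c) * S * (3 - of_int d) = (3 * S * real k) * (of_int c * (3 - of_int d) / 3)"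
      by simp
    hence *: "of_int (int k * c) * S * (3 - of_int d) = real K * (of_int c * (3 - of_int d) / 3)"
      unfolding K .
    show ?thesis
      unfolding * \<theta>_def exp_of_nat_mult[symmetric] by (simp add: mult_ac)
  qed
  have "j ^ ((N - 1) div 2) * klein_prod N (of_nat m * (of_int a * \<tau> + of_int b) / j) = \<theta> ^ K * klein_prod_twist N d (of_nat m * \<tau>)"
    using klein_prod_modular[OF \<tau>' det' N S] unfolding j num \<theta> .
  from this [symmetric] show ?thesis
    using j_nz by simp
qed

private lemma atoms:
  "klein_prod 3 (2 * ((of_int a * \<tau> + of_int b) / j)) = \<theta> ^ 10 * (leg3 d * klein_prod 3 (2 * \<tau>)) / j"
  "klein_prod 3 (1 * ((of_int a * \<tau> + of_int b) / j)) = \<theta> ^ 20 * (leg3 d * klein_prod 3 (1 * \<tau>)) / j"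
  "klein_prod 3 (4 * ((of_int a * \<tau> + of_int b) / j)) = \<theta> ^ 5 * (leg3 d * klein_prod 3 (4 * \<tau>)) / j"
  "klein_prod 5 (2 * ((of_int a * \<tau> + of_int b) / j)) = \<theta> ^ 18 * (leg5 d * klein_prod 5 (2 * \<tau>)) / j ^ 2"
  "klein_prod 5 (1 * ((of_int a * \<tau> + of_int b) / j)) = \<theta> ^ 36 * (leg5 d * klein_prod 5 (1 * \<tau>)) / j ^ 2"
  "klein_prod 5 (4 * ((of_int a * \<tau> + of_int b) / j)) = \<theta> ^ 9 * (leg5 d * klein_prod 5 (4 * \<tau>)) / j ^ 2"
  "klein_prod 15 (2 * ((of_int a * \<tau> + of_int b) / j)) = \<theta> ^ 56 * (leg3 d * leg5 d * klein_prod 15 (2 * \<tau>)) / j ^ 7"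
  "klein_prod 15 (4 * ((of_int a * \<tau> + of_int b) / j)) = \<theta> ^ 28 * (leg3 d * leg5 d * klein_prod 15 (4 * \<tau>)) / j ^ 7"
proof -
  have 2: "Im (2 * \<tau>) > 0" "Im (1 * \<tau>) > 0" "Im (4 * \<tau>) > 0"
    using \<tau> by simp_all
  note t = klein_prod_twist_3[OF _ coprime_d] klein_prod_twist_5[OF _ coprime_d] klein_prod_twist_15[OF _ coprime_d]
  \<comment> \<open>The values 1/3, 1 and 28/3 are n (n + 1) / 6 for n = 1, 2, 7. In the instances
    below the numbers are the scale m, the cofactor k = 60 / (m N) and the exponent 3 S k.\<close>
  note s3 = klein_prod_scaled[of 3 _ _ _ "1/3"] and s5 = klein_prod_scaled[of 5 _ _ _ 1] and s15 = klein_prod_scaled[of 15 _ _ _ "28/3"]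
  show "klein_prod 3 (2 * ((of_int a * \<tau> + of_int b) / j)) = \<theta> ^ 10 * (leg3 d * klein_prod 3 (2 * \<tau>)) / j"
    using s3[of 2 10 10] t(1)[OF 2(1)] by simp
  show "klein_prod 3 (1 * ((of_int a * \<tau> + of_int b) / j)) = \<theta> ^ 20 * (leg3 d * klein_prod 3 (1 * \<tau>)) / j"
    using s3[of 1 20 20] t(1)[OF 2(2)] by simp
  show "klein_prod 3 (4 * ((of_int a * \<tau> + of_int b) / j)) = \<theta> ^ 5 * (leg3 d * klein_prod 3 (4 * \<tau>)) / j"
    using s3[of 4 5 5] t(1)[OF 2(3)] by simp
  show "klein_prod 5 (2 * ((of_int a * \<tau> + of_int b) / j)) = \<theta> ^ 18 * (leg5 d * klein_prod 5 (2 * \<tau>)) / j ^ 2"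
    using s5[of 2 6 18] t(2)[OF 2(1)] sum_upto_2 by simp
  show "klein_prod 5 (1 * ((of_int a * \<tau> + of_int b) / j)) = \<theta> ^ 36 * (leg5 d * klein_prod 5 (1 * \<tau>)) / j ^ 2"
    using s5[of 1 12 36] t(2)[OF 2(2)] sum_upto_2 by simp
  show "klein_prod 5 (4 * ((of_int a * \<tau> + of_int b) / j)) = \<theta> ^ 9 * (leg5 d * klein_prod 5 (4 * \<tau>)) / j ^ 2"
    using s5[of 4 3 9] t(2)[OF 2(3)] sum_upto_2 by simp
  show "klein_prod 15 (2 * ((of_int a * \<tau> + of_int b) / j)) = \<theta> ^ 56 * (leg3 d * leg5 d * klein_prod 15 (2 * \<tau>)) / j ^ 7"
    using s15[of 2 2 56] t(3)[OF 2(1)] sum_upto_7 by simp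
  show "klein_prod 15 (4 * ((of_int a * \<tau> + of_int b) / j)) = \<theta> ^ 28 * (leg3 d * leg5 d * klein_prod 15 (4 * \<tau>)) / j ^ 7"
    using s15[of 4 1 28] t(3)[OF 2(3)] sum_upto_7 by simp
qed

text \<open>The index (0, 1/2) is fixed modulo integers because \<open>d\<close> is odd, and the
  remaining multiplier is a sign, which squaring removes. This form and the next one correct the
  weight and the powers of eta at 1, 2 and 4 in the quotients below.\<close>

private lemma atom_alpha:
  "klein_form 0 (1/2) ((of_int a * \<tau> + of_int b) / j) ^ 2 = klein_form 0 (1/2) \<tau> ^ 2 / j ^ 2"
proof -
  from coprime_d have "odd d"
    by (rule coprime_30D)
  then obtain e where e: "d = 2 * e + 1"
    by (elim oddE)
  have d2: "real_of_int d / 2 = 1 / 2 + of_int e"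
    by (simp add: e add_divide_distrib)
  have "j * klein_form 0 (1/2) ((of_int a * \<tau> + of_int b) / j) = klein_form (0 + of_int (30 * c)) (1/2 + of_int e) \<tau>"
    using klein_form_modular[OF \<tau> det, of 0 "1/2"] unfolding j_def[symmetric] by (simp add: d2)
  also have "\<dots> = exp (of_real pi * \<i> * of_real (of_int (30 * c + e + 30 * c * e) + 0 * of_int e - 1/2 * of_int (30 * c))) * klein_form 0 (1/2) \<tau>"
    by (rule klein_form_add_int[OF \<tau>])
  finally have "(j * klein_form 0 (1/2) ((of_int a * \<tau> + of_int b) / j)) ^ 2 =
    exp (of_real pi * \<i> * of_real (of_int (30 * c + e + 30 * c * e) + 0 * of_int e - 1/2 * of_int (30 * c))) ^ 2 * klein_form 0 (1/2) \<tau> ^ 2"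
    by (simp add: power_mult_distrib)
  also have "exp (of_real pi * \<i> * of_real (of_int (30 * c + e + 30 * c * e) + 0 * of_int e - 1/2 * of_int (30 * c))) ^ 2 = to_q (of_int (15 * c + e + 30 * c * e))"
    unfolding to_q_def exp_of_nat_mult[symmetric] by (simp add: algebra_simps)
  finally show ?thesis
    using j_nz by (simp add: power_mult_distrib field_simps del: of_int_add of_int_mult)
qed

private lemma atom_beta:
  "klein_form (1/2) 0 (4 * ((of_int a * \<tau> + of_int b) / j)) ^ 2 = klein_form (1/2) 0 (4 * \<tau>) ^ 2 / j ^ 2"
proof -
  have \<tau>': "Im (4 * \<tau>) > 0"
    using \<tau> by simp
  have det': "a * d - (4 * b) * (15 * c) = 1"
    using det by simp
  have j: "of_int (15 * c) * (4 * \<tau>) + of_int d = j"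
    by (simp add: j_def)
  have num: "of_int a * (4 * \<tau>) + of_int (4 * b) = 4 * (of_int a * \<tau> + of_int b)"
    by simp
  have "odd a"
    using det' by (metis dvd_diff even_mult_iff even_numeral odd_one)
  then obtain e where e: "a = 2 * e + 1"
    by (elim oddE)
  have a2: "real_of_int a / 2 = 1 / 2 + of_int e"
    by (simp add: e add_divide_distrib)
  have "j * klein_form (1/2) 0 (4 * ((of_int a * \<tau> + of_int b) / j)) = klein_form (1/2 + of_int e) (0 + of_int (2 * b)) (4 * \<tau>)"
    using klein_form_modular[OF \<tau>' det', of "1/2" 0] unfolding j num by (simp add: a2)
  also have "\<dots> = exp (of_real pi * \<i> * of_real (of_int (e + 2 * b + e * (2 * b)) + 1/2 * of_int (2 * b) - 0 * of_int e)) * klein_form (1/2) 0 (4 * \<tau>)"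
    by (rule klein_form_add_int[OF \<tau>'])
  finally have "(j * klein_form (1/2) 0 (4 * ((of_int a * \<tau> + of_int b) / j))) ^ 2 =
    exp (of_real pi * \<i> * of_real (of_int (e + 2 * b + e * (2 * b)) + 1/2 * of_int (2 * b) - 0 * of_int e)) ^ 2 * klein_form (1/2) 0 (4 * \<tau>) ^ 2"
    by (simp add: power_mult_distrib)
  also have "exp (of_real pi * \<i> * of_real (of_int (e + 2 * b + e * (2 * b)) + 1/2 * of_int (2 * b) - 0 * of_int e)) ^ 2 = to_q (of_int (e + 3 * b + e * (2 * b)))"
    unfolding to_q_def exp_of_nat_mult[symmetric] by (simp add: algebra_simps)
  finally show ?thesis
    using j_nz by (simp add: power_mult_distrib field_simps del: of_int_add of_int_mult)
qed

private lemma legs: "(leg3 d = 1 \<or> leg3 d = -1) \<and> (leg5 d = 1 \<or> leg5 d = -1)"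
  by (auto simp: leg3_def leg5_def)

lemma klein_quotient_X:
  defines "F \<equiv> (\<lambda>\<tau>. klein_prod 3 (2 * \<tau>) * klein_prod 5 (2 * \<tau>) / klein_prod 15 (4 * \<tau>) * (klein_form (1/2) 0 (4 * \<tau>) ^ 2) ^ 2)"
  shows "F ((of_int a * \<tau> + of_int b) / (of_int (60 * c) * \<tau> + of_int d)) = F \<tau>"
  unfolding F_def j_def[symmetric] atoms atom_beta
  by (rule klein_quotient_X_factors) (use legs j_nz \<theta>_nz in auto)

lemma klein_quotient_Y:
  defines "F \<equiv> (\<lambda>\<tau>. klein_prod 3 (1 * \<tau>) * klein_prod 5 (1 * \<tau>) * klein_prod 15 (2 * \<tau>) * klein_prod 3 (4 * \<tau>) * klein_prod 5 (4 * \<tau>) /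
     (klein_prod 3 (2 * \<tau>) * klein_prod 5 (2 * \<tau>) * klein_prod 15 (4 * \<tau>) ^ 2 * klein_form 0 (1/2) \<tau> ^ 2) * (klein_form (1/2) 0 (4 * \<tau>) ^ 2) ^ 3)"
  shows "F ((of_int a * \<tau> + of_int b) / (of_int (60 * c) * \<tau> + of_int d)) = F \<tau>"
  unfolding F_def j_def[symmetric] atoms atom_beta atom_alpha
  by (rule klein_quotient_Y_factors) (use legs j_nz \<theta>_42 in auto)

lemma klein_quotient_U:
  defines "F \<equiv> (\<lambda>\<tau>. klein_prod 15 (2 * \<tau>) ^ 3 * klein_prod 3 (4 * \<tau>) ^ 6 * klein_prod 5 (4 * \<tau>) ^ 2 /
     (klein_prod 3 (2 * \<tau>) ^ 3 * klein_prod 5 (2 * \<tau>) * klein_prod 15 (4 * \<tau>) ^ 6) * (klein_form (1/2) 0 (4 * \<tau>) ^ 2) ^ 8)"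
  shows "F ((of_int a * \<tau> + of_int b) / (of_int (60 * c) * \<tau> + of_int d)) = F \<tau>"
  unfolding F_def j_def[symmetric] atoms atom_beta
  by (rule klein_quotient_U_factors) (use legs j_nz \<theta>_nz in auto)

end

text \<open>The exponents of the three lists are chosen so that the poles lie only at cusps with
  gcd(c, 60) in {4, 60} (see \<open>ord60_nonneg\<close>), with orders 2, 3 and 8 at \<infinity>.
  The first two lists are stable under \<open>swap15\<close>, the third is not.\<close>

definition quotX :: "(nat \<times> int) list"
  where "quotX = [(6, 1), (10, 1), (4, -1), (60, -1)]"

definition quotY :: "(nat \<times> int) list"
  where "quotY = [(2, 1), (3, 1), (5, 1), (12, 1), (20, 1), (30, 1), (4, -2), (6, -1), (10, -1), (60, -2)]"

definition quotU :: "(nat \<times> int) list"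
  where "quotU = [(2, 1), (12, 6), (20, 2), (30, 3), (4, -2), (6, -3), (10, -1), (60, -6)]"

lemma klein_prod_eta_constants:
  obtains C3 C5 C15 where "C3 \<noteq> 0" "C5 \<noteq> 0" "C15 \<noteq> 0"
    "\<And>\<tau>. Im \<tau> > 0 \<Longrightarrow> klein_prod 3 \<tau> = C3 * eta (3 * \<tau>) / eta \<tau> ^ 3"
    "\<And>\<tau>. Im \<tau> > 0 \<Longrightarrow> klein_prod 5 \<tau> = C5 * eta (5 * \<tau>) / eta \<tau> ^ 5"
    "\<And>\<tau>. Im \<tau> > 0 \<Longrightarrow> klein_prod 15 \<tau> = C15 * eta (15 * \<tau>) / eta \<tau> ^ 15"
proof -
  obtain C3 where "C3 \<noteq> 0" "\<And>\<tau>. Im \<tau> > 0 \<Longrightarrow> klein_prod 3 \<tau> = C3 * eta (3 * \<tau>) / eta \<tau> ^ 3"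
    using klein_prod_eta[of 3] by auto
  moreover obtain C5 where "C5 \<noteq> 0" "\<And>\<tau>. Im \<tau> > 0 \<Longrightarrow> klein_prod 5 \<tau> = C5 * eta (5 * \<tau>) / eta \<tau> ^ 5"
    using klein_prod_eta[of 5] by auto
  moreover obtain C15 where "C15 \<noteq> 0" "\<And>\<tau>. Im \<tau> > 0 \<Longrightarrow> klein_prod 15 \<tau> = C15 * eta (15 * \<tau>) / eta \<tau> ^ 15"
    using klein_prod_eta[of 15] by auto
  ultimately show ?thesis
    using that by blast
qed

lemma klein_form_beta:
  assumes "Im \<tau> > 0"
  shows "klein_form (1/2) 0 (4 * \<tau>) ^ 2 = eta (2 * \<tau>) ^ 4 / eta (4 * \<tau>) ^ 8"
  using klein_half_eta(2)[of "4 * \<tau>"] assms by (simp add: power_divide flip: power_mult)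

lemma klein_form_alpha:
  assumes "Im \<tau> > 0"
  shows "klein_form 0 (1/2) \<tau> ^ 2 = - 4 * eta (2 * \<tau>) ^ 4 / eta \<tau> ^ 8"
  using klein_half_eta(1)[of "\<tau>"] assms by (simp add: power_divide power_mult_distrib flip: power_mult)

lemma eta_quot_X_klein:
  obtains C where "\<And>\<tau>. Im \<tau> > 0 \<Longrightarrow> eta_quot quotX \<tau> =
    C * (klein_prod 3 (2 * \<tau>) * klein_prod 5 (2 * \<tau>) / klein_prod 15 (4 * \<tau>) * (klein_form (1/2) 0 (4 * \<tau>) ^ 2) ^ 2)"
proof -
  obtain C3 C5 C15 where C: "C3 \<noteq> 0" "C5 \<noteq> 0" "C15 \<noteq> 0"
    "\<And>\<tau>. Im \<tau> > 0 \<Longrightarrow> klein_prod 3 \<tau> = C3 * eta (3 * \<tau>) / eta \<tau> ^ 3"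
    "\<And>\<tau>. Im \<tau> > 0 \<Longrightarrow> klein_prod 5 \<tau> = C5 * eta (5 * \<tau>) / eta \<tau> ^ 5"
    "\<And>\<tau>. Im \<tau> > 0 \<Longrightarrow> klein_prod 15 \<tau> = C15 * eta (15 * \<tau>) / eta \<tau> ^ 15"
    using klein_prod_eta_constants by metis
  show ?thesis
  proof (rule that[of "C15 / (C3 * C5)"])
    fix \<tau> assume \<tau>: "Im \<tau> > 0"
    have nz: "eta (of_nat n * \<tau>) \<noteq> 0" if "n > 0" for n
      using \<tau> that by (intro eta_nonzero) auto
    show "eta_quot quotX \<tau> = C15 / (C3 * C5) * (klein_prod 3 (2 * \<tau>) * klein_prod 5 (2 * \<tau>) / klein_prod 15 (4 * \<tau>) * (klein_form (1/2) 0 (4 * \<tau>) ^ 2) ^ 2)"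
      unfolding klein_form_beta[OF \<tau>] using \<tau> C nz[of 2] nz[of 4] nz[of 6] nz[of 10] nz[of 60]
      by (simp add: quotX_def power_int_minus field_simps power_divide flip: power_mult power_add, simp add: eval_nat_numeral mult_ac)
  qed
qed

lemma eta_quot_Y_klein:
  obtains C where "\<And>\<tau>. Im \<tau> > 0 \<Longrightarrow> eta_quot quotY \<tau> =
    C * (klein_prod 3 (1 * \<tau>) * klein_prod 5 (1 * \<tau>) * klein_prod 15 (2 * \<tau>) * klein_prod 3 (4 * \<tau>) * klein_prod 5 (4 * \<tau>) /
     (klein_prod 3 (2 * \<tau>) * klein_prod 5 (2 * \<tau>) * klein_prod 15 (4 * \<tau>) ^ 2 * klein_form 0 (1/2) \<tau> ^ 2) * (klein_form (1/2) 0 (4 * \<tau>) ^ 2) ^ 3)"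
proof -
  obtain C3 C5 C15 where C: "C3 \<noteq> 0" "C5 \<noteq> 0" "C15 \<noteq> 0"
    "\<And>\<tau>. Im \<tau> > 0 \<Longrightarrow> klein_prod 3 \<tau> = C3 * eta (3 * \<tau>) / eta \<tau> ^ 3"
    "\<And>\<tau>. Im \<tau> > 0 \<Longrightarrow> klein_prod 5 \<tau> = C5 * eta (5 * \<tau>) / eta \<tau> ^ 5"
    "\<And>\<tau>. Im \<tau> > 0 \<Longrightarrow> klein_prod 15 \<tau> = C15 * eta (15 * \<tau>) / eta \<tau> ^ 15"
    using klein_prod_eta_constants by metis
  show ?thesis
  proof (rule that[of "- 4 * C15 / (C3 * C5)"])
    fix \<tau> assume \<tau>: "Im \<tau> > 0"
    have nz: "eta (of_nat n * \<tau>) \<noteq> 0" if "n > 0" for n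
      using \<tau> that by (intro eta_nonzero) auto
    show "eta_quot quotY \<tau> = - 4 * C15 / (C3 * C5) * (klein_prod 3 (1 * \<tau>) * klein_prod 5 (1 * \<tau>) * klein_prod 15 (2 * \<tau>) * klein_prod 3 (4 * \<tau>) * klein_prod 5 (4 * \<tau>) /
     (klein_prod 3 (2 * \<tau>) * klein_prod 5 (2 * \<tau>) * klein_prod 15 (4 * \<tau>) ^ 2 * klein_form 0 (1/2) \<tau> ^ 2) * (klein_form (1/2) 0 (4 * \<tau>) ^ 2) ^ 3)"
      unfolding klein_form_beta[OF \<tau>] klein_form_alpha[OF \<tau>]
      using \<tau> C nz[of 1] nz[of 2] nz[of 3] nz[of 4] nz[of 5] nz[of 6] nz[of 10] nz[of 12] nz[of 20] nz[of 30] nz[of 60]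
      by (simp add: quotY_def power_int_minus field_simps power_divide power_mult_distrib flip: power_mult power_add, simp add: eval_nat_numeral mult_ac)
  qed
qed

lemma eta_quot_U_klein:
  obtains C where "\<And>\<tau>. Im \<tau> > 0 \<Longrightarrow> eta_quot quotU \<tau> =
    C * (klein_prod 15 (2 * \<tau>) ^ 3 * klein_prod 3 (4 * \<tau>) ^ 6 * klein_prod 5 (4 * \<tau>) ^ 2 /
     (klein_prod 3 (2 * \<tau>) ^ 3 * klein_prod 5 (2 * \<tau>) * klein_prod 15 (4 * \<tau>) ^ 6) * (klein_form (1/2) 0 (4 * \<tau>) ^ 2) ^ 8)"
proof -
  obtain C3 C5 C15 where C: "C3 \<noteq> 0" "C5 \<noteq> 0" "C15 \<noteq> 0"
    "\<And>\<tau>. Im \<tau> > 0 \<Longrightarrow> klein_prod 3 \<tau> = C3 * eta (3 * \<tau>) / eta \<tau> ^ 3"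
    "\<And>\<tau>. Im \<tau> > 0 \<Longrightarrow> klein_prod 5 \<tau> = C5 * eta (5 * \<tau>) / eta \<tau> ^ 5"
    "\<And>\<tau>. Im \<tau> > 0 \<Longrightarrow> klein_prod 15 \<tau> = C15 * eta (15 * \<tau>) / eta \<tau> ^ 15"
    using klein_prod_eta_constants by metis
  show ?thesis
  proof (rule that[of "C15 ^ 3 / (C3 ^ 3 * C5)"])
    fix \<tau> assume \<tau>: "Im \<tau> > 0"
    have nz: "eta (of_nat n * \<tau>) \<noteq> 0" if "n > 0" for n
      using \<tau> that by (intro eta_nonzero) auto
    show "eta_quot quotU \<tau> = C15 ^ 3 / (C3 ^ 3 * C5) * (klein_prod 15 (2 * \<tau>) ^ 3 * klein_prod 3 (4 * \<tau>) ^ 6 * klein_prod 5 (4 * \<tau>) ^ 2 /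
     (klein_prod 3 (2 * \<tau>) ^ 3 * klein_prod 5 (2 * \<tau>) * klein_prod 15 (4 * \<tau>) ^ 6) * (klein_form (1/2) 0 (4 * \<tau>) ^ 2) ^ 8)"
      unfolding klein_form_beta[OF \<tau>]
      using \<tau> C nz[of 2] nz[of 4] nz[of 6] nz[of 10] nz[of 12] nz[of 20] nz[of 30] nz[of 60]
      by (simp add: quotU_def power_int_minus field_simps power_divide power_mult_distrib flip: power_mult power_add, simp add: eval_nat_numeral mult_ac)
  qed
qed

lemma eta_quot_invariant:
  fixes a b c d :: int
  assumes "r \<in> {quotX, quotY, quotU}" and \<tau>: "Im \<tau> > 0" and det: "a * d - b * (60 * c) = 1"
  shows "eta_quot r ((of_int a * \<tau> + of_int b) / (of_int (60 * c) * \<tau> + of_int d)) = eta_quot r \<tau>"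
proof -
  note \<tau>' = moebius_int(2)[OF \<tau> det]
  from assms(1) consider "r = quotX" | "r = quotY" | "r = quotU"
    by blast
  thus ?thesis
  proof cases
    case 1
    obtain C where "\<And>\<tau>. Im \<tau> > 0 \<Longrightarrow> eta_quot quotX \<tau> =
      C * (klein_prod 3 (2 * \<tau>) * klein_prod 5 (2 * \<tau>) / klein_prod 15 (4 * \<tau>) * (klein_form (1/2) 0 (4 * \<tau>) ^ 2) ^ 2)"
      using eta_quot_X_klein by blast
    note * = this[OF \<tau>'] this[OF \<tau>]
    show ?thesis
      unfolding 1 * klein_quotient_X[OF \<tau> det] ..
  next
    case 2
    obtain C where "\<And>\<tau>. Im \<tau> > 0 \<Longrightarrow> eta_quot quotY \<tau> =
      C * (klein_prod 3 (1 * \<tau>) * klein_prod 5 (1 * \<tau>) * klein_prod 15 (2 * \<tau>) * klein_prod 3 (4 * \<tau>) * klein_prod 5 (4 * \<tau>) /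
     (klein_prod 3 (2 * \<tau>) * klein_prod 5 (2 * \<tau>) * klein_prod 15 (4 * \<tau>) ^ 2 * klein_form 0 (1/2) \<tau> ^ 2) * (klein_form (1/2) 0 (4 * \<tau>) ^ 2) ^ 3)"
      using eta_quot_Y_klein by blast
    note * = this[OF \<tau>'] this[OF \<tau>]
    show ?thesis
      unfolding 2 * klein_quotient_Y[OF \<tau> det] ..
  next
    case 3
    obtain C where "\<And>\<tau>. Im \<tau> > 0 \<Longrightarrow> eta_quot quotU \<tau> =
      C * (klein_prod 15 (2 * \<tau>) ^ 3 * klein_prod 3 (4 * \<tau>) ^ 6 * klein_prod 5 (4 * \<tau>) ^ 2 /
     (klein_prod 3 (2 * \<tau>) ^ 3 * klein_prod 5 (2 * \<tau>) * klein_prod 15 (4 * \<tau>) ^ 6) * (klein_form (1/2) 0 (4 * \<tau>) ^ 2) ^ 8)"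
      using eta_quot_U_klein by blast
    note * = this[OF \<tau>'] this[OF \<tau>]
    show ?thesis
      unfolding 3 * klein_quotient_U[OF \<tau> det] ..
  qed
qed

section \<open>Meromorphic functions on the upper half-plane\<close>

text \<open>\<open>mero_of\<close> changes a function only at its singularities. This upgrades the
  field laws, which are known off a sparse set, to equalities at every regular point.\<close>

lemma eval_mero_of_analytic:
  assumes "g meromorphic_on uhp" "Im z > 0" "g analytic_on {z}"
  shows "eval_mero (mero_of g) z = g z"
  using assms by (simp add: mero_of.rep_eq)

context
  fixes f g :: mero_uhp and z :: complex
  assumes z: "Im z > 0" and f: "eval_mero f analytic_on {z}" and g: "eval_mero g analytic_on {z}"
begin

lemma eval_plus_at: "eval_mero (f + g) z = eval_mero f z + eval_mero g z"
  unfolding plus_mero_uhp_def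
  by (rule eval_mero_of_analytic[OF _ z]) (intro meromorphic_intros analytic_intros f g)+

lemma eval_minus_at: "eval_mero (f - g) z = eval_mero f z - eval_mero g z"
  unfolding minus_mero_uhp_def
  by (rule eval_mero_of_analytic[OF _ z]) (intro meromorphic_intros analytic_intros f g)+

lemma eval_times_at: "eval_mero (f * g) z = eval_mero f z * eval_mero g z"
  unfolding times_mero_uhp_def
  by (rule eval_mero_of_analytic[OF _ z]) (intro meromorphic_intros analytic_intros f g)+

end

lemma eval_uminus_at:
  assumes "Im z > 0" "eval_mero f analytic_on {z}"
  shows "eval_mero (- f) z = - eval_mero f z"
  unfolding uminus_mero_uhp_def
  by (rule eval_mero_of_analytic[OF _ assms(1)]) (intro meromorphic_intros analytic_intros assms)+

lemma eval_inverse_at: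
  assumes "Im z > 0" "eval_mero f analytic_on {z}" "eval_mero f z \<noteq> 0"
  shows "eval_mero (inverse f) z = inverse (eval_mero f z)"
  unfolding inverse_mero_uhp_def
  by (rule eval_mero_of_analytic[OF _ assms(1)]) (use assms in \<open>auto intro!: meromorphic_intros analytic_intros\<close>)

definition mconst :: "complex \<Rightarrow> mero_uhp" where "mconst c = mero_of (\<lambda>_. c)"

lemma eval_mconst: "Im z > 0 \<Longrightarrow> eval_mero (mconst c) z = c"
  unfolding mconst_def by (rule eval_mero_of_analytic) auto

lemma mconst_0 [simp]: "mconst 0 = 0" and mconst_1 [simp]: "mconst 1 = 1"
  by (simp_all add: mconst_def zero_mero_uhp_def one_mero_uhp_def)

lemma mero_eqI_uhp:
  assumes "\<And>z. Im z > 0 \<Longrightarrow> eval_mero f z = eval_mero g z"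
  shows "f = g"
  by (rule mero_eqI) (use eventually_in_cosparse[OF order_refl open_uhp] assms in \<open>auto elim: eventually_mono\<close>)

lemma analytic_cong_uhp:
  assumes "\<And>w. w \<in> A \<Longrightarrow> f w = g w" "open A" "z \<in> A" "g analytic_on {z}"
  shows "f analytic_on {z}"
proof -
  have "eventually (\<lambda>w. f w = g w) (nhds z)"
    using assms by (auto simp: eventually_nhds)
  thus ?thesis
    using assms(4) analytic_at_cong by blast
qed

lemma open_upper: "open {z. Im z > Y}"
  by (rule open_halfspace_Im_gt)

context
  fixes f g :: mero_uhp and A :: "complex set"
  assumes A: "open A" "A \<subseteq> uhp" and f: "eval_mero f analytic_on A" and g: "eval_mero g analytic_on A"
begin

private lemma at: "z \<in> A \<Longrightarrow> Im z > 0" "z \<in> A \<Longrightarrow> eval_mero f analytic_on {z}" "z \<in> A \<Longrightarrow> eval_mero g analytic_on {z}"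
  using A analytic_on_subset[OF f, of "{z}"] analytic_on_subset[OF g, of "{z}"] by auto

lemma analytic_plus: "eval_mero (f + g) analytic_on A"
proof (subst analytic_on_analytic_at, intro ballI)
  fix z assume z: "z \<in> A"
  show "eval_mero (f + g) analytic_on {z}"
    by (rule analytic_cong_uhp[OF eval_plus_at[OF at] A(1) z analytic_on_add[OF at(2,3)[OF z]]])
qed

lemma analytic_times: "eval_mero (f * g) analytic_on A"
proof (subst analytic_on_analytic_at, intro ballI)
  fix z assume z: "z \<in> A"
  show "eval_mero (f * g) analytic_on {z}"
    by (rule analytic_cong_uhp[OF eval_times_at[OF at] A(1) z analytic_on_mult[OF at(2,3)[OF z]]])
qed

end

lemma mconst_analytic:
  assumes "A \<subseteq> uhp"
  shows "eval_mero (mconst c) analytic_on A"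
proof (rule analytic_on_subset[OF _ assms])
  have "eval_mero (mconst c) holomorphic_on uhp"
    by (rule holomorphic_transform[OF holomorphic_on_const[of c]]) (simp add: eval_mconst)
  thus "eval_mero (mconst c) analytic_on uhp"
    using open_uhp by (simp add: analytic_on_open)
qed

lemma mconst_hom:
  "mconst (a + b) = mconst a + mconst b" "mconst (a * b) = mconst a * mconst b" "mconst (a - b) = mconst a - mconst b"
  "mconst (- a) = - mconst a" "mconst (inverse a) = inverse (mconst a)"
proof -
  have *: "eval_mero (mconst c) analytic_on {z}" if "Im z > 0" for c z
    using mconst_analytic[of "{z}"] that by auto
  show 1: "mconst (a + b) = mconst a + mconst b" "mconst (a * b) = mconst a * mconst b" "mconst (a - b) = mconst a - mconst b"
       "mconst (- a) = - mconst a" for a b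
    by (rule mero_eqI_uhp; simp add: eval_mconst eval_plus_at eval_times_at eval_minus_at eval_uminus_at *)+
  show "mconst (inverse a) = inverse (mconst a)"
  proof (cases "a = 0")
    case False
    hence "mconst a * mconst (inverse a) = 1"
      by (simp flip: 1)
    thus ?thesis
      by (metis inverse_unique)
  qed auto
qed

lemma mconst_of_nat: "mconst (of_nat n) = of_nat n"
  by (induction n) (simp_all add: mconst_hom)

lemma mconst_of_int: "mconst (of_int n) = of_int n"
  by (cases n rule: int_cases2) (simp_all add: mconst_of_nat mconst_hom)

lemma mconst_numeral: "mconst (numeral n) = numeral n"
  using mconst_of_nat[of "numeral n"] by simp

lemma mconst_eq_iff [simp]: "mconst a = mconst b \<longleftrightarrow> a = b"
proof
  assume "mconst a = mconst b"
  hence "eval_mero (mconst a) \<i> = eval_mero (mconst b) \<i>"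
    by simp
  thus "a = b"
    by (simp add: eval_mconst)
qed simp

text \<open>A Moebius map is injective on the half-plane, so it sends punctured neighbourhoods into
  punctured neighbourhoods and exceptional points stay isolated.\<close>

lemma cosparse_moebius:
  assumes "det M > 0" "\<forall>\<^sub>\<approx>w\<in>uhp. P w"
  shows "\<forall>\<^sub>\<approx>z\<in>uhp. P (moebius_map M z)"
  unfolding eventually_cosparse_open_eq[OF open_uhp]
proof
  fix w assume w: "w \<in> uhp"
  have "moebius_map M analytic_on {w}"
    using moebius_analytic[OF assms(1)] by (rule analytic_on_subset) (use w in auto)
  hence "moebius_map M \<midarrow>w\<rightarrow> moebius_map M w"
    by (intro isContD analytic_at_imp_isCont)
  moreover have "eventually (\<lambda>u. u \<in> uhp - {w}) (at w)"
    using open_uhp w by (rule eventually_at_in_open)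
  hence "eventually (\<lambda>u. moebius_map M u \<noteq> moebius_map M w) (at w)"
    by eventually_elim (metis assms(1) Diff_iff moebius_matrix_inv(1) singletonI w)
  ultimately have "filterlim (moebius_map M) (at (moebius_map M w)) (at w)"
    by (simp add: filterlim_at)
  moreover have "eventually P (at (moebius_map M w))"
    using assms(2) moebius_in_uhp[OF assms(1) w] unfolding eventually_cosparse_open_eq[OF open_uhp] by blast
  ultimately show "eventually (\<lambda>z. P (moebius_map M z)) (at w)"
    by (auto simp: filterlim_iff)
qed

lemma eval_pullback_cosparse:
  assumes "det M > 0"
  shows "\<forall>\<^sub>\<approx>z\<in>uhp. eval_mero (pullback M f) z = eval_mero f (moebius_map M z)"
  using eventually_in_cosparse[OF order_refl open_uhp] by eventually_elim (use eval_pullback[OF assms] in auto)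

context
  fixes M :: "real^2^2"
  assumes M: "det M > 0"
begin

lemma pullback_plus: "pullback M (f + g) = pullback M f + pullback M g"
  by (rule mero_eqI)
     (use cosparse_moebius[OF M eval_plus[of f g]] eval_plus[of "pullback M f" "pullback M g"]
          eval_pullback_cosparse[OF M, of f] eval_pullback_cosparse[OF M, of g] eval_pullback_cosparse[OF M, of "f + g"]
      in eventually_elim, simp)

lemma pullback_times: "pullback M (f * g) = pullback M f * pullback M g"
  by (rule mero_eqI)
     (use cosparse_moebius[OF M eval_times[of f g]] eval_times[of "pullback M f" "pullback M g"]
          eval_pullback_cosparse[OF M, of f] eval_pullback_cosparse[OF M, of g] eval_pullback_cosparse[OF M, of "f * g"]
      in eventually_elim, simp)

lemma pullback_mconst: "pullback M (mconst c) = mconst c"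
  by (rule mero_eqI_uhp) (use moebius_in_uhp[OF M] in \<open>simp add: eval_pullback M eval_mconst\<close>)

lemma pullback_0: "pullback M 0 = 0" and pullback_1: "pullback M 1 = 1"
  using pullback_mconst[of 0] pullback_mconst[of 1] by simp_all

lemma pullback_uminus: "pullback M (- f) = - pullback M f"
  using pullback_plus[of f "- f"] by (simp add: pullback_0 eq_neg_iff_add_eq_0 add.commute)

lemma pullback_minus: "pullback M (f - g) = pullback M f - pullback M g"
  using pullback_plus[of f "- g"] by (simp add: pullback_uminus)

lemma pullback_inverse: "pullback M (inverse f) = inverse (pullback M f)"
proof (cases "f = 0")
  case False
  hence "pullback M f * pullback M (inverse f) = 1"
    by (simp add: pullback_1 flip: pullback_times)
  thus ?thesis
    by (metis inverse_unique)
qed (simp add: pullback_0)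

lemma pullback_inverse_matrix: "pullback (matrix_inv M) (pullback M f) = f" "pullback M (pullback (matrix_inv M) f) = f"
proof -
  have M': "det (matrix_inv M) > 0"
    using moebius_matrix_inv(3)[OF M, of \<i>] by simp
  show "pullback (matrix_inv M) (pullback M f) = f"
    by (rule mero_eqI_uhp)
       (use moebius_in_uhp[OF M'] moebius_matrix_inv(2)[OF M] in \<open>simp add: eval_pullback M M'\<close>)
  show "pullback M (pullback (matrix_inv M) f) = f"
    by (rule mero_eqI_uhp)
       (use moebius_in_uhp[OF M] moebius_matrix_inv(1)[OF M] in \<open>simp add: eval_pullback M M'\<close>)
qed

lemma pullback_eq_0_iff: "pullback M f = 0 \<longleftrightarrow> f = 0"
proof
  assume "pullback M f = 0"
  thus "f = 0"
    using pullback_inverse_matrix(1)[of f] pullback_inverse_matrix(1)[of 0] by (simp add: pullback_0)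
qed (simp add: pullback_0)

lemma pullback_analytic:
  assumes "eval_mero f analytic_on {moebius_map M z}" "Im z > 0"
  shows "eval_mero (pullback M f) analytic_on {z}"
proof (rule analytic_cong_uhp[where A = uhp])
  have "moebius_map M analytic_on {z}"
    using moebius_analytic[OF M] by (rule analytic_on_subset) (use assms in auto)
  from analytic_on_compose[OF this] assms show "(\<lambda>z. eval_mero f (moebius_map M z)) analytic_on {z}"
    by (simp add: o_def)
qed (use assms M in \<open>auto simp: eval_pullback open_uhp\<close>)

end

section \<open>Growth at infinity and \<open>q\<close>-expansions\<close>

text \<open>The bound with \<rho> = -2 \<pi> n corresponds to order at least n in exp(2 \<pi> i z).
  In contrast to a q-expansion it refers to no period, so sums, products and affine substitutions
  are immediate.\<close>

definition growth_le :: "real \<Rightarrow> mero_uhp \<Rightarrow> bool"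
  where "growth_le \<rho> f \<longleftrightarrow> (\<exists>C Y. Y > 0 \<and> (\<forall>z. Im z > Y \<longrightarrow> eval_mero f analytic_on {z} \<and> norm (eval_mero f z) \<le> C * exp (\<rho> * Im z)))"

lemma growth_leE:
  assumes "growth_le \<rho> f"
  obtains C Y where "C > 0" "\<And>z. Im z > Y \<Longrightarrow> Im z > 0" "eval_mero f analytic_on {z. Im z > Y}"
    "\<And>z. Im z > Y \<Longrightarrow> norm (eval_mero f z) \<le> C * exp (\<rho> * Im z)" "Y > 0"
proof -
  from assms obtain C Y where CY: "Y > 0" "\<And>z. Im z > Y \<Longrightarrow> eval_mero f analytic_on {z}"
    "\<And>z. Im z > Y \<Longrightarrow> norm (eval_mero f z) \<le> C * exp (\<rho> * Im z)"
    by (auto simp: growth_le_def)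
  show ?thesis
  proof (rule that[of "max C 1" Y])
    show "eval_mero f analytic_on {z. Im z > Y}"
      by (subst analytic_on_analytic_at) (use CY in auto)
    show "norm (eval_mero f z) \<le> max C 1 * exp (\<rho> * Im z)" if "Im z > Y" for z
      by (rule order.trans[OF CY(3)[OF that]]) (intro mult_right_mono, auto)
  qed (use CY in auto)
qed

lemma growth_leI:
  assumes "eval_mero f analytic_on {z. Im z > Y}" "\<And>z. Im z > Y \<Longrightarrow> norm (eval_mero f z) \<le> C * exp (\<rho> * Im z)"
  shows "growth_le \<rho> f"
  unfolding growth_le_def
  by (rule exI[of _ C], rule exI[of _ "max Y 1"])
     (use assms analytic_on_analytic_at[of "eval_mero f" "{z. Im z > Y}"] in auto)

lemma growth_le_mono:
  assumes "growth_le \<rho> f" "\<rho> \<le> \<rho>'"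
  shows "growth_le \<rho>' f"
proof -
  from assms(1) obtain C Y where CY: "C > 0" "\<And>z. Im z > Y \<Longrightarrow> Im z > 0" "eval_mero f analytic_on {z. Im z > Y}"
    "\<And>z. Im z > Y \<Longrightarrow> norm (eval_mero f z) \<le> C * exp (\<rho> * Im z)" "Y > 0"
    by (rule growth_leE) blast
  show ?thesis
  proof (rule growth_leI[OF CY(3)])
    fix z assume z: "Im z > Y"
    have "C * exp (\<rho> * Im z) \<le> C * exp (\<rho>' * Im z)"
      using CY(1) CY(2)[OF z] assms(2) by (intro mult_left_mono) (auto intro!: mult_right_mono)
    with CY(4)[OF z] show "norm (eval_mero f z) \<le> C * exp (\<rho>' * Im z)"
      by linarith
  qed
qed

lemma growth_le_plus:
  assumes "growth_le \<rho> f" "growth_le \<rho> g"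
  shows "growth_le \<rho> (f + g)"
proof -
  from assms(1) obtain C Y where CY: "C > 0" "\<And>z. Im z > Y \<Longrightarrow> Im z > 0" "eval_mero f analytic_on {z. Im z > Y}"
    "\<And>z. Im z > Y \<Longrightarrow> norm (eval_mero f z) \<le> C * exp (\<rho> * Im z)" "Y > 0"
    by (rule growth_leE) blast
  from assms(2) obtain C' Y' where CY': "C' > 0" "\<And>z. Im z > Y' \<Longrightarrow> Im z > 0" "eval_mero g analytic_on {z. Im z > Y'}"
    "\<And>z. Im z > Y' \<Longrightarrow> norm (eval_mero g z) \<le> C' * exp (\<rho> * Im z)" "Y' > 0"
    by (rule growth_leE) blast
  have an: "eval_mero f analytic_on {z. Im z > max Y Y'}" "eval_mero g analytic_on {z. Im z > max Y Y'}"
    by (rule analytic_on_subset[OF CY(3)], force) (rule analytic_on_subset[OF CY'(3)], force)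
  show ?thesis
  proof (rule growth_leI[of _ "max Y Y'" "C + C'"])
    show "eval_mero (f + g) analytic_on {z. Im z > max Y Y'}"
      by (rule analytic_plus[OF open_upper _ an]) (use CY(2) in auto)
    fix z assume z: "Im z > max Y Y'"
    have "eval_mero (f + g) z = eval_mero f z + eval_mero g z"
      using CY(2) z an by (intro eval_plus_at) (auto intro: analytic_on_subset)
    hence "norm (eval_mero (f + g) z) \<le> norm (eval_mero f z) + norm (eval_mero g z)"
      by (simp add: norm_triangle_ineq)
    also have "\<dots> \<le> (C + C') * exp (\<rho> * Im z)"
      using CY(4)[of z] CY'(4)[of z] z by (simp add: algebra_simps)
    finally show "norm (eval_mero (f + g) z) \<le> (C + C') * exp (\<rho> * Im z)" .
  qed
qed

lemma growth_le_times:
  assumes "growth_le \<rho> f" "growth_le \<rho>' g"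
  shows "growth_le (\<rho> + \<rho>') (f * g)"
proof -
  from assms(1) obtain C Y where CY: "C > 0" "\<And>z. Im z > Y \<Longrightarrow> Im z > 0" "eval_mero f analytic_on {z. Im z > Y}"
    "\<And>z. Im z > Y \<Longrightarrow> norm (eval_mero f z) \<le> C * exp (\<rho> * Im z)" "Y > 0"
    by (rule growth_leE) blast
  from assms(2) obtain C' Y' where CY': "C' > 0" "\<And>z. Im z > Y' \<Longrightarrow> Im z > 0" "eval_mero g analytic_on {z. Im z > Y'}"
    "\<And>z. Im z > Y' \<Longrightarrow> norm (eval_mero g z) \<le> C' * exp (\<rho>' * Im z)" "Y' > 0"
    by (rule growth_leE) blast
  have an: "eval_mero f analytic_on {z. Im z > max Y Y'}" "eval_mero g analytic_on {z. Im z > max Y Y'}"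
    by (rule analytic_on_subset[OF CY(3)], force) (rule analytic_on_subset[OF CY'(3)], force)
  show ?thesis
  proof (rule growth_leI[of _ "max Y Y'" "C * C'"])
    show "eval_mero (f * g) analytic_on {z. Im z > max Y Y'}"
      by (rule analytic_times[OF open_upper _ an]) (use CY(2) in auto)
    fix z assume z: "Im z > max Y Y'"
    have "eval_mero (f * g) z = eval_mero f z * eval_mero g z"
      using CY(2) z an by (intro eval_times_at) (auto intro: analytic_on_subset)
    hence "norm (eval_mero (f * g) z) = norm (eval_mero f z) * norm (eval_mero g z)"
      by (simp add: norm_mult)
    also have "\<dots> \<le> (C * exp (\<rho> * Im z)) * (C' * exp (\<rho>' * Im z))"
      using CY(1) CY(4)[of z] CY'(4)[of z] z by (intro mult_mono) auto
    finally show "norm (eval_mero (f * g) z) \<le> (C * C') * exp ((\<rho> + \<rho>') * Im z)"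
      by (simp add: exp_add algebra_simps)
  qed
qed

lemma growth_le_mconst: "growth_le 0 (mconst c)"
  by (rule growth_leI[of _ 0 "norm c"]) (auto intro!: mconst_analytic simp: eval_mconst)

lemma growth_le_power:
  assumes "growth_le \<rho> f"
  shows "growth_le (of_nat n * \<rho>) (f ^ n)"
proof (induction n)
  case 0
  show ?case
    using growth_le_mconst[of 1] by simp
next
  case (Suc n)
  show ?case
    using growth_le_times[OF assms Suc] by (simp add: algebra_simps)
qed

lemma growth_le_affine:
  assumes "growth_le \<rho> f" "\<alpha> > 0" "det M > 0" and M: "\<And>z. Im z > 0 \<Longrightarrow> moebius_map M z = of_real \<alpha> * z + of_real \<beta>"
  shows "growth_le (\<rho> * \<alpha>) (pullback M f)"
proof -
  from assms(1) obtain C Y where CY: "C > 0" "\<And>z. Im z > Y \<Longrightarrow> Im z > 0" "eval_mero f analytic_on {z. Im z > Y}"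
    "\<And>z. Im z > Y \<Longrightarrow> norm (eval_mero f z) \<le> C * exp (\<rho> * Im z)" "Y > 0"
    by (rule growth_leE) blast
  have pos: "Im z > 0" if "Im z > Y / \<alpha>" for z
    using that CY(5) assms(2) by (smt (verit) divide_pos_pos)
  have im: "Im (moebius_map M z) = \<alpha> * Im z" "Im (moebius_map M z) > Y" if "Im z > Y / \<alpha>" for z
    using M[OF pos[OF that]] that assms(2) by (auto simp: field_simps)
  show ?thesis
  proof (rule growth_leI[of _ "Y / \<alpha>" C])
    show "eval_mero (pullback M f) analytic_on {z. Im z > Y / \<alpha>}"
    proof (subst analytic_on_analytic_at, intro ballI)
      fix z assume "z \<in> {z. Im z > Y / \<alpha>}"
      hence z: "Im z > Y / \<alpha>" by simp
      show "eval_mero (pullback M f) analytic_on {z}"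
        by (rule pullback_analytic[OF assms(3) _ pos[OF z]]) (rule analytic_on_subset[OF CY(3)], use im(2)[OF z] in simp)
    qed
    fix z assume z: "Im z > Y / \<alpha>"
    show "norm (eval_mero (pullback M f) z) \<le> C * exp (\<rho> * \<alpha> * Im z)"
      using CY(4)[OF im(2)[OF z]] pos[OF z] assms(3) im(1)[OF z] by (simp add: eval_pullback mult.assoc)
  qed
qed

section \<open>Passing between growth bounds and q-expansions\<close>

lemma filterlim_q:
  assumes "h > 0"
  shows "filterlim (\<lambda>z. exp (2 * of_real pi * \<i> * z / of_nat h)) (at 0) (filtercomap Im at_top)"
proof -
  have "filterlim (\<lambda>x. x / real h) at_top at_top"
    using assms by real_asymp
  hence "filterlim (\<lambda>z. Im z / real h) at_top (filtercomap Im at_top)"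
    by (rule filterlim_compose) (rule filterlim_filtercomap)
  hence "filterlim (\<lambda>z. z / of_nat h) (filtercomap Im at_top) (filtercomap Im at_top)"
    by (simp add: filterlim_filtercomap_iff o_def Im_divide_of_nat)
  from filterlim_compose[OF filterlim_to_q this]
  have "((\<lambda>z. to_q (z / of_nat h)) \<longlongrightarrow> 0) (filtercomap Im at_top)" .
  thus ?thesis
    by (auto simp: filterlim_at to_q_def)
qed

lemma has_q_expansion_analytic:
  assumes "has_q_expansion h f F" "h > 0"
  shows "eventually (\<lambda>z. eval_mero f analytic_on {z}) (filtercomap Im at_top)"
proof -
  define Q where "Q = (\<lambda>z. exp (2 * of_real pi * \<i> * z / of_nat h))"
  have F: "fls_conv_radius F > 0" "eventually (\<lambda>z. eval_mero f z = eval_fls F (Q z)) (filtercomap Im at_top)"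
    using assms(1) by (auto simp: has_q_expansion_def Q_def)
  obtain r where r: "r > 0" "ereal r < fls_conv_radius F"
    using F(1) by (metis ereal_dense2 ereal_less(2))
  have "eventually (\<lambda>q. norm q < r) (at (0::complex))"
    using r(1) by (auto simp: eventually_at intro!: exI[of _ r])
  hence "eventually (\<lambda>z. norm (Q z) < r) (filtercomap Im at_top)"
    using filterlim_q[OF assms(2)] unfolding Q_def filterlim_iff by blast
  with F(2) have "eventually (\<lambda>z. eval_mero f z = eval_fls F (Q z) \<and> norm (Q z) < r) (filtercomap Im at_top)"
    by eventually_elim auto
  then obtain Y where Y: "\<And>z. Im z > Y \<Longrightarrow> eval_mero f z = eval_fls F (Q z) \<and> norm (Q z) < r"
    unfolding eventually_filtercomap_at_top_dense by blast
  have "eval_mero f analytic_on {z}" if z: "Im z > Y" for z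
  proof (rule analytic_cong_uhp[where A = "{z. Im z > Y}" and g = "\<lambda>z. eval_fls F (Q z)"])
    have "(\<lambda>z. eval_fls F (Q z)) holomorphic_on {z. Im z > Y}"
    proof (rule holomorphic_on_eval_fls')
      show "Q holomorphic_on {z. Im z > Y}"
        unfolding Q_def by (intro holomorphic_intros) (use assms in auto)
      have "Q z \<in> eball 0 (fls_conv_radius F) - {0}" if "Im z > Y" for z
        using Y[OF that] r(2) by (auto simp: Q_def in_eball_iff intro: le_less_trans) (metis ereal_less_eq(3) le_less_trans less_imp_le)
      thus "Q ` {z. Im z > Y} \<subseteq> eball 0 (fls_conv_radius F) - (if fls_subdegree F \<ge> 0 then {} else {0})"
        by auto
    qed
    thus "(\<lambda>z. eval_fls F (Q z)) analytic_on {z}"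
      using z open_upper by (auto simp: analytic_at)
  qed (use Y z open_upper in auto)
  thus ?thesis
    by (auto simp: eventually_filtercomap_at_top_dense intro!: exI[of _ Y])
qed

lemma has_q_expansion_growth:
  assumes "has_q_expansion h f F" "h > 0" "\<And>k. k < n \<Longrightarrow> fls_nth F k = 0"
  shows "growth_le (- 2 * pi * of_int n / of_nat h) f"
proof -
  define Q where "Q = (\<lambda>z. exp (2 * of_real pi * \<i> * z / of_nat h))"
  have F: "fls_conv_radius F > 0" "eventually (\<lambda>z. eval_mero f z = eval_fls F (Q z)) (filtercomap Im at_top)"
    using assms(1) by (auto simp: has_q_expansion_def Q_def)
  define G where "G = fls_shift n F"
  have G: "fls_conv_radius G > 0" "fls_subdegree G \<ge> 0"
  proof -
    show "fls_conv_radius G > 0"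
      using F(1) by (simp add: G_def)
    show "fls_subdegree G \<ge> 0"
    proof (cases "G = 0")
      case False
      show ?thesis
        by (rule fls_subdegree_geI[OF False]) (use assms(3) in \<open>auto simp: G_def\<close>)
    qed auto
  qed
  have "eval_fls G \<midarrow>0\<rightarrow> fls_nth G 0"
    using has_laurent_expansion_imp_tendsto_0[OF eval_fls_has_laurent_expansion[OF G(1)] G(2)] .
  hence "eventually (\<lambda>q. norm (eval_fls G q) < norm (fls_nth G 0) + 1) (at 0)"
    by (intro order_tendstoD(2)[OF tendsto_norm]) auto
  hence "eventually (\<lambda>z. norm (eval_fls G (Q z)) < norm (fls_nth G 0) + 1) (filtercomap Im at_top)"
    using filterlim_q[OF assms(2)] unfolding Q_def filterlim_iff by blast
  with F(2) have "eventually (\<lambda>z. norm (eval_mero f z) \<le> (norm (fls_nth G 0) + 1) * exp (- 2 * pi * of_int n / of_nat h * Im z)) (filtercomap Im at_top)"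
  proof eventually_elim
    case (elim z)
    have Q0: "Q z \<noteq> 0"
      by (simp add: Q_def)
    have "norm (Q z) = exp (- 2 * pi * Im z / of_nat h)"
      by (simp add: Q_def Im_divide_of_nat)
    hence nQ: "norm (Q z) powi n = exp (- 2 * pi * of_int n / of_nat h * Im z)"
      by (simp add: exp_power_int algebra_simps)
    have "eval_fls F (Q z) = eval_fls G (Q z) * Q z powi n"
      unfolding G_def using Q0 by (subst eval_fls_shift) (auto simp: power_int_minus)
    hence "norm (eval_mero f z) = norm (eval_fls G (Q z)) * norm (Q z) powi n"
      using elim(1) by (simp add: norm_mult norm_power_int)
    thus ?case
      using elim(2) unfolding nQ by (auto intro!: mult_right_mono)
  qed
  with has_q_expansion_analytic[OF assms(1,2)]
  have "eventually (\<lambda>z. eval_mero f analytic_on {z} \<and> norm (eval_mero f z) \<le> (norm (fls_nth G 0) + 1) * exp (- 2 * pi * of_int n / of_nat h * Im z)) (filtercomap Im at_top)"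
    by eventually_elim auto
  then obtain Y where Y: "\<And>z. Im z > Y \<Longrightarrow> eval_mero f analytic_on {z} \<and> norm (eval_mero f z) \<le> (norm (fls_nth G 0) + 1) * exp (- 2 * pi * of_int n / of_nat h * Im z)"
    unfolding eventually_filtercomap_at_top_dense by blast
  show ?thesis
  proof (rule growth_leI[of _ Y "norm (fls_nth G 0) + 1"])
    show "eval_mero f analytic_on {z. Im z > Y}"
      by (subst analytic_on_analytic_at) (use Y in auto)
  qed (use Y in auto)
qed

lemma has_q_expansion_growth':
  assumes "has_q_expansion h f F" "h > 0"
  shows "\<exists>\<rho>. growth_le \<rho> f"
  using has_q_expansion_growth[OF assms, of "fls_subdegree F"] fls_eq0_below_subdegree by blast

text \<open>Periodicity makes \<open>f\<close> a function \<open>g\<close> of q on a punctured disc.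
  The growth bound says precisely that g(q) q^(-n) is bounded there, so its singularity at 0 is
  removable and its Taylor series gives the expansion.\<close>

lemma growth_imp_has_q_expansion:
  assumes per: "\<And>z. Im z > 0 \<Longrightarrow> eval_mero f (z + of_nat h) = eval_mero f z" and h: "h > 0"
    and gr: "growth_le (- 2 * pi * of_int n / of_nat h) f"
  shows "\<exists>F. has_q_expansion h f F \<and> (\<forall>k<n. fls_nth F k = 0)"
proof -
  define Q where "Q = (\<lambda>z. exp (2 * of_real pi * \<i> * z / of_nat h))"
  obtain C Y where CY: "C > 0" "\<And>z. Im z > Y \<Longrightarrow> Im z > 0" "eval_mero f analytic_on {z. Im z > Y}"
    "\<And>z. Im z > Y \<Longrightarrow> norm (eval_mero f z) \<le> C * exp (- 2 * pi * of_int n / of_nat h * Im z)" "Y > 0"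
    using gr by (rule growth_leE) blast
  define L where "L = (\<lambda>q. of_nat h / (2 * of_real pi * \<i>) * Ln q)"
  define g where "g = (\<lambda>q. eval_mero f (L q))"
  have QL: "Q (L q) = q" if "q \<noteq> 0" for q
    using that h by (simp add: Q_def L_def)
  have norm_Q: "norm (Q z) = exp (- 2 * pi * Im z / of_nat h)" for z
    by (simp add: Q_def Im_divide_of_nat)
  define r where "r = exp (- 2 * pi * Y / of_nat h)"
  have r: "r > 0"
    by (simp add: r_def)
  have less_r: "norm (Q z) < r \<longleftrightarrow> Im z > Y" for z
    using h by (simp add: norm_Q r_def field_simps)
  have per_nat: "eval_mero f (z + of_nat k * of_nat h) = eval_mero f z" if "Im z > 0" for z k
  proof (induction k)
    case (Suc k)
    have "eval_mero f (z + of_nat (Suc k) * of_nat h) = eval_mero f ((z + of_nat k * of_nat h) + of_nat h)"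
      by (simp add: algebra_simps)
    also have "\<dots> = eval_mero f (z + of_nat k * of_nat h)"
      by (rule per) (use that in simp)
    finally show ?case
      using Suc by simp
  qed auto
  have per_int: "eval_mero f (z + of_int k * of_nat h) = eval_mero f z" if "Im z > 0" for z k
    using per_nat[of z "nat k"] per_nat[of "z + of_int k * of_nat h" "nat (- k)"] that by (cases "k \<ge> 0") auto
  have same: "eval_mero f z = eval_mero f w" if "Q z = Q w" "Im z > 0" for z w
  proof -
    from that(1) obtain k :: int where "2 * of_real pi * \<i> * z / of_nat h = 2 * of_real pi * \<i> * w / of_nat h + of_int (2 * k) * of_real pi * \<i>"
      unfolding Q_def exp_eq by (auto simp: mult_ac)
    hence "(2 * of_real pi * \<i> / of_nat h) * z = (2 * of_real pi * \<i> / of_nat h) * (w + of_int k * of_nat h)"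
      using h by (simp add: ring_distribs add_divide_distrib mult_ac)
    hence "z = w + of_int k * of_nat h"
      using h by simp
    thus ?thesis
      using per_int[of w k] that(2) by simp
  qed
  have g_Q: "g (Q z) = eval_mero f z" if "Im z > Y" for z
  proof -
    have "Q (L (Q z)) = Q z"
      by (rule QL) (simp add: Q_def)
    moreover from this have "Im (L (Q z)) > Y"
      using that less_r by metis
    ultimately show ?thesis
      unfolding g_def using same[of "L (Q z)" z] CY(2) by auto
  qed
  have "g analytic_on {q0}" if q0: "q0 \<in> ball 0 r - {0}" for q0
  proof -
    \<comment> \<open>The principal logarithm in \<open>L\<close> jumps on the negative axis. Near
      \<open>q0\<close> the branch Ln(q / q0) + Ln q0 is analytic, and by periodicity it leads to
      the same function \<open>g\<close>.\<close>
    define L' where "L' = (\<lambda>q. of_nat h / (2 * of_real pi * \<i>) * (Ln (q / q0) + Ln q0))"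
    have QL': "Q (L' q) = q" if "q \<noteq> 0" for q
      using that q0 h by (simp add: Q_def L'_def exp_add)
    have L': "L' analytic_on {q0}"
      unfolding L'_def using q0 by (intro analytic_intros) auto
    have "Im (L' q0) > Y"
      using QL'[of q0] q0 less_r[of "L' q0"] by auto
    hence "eval_mero f analytic_on {L' q0}"
      by (intro analytic_on_subset[OF CY(3)]) auto
    with analytic_on_compose[OF L'] have an: "(\<lambda>q. eval_mero f (L' q)) analytic_on {q0}"
      by (simp add: o_def)
    show ?thesis
    proof (rule analytic_cong_uhp[OF _ _ q0 an])
      fix q :: complex assume q: "q \<in> ball 0 r - {0}"
      have "Q (L' q) = q"
        using q by (intro QL') auto
      moreover from this have "Im (L' q) > Y"
        using q less_r[of "L' q"] by auto
      ultimately show "g q = eval_mero f (L' q)"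
        using g_Q[of "L' q"] by simp
    qed auto
  qed
  hence g_hol: "g holomorphic_on ball 0 r - {0}"
    by (intro analytic_imp_holomorphic) (subst analytic_on_analytic_at, blast)
  have bound: "norm (g q * q powi (- n)) \<le> C" if q: "q \<in> ball 0 r - {0}" for q
  proof -
    define z where "z = L q"
    have Qz: "Q z = q"
      unfolding z_def by (rule QL) (use q in auto)
    hence z: "Im z > Y"
      using less_r[of z] q by auto
    have "norm (g q) = norm (eval_mero f z)"
      by (simp add: g_def z_def)
    also have "\<dots> \<le> C * exp (- 2 * pi * of_int n / of_nat h * Im z)"
      by (rule CY(4)[OF z])
    also have "exp (- 2 * pi * of_int n / of_nat h * Im z) = norm q powi n"
      unfolding Qz[symmetric] norm_Q exp_power_int by (simp add: algebra_simps)
    finally have "norm (g q) * norm q powi (- n) \<le> C * norm q powi n * norm q powi (- n)"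
      by (intro mult_right_mono) auto
    also have "\<dots> = C"
      using q by (simp add: power_int_minus)
    finally show ?thesis
      by (simp add: norm_mult norm_power_int)
  qed
  have "\<exists>G. G holomorphic_on ball 0 r \<and> (\<forall>q\<in>ball 0 r - {0}. G q = g q * q powi (- n))"
  proof (subst holomorphic_on_extend_bounded)
    show "(\<lambda>q. g q * q powi (- n)) holomorphic_on ball 0 r - {0}"
      by (intro holomorphic_intros g_hol) auto
    show "\<exists>B. \<forall>\<^sub>F q in at 0. norm (g q * q powi (- n)) \<le> B"
    proof (rule exI[of _ C])
      have "\<forall>\<^sub>F q in at 0. q \<in> ball 0 r - {0 :: complex}"
        by (rule eventually_at_in_open) (use r in auto)
      thus "\<forall>\<^sub>F q in at 0. norm (g q * q powi (- n)) \<le> C"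
        by eventually_elim (rule bound)
    qed
  qed (use r in auto)
  then obtain G where G: "G holomorphic_on ball 0 r" "\<And>q. q \<in> ball 0 r - {0} \<Longrightarrow> G q = g q * q powi (- n)"
    by blast
  define P where "P = fps_expansion G 0"
  have P: "G has_fps_expansion P"
    unfolding P_def using G(1) r by (intro has_fps_expansion_fps_expansion[of "ball 0 r"]) auto
  define F where "F = fls_shift (- n) (fps_to_fls P)"
  have "(\<lambda>q. G q * q powi n) has_laurent_expansion F"
    unfolding F_def by (intro laurent_expansion_intros has_laurent_expansion_fps[OF P])
  also have "?this \<longleftrightarrow> g has_laurent_expansion F"
  proof (rule has_laurent_expansion_cong)
    have "\<forall>\<^sub>F q in at 0. q \<in> ball 0 r - {0 :: complex}"
      by (rule eventually_at_in_open) (use r in auto)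
    thus "\<forall>\<^sub>F q in at 0. G q * q powi n = g q"
      by eventually_elim (auto simp: G(2) power_int_minus)
  qed auto
  finally have F: "fls_conv_radius F > 0" "eventually (\<lambda>q. eval_fls F q = g q) (at 0)"
    by (auto simp: has_laurent_expansion_def)
  have "eventually (\<lambda>z. eval_fls F (Q z) = g (Q z)) (filtercomap Im at_top)"
    using F(2) filterlim_q[OF h] unfolding Q_def filterlim_iff by blast
  moreover have "eventually (\<lambda>z. Im z > Y) (filtercomap Im at_top)"
    by (auto simp: eventually_filtercomap_at_top_dense)
  ultimately have "eventually (\<lambda>z. eval_mero f z = eval_fls F (Q z)) (filtercomap Im at_top)"
    by eventually_elim (simp add: g_Q)
  hence "has_q_expansion h f F"
    using F(1) by (simp add: has_q_expansion_def Q_def)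
  moreover have "fls_nth F k = 0" if "k < n" for k
    using that by (simp add: F_def)
  ultimately show ?thesis
    by blast
qed

text \<open>A single transfer from Laurent series at 0 to expansions at \<infinity>. It serves the
  ring operations and, with an operation that ignores its second argument, the inverse.\<close>

lemma has_q_expansion_imp_laurent:
  assumes "has_q_expansion h f F" "has_q_expansion h g G"
    and h: "h > 0" and op: "\<And>u v. (u has_laurent_expansion F) \<Longrightarrow> (v has_laurent_expansion G) \<Longrightarrow> (\<lambda>x. op (u x) (v x)) has_laurent_expansion H"
    and "\<forall>\<^sub>F z in filtercomap Im at_top. eval_mero k z = op (eval_mero f z) (eval_mero g z)"
  shows "has_q_expansion h k H"
proof -
  define Q where "Q = (\<lambda>z. exp (2 * of_real pi * \<i> * z / of_nat h))"
  have F: "fls_conv_radius F > 0" "eventually (\<lambda>z. eval_mero f z = eval_fls F (Q z)) (filtercomap Im at_top)"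
    and G: "fls_conv_radius G > 0" "eventually (\<lambda>z. eval_mero g z = eval_fls G (Q z)) (filtercomap Im at_top)"
    using assms(1,2) by (auto simp: has_q_expansion_def Q_def)
  have "(\<lambda>x. op (eval_fls F x) (eval_fls G x)) has_laurent_expansion H"
    by (intro op eval_fls_has_laurent_expansion F G)
  hence H: "fls_conv_radius H > 0" "eventually (\<lambda>q. eval_fls H q = op (eval_fls F q) (eval_fls G q)) (at 0)"
    by (auto simp: has_laurent_expansion_def)
  have "eventually (\<lambda>z. eval_fls H (Q z) = op (eval_fls F (Q z)) (eval_fls G (Q z))) (filtercomap Im at_top)"
    using H(2) filterlim_q[OF h] unfolding Q_def filterlim_iff by blast
  with F(2) G(2) assms(5) have "eventually (\<lambda>z. eval_mero k z = eval_fls H (Q z)) (filtercomap Im at_top)"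
    by eventually_elim simp
  thus ?thesis
    using H(1) by (simp add: has_q_expansion_def Q_def)
qed

lemma eventually_upper: "eventually (\<lambda>z. Im z > 0) (filtercomap Im at_top)"
  by (auto simp: eventually_filtercomap_at_top_dense)

lemma eventually_upper_nontriv: "filtercomap Im at_top \<noteq> bot"
proof
  assume "filtercomap Im at_top = bot"
  hence "eventually (\<lambda>_. False) (filtercomap Im at_top)"
    by simp
  then obtain N where "\<And>z. Im z > N \<Longrightarrow> False"
    unfolding eventually_filtercomap_at_top_dense by blast
  from this[of "Complex 0 (N + 1)"] show False
    by simp
qed

context
  fixes f g :: mero_uhp and F G :: "complex fls" and h :: nat
  assumes f: "has_q_expansion h f F" and g: "has_q_expansion h g G" and h: "h > 0"
begin

lemma has_q_expansion_plus: "has_q_expansion h (f + g) (F + G)"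
proof (rule has_q_expansion_imp_laurent[OF f g h])
  show "\<forall>\<^sub>F z in filtercomap Im at_top. eval_mero (f + g) z = eval_mero f z + eval_mero g z"
    using has_q_expansion_analytic[OF f h] has_q_expansion_analytic[OF g h] eventually_upper
    by eventually_elim (rule eval_plus_at)
qed (intro laurent_expansion_intros)

lemma has_q_expansion_minus: "has_q_expansion h (f - g) (F - G)"
proof (rule has_q_expansion_imp_laurent[OF f g h])
  show "\<forall>\<^sub>F z in filtercomap Im at_top. eval_mero (f - g) z = eval_mero f z - eval_mero g z"
    using has_q_expansion_analytic[OF f h] has_q_expansion_analytic[OF g h] eventually_upper
    by eventually_elim (rule eval_minus_at)
qed (intro laurent_expansion_intros)

lemma has_q_expansion_times: "has_q_expansion h (f * g) (F * G)"
proof (rule has_q_expansion_imp_laurent[OF f g h])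
  show "\<forall>\<^sub>F z in filtercomap Im at_top. eval_mero (f * g) z = eval_mero f z * eval_mero g z"
    using has_q_expansion_analytic[OF f h] has_q_expansion_analytic[OF g h] eventually_upper
    by eventually_elim (rule eval_times_at)
qed (intro laurent_expansion_intros)

end

lemma has_q_expansion_mconst: "has_q_expansion h (mconst c) (fls_const c)"
  unfolding has_q_expansion_def using eventually_upper by (auto elim!: eventually_mono simp: eval_mconst)

lemma has_q_expansion_unique:
  assumes "has_q_expansion h f F" "has_q_expansion h f G" "h > 0"
  shows "F = G"
proof -
  define Q where "Q = (\<lambda>z. exp (2 * of_real pi * \<i> * z / of_nat h))"
  have F: "fls_conv_radius F > 0" "eventually (\<lambda>z. eval_mero f z = eval_fls F (Q z)) (filtercomap Im at_top)"
    and G: "fls_conv_radius G > 0" "eventually (\<lambda>z. eval_mero f z = eval_fls G (Q z)) (filtercomap Im at_top)"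
    using assms(1,2) by (auto simp: has_q_expansion_def Q_def)
  from F(2) G(2) have "eventually (\<lambda>z. eval_fls F (Q z) = eval_fls G (Q z)) (filtercomap Im at_top)"
    by eventually_elim simp
  then obtain Y where Y: "\<And>z. Im z > Y \<Longrightarrow> eval_fls F (Q z) = eval_fls G (Q z)"
    unfolding eventually_filtercomap_at_top_dense by blast
  have "eventually (\<lambda>q. q \<in> ball 0 (exp (- 2 * pi * Y / of_nat h)) - {0 :: complex}) (at 0)"
    by (rule eventually_at_in_open) auto
  hence "eventually (\<lambda>q. eval_fls F q = eval_fls G q) (at 0)"
  proof eventually_elim
    case (elim q)
    define z where "z = of_nat h / (2 * of_real pi * \<i>) * Ln q"
    have Qz: "Q z = q"
      using elim assms(3) by (simp add: Q_def z_def)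
    have "norm (Q z) = exp (- 2 * pi * Im z / of_nat h)"
      by (simp add: Q_def Im_divide_of_nat)
    hence "exp (- 2 * pi * Im z / of_nat h) < exp (- 2 * pi * Y / of_nat h)"
      using elim Qz by auto
    hence "Im z > Y"
      using assms(3) by (simp add: field_simps)
    from Y[OF this] show ?case
      by (simp add: Qz)
  qed
  hence "eval_fls F has_laurent_expansion G"
    using G(1) by (auto simp: has_laurent_expansion_def eq_commute elim: eventually_mono)
  thus ?thesis
    using eval_fls_has_laurent_expansion[OF F(1)] by (rule has_laurent_expansion_unique[rotated])
qed

lemma eval_mero_eq_0_imp_eq_0:
  assumes "\<forall>\<^sub>F z in filtercomap Im at_top. eval_mero f z = 0"
  shows "f = 0"
proof (rule ccontr)
  assume "f \<noteq> 0"
  have "\<not>(\<forall>\<^sub>\<approx>z\<in>uhp. eval_mero f z = 0)"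
  proof
    assume "\<forall>\<^sub>\<approx>z\<in>uhp. eval_mero f z = 0"
    hence "\<forall>\<^sub>\<approx>z\<in>uhp. eval_mero f z = eval_mero 0 z"
      using eval_zero by eventually_elim simp
    hence "f = 0"
      by (rule mero_eqI)
    with \<open>f \<noteq> 0\<close> show False ..
  qed
  hence "\<forall>\<^sub>\<approx>z\<in>uhp. eval_mero f z \<noteq> 0"
    using meromorphic_imp_constant_or_avoid[OF eval_mero_meromorphic open_uhp connected_uhp, of f 0] by blast
  moreover obtain Y where Y: "\<And>z. Im z > Y \<Longrightarrow> eval_mero f z = 0"
    using assms unfolding eventually_filtercomap_at_top_dense by blast
  define w where "w = Complex 0 (max Y 0 + 1)"
  have w: "w \<in> uhp" "Im w > Y"
    by (auto simp: w_def)
  ultimately have "eventually (\<lambda>z. eval_mero f z \<noteq> 0) (at w)"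
    unfolding eventually_cosparse_open_eq[OF open_uhp] by blast
  moreover have "eventually (\<lambda>z. z \<in> {z. Im z > Y}) (at w)"
    by (rule eventually_at_in_open'[OF open_upper]) (use w in auto)
  ultimately have "eventually (\<lambda>_. False) (at w)"
    by eventually_elim (use Y in auto)
  thus False
    by simp
qed

lemma has_q_expansion_0_iff:
  assumes "has_q_expansion h f F" "h > 0"
  shows "f = 0 \<longleftrightarrow> F = 0"
proof
  assume "f = 0"
  thus "F = 0"
    using has_q_expansion_mconst[of h 0] assms by (auto dest: has_q_expansion_unique)
next
  assume "F = 0"
  with assms(1) show "f = 0"
    by (intro eval_mero_eq_0_imp_eq_0) (auto simp: has_q_expansion_def)
qed

lemma has_q_expansion_inverse:
  assumes f: "has_q_expansion h f F" and h: "h > 0"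
  shows "has_q_expansion h (inverse f) (inverse F)"
proof (cases "f = 0")
  case True
  thus ?thesis
    using has_q_expansion_0_iff[OF assms] f by simp
next
  case False
  define Q where "Q = (\<lambda>z. exp (2 * of_real pi * \<i> * z / of_nat h))"
  have F: "fls_conv_radius F > 0" "eventually (\<lambda>z. eval_mero f z = eval_fls F (Q z)) (filtercomap Im at_top)"
    using assms(1) by (auto simp: has_q_expansion_def Q_def)
  have "F \<noteq> 0"
    using has_q_expansion_0_iff[OF assms] False by simp
  hence "eventually (\<lambda>q. eval_fls F q \<noteq> 0) (at 0)"
    by (rule has_laurent_expansion_nonzero_imp_eventually_nonzero[OF eval_fls_has_laurent_expansion[OF F(1)]])
  hence nz: "eventually (\<lambda>z. eval_fls F (Q z) \<noteq> 0) (filtercomap Im at_top)"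
    using filterlim_q[OF h] unfolding Q_def filterlim_iff by blast
  show ?thesis
  proof (rule has_q_expansion_imp_laurent[OF f f h, of "\<lambda>a b. inverse a"])
    show "\<forall>\<^sub>F z in filtercomap Im at_top. eval_mero (inverse f) z = inverse (eval_mero f z)"
      using has_q_expansion_analytic[OF f h] nz F(2) eventually_upper
      by eventually_elim (rule eval_inverse_at, auto)
  qed (intro laurent_expansion_intros)
qed

section \<open>The modular group\<close>

lemma mat2_eqI:
  fixes A B :: "real^2^2"
  assumes "A $ 1 $ 1 = B $ 1 $ 1" "A $ 1 $ 2 = B $ 1 $ 2" "A $ 2 $ 1 = B $ 2 $ 1" "A $ 2 $ 2 = B $ 2 $ 2"
  shows "A = B"
  using assms by (simp add: vec_eq_iff forall_2)

lemma mat2_mult: "mat2 a b c d ** mat2 a' b' c' d' = mat2 (a * a' + b * c') (a * b' + b * d') (c * a' + d * c') (c * b' + d * d')"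
  by (rule mat2_eqI) (simp_all add: matrix_matrix_mult_def sum_2)

lemma SL2Z_E:
  assumes "M \<in> SL2Z"
  obtains a b c d :: int where "M = mat2 (of_int a) (of_int b) (of_int c) (of_int d)" "a * d - b * c = 1"
proof -
  have "\<And>i j. M $ i $ j \<in> \<int>" "det M = 1"
    using assms by (auto simp: SL2Z_def)
  then obtain a b c d where *: "M $ 1 $ 1 = of_int a" "M $ 1 $ 2 = of_int b" "M $ 2 $ 1 = of_int c" "M $ 2 $ 2 = of_int d"
    by (metis Ints_cases)
  have "M = mat2 (of_int a) (of_int b) (of_int c) (of_int d)"
    by (rule mat2_eqI) (simp_all add: *)
  moreover have "of_int (a * d - b * c) = (1 :: real)"
    using \<open>det M = 1\<close> by (simp add: det_2 *)
  hence "a * d - b * c = 1"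
    by (simp only: of_int_eq_1_iff)
  ultimately show ?thesis
    using that by blast
qed

lemma SL2Z_I:
  fixes a b c d :: int
  assumes "a * d - b * c = 1"
  shows "mat2 (of_int a) (of_int b) (of_int c) (of_int d) \<in> SL2Z"
proof -
  have "of_int (a * d - b * c) = (1 :: real)"
    using assms by simp
  thus ?thesis
    by (auto simp: SL2Z_def det_2 forall_2)
qed

lemma SL2Z_det: "M \<in> SL2Z \<Longrightarrow> det M = 1"
  by (auto simp: SL2Z_def)

lemma SL2Z_mult: "A \<in> SL2Z \<Longrightarrow> B \<in> SL2Z \<Longrightarrow> A ** B \<in> SL2Z"
  unfolding SL2Z_def mem_Collect_eq det_mul by (auto simp: matrix_matrix_mult_def sum_2)

lemma SL2Z_mat_1: "mat 1 \<in> SL2Z"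
  unfolding SL2Z_def mem_Collect_eq det_I by (auto simp: mat_def)

lemma pullback_mat_1: "pullback (mat 1) f = f"
proof (rule mero_eqI_uhp)
  fix z :: complex assume "Im z > 0"
  moreover have "moebius_map (mat 1) z = z"
    by (simp add: moebius_map_def mat_def)
  ultimately show "eval_mero (pullback (mat 1) f) z = eval_mero f z"
    by (simp add: eval_pullback det_I)
qed

lemma mat2_inverse:
  fixes a b c d :: real
  assumes "a * d - b * c = 1"
  shows "mat2 a b c d ** mat2 d (- b) (- c) a = mat 1" "mat2 d (- b) (- c) a ** mat2 a b c d = mat 1"
  using assms by (auto intro!: mat2_eqI simp: mat2_mult mat_def algebra_simps)

lemma SL2Z_inverse:
  assumes "A \<in> SL2Z"
  obtains B where "B \<in> SL2Z" "A ** B = mat 1" "B ** A = mat 1"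
proof -
  obtain a b c d :: int where A: "A = mat2 (of_int a) (of_int b) (of_int c) (of_int d)" "a * d - b * c = 1"
    using assms by (rule SL2Z_E)
  have "of_int (a * d - b * c) = (1 :: real)"
    using A by simp
  hence 1: "of_int a * of_int d - of_int b * of_int c = (1 :: real)"
    by simp
  have "mat2 (of_int d) (of_int (- b)) (of_int (- c)) (of_int a) \<in> SL2Z"
    by (rule SL2Z_I) (use A in \<open>simp add: algebra_simps\<close>)
  with mat2_inverse[OF 1] show ?thesis
    by (intro that[of "mat2 (of_int d) (of_int (- b)) (of_int (- c)) (of_int a)"]) (simp_all add: A)
qed

lemma Gamma0_I:
  fixes a b c d :: int
  assumes "a * d - b * (int N * c) = 1"
  shows "mat2 (of_int a) (of_int b) (of_int (int N * c)) (of_int d) \<in> Gamma0 N"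
  using SL2Z_I[OF assms] unfolding Gamma0_def by (auto intro!: exI[of _ c])

lemma Gamma0_E:
  assumes "M \<in> Gamma0 N"
  obtains a b c d :: int where "M = mat2 (of_int a) (of_int b) (of_int (int N * c)) (of_int d)" "a * d - b * (int N * c) = 1"
proof -
  from assms obtain k :: int where k: "M $ 2 $ 1 = of_nat N * of_int k" "M \<in> SL2Z"
    by (auto simp: Gamma0_def)
  obtain a b c d :: int where M: "M = mat2 (of_int a) (of_int b) (of_int c) (of_int d)" "a * d - b * c = 1"
    using k(2) by (rule SL2Z_E)
  have "real_of_int c = of_int (int N * k)"
    using k(1) M(1) by simp
  hence "c = int N * k"
    by (simp only: of_int_eq_iff)
  thus ?thesis
    using that[of a b k d] M by simp
qed

lemma Gamma0_SL2Z: "M \<in> Gamma0 N \<Longrightarrow> M \<in> SL2Z"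
  by (simp add: Gamma0_def)

lemma pullback_mult_SL2Z: "A \<in> SL2Z \<Longrightarrow> B \<in> SL2Z \<Longrightarrow> pullback (A ** B) f = pullback B (pullback A f)"
  by (rule pullback_mult) (simp_all add: SL2Z_det)

text \<open>\<open>A\<close> and \<open>B\<close> agree modulo \<open>N\<close>, so that \<open>B A\<^sup>-\<^sup>1\<close> lies in \<open>\<Gamma>\<^sub>0(N)\<close>.\<close>

lemma pullback_cong_mod:
  fixes a b c d a' b' c' d' :: int
  assumes inv: "\<forall>M\<in>Gamma0 N. pullback M f = f"
    and A: "a * d - b * c = 1" and B: "a' * d' - b' * c' = 1"
    and cong: "c mod int N = c' mod int N" "d mod int N = d' mod int N"
  shows "pullback (mat2 (of_int a) (of_int b) (of_int c) (of_int d)) f = pullback (mat2 (of_int a') (of_int b') (of_int c') (of_int d')) f"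
proof -
  define A B where "A = mat2 (of_int a) (of_int b) (of_int c) (of_int d)" and "B = mat2 (of_int a') (of_int b') (of_int c') (of_int d')"
  define G where "G = mat2 (of_int (a' * d - b' * c)) (of_int (b' * a - a' * b)) (of_int (c' * d - d' * c)) (of_int (d' * a - c' * b))"
  have "(c' * d) mod int N = (c * d') mod int N"
    using cong by (intro mod_mult_cong) auto
  hence "int N dvd c' * d - c * d'"
    by (simp only: mod_eq_dvd_iff)
  then obtain k where "c' * d - c * d' = int N * k"
    by (elim dvdE)
  hence k: "c' * d - d' * c = int N * k"
    by (simp add: mult.commute)
  have det: "(a' * d - b' * c) * (d' * a - c' * b) - (b' * a - a' * b) * (c' * d - d' * c) = 1"
  proof -
    have "(a' * d - b' * c) * (d' * a - c' * b) - (b' * a - a' * b) * (c' * d - d' * c) = (a * d - b * c) * (a' * d' - b' * c')"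
      by (simp add: algebra_simps)
    thus ?thesis
      using A B by simp
  qed
  have G: "G \<in> Gamma0 N"
    using Gamma0_I[of "a' * d - b' * c" "d' * a - c' * b" "b' * a - a' * b" N k] det unfolding G_def k by simp
  have "G ** A = B"
  proof -
    have e: "(a' * d - b' * c) * a + (b' * a - a' * b) * c = a' * (a * d - b * c)"
      "(a' * d - b' * c) * b + (b' * a - a' * b) * d = b' * (a * d - b * c)"
      "(c' * d - d' * c) * a + (d' * a - c' * b) * c = c' * (a * d - b * c)"
      "(c' * d - d' * c) * b + (d' * a - c' * b) * d = d' * (a * d - b * c)"
      by (simp_all add: algebra_simps)
    show ?thesis
      unfolding G_def A_def B_def mat2_mult of_int_mult[symmetric] of_int_add[symmetric] e A by simp
  qed
  moreover have "A \<in> SL2Z" "G \<in> SL2Z"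
    using SL2Z_I[OF A] Gamma0_SL2Z[OF G] by (simp_all add: A_def)
  ultimately have "pullback B f = pullback A (pullback G f)"
    using pullback_mult_SL2Z by metis
  thus ?thesis
    using inv G by (simp add: A_def B_def)
qed

definition translates :: "mero_uhp \<Rightarrow> mero_uhp set"
  where "translates f = (\<lambda>M. pullback M f) ` SL2Z"

text \<open>By \<open>pullback_cong_mod\<close> a translate depends only on the lower row of the
  matrix modulo N, and \<open>h\<close> selects the translate that belongs to a pair of
  residues.\<close>

lemma finite_translates:
  assumes inv: "\<forall>M\<in>Gamma0 N. pullback M f = f" and "N > 0"
  shows "finite (translates f)"
proof -
  define P where "P = (\<lambda>(u, v) g. \<exists>a b c d :: int. a * d - b * c = 1 \<and> c mod int N = u \<and> d mod int N = v \<and>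
     g = pullback (mat2 (of_int a) (of_int b) (of_int c) (of_int d)) f)"
  define h where "h = (\<lambda>p. SOME g. P p g)"
  have "translates f \<subseteq> h ` ({0..<int N} \<times> {0..<int N})"
  proof
    fix g assume "g \<in> translates f"
    then obtain M where M: "M \<in> SL2Z" "g = pullback M f"
      by (auto simp: translates_def)
    obtain a b c d :: int where abcd: "M = mat2 (of_int a) (of_int b) (of_int c) (of_int d)" "a * d - b * c = 1"
      using M(1) by (rule SL2Z_E)
    have P: "P (c mod int N, d mod int N) g"
      unfolding P_def using abcd M(2) by auto
    have "P (c mod int N, d mod int N) (h (c mod int N, d mod int N))"
      unfolding h_def by (rule someI[of "P (c mod int N, d mod int N)", OF P])
    hence "h (c mod int N, d mod int N) = g"
      unfolding P_def M(2) abcd(1) using pullback_cong_mod[OF inv _ abcd(2)] by auto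
    moreover have "(c mod int N, d mod int N) \<in> {0..<int N} \<times> {0..<int N}"
      using assms(2) by auto
    ultimately show "g \<in> h ` ({0..<int N} \<times> {0..<int N})"
      by (metis imageI)
  qed
  thus ?thesis
    by (rule finite_subset) auto
qed

lemma translates_self: "f \<in> translates f"
  unfolding translates_def using SL2Z_mat_1 pullback_mat_1 by (metis imageI)

lemma translates_pullback:
  assumes "M \<in> SL2Z"
  shows "pullback M ` translates f = translates f" "inj_on (pullback M) (translates f)"
proof -
  obtain B where B: "B \<in> SL2Z" "M ** B = mat 1" "B ** M = mat 1"
    using assms by (rule SL2Z_inverse)
  have sub: "pullback A ` translates f \<subseteq> translates f" if "A \<in> SL2Z" for A
    unfolding translates_def using pullback_mult_SL2Z[OF _ that] SL2Z_mult[OF _ that] by (auto simp: image_iff) metis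
  have inv: "pullback M (pullback B g) = g" "pullback B (pullback M g) = g" for g
    using pullback_mult_SL2Z[OF B(1) assms] pullback_mult_SL2Z[OF assms B(1)] B pullback_mat_1 by metis+
  show "pullback M ` translates f = translates f"
  proof
    show "translates f \<subseteq> pullback M ` translates f"
      using sub[OF B(1)] inv(1) by (metis image_eqI image_subset_iff subsetI)
  qed (rule sub[OF assms])
  show "inj_on (pullback M) (translates f)"
    using inv(2) by (metis inj_onI)
qed

text \<open>
  Among the finitely many coprime \<open>(c, d)\<close> with \<open>\<bar>c z + d\<bar> \<le> 1\<close>, choose one that minimises
  \<open>\<bar>c z + d\<bar>\<close>.
\<close>

lemma SL2Z_reduce:
  assumes z: "Im z > 0"
  obtains M where "M \<in> SL2Z" "Im (moebius_map M z) \<ge> 1 / 2" "\<bar>Re (moebius_map M z)\<bar> \<le> 1 / 2"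
proof -
  define S where "S = {(c, d). coprime c d \<and> norm (of_int c * z + of_int d) \<le> 1}"
  define B where "B = \<lceil>1 / Im z\<rceil>"
  define D where "D = \<lceil>1 + of_int B * \<bar>Re z\<bar>\<rceil>"
  have "S \<subseteq> {-B..B} \<times> {-D..D}"
  proof clarify
    fix c d assume "(c, d) \<in> S"
    hence n: "norm (of_int c * z + of_int d) \<le> 1"
      by (simp add: S_def)
    have "\<bar>of_int c * Im z\<bar> \<le> 1"
      using abs_Im_le_cmod[of "of_int c * z + of_int d"] n by simp
    hence "\<bar>of_int c\<bar> \<le> 1 / Im z"
      using z by (simp add: abs_mult field_simps)
    also have "\<dots> \<le> of_int B"
      by (simp add: B_def)
    finally have cB: "\<bar>c\<bar> \<le> B"
      by (metis of_int_abs of_int_le_iff)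
    have "\<bar>of_int c * Re z + of_int d\<bar> \<le> 1"
      using abs_Re_le_cmod[of "of_int c * z + of_int d"] n by simp
    hence "\<bar>of_int d\<bar> \<le> 1 + \<bar>of_int c\<bar> * \<bar>Re z\<bar>"
      unfolding abs_mult[symmetric] by linarith
    also have "\<dots> \<le> 1 + of_int B * \<bar>Re z\<bar>"
      using cB by (intro add_left_mono mult_right_mono) (auto simp flip: of_int_abs)
    also have "\<dots> \<le> of_int D"
      by (simp add: D_def)
    finally have "\<bar>d\<bar> \<le> D"
      by (metis of_int_abs of_int_le_iff)
    with cB show "c \<in> {-B..B} \<and> d \<in> {-D..D}"
      by auto
  qed
  hence fin: "finite S"
    by (rule finite_subset) auto
  have ne: "(0, 1) \<in> S"
    by (simp add: S_def)
  define p where "p = arg_min_on (\<lambda>(c, d). norm (of_int c * z + of_int d)) S"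
  obtain c d where p: "p = (c, d)"
    by force
  have "p \<in> S"
    unfolding p_def using fin ne by (intro arg_min_if_finite) auto
  hence cd: "coprime c d" "norm (of_int c * z + of_int d) \<le> 1"
    by (auto simp: S_def p)
  have min: "norm (of_int c * z + of_int d) \<le> norm (of_int c' * z + of_int d')" if "coprime c' d'" for c' d'
  proof (cases "norm (of_int c' * z + of_int d') \<le> 1")
    case True
    hence "(c', d') \<in> S"
      using that by (simp add: S_def)
    from arg_min_least[OF fin _ this, of "\<lambda>(c, d). norm (of_int c * z + of_int d)"] ne show ?thesis
      unfolding p_def[symmetric] p by auto
  qed (use cd(2) in linarith)
  obtain a b where ab: "a * d - b * c = 1"
    using cd(1) bezout_int[of d c] by (metis coprime_commute coprime_iff_gcd_eq_1 diff_minus_eq_add minus_mult_left)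
  define j where "j = of_int c * z + of_int d"
  define w where "w = (of_int a * z + of_int b) / j"
  have j: "j \<noteq> 0" and w: "Im w > 0"
    using moebius_int[OF z ab] by (simp_all add: j_def w_def)
  define n where "n = - round (Re w)"
  have det: "(a + n * c) * d - (b + n * d) * c = 1"
    using ab by (simp add: algebra_simps)
  define M where "M = mat2 (of_int (a + n * c)) (of_int (b + n * d)) (of_int c) (of_int d)"
  have Mz: "moebius_map M z = w + of_int n"
  proof -
    have "moebius_map M z = (of_int a * z + of_int b + of_int n * j) / j"
      by (simp add: moebius_map_def M_def j_def algebra_simps)
    thus ?thesis
      using j by (simp add: w_def add_divide_distrib)
  qed
  have "coprime (a + n * c) (b + n * d)"
  proof (rule coprimeI)
    fix x assume "x dvd a + n * c" "x dvd b + n * d"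
    hence "x dvd (a + n * c) * d - (b + n * d) * c"
      by simp
    thus "is_unit x"
      unfolding det by simp
  qed
  \<comment> \<open>Minimality of \<open>j\<close> is tested against the top row of
    \<open>M\<close>, which is again a coprime pair. The outcome is the inequality |M z| \<ge> 1 of
    the classical fundamental domain.\<close>
  hence "norm j \<le> norm (of_int (a + n * c) * z + of_int (b + n * d))"
    unfolding j_def by (rule min)
  also have "of_int (a + n * c) * z + of_int (b + n * d) = moebius_map M z * j"
    using j unfolding Mz w_def by (simp add: field_simps) (simp add: j_def algebra_simps)
  finally have "1 \<le> norm (moebius_map M z)"
    using j by (simp add: norm_mult)
  hence "1 \<le> norm (moebius_map M z) ^ 2"
    by simp
  hence le: "1 \<le> Re (moebius_map M z) ^ 2 + Im (moebius_map M z) ^ 2"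
    by (simp add: cmod_power2)
  have re: "\<bar>Re (moebius_map M z)\<bar> \<le> 1 / 2"
    using of_int_round_abs_le[of "Re w"] by (simp add: Mz n_def abs_minus_commute)
  hence "Re (moebius_map M z) ^ 2 \<le> (1 / 2) ^ 2"
    by (metis abs_ge_zero power2_abs power_mono)
  with le have "(1 / 2) ^ 2 \<le> Im (moebius_map M z) ^ 2"
    by (simp add: power2_eq_square)
  moreover have "Im (moebius_map M z) > 0"
    using w by (simp add: Mz)
  ultimately have "Im (moebius_map M z) \<ge> 1 / 2"
    by (intro power2_le_imp_le[of "1/2"]) auto
  moreover have "M \<in> SL2Z"
    unfolding M_def by (rule SL2Z_I[OF det])
  ultimately show ?thesis
    using re that by blast
qed

text \<open>
  The product over all translates has an \<open>SL\<^sub>2(\<int>)\<close>-invariant absolute value, which tends to 0 at infinity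
  and therefore has a maximum.
\<close>

lemma vanishing_at_infinity_imp_eq_0:
  assumes inv: "\<forall>M\<in>Gamma0 N. pullback M f = f" and N: "N > 0"
    and hol: "eval_mero f analytic_on uhp"
    and bdd: "\<And>M. M \<in> SL2Z \<Longrightarrow> growth_le 0 (pullback M f)"
    and van: "\<rho> < 0" "growth_le \<rho> f"
  shows "f = 0"
proof (rule ccontr)
  assume f0: "f \<noteq> 0"
  define S where "S = translates f"
  have fin: "finite S"
    unfolding S_def by (rule finite_translates[OF inv N])
  have S0: "0 \<notin> S"
    using f0 by (auto simp: S_def translates_def pullback_eq_0_iff SL2Z_det)
  have S_an: "eval_mero g analytic_on uhp" if g: "g \<in> S" for g
  proof -
    obtain M where M: "M \<in> SL2Z" "g = pullback M f"
      using g unfolding S_def translates_def by blast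
    have d: "det M > 0"
      using M by (simp add: SL2Z_det)
    show ?thesis
      unfolding M(2)
      by (subst analytic_on_analytic_at)
         (auto intro!: pullback_analytic[OF d] analytic_on_subset[OF hol] simp: moebius_in_uhp[OF d, simplified])
  qed
  define p where "p = (\<lambda>z. \<Prod>g\<in>S. eval_mero g z)"
  have p_hol: "p holomorphic_on uhp"
    unfolding p_def by (intro holomorphic_intros analytic_imp_holomorphic S_an)
  have p_inv: "p (moebius_map M z) = p z" if "M \<in> SL2Z" "Im z > 0" for M z
  proof -
    have "p z = (\<Prod>g\<in>pullback M ` S. eval_mero g z)"
      unfolding p_def S_def translates_pullback(1)[OF that(1)] ..
    also have "\<dots> = (\<Prod>g\<in>S. eval_mero (pullback M g) z)"
      unfolding S_def by (subst prod.reindex[OF translates_pullback(2)[OF that(1)]]) simp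
    also have "\<dots> = p (moebius_map M z)"
      unfolding p_def by (intro prod.cong) (use that in \<open>auto simp: eval_pullback SL2Z_det\<close>)
    finally show ?thesis ..
  qed
  have p_lim: "(p \<longlongrightarrow> 0) (filtercomap Im at_top)"
  proof -
    have "(eval_mero f \<longlongrightarrow> 0) (filtercomap Im at_top)"
    proof -
      obtain C Y where CY: "C > 0" "\<And>z. Im z > Y \<Longrightarrow> norm (eval_mero f z) \<le> C * exp (\<rho> * Im z)"
        using van(2) by (rule growth_leE) blast
      have "((\<lambda>x. C * exp (\<rho> * x)) \<longlongrightarrow> 0) at_top"
        using van(1) by real_asymp
      hence "((\<lambda>z. C * exp (\<rho> * Im z)) \<longlongrightarrow> 0) (filtercomap Im at_top)"
        by (rule filterlim_compose) (rule filterlim_filtercomap)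
      moreover have "eventually (\<lambda>z. norm (eval_mero f z) \<le> C * exp (\<rho> * Im z)) (filtercomap Im at_top)"
        using CY(2) by (auto simp: eventually_filtercomap_at_top_dense)
      ultimately show ?thesis
        by (rule Lim_null_comparison[rotated])
    qed
    moreover have "Bfun (\<lambda>z. \<Prod>g\<in>S - {f}. eval_mero g z) (filtercomap Im at_top)"
    proof -
      have "Bfun (\<lambda>z. \<Prod>g\<in>T. eval_mero g z) (filtercomap Im at_top)" if "T \<subseteq> S" "finite T" for T
        using that(2,1)
      proof (induction T rule: finite_induct)
        case empty
        show ?case
          by (auto intro: Bfun_const)
      next
        case (insert g T)
        obtain M where M: "M \<in> SL2Z" "g = pullback M f"
        proof -
          have "g \<in> S"
            using insert.prems by simp
          then obtain M where "M \<in> SL2Z" "g = pullback M f"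
            unfolding S_def translates_def by blast
          thus ?thesis
            by (rule that)
        qed
        obtain C Y where CY: "\<And>z. Im z > Y \<Longrightarrow> norm (eval_mero g z) \<le> C * exp (0 * Im z)"
          using bdd[OF M(1)] unfolding M(2) by (rule growth_leE) blast
        have "Bfun (eval_mero g) (filtercomap Im at_top)"
          by (rule BfunI[of _ C]) (use CY in \<open>auto simp: eventually_filtercomap_at_top_dense\<close>)
        moreover have "Bfun (\<lambda>z. \<Prod>g\<in>T. eval_mero g z) (filtercomap Im at_top)"
          using insert by auto
        ultimately obtain K1 K2 where K: "eventually (\<lambda>z. norm (eval_mero g z) \<le> K1) (filtercomap Im at_top)"
          "eventually (\<lambda>z. norm (\<Prod>g\<in>T. eval_mero g z) \<le> K2) (filtercomap Im at_top)" "K1 > 0" "K2 > 0"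
          by (elim BfunE) auto
        show ?case
        proof (rule BfunI[of _ "K1 * K2"])
          show "eventually (\<lambda>z. norm (\<Prod>g\<in>insert g T. eval_mero g z) \<le> K1 * K2) (filtercomap Im at_top)"
            using K(1,2) by eventually_elim (use insert K(3,4) in \<open>auto simp: norm_mult intro!: mult_mono\<close>)
        qed
      qed
      thus ?thesis
        using fin by blast
    qed
    ultimately have "((\<lambda>z. eval_mero f z * (\<Prod>g\<in>S - {f}. eval_mero g z)) \<longlongrightarrow> 0) (filtercomap Im at_top)"
      unfolding tendsto_Zfun_iff diff_zero by (rule bounded_bilinear.Zfun_prod_Bfun[OF bounded_bilinear_mult])
    moreover have "p = (\<lambda>z. eval_mero f z * (\<Prod>g\<in>S - {f}. eval_mero g z))"
      unfolding p_def using fin translates_self[of f] by (auto simp: S_def prod.remove fun_eq_iff)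
    ultimately show ?thesis
      by simp
  qed
  have "\<exists>z1\<in>uhp. p z1 \<noteq> 0"
  proof -
    have "\<forall>\<^sub>\<approx>z\<in>uhp. eval_mero g z \<noteq> 0" if "g \<in> S" for g
    proof (rule ccontr)
      assume "\<not> (\<forall>\<^sub>\<approx>z\<in>uhp. eval_mero g z \<noteq> 0)"
      hence "\<forall>\<^sub>\<approx>z\<in>uhp. eval_mero g z = 0"
        using meromorphic_imp_constant_or_avoid[OF eval_mero_meromorphic open_uhp connected_uhp, of g 0] by blast
      hence "\<forall>\<^sub>\<approx>z\<in>uhp. eval_mero g z = eval_mero 0 z"
        using eval_zero by eventually_elim simp
      hence "g = 0"
        by (rule mero_eqI)
      with S0 that show False
        by simp
    qed
    hence "\<forall>\<^sub>\<approx>z\<in>uhp. \<forall>g\<in>S. eval_mero g z \<noteq> 0"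
      using fin by (subst eventually_ball_finite_distrib) auto
    hence "\<forall>\<^sub>\<approx>z\<in>uhp. p z \<noteq> 0"
      by eventually_elim (use fin in \<open>auto simp: p_def\<close>)
    hence "eventually (\<lambda>z. p z \<noteq> 0) (at \<i>)"
      unfolding eventually_cosparse_open_eq[OF open_uhp] by simp
    moreover have "eventually (\<lambda>z. z \<in> uhp) (at \<i>)"
      by (rule eventually_at_in_open'[OF open_uhp]) simp
    ultimately have "eventually (\<lambda>z. p z \<noteq> 0 \<and> z \<in> uhp) (at \<i>)"
      by eventually_elim auto
    from eventually_happens[OF this] show ?thesis
      by auto
  qed
  then obtain z1 where z1: "Im z1 > 0" "p z1 \<noteq> 0"
    by auto
  have "eventually (\<lambda>z. norm (p z) < norm (p z1)) (filtercomap Im at_top)"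
    using order_tendstoD(2)[OF tendsto_norm[OF p_lim], of "norm (p z1)"] z1 by simp
  then obtain Y where Y: "\<And>z. Im z > Y \<Longrightarrow> norm (p z) < norm (p z1)"
    unfolding eventually_filtercomap_at_top_dense by blast
  \<comment> \<open>Above height \<open>Y\<close> the modulus stays below |p(z1)|, so the supremum
    can be sought in this compact box. The height is at least 1 so that the box contains i.\<close>
  define R where "R = cbox (Complex (- 1 / 2) (1 / 2)) (Complex (1 / 2) (max Y 1))"
  have R: "z \<in> R \<longleftrightarrow> \<bar>Re z\<bar> \<le> 1 / 2 \<and> 1 / 2 \<le> Im z \<and> Im z \<le> max Y 1" for z
    by (auto simp: R_def in_cbox_complex_iff)
  have R_uhp: "R \<subseteq> uhp"
    by (auto simp: R)
  have "\<exists>z0\<in>R. \<forall>z\<in>R. norm (p z) \<le> norm (p z0)"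
  proof (rule continuous_attains_sup)
    show "compact R"
      by (simp add: R_def)
    show "R \<noteq> {}"
      using R[of \<i>] by auto
    show "continuous_on R (\<lambda>z. norm (p z))"
      by (intro continuous_on_norm holomorphic_on_imp_continuous_on holomorphic_on_subset[OF p_hol R_uhp])
  qed
  then obtain z0 where z0: "z0 \<in> R" "\<And>z. z \<in> R \<Longrightarrow> norm (p z) \<le> norm (p z0)"
    by blast
  have red: "norm (p z) \<le> norm (p z0) \<or> norm (p z) < norm (p z1)" if z: "Im z > 0" for z
  proof -
    obtain M where M: "M \<in> SL2Z" "Im (moebius_map M z) \<ge> 1 / 2" "\<bar>Re (moebius_map M z)\<bar> \<le> 1 / 2"
      using SL2Z_reduce[OF z] by blast
    have "p z = p (moebius_map M z)"
      using p_inv[OF M(1) z] by simp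
    thus ?thesis
      using z0(2)[of "moebius_map M z"] Y[of "moebius_map M z"] M by (cases "Im (moebius_map M z) > Y") (auto simp: R)
  qed
  \<comment> \<open>Applied to \<open>z1\<close> itself, \<open>red\<close> leaves only its first
    alternative, so |p(z1)| \<le> |p(z0)| and the second alternative is subsumed for every other
    point.\<close>
  have max: "norm (p z) \<le> norm (p z0)" if "z \<in> uhp" for z
    using red[of z] red[of z1] z1 that by auto
  have "p constant_on uhp"
    by (rule maximum_modulus_principle[OF p_hol open_uhp connected_uhp open_uhp order_refl, of z0])
       (use z0(1) R_uhp max in auto)
  then obtain c where c: "\<And>z. z \<in> uhp \<Longrightarrow> p z = c"
    by (auto simp: constant_on_def)
  have "((\<lambda>_. c) \<longlongrightarrow> 0) (filtercomap Im at_top)"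
    by (rule Lim_transform_eventually[OF p_lim]) (use eventually_upper in eventually_elim, use c in auto)
  hence "c = 0"
    using tendsto_const_iff[OF eventually_upper_nontriv] by metis
  with c[of z1] z1 show False
    by simp
qed

section \<open>The function field of \<open>X\<^sub>0(60)\<close> over \<open>\<complex>\<close>\<close>

lemma pullback_moebius_cong:
  assumes "det M > 0" "det M' > 0" "\<And>z. Im z > 0 \<Longrightarrow> moebius_map M z = moebius_map M' z"
  shows "pullback M f = pullback M' f"
  by (rule mero_eqI_uhp) (simp add: eval_pullback assms)

lemma moebius_mat2: "moebius_map (mat2 a b c d) z = (of_real a * z + of_real b) / (of_real c * z + of_real d)"
  by (simp add: moebius_map_def)

lemma det_mat2: "det (mat2 a b c d) = a * d - b * c"
  by (simp add: det_2)

text \<open>The triangular reduction already used for eta, now for pullbacks. It shows that the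
  matrix of \<open>w\<close> followed by a move to a cusp amounts to a move to some cusp followed by
  an affine map, so growth at cusps is preserved by \<open>w\<close>.\<close>

lemma integer_matrix_decomp:
  fixes p q r s :: int
  assumes "p * s - q * r > 0"
  obtains M \<alpha> \<beta> where "M \<in> SL2Z" "\<alpha> > 0"
    "\<And>f. pullback (mat2 (of_int p) (of_int q) (of_int r) (of_int s)) f = pullback (mat2 \<alpha> \<beta> 0 1) (pullback M f)"
proof -
  define g where "g = gcd p r"
  have g: "g > 0"
    using assms by (auto simp: g_def gcd_pos_int)
  obtain p' where p': "p = g * p'"
    unfolding g_def by (metis dvdE gcd_dvd1)
  obtain r' where r': "r = g * r'"
    unfolding g_def by (metis dvdE gcd_dvd2)
  have "coprime p' r'"
  proof -
    have "g * gcd p' r' = g"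
      using gcd_mult_distrib_int[of g p' r'] g unfolding p'[symmetric] r'[symmetric] by (simp add: g_def)
    thus ?thesis
      using g by (simp add: coprime_iff_gcd_eq_1)
  qed
  then obtain t s'' where "p' * t + r' * s'' = 1"
    by (metis bezout_int coprime_iff_gcd_eq_1 mult.commute)
  then obtain s' where st: "p' * t - s' * r' = 1"
    using that by (metis diff_minus_eq_add minus_mult_left mult.commute)
  define \<beta> where "\<beta> = t * q - s' * s"
  define D where "D = p' * s - r' * q"
  have gD: "g * D > 0"
    using assms by (simp add: D_def p' r' algebra_simps)
  hence D: "D > 0"
    using g by (simp add: zero_less_mult_iff)
  have e1: "p' * \<beta> + s' * D = q" and e2: "r' * \<beta> + t * D = s"
  proof -
    have "p' * \<beta> + s' * D = (p' * t - s' * r') * q" "r' * \<beta> + t * D = (p' * t - s' * r') * s"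
      by (simp_all add: \<beta>_def D_def algebra_simps)
    thus "p' * \<beta> + s' * D = q" "r' * \<beta> + t * D = s"
      by (simp_all add: st)
  qed
  define M where "M = mat2 (of_int p') (of_int s') (of_int r') (of_int t)"
  define U where "U = mat2 (of_int g / of_int D) (of_int \<beta> / of_int D) 0 1"
  define V where "V = mat2 (of_int g) (of_int \<beta>) 0 (of_int D)"
  have M: "M \<in> SL2Z"
    unfolding M_def by (rule SL2Z_I[OF st])
  have MV: "M ** V = mat2 (of_int p) (of_int q) (of_int r) (of_int s)"
    unfolding M_def V_def mat2_mult of_int_mult[symmetric] of_int_add[symmetric] e1 e2 by (simp add: p' r' mult.commute)
  have dets: "det M > 0" "det V > 0" "det U > 0"
    using M g D by (simp_all add: SL2Z_det V_def U_def det_mat2)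
  show ?thesis
  proof (rule that[OF M, of "of_int g / of_int D" "of_int \<beta> / of_int D"])
    fix f
    have "pullback (mat2 (of_int p) (of_int q) (of_int r) (of_int s)) f = pullback V (pullback M f)"
      unfolding MV[symmetric] by (rule pullback_mult[OF dets(1,2)])
    also have "\<dots> = pullback U (pullback M f)"
      by (rule pullback_moebius_cong[OF dets(2,3)]) (use D in \<open>simp add: V_def U_def moebius_mat2 add_divide_distrib\<close>)
    finally show "pullback (mat2 (of_int p) (of_int q) (of_int r) (of_int s)) f = pullback (mat2 (of_int g / of_int D) (of_int \<beta> / of_int D) 0 1) (pullback M f)"
      by (simp add: U_def)
  qed (use g D in auto)
qed

lemma growth_le_pullback_affine:
  assumes "growth_le \<rho> f" "\<alpha> > 0"
  shows "growth_le (\<rho> * \<alpha>) (pullback (mat2 \<alpha> \<beta> 0 1) f)"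
  by (rule growth_le_affine[OF assms(1,2), of _ \<beta>]) (use assms in \<open>auto simp: det_mat2 moebius_mat2\<close>)

abbreviation K60 :: "mero_uhp set" where "K60 \<equiv> complex_function_field_X0 60"

lemma eval_translate_periodic:
  assumes inv: "\<forall>M\<in>Gamma0 60. pullback M f = f" and M: "M \<in> SL2Z" and z: "Im z > 0"
  shows "eval_mero (pullback M f) (z + 60) = eval_mero (pullback M f) z"
proof -
  obtain a b c d :: int where abcd: "M = mat2 (of_int a) (of_int b) (of_int c) (of_int d)" "a * d - b * c = 1"
    using M by (rule SL2Z_E)
  define T where "T = mat2 (of_int 1) (of_int 60) (of_int 0) (of_int 1)"
  have T: "T \<in> SL2Z"
    unfolding T_def by (rule SL2Z_I) simp
  have "M ** T = mat2 (of_int a) (of_int (60 * a + b)) (of_int c) (of_int (d + c * 60))"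
    unfolding abcd T_def mat2_mult by (rule mat2_eqI) simp_all
  moreover have "pullback (mat2 (of_int a) (of_int (60 * a + b)) (of_int c) (of_int (d + c * 60))) f = pullback M f"
    unfolding abcd(1) by (rule pullback_cong_mod[OF inv]) (use abcd(2) in \<open>simp_all add: algebra_simps\<close>)
  ultimately have "pullback T (pullback M f) = pullback M f"
    using pullback_mult_SL2Z[OF M T] by metis
  moreover have "moebius_map T z = z + 60"
    by (simp add: T_def moebius_map_def)
  ultimately show ?thesis
    using eval_pullback[of T z "pullback M f"] z SL2Z_det[OF T] by simp
qed

text \<open>The k-th power of exp(2 \<pi> i z / 60) has modulus exp(-2 \<pi> k Im z / 60), so \<rho>
  corresponds to the exponent -30 \<rho> / \<pi>. When this is not an integer, rounding down leaves
  one coefficient open; if it were not 0, it would be the leading one and violate the bound as Im z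
  grows.\<close>

lemma growth_imp_expansion_60:
  assumes inv: "\<forall>M\<in>Gamma0 60. pullback M f = f" and M: "M \<in> SL2Z" and gr: "growth_le \<rho> (pullback M f)"
  shows "\<exists>F. has_q_expansion 60 (pullback M f) F \<and> (\<forall>k. of_int k < - (30 * \<rho> / pi) \<longrightarrow> fls_nth F k = 0)"
proof -
  define n where "n = \<lceil>- (30 * \<rho> / pi)\<rceil>"
  define m where "m = \<lfloor>- (30 * \<rho> / pi)\<rfloor>"
  have "real_of_int m \<le> - (30 * \<rho> / pi)"
    by (simp add: m_def)
  hence "\<rho> \<le> - 2 * pi * of_int m / of_nat 60"
    using pi_gt_zero by (simp add: field_simps)
  hence gr': "growth_le (- 2 * pi * of_int m / of_nat 60) (pullback M f)"
    by (rule growth_le_mono[OF gr])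
  obtain F where F: "has_q_expansion 60 (pullback M f) F"
    using growth_imp_has_q_expansion[OF _ _ gr'] eval_translate_periodic[OF inv M] by auto
  have "fls_nth F k = 0" if k: "of_int k < - (30 * \<rho> / pi)" for k
  proof (cases "F = 0")
    case False
    show ?thesis
    proof (rule ccontr)
      assume "fls_nth F k \<noteq> 0"
      hence "fls_subdegree F \<le> k"
        by (rule fls_subdegree_leI)
      with k have s: "of_int (fls_subdegree F) < - (30 * \<rho> / pi)"
        by linarith
      define s where "s = fls_subdegree F"
      define \<sigma> where "\<sigma> = - 2 * pi * of_int s / (60::real)"
      have \<sigma>: "\<rho> < \<sigma>"
        using s pi_gt_zero by (simp add: \<sigma>_def s_def field_simps)
      define G where "G = fls_shift s F"
      define Q where "Q = (\<lambda>z. exp (2 * of_real pi * \<i> * z / of_nat 60))"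
      have F': "fls_conv_radius F > 0" "eventually (\<lambda>z. eval_mero (pullback M f) z = eval_fls F (Q z)) (filtercomap Im at_top)"
        using F by (auto simp: has_q_expansion_def Q_def)
      have G: "fls_conv_radius G > 0" "fls_subdegree G \<ge> 0" "fls_nth G 0 \<noteq> 0"
        using F'(1) False by (simp_all add: G_def s_def)
      have "eval_fls G \<midarrow>0\<rightarrow> fls_nth G 0"
        using has_laurent_expansion_imp_tendsto_0[OF eval_fls_has_laurent_expansion[OF G(1)] G(2)] .
      hence lim: "((\<lambda>z. eval_fls G (Q z)) \<longlongrightarrow> fls_nth G 0) (filtercomap Im at_top)"
        by (rule filterlim_compose) (use filterlim_q[of 60] in \<open>simp add: Q_def\<close>)
      obtain C Y where CY: "C > 0" "\<And>z. Im z > Y \<Longrightarrow> norm (eval_mero (pullback M f) z) \<le> C * exp (\<rho> * Im z)"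
        using gr by (rule growth_leE) blast
      have "eventually (\<lambda>z. norm (eval_fls G (Q z)) \<le> C * exp ((\<rho> - \<sigma>) * Im z)) (filtercomap Im at_top)"
      proof -
        have "eventually (\<lambda>z. Im z > Y) (filtercomap Im at_top)"
          by (auto simp: eventually_filtercomap_at_top_dense)
        with F'(2) show ?thesis
        proof eventually_elim
          case (elim z)
          have Q0: "Q z \<noteq> 0"
            by (simp add: Q_def)
          have "norm (Q z) = exp (- 2 * pi * Im z / 60)"
            by (simp add: Q_def Im_divide_numeral)
          hence nQ: "norm (Q z) powi (- s) = exp (- \<sigma> * Im z)"
            by (simp add: exp_power_int \<sigma>_def algebra_simps)
          have "norm (eval_fls G (Q z)) = norm (eval_fls F (Q z)) * norm (Q z) powi (- s)"
            unfolding G_def using Q0 by (subst eval_fls_shift) (auto simp: norm_mult norm_power_int)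
          also have "\<dots> \<le> C * exp (\<rho> * Im z) * exp (- \<sigma> * Im z)"
            unfolding nQ using CY(2)[of z] elim by (intro mult_right_mono) auto
          also have "\<dots> = C * exp ((\<rho> - \<sigma>) * Im z)"
            by (simp add: algebra_simps flip: exp_add)
          finally show ?case .
        qed
      qed
      moreover have "((\<lambda>z. C * exp ((\<rho> - \<sigma>) * Im z)) \<longlongrightarrow> 0) (filtercomap Im at_top)"
      proof -
        have "((\<lambda>x. C * exp ((\<rho> - \<sigma>) * x)) \<longlongrightarrow> 0) at_top"
          using \<sigma> by real_asymp
        thus ?thesis
          by (rule filterlim_compose) (rule filterlim_filtercomap)
      qed
      ultimately have "((\<lambda>z. eval_fls G (Q z)) \<longlongrightarrow> 0) (filtercomap Im at_top)"
        by (rule Lim_null_comparison)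
      from tendsto_unique[OF eventually_upper_nontriv lim this] G(3) show False
        by simp
    qed
  qed auto
  with F show ?thesis
    by blast
qed

text \<open>Expansions of unspecified width are traded for growth bounds. The converse uses that 60
  is a period of every translate, so one width serves at all cusps.\<close>

lemma K60_iff: "f \<in> K60 \<longleftrightarrow> (\<forall>M\<in>Gamma0 60. pullback M f = f) \<and> (\<forall>M\<in>SL2Z. \<exists>\<rho>. growth_le \<rho> (pullback M f))"
proof
  assume "f \<in> K60"
  thus "(\<forall>M\<in>Gamma0 60. pullback M f = f) \<and> (\<forall>M\<in>SL2Z. \<exists>\<rho>. growth_le \<rho> (pullback M f))"
    unfolding complex_function_field_X0_def using has_q_expansion_growth' by blast
next
  assume *: "(\<forall>M\<in>Gamma0 60. pullback M f = f) \<and> (\<forall>M\<in>SL2Z. \<exists>\<rho>. growth_le \<rho> (pullback M f))"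
  hence "\<exists>h>0. \<exists>F. has_q_expansion h (pullback M f) F" if "M \<in> SL2Z" for M
    using that growth_imp_expansion_60[of f M] by (meson zero_less_numeral)
  with * show "f \<in> K60"
    by (simp add: complex_function_field_X0_def)
qed

lemma K60_inv: "f \<in> K60 \<Longrightarrow> M \<in> Gamma0 60 \<Longrightarrow> pullback M f = f"
  by (simp add: complex_function_field_X0_def)

lemma K60_growth: "f \<in> K60 \<Longrightarrow> M \<in> SL2Z \<Longrightarrow> \<exists>\<rho>. growth_le \<rho> (pullback M f)"
  by (simp add: K60_iff)

lemma SL2Z_det_pos: "M \<in> SL2Z \<Longrightarrow> det M > 0"
  by (simp add: SL2Z_det)

lemma K60_plus: assumes "f \<in> K60" "g \<in> K60" shows "f + g \<in> K60"
  unfolding K60_iff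
proof (intro conjI ballI)
  fix M assume M: "M \<in> SL2Z"
  obtain \<rho> \<rho>' where "growth_le \<rho> (pullback M f)" "growth_le \<rho>' (pullback M g)"
    using K60_growth[OF assms(1) M] K60_growth[OF assms(2) M] by blast
  hence "growth_le (max \<rho> \<rho>') (pullback M f)" "growth_le (max \<rho> \<rho>') (pullback M g)"
    by (auto intro: growth_le_mono)
  thus "\<exists>\<rho>. growth_le \<rho> (pullback M (f + g))"
    unfolding pullback_plus[OF SL2Z_det_pos[OF M]] using growth_le_plus by blast
qed (use assms in \<open>simp add: pullback_plus SL2Z_det_pos Gamma0_SL2Z K60_inv\<close>)

lemma K60_times: assumes "f \<in> K60" "g \<in> K60" shows "f * g \<in> K60"
  unfolding K60_iff
proof (intro conjI ballI)
  fix M assume M: "M \<in> SL2Z"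
  show "\<exists>\<rho>. growth_le \<rho> (pullback M (f * g))"
    unfolding pullback_times[OF SL2Z_det_pos[OF M]]
    using K60_growth[OF assms(1) M] K60_growth[OF assms(2) M] growth_le_times by blast
qed (use assms in \<open>simp add: pullback_times SL2Z_det_pos Gamma0_SL2Z K60_inv\<close>)

lemma K60_mconst: "mconst c \<in> K60"
  unfolding K60_iff using growth_le_mconst by (auto simp: pullback_mconst SL2Z_det_pos Gamma0_SL2Z)

lemma K60_uminus: assumes "f \<in> K60" shows "- f \<in> K60"
  using K60_times[OF K60_mconst[of "-1"] assms] by (simp add: mconst_hom)

lemma K60_minus: assumes "f \<in> K60" "g \<in> K60" shows "f - g \<in> K60"
  using K60_plus[OF assms(1) K60_uminus[OF assms(2)]] by simp

text \<open>An upper growth bound says nothing about 1 / f, so here the Laurent expansion at each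
  cusp is inverted instead.\<close>

lemma K60_inverse: assumes "f \<in> K60" shows "inverse f \<in> K60"
  unfolding K60_iff
proof (intro conjI ballI)
  fix M assume M: "M \<in> SL2Z"
  obtain h F where hF: "h > 0" "has_q_expansion h (pullback M f) F"
    using assms M unfolding complex_function_field_X0_def by blast
  show "\<exists>\<rho>. growth_le \<rho> (pullback M (inverse f))"
    unfolding pullback_inverse[OF SL2Z_det_pos[OF M]]
    using has_q_expansion_growth'[OF has_q_expansion_inverse[OF hF(2,1)] hF(1)] .
qed (use assms in \<open>simp add: pullback_inverse SL2Z_det_pos Gamma0_SL2Z K60_inv\<close>)

text \<open>The matrix with A = C = 1, B = -4, D = -1, multiplied by sqrt 15, which does not change
  the Moebius map. It sends \<infinity> to 1/4, and its square is scalar.\<close>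

definition W0 :: "real^2^2" where "W0 = mat2 (of_int 15) (of_int (- 4)) (of_int 60) (of_int (- 15))"

lemma det_W0: "det W0 > 0"
  by (simp add: W0_def det_mat2)

lemma moebius_W0: "moebius_map W0 z = (15 * z - 4) / (60 * z - 15)"
  by (simp add: W0_def moebius_mat2)

lemma atkin_lehner_W0:
  assumes "f \<in> K60"
  shows "atkin_lehner 60 15 f = pullback W0 f"
proof -
  define W where "W = (1 / sqrt (of_nat 15)) *\<^sub>R mat2 (of_int 1 * of_nat 15) (of_int (- 4)) (of_nat 60 * of_int 1) (of_int (- 1) * of_nat 15)"
  have d: "det W = 1"
    unfolding W_def by (subst det_mat2_scaled) auto
  have "W \<in> atkin_lehner_matrices 60 15"
    unfolding atkin_lehner_matrices_def using d W_def by blast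
  hence "atkin_lehner 60 15 f = pullback W f"
    by (intro atkin_lehner_eq assms) auto
  also have "\<dots> = pullback W0 f"
  proof (rule pullback_moebius_cong)
    fix z :: complex
    have "moebius_map W z = (of_real (1 / sqrt 15) * (15 * z - 4)) / (of_real (1 / sqrt 15) * (60 * z - 15))"
      by (simp add: W_def moebius_map_def algebra_simps)
    also have "\<dots> = (15 * z - 4) / (60 * z - 15)"
      by (rule mult_divide_mult_cancel_left) simp
    finally show "moebius_map W z = moebius_map W0 z"
      by (simp add: moebius_W0)
  qed (use d det_W0 in auto)
  finally show ?thesis .
qed

lemma W0_W0: "pullback W0 (pullback W0 f) = f"
proof -
  have 1: "W0 ** W0 = mat2 (- 15) 0 0 (- 15)"
    by (simp add: W0_def mat2_mult)
  have "pullback W0 (pullback W0 f) = pullback (mat2 (- 15) 0 0 (- 15)) f"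
    using pullback_mult[OF det_W0 det_W0, of f] unfolding 1 by simp
  also have "\<dots> = pullback (mat 1) f"
    by (rule pullback_moebius_cong) (simp_all add: det_mat2 det_I, simp add: moebius_map_def mat_def)
  finally show ?thesis
    by (simp add: pullback_mat_1)
qed

lemma K60_W0: assumes "f \<in> K60" shows "pullback W0 f \<in> K60"
  unfolding K60_iff
proof (intro conjI ballI)
  fix G assume G: "G \<in> Gamma0 60"
  obtain a b c d :: int where abcd: "G = mat2 (of_int a) (of_int b) (of_int (int 60 * c)) (of_int d)" "a * d - b * (int 60 * c) = 1"
    using G by (rule Gamma0_E)
  \<comment> \<open>This is the conjugate of \<open>G\<close> by \<open>W0\<close>; it lies in
    \<open>\<Gamma>\<^sub>0(60)\<close> because \<open>w\<close> normalises that group.\<close>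
  define G' where "G' = mat2 (of_int (- 15 * a + 240 * c - 60 * b + 16 * d)) (of_int (4 * a - 64 * c + 15 * b - 4 * d))
     (of_int (int 60 * (- a + 15 * c - 4 * b + d))) (of_int (16 * a - 240 * c + 60 * b - 15 * d))"
  have "G' \<in> Gamma0 60"
    unfolding G'_def
  proof (rule Gamma0_I)
    have "(- 15 * a + 240 * c - 60 * b + 16 * d) * (16 * a - 240 * c + 60 * b - 15 * d) -
        (4 * a - 64 * c + 15 * b - 4 * d) * (int 60 * (- a + 15 * c - 4 * b + d)) = a * d - b * (int 60 * c)"
      by (simp add: algebra_simps)
    thus "(- 15 * a + 240 * c - 60 * b + 16 * d) * (16 * a - 240 * c + 60 * b - 15 * d) -
        (4 * a - 64 * c + 15 * b - 4 * d) * (int 60 * (- a + 15 * c - 4 * b + d)) = 1"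
      using abcd(2) by simp
  qed
  have eq: "W0 ** G = G' ** W0"
    unfolding W0_def G'_def abcd(1) mat2_mult by (rule mat2_eqI) (simp_all add: algebra_simps)
  have "pullback G (pullback W0 f) = pullback (W0 ** G) f"
    by (rule pullback_mult [symmetric]) (use G in \<open>auto intro: det_W0 SL2Z_det_pos Gamma0_SL2Z\<close>)
  also have "\<dots> = pullback W0 (pullback G' f)"
    unfolding eq by (rule pullback_mult) (use \<open>G' \<in> Gamma0 60\<close> in \<open>auto intro: det_W0 SL2Z_det_pos Gamma0_SL2Z\<close>)
  also have "pullback G' f = f"
    using assms \<open>G' \<in> Gamma0 60\<close> by (rule K60_inv)
  finally show "pullback G (pullback W0 f) = pullback W0 f" .
next
  fix M assume M: "M \<in> SL2Z"
  obtain a b c d :: int where abcd: "M = mat2 (of_int a) (of_int b) (of_int c) (of_int d)" "a * d - b * c = 1"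
    using M by (rule SL2Z_E)
  have eq: "W0 ** M = mat2 (of_int (15 * a - 4 * c)) (of_int (15 * b - 4 * d)) (of_int (60 * a - 15 * c)) (of_int (60 * b - 15 * d))"
    unfolding W0_def abcd(1) mat2_mult by (rule mat2_eqI) simp_all
  have "(15 * a - 4 * c) * (60 * b - 15 * d) - (15 * b - 4 * d) * (60 * a - 15 * c) = 15 * (a * d - b * c)"
    by (simp add: algebra_simps)
  hence pos: "(15 * a - 4 * c) * (60 * b - 15 * d) - (15 * b - 4 * d) * (60 * a - 15 * c) > 0"
    using abcd(2) by simp
  obtain M' \<alpha> \<beta> where M': "M' \<in> SL2Z" "\<alpha> > 0" "\<And>f. pullback (W0 ** M) f = pullback (mat2 \<alpha> \<beta> 0 1) (pullback M' f)"
    using integer_matrix_decomp[OF pos] unfolding eq[symmetric] by blast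
  have "pullback M (pullback W0 f) = pullback (mat2 \<alpha> \<beta> 0 1) (pullback M' f)"
    unfolding M'(3)[symmetric] by (rule pullback_mult [symmetric]) (use M in \<open>auto intro: det_W0 SL2Z_det_pos\<close>)
  thus "\<exists>\<rho>. growth_le \<rho> (pullback M (pullback W0 f))"
    using K60_growth[OF assms M'(1)] growth_le_pullback_affine M'(2) by metis
qed

text \<open>The cusps with gcd(c, 60) = 4 are equivalent to 1/4, the image of \<infinity> under
  \<open>w\<close>. For a \<open>w\<close>-invariant function the behaviour there is that at
  \<infinity>, slowed down by the width 15 of this cusp.\<close>

lemma growth_le_class_4:
  assumes f: "f \<in> K60" "pullback W0 f = f" and gr: "growth_le \<rho> f"
    and det: "a * d - b * c = 1" and c: "gcd c 60 = 4"
  shows "growth_le (\<rho> / 15) (pullback (mat2 (of_int a) (of_int b) (of_int c) (of_int d)) f)"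
proof -
  define M where "M = mat2 (of_int a) (of_int b) (of_int c) (of_int d)"
  have "4 dvd c"
    by (metis c gcd_dvd1)
  then obtain c1 where c1: "c = 4 * c1"
    by (elim dvdE)
  have "gcd (4 * c1) (4 * 15) = 4 * gcd c1 15"
    using gcd_mult_distrib_int[of 4 c1 15] by simp
  hence "gcd c1 15 = 1"
    using c c1 by simp
  hence "coprime c1 15"
    by (simp add: coprime_iff_gcd_eq_1)
  moreover have "coprime 4 (15 :: int)"
    by (simp add: coprime_iff_gcd_eq_1 gcd_non_0_int)
  ultimately have "coprime (4 * c1) 15"
    by simp
  then obtain u v where uv: "u * (4 * c1) + v * 15 = 1"
    by (metis bezout_int coprime_iff_gcd_eq_1)
  \<comment> \<open>The translation by \<open>k\<close> has to make the lower left entry c - 4 (d +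
    k c) of the matrix product \<open>M\<close> times the inverse of \<open>L\<close> divisible by
    60. With c = 4 c1 this asks for 4 c1 k = c1 - d modulo 15, and \<open>u\<close> inverts 4 c1
    modulo 15.\<close>
  define k where "k = u * (c1 - d)"
  have "4 * c1 * k = (u * (4 * c1)) * (c1 - d)"
    by (simp add: k_def)
  also have "u * (4 * c1) = 1 - v * 15"
    using uv by simp
  finally have kk: "4 * c1 * k = c1 - d - 15 * (v * (c1 - d))"
    by (simp add: algebra_simps)
  define e where "e = v * (c1 - d)"
  have low: "c - 4 * (d + k * c) = int 60 * e"
  proof -
    have "c - 4 * (d + k * c) = 4 * (c1 - d - 4 * c1 * k)"
      by (simp add: c1 algebra_simps)
    thus ?thesis
      unfolding kk e_def by simp
  qed
  define G where "G = mat2 (of_int (a - 4 * (b + k * a))) (of_int (b + k * a)) (of_int (int 60 * e)) (of_int (d + k * c))"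
  have G: "G \<in> Gamma0 60"
    unfolding G_def
  proof (rule Gamma0_I)
    show "(a - 4 * (b + k * a)) * (d + k * c) - (b + k * a) * (int 60 * e) = 1"
      unfolding low[symmetric] using det by (simp add: algebra_simps)
  qed
  define L where "L = mat2 (of_int 1) (of_int (- k)) (of_int 4) (of_int (1 - 4 * k))"
  have L: "L \<in> SL2Z"
    unfolding L_def by (rule SL2Z_I) simp
  have M: "M = G ** L"
  proof -
    have *: "real_of_int (int 60 * e) = of_int c - 4 * (of_int d + of_int k * of_int c)"
      unfolding low[symmetric] by simp
    show ?thesis
      unfolding M_def G_def L_def mat2_mult * by (rule mat2_eqI) (simp_all add: algebra_simps)
  qed
  have "pullback M f = pullback L f"
    unfolding M using pullback_mult_SL2Z[OF Gamma0_SL2Z[OF G] L] K60_inv[OF f(1) G] by metis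
  also have "\<dots> = pullback L (pullback W0 f)"
    by (simp add: f(2))
  also have "\<dots> = pullback (W0 ** L) f"
    by (rule pullback_mult [symmetric]) (use L in \<open>auto intro: det_W0 SL2Z_det_pos\<close>)
  also have "W0 ** L = mat2 (- 1) (of_int k - 4) 0 (- 15)"
    unfolding W0_def L_def mat2_mult by (rule mat2_eqI) simp_all
  also have "pullback \<dots> f = pullback (mat2 (1 / 15) ((4 - of_int k) / 15) 0 1) f"
    by (rule pullback_moebius_cong) (auto simp: det_mat2 moebius_mat2 field_simps)
  finally have "pullback M f = pullback (mat2 (1 / 15) ((4 - of_int k) / 15) 0 1) f" .
  thus ?thesis
    using growth_le_pullback_affine[OF gr, of "1 / 15"] by (simp add: M_def)
qed

text \<open>The functions on the quotient by \<open>w\<close> that are regular outside the image of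
  \<infinity>, where poles of any order are allowed. The two excluded values of the gcd are the two
  classes of cusps that \<open>w\<close> exchanges above that point.\<close>

definition Rplus :: "mero_uhp set"
  where "Rplus = {f \<in> K60. pullback W0 f = f \<and> eval_mero f analytic_on uhp \<and>
     (\<forall>a b c d :: int. a * d - b * c = 1 \<longrightarrow> gcd c 60 \<notin> {4, 60} \<longrightarrow> growth_le 0 (pullback (mat2 (of_int a) (of_int b) (of_int c) (of_int d)) f))}"

lemma Rplus_K60: "f \<in> Rplus \<Longrightarrow> f \<in> K60"
  by (simp add: Rplus_def)

lemma Rplus_eq_0:
  assumes f: "f \<in> Rplus" and gr: "growth_le \<rho> f" "\<rho> < 0"
  shows "f = 0"
proof (rule vanishing_at_infinity_imp_eq_0[of 60 f \<rho>])
  show "\<forall>M\<in>Gamma0 60. pullback M f = f"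
    using f K60_inv Rplus_K60 by blast
  fix M assume "M \<in> SL2Z"
  then obtain a b c d :: int where abcd: "M = mat2 (of_int a) (of_int b) (of_int c) (of_int d)" "a * d - b * c = 1"
    by (rule SL2Z_E)
  consider "gcd c 60 = 60" | "gcd c 60 = 4" | "gcd c 60 \<notin> {4, 60}"
    by blast
  thus "growth_le 0 (pullback M f)"
  proof cases
    case 1
    hence "60 dvd c"
      by (metis gcd_dvd1)
    then obtain c' where "c = int 60 * c'"
      by auto
    hence "M \<in> Gamma0 60"
      using Gamma0_I[of a d b 60 c'] abcd by simp
    hence "pullback M f = f"
      using f by (intro K60_inv Rplus_K60)
    thus ?thesis
      using growth_le_mono[OF gr(1)] gr(2) by simp
  next
    case 2
    have "growth_le (\<rho> / 15) (pullback M f)"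
      unfolding abcd(1) by (rule growth_le_class_4[OF _ _ gr(1) abcd(2) 2]) (use f in \<open>auto simp: Rplus_def\<close>)
    thus ?thesis
      by (rule growth_le_mono) (use gr(2) in simp)
  next
    case 3
    thus ?thesis
      using f abcd by (auto simp: Rplus_def)
  qed
qed (use assms in \<open>auto simp: Rplus_def\<close>)

lemma Rplus_plus: assumes "f \<in> Rplus" "g \<in> Rplus" shows "f + g \<in> Rplus"
  using assms unfolding Rplus_def
  by (auto simp: pullback_plus det_W0 K60_plus det_mat2 simp flip: of_int_mult of_int_diff intro!: analytic_plus open_uhp growth_le_plus)

lemma Rplus_times: assumes "f \<in> Rplus" "g \<in> Rplus" shows "f * g \<in> Rplus"
  using assms unfolding Rplus_def
  by (auto simp: pullback_times det_W0 K60_times det_mat2 simp flip: of_int_mult of_int_diff intro!: analytic_times open_uhp growth_le_times[of 0 _ 0, simplified])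

lemma Rplus_mconst: "mconst c \<in> Rplus"
  unfolding Rplus_def
  by (auto simp: pullback_mconst det_W0 K60_mconst det_mat2 simp flip: of_int_mult of_int_diff intro!: mconst_analytic growth_le_mconst)

lemma Rplus_minus: assumes "f \<in> Rplus" "g \<in> Rplus" shows "f - g \<in> Rplus"
  using Rplus_plus[OF assms(1) Rplus_times[OF Rplus_mconst[of "-1"] assms(2)]] by (simp add: mconst_hom)

lemma Rplus_power: "f \<in> Rplus \<Longrightarrow> f ^ n \<in> Rplus"
  using Rplus_mconst[of 1] by (induction n) (auto intro: Rplus_times)

lemma K60_expansion_1:
  assumes "f \<in> K60"
  shows "\<exists>F. has_q_expansion 1 f F"
proof -
  obtain \<rho> where \<rho>: "growth_le \<rho> f"
    using K60_growth[OF assms SL2Z_mat_1] by (auto simp: pullback_mat_1)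
  define m where "m = \<lfloor>- (\<rho> / (2 * pi))\<rfloor>"
  have "real_of_int m \<le> - (\<rho> / (2 * pi))"
    by (simp add: m_def)
  hence "\<rho> \<le> - 2 * pi * of_int m / of_nat 1"
    using pi_gt_zero by (simp add: field_simps)
  hence gr: "growth_le (- 2 * pi * of_int m / of_nat 1) f"
    by (rule growth_le_mono[OF \<rho>])
  have per: "eval_mero f (z + of_nat 1) = eval_mero f z" if z: "Im z > 0" for z
  proof -
    define T where "T = mat2 (of_int 1) (of_int 1) (of_int (int 60 * 0)) (of_int 1)"
    have T: "T \<in> Gamma0 60"
      unfolding T_def by (rule Gamma0_I) simp
    have "moebius_map T z = z + 1"
      by (simp add: T_def moebius_map_def)
    thus ?thesis
      using eval_pullback[of T z f] z K60_inv[OF assms T] SL2Z_det_pos[OF Gamma0_SL2Z[OF T]] by simp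
  qed
  show ?thesis
    using growth_imp_has_q_expansion[OF per _ gr] by auto
qed

section \<open>Polynomials in a function\<close>

definition rhom :: "('a::comm_ring_1 \<Rightarrow> 'b::comm_ring_1) \<Rightarrow> bool"
  where "rhom h \<longleftrightarrow> h 0 = 0 \<and> h 1 = 1 \<and> (\<forall>a b. h (a + b) = h a + h b) \<and> (\<forall>a b. h (a * b) = h a * h b)"

text \<open>Evaluation through a coefficient map: with complex coefficients for the function field
  over \<complex>, with rational ones for the descent, and nested three times for the polynomial
  ring in three variables.\<close>

definition hev :: "('a::comm_ring_1 \<Rightarrow> 'b::comm_ring_1) \<Rightarrow> 'a poly \<Rightarrow> 'b \<Rightarrow> 'b"
  where "hev h p x = poly (map_poly h p) x"

lemma hev_0 [simp]: "hev h 0 x = 0"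
  by (simp add: hev_def)

context
  fixes h :: "'a::comm_ring_1 \<Rightarrow> 'b::comm_ring_1"
  assumes h: "rhom h"
begin

lemma rhom_simps: "h 0 = 0" "h 1 = 1" "h (a + b) = h a + h b" "h (a * b) = h a * h b"
  using h by (auto simp: rhom_def)

lemma rhom_uminus: "h (- a) = - h a"
proof -
  have "h (- a) + h a = 0"
    using rhom_simps(3)[of "- a" a] rhom_simps(1) by simp
  thus ?thesis
    by (simp add: eq_neg_iff_add_eq_0)
qed

lemma rhom_minus: "h (a - b) = h a - h b"
  using rhom_simps(3)[of a "- b"] by (simp add: rhom_uminus)

lemma rhom_power: "h (a ^ n) = h a ^ n"
  by (induction n) (simp_all add: rhom_simps)

lemma rhom_of_nat: "h (of_nat n) = of_nat n"
  by (induction n) (simp_all add: rhom_simps)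

lemma rhom_numeral: "h (numeral n) = numeral n"
  using rhom_of_nat[of "numeral n"] by simp

lemma hev_pCons: "hev h (pCons a p) x = h a + x * hev h p x"
  by (simp add: hev_def map_poly_pCons rhom_simps)

lemma hev_add: "hev h (p + q) x = hev h p x + hev h q x"
proof -
  have "map_poly h (p + q) = map_poly h p + map_poly h q"
    by (intro poly_eqI) (simp add: coeff_map_poly rhom_simps)
  thus ?thesis
    by (simp add: hev_def)
qed

lemma hev_smult: "hev h (Polynomial.smult a p) x = h a * hev h p x"
proof -
  have "map_poly h (Polynomial.smult a p) = Polynomial.smult (h a) (map_poly h p)"
    by (intro poly_eqI) (simp add: coeff_map_poly rhom_simps)
  thus ?thesis
    by (simp add: hev_def)
qed

lemma hev_mult: "hev h (p * q) x = hev h p x * hev h q x"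
  by (induction p) (simp_all add: hev_pCons hev_add hev_smult rhom_simps algebra_simps)

lemma rhom_hev: "rhom (\<lambda>p. hev h p x)"
  using hev_pCons[of 1 0 x] by (auto simp: rhom_def hev_add hev_mult rhom_simps one_pCons)

lemma hev_monom: "hev h (Polynomial.monom a n) x = h a * x ^ n"
  by (induction n) (simp_all add: monom_0 monom_Suc hev_pCons rhom_simps algebra_simps)

lemma hev_1: "hev h 1 x = 1"
  using hev_pCons[of 1 0 x] by (simp add: one_pCons rhom_simps)

lemma hev_prod: "hev h (prod f I) x = (\<Prod>i\<in>I. hev h (f i) x)"
  by (induction I rule: infinite_finite_induct) (simp_all add: hev_1 hev_mult)

lemma hev_power: "hev h (p ^ n) x = hev h p x ^ n"
  by (induction n) (simp_all add: hev_1 hev_mult)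

end

lemma rhom_mconst: "rhom mconst"
  by (simp add: rhom_def mconst_hom)

abbreviation cev :: "complex poly \<Rightarrow> mero_uhp \<Rightarrow> mero_uhp"
  where "cev \<equiv> hev mconst"

lemma hev_minus: "rhom h \<Longrightarrow> hev h (p - q) x = hev h p x - hev h q x"
  by (rule rhom_minus[OF rhom_hev])

lemmas cev_pCons = hev_pCons[OF rhom_mconst] and cev_add = hev_add[OF rhom_mconst]
  and cev_mult = hev_mult[OF rhom_mconst] and cev_smult = hev_smult[OF rhom_mconst]
  and cev_monom = hev_monom[OF rhom_mconst] and cev_1 = hev_1[OF rhom_mconst]
  and cev_prod = hev_prod[OF rhom_mconst] and cev_power = hev_power[OF rhom_mconst]
  and cev_minus = hev_minus[OF rhom_mconst]

lemma pullback_cev: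
  assumes "det M > 0"
  shows "pullback M (cev p f) = cev p (pullback M f)"
  by (induction p) (simp_all add: cev_pCons pullback_plus[OF assms] pullback_times[OF assms] pullback_mconst[OF assms] pullback_0[OF assms])

lemma cev_closed:
  assumes "\<And>a b. a \<in> A \<Longrightarrow> b \<in> A \<Longrightarrow> a + b \<in> A" "\<And>a b. a \<in> A \<Longrightarrow> b \<in> A \<Longrightarrow> a * b \<in> A" "\<And>c. mconst c \<in> A" "f \<in> A"
  shows "cev p f \<in> A"
  using assms(3)[of 0] by (induction p) (auto simp: cev_pCons intro!: assms)

lemma Rplus_cev: "f \<in> Rplus \<Longrightarrow> cev p f \<in> Rplus"
  by (intro cev_closed Rplus_plus Rplus_times Rplus_mconst)

lemma K60_cev: "f \<in> K60 \<Longrightarrow> cev p f \<in> K60"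
  by (intro cev_closed K60_plus K60_times K60_mconst)

lemma cev_growth_0:
  assumes "growth_le 0 f"
  shows "growth_le 0 (cev p f)"
  using cev_closed[of "{g. growth_le 0 g}" f p] assms growth_le_times[of 0 _ 0]
  by (auto intro: growth_le_plus growth_le_mconst)

section \<open>Orders and leading terms at \<infinity>\<close>

definition ordge :: "int \<Rightarrow> mero_uhp \<Rightarrow> bool"
  where "ordge n f \<longleftrightarrow> (\<exists>F. has_q_expansion 1 f F \<and> (\<forall>k<n. fls_nth F k = 0))"

definition has_lead :: "int \<Rightarrow> complex \<Rightarrow> mero_uhp \<Rightarrow> bool"
  where "has_lead n c f \<longleftrightarrow> c \<noteq> 0 \<and> (\<exists>F. has_q_expansion 1 f F \<and> fls_subdegree F = n \<and> fls_nth F n = c)"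

lemma has_lead_nonzero:
  assumes "has_lead n c f"
  shows "f \<noteq> 0"
proof -
  obtain F where F: "has_q_expansion 1 f F" "fls_nth F n = c" "c \<noteq> 0"
    using assms by (auto simp: has_lead_def)
  hence "F \<noteq> 0" by auto
  thus ?thesis using has_q_expansion_0_iff[OF F(1)] by simp
qed

lemma has_lead_times:
  assumes "has_lead n c f" "has_lead m d g"
  shows "has_lead (n + m) (c * d) (f * g)"
proof -
  obtain F G where F: "has_q_expansion 1 f F" "fls_subdegree F = n" "fls_nth F n = c" "c \<noteq> 0"
    and G: "has_q_expansion 1 g G" "fls_subdegree G = m" "fls_nth G m = d" "d \<noteq> 0"
    using assms by (auto simp: has_lead_def)
  have "F \<noteq> 0" "G \<noteq> 0" using F(3,4) G(3,4) by auto
  hence "fls_subdegree (F * G) = n + m" "fls_nth (F * G) (n + m) = c * d"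
    using fls_times_base[of F G] F G by auto
  moreover have "has_q_expansion 1 (f * g) (F * G)"
    by (intro has_q_expansion_times F G) auto
  ultimately show ?thesis
    using F(4) G(4) by (auto simp: has_lead_def)
qed

lemma has_lead_mconst: "c \<noteq> 0 \<Longrightarrow> has_lead 0 c (mconst c)"
  using has_q_expansion_mconst[of 1 c] by (auto simp: has_lead_def intro!: exI[of _ "fls_const c"])

lemma has_lead_power:
  assumes "has_lead n c f"
  shows "has_lead (int k * n) (c ^ k) (f ^ k)"
proof (induction k)
  case 0
  thus ?case using has_lead_mconst[of 1] by simp
next
  case (Suc k)
  from has_lead_times[OF assms this] show ?case by (simp add: algebra_simps)
qed

lemma ordge_mono: "ordge n f \<Longrightarrow> m \<le> n \<Longrightarrow> ordge m f"
  unfolding ordge_def by force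

lemma ordge_reduce:
  assumes "ordge n f" "has_lead n c g"
  shows "\<exists>a. ordge (n + 1) (f - mconst a * g)"
proof -
  obtain F G where F: "has_q_expansion 1 f F" "\<forall>k<n. fls_nth F k = 0"
    and G: "has_q_expansion 1 g G" "fls_subdegree G = n" "fls_nth G n = c" "c \<noteq> 0"
    using assms by (auto simp: ordge_def has_lead_def)
  define a where "a = fls_nth F n / c"
  have "has_q_expansion 1 (f - mconst a * g) (F - fls_const a * G)"
    by (intro has_q_expansion_minus has_q_expansion_times has_q_expansion_mconst F G) auto
  moreover have "fls_nth (F - fls_const a * G) k = 0" if "k < n + 1" for k
  proof (cases "k = n")
    case True
    thus ?thesis using G by (simp add: a_def)
  next
    case False
    hence "k < n" using that by simp
    thus ?thesis using F G by simp
  qed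
  ultimately show ?thesis
    unfolding ordge_def by blast
qed

text \<open>This is what makes every identity in \<open>Rplus\<close> a finite check: the
  coefficients up to and including that of q^0 decide.\<close>

lemma Rplus_ordge_eq_0:
  assumes "f \<in> Rplus" "ordge 1 f"
  shows "f = 0"
proof -
  obtain F where F: "has_q_expansion 1 f F" "\<And>k. k < 1 \<Longrightarrow> fls_nth F k = 0"
    using assms by (auto simp: ordge_def)
  have "growth_le (- 2 * pi * of_int 1 / of_nat 1) f"
    by (rule has_q_expansion_growth[OF F(1)]) (use F(2) in auto)
  from Rplus_eq_0[OF assms(1) this] show ?thesis
    by simp
qed

section \<open>Clearing poles by polynomials in one function\<close>

lemma analytic_atI:
  assumes "Im z > 0" "eventually (\<lambda>w. eval_mero g w = A w) (at z)" "A analytic_on {z}"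
  shows "eval_mero g analytic_on {z}"
proof -
  have "\<not> is_pole A z"
    using assms(3) analytic_at_imp_no_pole by blast
  hence "\<not> is_pole (eval_mero g) z"
    using is_pole_cong[OF assms(2) refl] by simp
  thus ?thesis
    using nicely_meromorphic_on_imp_analytic_at[OF eval_mero_nicely] assms(1) by simp
qed

lemma cosparse_uhp_at:
  assumes "\<forall>\<^sub>\<approx>w\<in>uhp. P w" "Im z > 0"
  shows "eventually P (at z)"
  using assms by (simp add: eventually_cosparse_open_eq[OF open_uhp])

lemma analytic_times_at:
  assumes "Im z > 0" "eval_mero f analytic_on {z}" "eval_mero g analytic_on {z}"
  shows "eval_mero (f * g) analytic_on {z}"
  by (rule analytic_atI[OF assms(1) cosparse_uhp_at[OF eval_times assms(1)]]) (intro analytic_intros assms)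

lemma cev_analytic_at:
  assumes "Im z > 0" "eval_mero f analytic_on {z}"
  shows "eval_mero (cev p f) analytic_on {z}"
proof (rule cev_closed[of "{g. eval_mero g analytic_on {z}}" f p, simplified])
  fix a b assume "eval_mero a analytic_on {z}" "eval_mero b analytic_on {z}"
  thus "eval_mero (a + b) analytic_on {z}"
    by (intro analytic_atI[OF assms(1) cosparse_uhp_at[OF eval_plus assms(1)]] analytic_intros)
qed (use assms in \<open>auto intro: analytic_times_at mconst_analytic\<close>)

text \<open>The factor f - f(z) vanishes at z, so it is w - z times the analytic difference quotient
  \<open>k\<close>. Taking as many such factors as the absolute value of the order \<open>n\<close>
  of \<open>g\<close> makes the total exponent n + m nonnegative.\<close>

lemma clear_pole:
  assumes z: "Im z > 0" and f: "eval_mero f analytic_on {z}"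
  shows "\<exists>m. eval_mero ((f - mconst (eval_mero f z)) ^ m * g) analytic_on {z}"
proof (cases "g = 0")
  case True
  thus ?thesis
    using mconst_analytic[of "{z}" 0] z by auto
next
  case False
  have nz: "eventually (\<lambda>w. eval_mero g w \<noteq> 0) (at z)"
  proof -
    have "eventually (\<lambda>w. eval_mero (inverse g * g) w = eval_mero (inverse g) w * eval_mero g w) (at z)"
      by (rule cosparse_uhp_at[OF eval_times z])
    moreover have "eventually (\<lambda>w. eval_mero 1 w = 1) (at z)"
      by (rule cosparse_uhp_at[OF eval_one z])
    ultimately show ?thesis
      by eventually_elim (use False in auto)
  qed
  have "eval_mero g meromorphic_on {z}"
    by (rule meromorphic_on_subset[OF eval_mero_meromorphic]) (use z in auto)
  hence "isolated_singularity_at (eval_mero g) z" "not_essential (eval_mero g) z"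
    by (auto simp: meromorphic_at_iff)
  from zorder_exist[OF this] nz obtain r where r: "r > 0"
    "zor_poly (eval_mero g) z holomorphic_on cball z r"
    "\<And>w. w \<in> cball z r - {z} \<Longrightarrow> eval_mero g w = zor_poly (eval_mero g) z w * (w - z) powi zorder (eval_mero g) z"
    using eventually_frequently[OF _ nz] by (auto simp: trivial_limit_at)
  define h where "h = zor_poly (eval_mero g) z"
  define n where "n = zorder (eval_mero g) z"
  define m where "m = nat \<bar>n\<bar>"
  define c where "c = eval_mero f z"
  have h: "h analytic_on {z}"
    unfolding h_def using holomorphic_on_subset[OF r(2), of "ball z r"] r(1)
    by (auto simp: analytic_at intro!: exI[of _ "ball z r"])
  obtain S where S: "open S" "z \<in> S" "eval_mero f holomorphic_on S"
    using f by (auto simp: analytic_at)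
  define k where "k = (\<lambda>w. if w = z then deriv (eval_mero f) z else (eval_mero f w - eval_mero f z) / (w - z))"
  have "k holomorphic_on S"
    unfolding k_def using S by (intro pole_lemma) (auto simp: interior_open)
  hence k: "k analytic_on {z}"
    using S by (auto simp: analytic_at)
  have m: "eval_mero f w - c = (w - z) * k w" if "w \<noteq> z" for w
    using that by (simp add: k_def c_def)
  have Aa: "(\<lambda>w. k w ^ m * h w * (w - z) ^ nat (n + int m)) analytic_on {z}"
    by (intro analytic_intros k h)
  have "eventually (\<lambda>w. w \<in> ball z r - {z}) (at z)"
    using r(1) by (intro eventually_at_in_open) auto
  hence near: "eventually (\<lambda>w. eval_mero g w = h w * (w - z) powi n \<and> w \<noteq> z) (at z)"
    by eventually_elim (use r(3) in \<open>auto simp: h_def n_def\<close>)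
  have pw: "eventually (\<lambda>w. eval_mero ((f - mconst c) ^ m) w = (eval_mero f w - c) ^ m) (at z)"
  proof (induction m)
    case 0
    show ?case using cosparse_uhp_at[OF eval_one z] by eventually_elim simp
  next
    case (Suc m)
    have "eventually (\<lambda>w. Im w > 0) (at z)"
      using eventually_at_in_open'[OF open_uhp, of z] z by simp
    with Suc cosparse_uhp_at[OF eval_times z, of "f - mconst c" "(f - mconst c) ^ m"] cosparse_uhp_at[OF eval_minus z, of f "mconst c"]
    show ?case by eventually_elim (simp add: eval_mconst)
  qed
  have "eventually (\<lambda>w. eval_mero ((f - mconst c) ^ m * g) w = k w ^ m * h w * (w - z) ^ nat (n + int m)) (at z)"
    using near pw cosparse_uhp_at[OF eval_times z, of "(f - mconst c) ^ m" g]
  proof eventually_elim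
    case (elim w)
    have "eval_mero ((f - mconst c) ^ m * g) w = k w ^ m * h w * ((w - z) powi n * (w - z) ^ m)"
      using elim m[of w] by (simp add: power_mult_distrib)
    also have "(w - z) powi n * (w - z) ^ m = (w - z) powi (n + int m)"
      using elim by (simp add: power_int_add)
    also have "\<dots> = (w - z) ^ nat (n + int m)"
      by (simp add: power_int_def m_def)
    finally show ?case .
  qed
  from analytic_atI[OF z this Aa] show ?thesis
    unfolding c_def by blast
qed

lemma clear_poles_finite:
  assumes "finite P" and S: "S \<subseteq> uhp" and f: "\<And>z. z \<in> S \<Longrightarrow> eval_mero f analytic_on {z}"
    and g: "\<And>z. z \<in> S - P \<Longrightarrow> eval_mero g analytic_on {z}"
  shows "\<exists>b. b \<noteq> 0 \<and> (\<forall>z\<in>S. eval_mero (cev b f * g) analytic_on {z})"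
  using assms(1,4)
proof (induction P arbitrary: g)
  case empty
  thus ?case by (intro exI[of _ 1]) (auto simp: cev_1)
next
  case (insert p P)
  show ?case
  proof (cases "p \<in> S")
    case False
    thus ?thesis using insert.IH[of g] insert.prems by auto
  next
    case True
    have p: "Im p > 0" using True S by auto
    obtain m where m: "eval_mero ((f - mconst (eval_mero f p)) ^ m * g) analytic_on {p}"
      using clear_pole[OF p f[OF True]] by blast
    define b1 where "b1 = [:- eval_mero f p, 1:] ^ m"
    have b1: "cev b1 f = (f - mconst (eval_mero f p)) ^ m"
      by (simp add: b1_def cev_power cev_pCons mconst_hom)
    have "eval_mero (cev b1 f * g) analytic_on {z}" if "z \<in> S - P" for z
    proof (cases "z = p")
      case True
      thus ?thesis using m b1 by simp
    next
      case False
      thus ?thesis using that insert.prems f S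
        by (intro analytic_times_at cev_analytic_at) auto
    qed
    from insert.IH[OF this] obtain b where b: "b \<noteq> 0" "\<forall>z\<in>S. eval_mero (cev b f * (cev b1 f * g)) analytic_on {z}"
      by blast
    have "b1 \<noteq> 0" by (simp add: b1_def)
    thus ?thesis
      using b by (intro exI[of _ "b * b1"]) (auto simp: cev_mult mult.assoc)
  qed
qed

definition reduced_region :: "complex set"
  where "reduced_region = {z. Im z \<ge> 1 / 2 \<and> \<bar>Re z\<bar> \<le> 1 / 2}"

text \<open>Here \<open>f\<close> and \<open>g\<close> are translates by one matrix. In the reduced
  region \<open>g\<close> has finitely many poles, since beyond some height it is analytic and below
  it the region is compact. If \<open>f\<close> is bounded at the cusp, its value \<open>c\<close>
  there provides a further factor that also clears the pole of \<open>g\<close> at the cusp.\<close>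

lemma clear_pair:
  assumes f: "eval_mero f analytic_on uhp" and g: "growth_le \<rho> g"
    and fM: "\<forall>M\<in>Gamma0 60. pullback M f0 = f0" "M \<in> SL2Z" "f = pullback M f0"
  shows "\<exists>b. b \<noteq> 0 \<and> (\<forall>z\<in>reduced_region. eval_mero (cev b f * g) analytic_on {z}) \<and>
     (growth_le 0 f \<longrightarrow> growth_le 0 (cev b f * g))"
proof -
  have fz: "eval_mero f analytic_on {z}" if "Im z > 0" for z
    by (rule analytic_on_subset[OF f]) (use that in auto)
  obtain Y where Y: "eval_mero g analytic_on {z. Im z > Y}" "Y > 0"
    using growth_leE[OF g] by metis
  define B where "B = cbox (Complex (- 1 / 2) (1 / 2)) (Complex (1 / 2) (Y + 1))"
  have B: "B \<subseteq> uhp" "compact B"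
    by (auto simp: B_def in_cbox_complex_iff)
  define P where "P = B \<inter> {z \<in> uhp. \<not> eval_mero g analytic_on {z}}"
  have "finite P"
    unfolding P_def
    by (rule sparse_in_compact_finite[OF _ B(2)] sparse_in_subset[OF _ B(1)] meromorphic_on_imp_sparse_singularities' eval_mero_meromorphic)+
  have gP: "eval_mero g analytic_on {z}" if "z \<in> reduced_region - P" for z
  proof (cases "Im z > Y")
    case True
    thus ?thesis by (intro analytic_on_subset[OF Y(1)]) auto
  next
    case False
    hence "z \<in> B" using that by (auto simp: B_def in_cbox_complex_iff reduced_region_def abs_le_iff)
    thus ?thesis using that B(1) by (auto simp: P_def)
  qed
  have RR: "reduced_region \<subseteq> uhp" by (auto simp: reduced_region_def)
  have "eval_mero f analytic_on {z}" if "z \<in> reduced_region" for z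
    by (rule fz) (use that RR in auto)
  then obtain b1 where b1: "b1 \<noteq> 0" "\<forall>z\<in>reduced_region. eval_mero (cev b1 f * g) analytic_on {z}"
    using clear_poles_finite[OF \<open>finite P\<close> RR _ gP] by metis
  show ?thesis
  proof (cases "growth_le 0 f")
    case False
    thus ?thesis using b1 by blast
  next
    case True
    obtain F where F: "has_q_expansion 60 f F" "\<And>k. of_int k < - (30 * 0 / pi) \<Longrightarrow> fls_nth F k = 0"
      using growth_imp_expansion_60[OF fM(1,2)] True unfolding fM(3) by blast
    define c where "c = fls_nth F 0"
    have "has_q_expansion 60 (f - mconst c) (F - fls_const c)"
      by (intro has_q_expansion_minus has_q_expansion_mconst F) auto
    hence "growth_le (- 2 * pi * of_int 1 / of_nat 60) (f - mconst c)"
    proof (rule has_q_expansion_growth)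
      fix k :: int assume "k < 1"
      thus "fls_nth (F - fls_const c) k = 0"
        using F(2)[of k] by (cases "k = 0") (auto simp: c_def)
    qed auto
    hence gr: "growth_le (- (pi / 30)) (f - mconst c)"
      by simp
    \<comment> \<open>Since f - c has a zero in exp(2 \<pi> i z / 60), it decays at least like
      exp(-\<pi> Im z / 30); n such factors outweigh the growth \<rho> of \<open>g\<close>.\<close>
    obtain n :: nat where n: "of_nat n * (pi / 30) \<ge> \<rho>"
      using reals_Archimedean3[of "pi / 30"] less_imp_le by (metis divide_pos_pos pi_gt_zero zero_less_numeral)
    have "growth_le (of_nat n * (- (pi / 30)) + \<rho>) ((f - mconst c) ^ n * g)"
      by (intro growth_le_times growth_le_power gr g)
    hence "growth_le 0 ((f - mconst c) ^ n * g)"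
      by (rule growth_le_mono) (use n in auto)
    hence "growth_le (0 + 0) (cev b1 f * ((f - mconst c) ^ n * g))"
      by (intro growth_le_times cev_growth_0 True)
    moreover have e: "cev b1 f * ((f - mconst c) ^ n * g) = cev (b1 * [:- c, 1:] ^ n) f * g"
      by (simp add: cev_mult cev_power cev_pCons mconst_hom mult.assoc)
    moreover have "eval_mero (cev (b1 * [:- c, 1:] ^ n) f * g) analytic_on {z}" if "z \<in> reduced_region" for z
    proof -
      have z: "Im z > 0" using that by (auto simp: reduced_region_def)
      have e2: "cev (b1 * [:- c, 1:] ^ n) f * g = cev ([:- c, 1:] ^ n) f * (cev b1 f * g)"
        by (simp only: cev_mult ac_simps)
      show ?thesis
        unfolding e2 by (intro analytic_times_at[OF z cev_analytic_at[OF z fz[OF z]]] bspec[OF b1(2)] that)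
    qed
    ultimately show ?thesis
      using b1(1) by (intro exI[of _ "b1 * [:- c, 1:] ^ n"]) simp
  qed
qed

text \<open>
  A pole in the upper half-plane, or a cusp outside the two classes where \<open>x\<close> has its poles, is a zero of
  some \<open>x - c\<close>.
\<close>

lemma denominator_in_Rplus:
  assumes x: "x \<in> Rplus" and g: "g \<in> K60" "pullback W0 g = g"
  shows "\<exists>b. b \<noteq> 0 \<and> cev b x * g \<in> Rplus"
proof -
  have xR: "pullback W0 x = x" "eval_mero x analytic_on uhp" "x \<in> K60"
    "\<And>a b c d :: int. a * d - b * c = 1 \<Longrightarrow> gcd c 60 \<notin> {4, 60} \<Longrightarrow> growth_le 0 (pullback (mat2 (of_int a) (of_int b) (of_int c) (of_int d)) x)"
    using x unfolding Rplus_def by auto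
  have inv: "\<forall>M\<in>Gamma0 60. pullback M x = x" "\<forall>M\<in>Gamma0 60. pullback M g = g"
    using K60_inv xR(3) g(1) by blast+
  have xan: "eval_mero (pullback M x) analytic_on uhp" if "M \<in> SL2Z" for M
  proof (subst analytic_on_analytic_at, intro ballI)
    fix z assume "z \<in> uhp"
    thus "eval_mero (pullback M x) analytic_on {z}"
      using SL2Z_det_pos[OF that] moebius_in_uhp[OF SL2Z_det_pos[OF that], of z]
      by (intro pullback_analytic analytic_on_subset[OF xR(2)]) auto
  qed
  \<comment> \<open>\<open>x\<close> and \<open>g\<close> have to be moved by the same matrix, so
    the pairs of translates are collected. Each pair yields one polynomial, and there are finitely
    many pairs.\<close>
  define pairs where "pairs = (\<lambda>M. (pullback M x, pullback M g)) ` SL2Z"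
  have "pairs \<subseteq> translates x \<times> translates g"
    by (auto simp: pairs_def translates_def)
  moreover have "finite (translates x \<times> translates g)"
    by (intro finite_cartesian_product finite_translates[OF inv(1)] finite_translates[OF inv(2)]) auto
  ultimately have fin: "finite pairs"
    by (rule finite_subset)
  have "\<exists>b. b \<noteq> 0 \<and> (\<forall>z\<in>reduced_region. eval_mero (cev b (fst p) * snd p) analytic_on {z}) \<and>
     (growth_le 0 (fst p) \<longrightarrow> growth_le 0 (cev b (fst p) * snd p))" if p: "p \<in> pairs" for p
  proof -
    obtain M where M: "M \<in> SL2Z" "p = (pullback M x, pullback M g)"
      using p by (auto simp: pairs_def)
    obtain \<rho> where "growth_le \<rho> (pullback M g)"
      using K60_growth[OF g(1) M(1)] by blast
    from clear_pair[OF xan[OF M(1)] this inv(1) M(1) refl] show ?thesis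
      unfolding M(2) by simp
  qed
  then obtain b where b: "\<And>p. p \<in> pairs \<Longrightarrow> b p \<noteq> 0"
    "\<And>p z. p \<in> pairs \<Longrightarrow> z \<in> reduced_region \<Longrightarrow> eval_mero (cev (b p) (fst p) * snd p) analytic_on {z}"
    "\<And>p. p \<in> pairs \<Longrightarrow> growth_le 0 (fst p) \<Longrightarrow> growth_le 0 (cev (b p) (fst p) * snd p)"
    by metis
  \<comment> \<open>One polynomial for all cusps and all poles: for a given pair the surplus factors
    are polynomials in a translate of \<open>x\<close> and create no new poles.\<close>
  define B where "B = prod b pairs"
  have B: "\<exists>B'. B = B' * b p" if "p \<in> pairs" for p
    unfolding B_def using prod.remove[OF fin that, of b] by (metis mult.commute)
  have Ban: "eval_mero (pullback M (cev B x * g)) analytic_on {z}" if M: "M \<in> SL2Z" and z: "z \<in> reduced_region" for M z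
  proof -
    have p: "(pullback M x, pullback M g) \<in> pairs" using M by (auto simp: pairs_def)
    obtain B' where B': "B = B' * b (pullback M x, pullback M g)" using B[OF p] by blast
    have d: "det M > 0" using M by (rule SL2Z_det_pos)
    have z': "Im z > 0" using z by (auto simp: reduced_region_def)
    have "pullback M (cev B x * g) = cev B' (pullback M x) * (cev (b (pullback M x, pullback M g)) (pullback M x) * pullback M g)"
      by (simp add: pullback_times[OF d] pullback_cev[OF d] B' cev_mult mult.assoc)
    thus ?thesis
      using b(2)[OF p z] analytic_on_subset[OF xan[OF M], of "{z}"] z'
      by (simp add: analytic_times_at cev_analytic_at)
  qed
  have "eval_mero (cev B x * g) analytic_on uhp"
  proof (subst analytic_on_analytic_at, intro ballI)
    fix z assume "z \<in> uhp"
    hence z: "Im z > 0" by simp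
    obtain M where M: "M \<in> SL2Z" "moebius_map M z \<in> reduced_region"
      using SL2Z_reduce[OF z] by (auto simp: reduced_region_def)
    obtain N where N: "N \<in> SL2Z" "N ** M = mat 1"
      using SL2Z_inverse[OF M(1)] by metis
    have "pullback M (pullback N (cev B x * g)) = cev B x * g"
      using pullback_mult_SL2Z[OF N(1) M(1)] N(2) pullback_mat_1 by metis
    thus "eval_mero (cev B x * g) analytic_on {z}"
      using pullback_analytic[OF SL2Z_det_pos[OF M(1)] Ban[OF N(1) M(2)] z] by simp
  qed
  moreover have "growth_le 0 (pullback (mat2 (of_int a) (of_int b') (of_int c) (of_int d)) (cev B x * g))"
    if "a * d - b' * c = 1" "gcd c 60 \<notin> {4, 60}" for a b' c d :: int
  proof -
    define M where "M = mat2 (of_int a) (of_int b') (of_int c) (of_int d)"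
    have M: "M \<in> SL2Z" unfolding M_def by (rule SL2Z_I[OF that(1)])
    have gx: "growth_le 0 (pullback M x)" unfolding M_def by (rule xR(4)[OF that])
    have p: "(pullback M x, pullback M g) \<in> pairs" using M by (auto simp: pairs_def)
    obtain B' where B': "B = B' * b (pullback M x, pullback M g)" using B[OF p] by blast
    have d: "det M > 0" using M by (rule SL2Z_det_pos)
    have "pullback M (cev B x * g) = cev B' (pullback M x) * (cev (b (pullback M x, pullback M g)) (pullback M x) * pullback M g)"
      by (simp add: pullback_times[OF d] pullback_cev[OF d] B' cev_mult mult.assoc)
    moreover have "growth_le (0 + 0) \<dots>"
      using b(3)[OF p] gx by (intro growth_le_times cev_growth_0) auto
    ultimately show ?thesis
      unfolding M_def by simp
  qed
  moreover have "cev B x * g \<in> K60"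
    by (intro K60_times K60_cev xR g)
  moreover have "pullback W0 (cev B x * g) = cev B x * g"
    by (simp add: pullback_times[OF det_W0] pullback_cev[OF det_W0] xR g)
  ultimately have "cev B x * g \<in> Rplus"
    unfolding Rplus_def by blast
  moreover have "B \<noteq> 0"
    unfolding B_def using b(1) fin by simp
  ultimately show ?thesis
    by blast
qed

section \<open>Invariant functions as rational functions of \<open>x\<close> and \<open>y\<close>\<close>

locale xy_basis =
  fixes x y :: mero_uhp
  assumes xR: "x \<in> Rplus" and yR: "y \<in> Rplus"
    and xl: "has_lead (- 2) 1 x" and yl: "has_lead (- 3) 1 y"
begin

lemma reduce_mod_const:
  assumes "ordge (- 1) g"
  shows "\<exists>p r. \<exists>G. has_q_expansion 1 (g - (cev p x + cev r x * y)) G \<and> (\<forall>k<1. k \<noteq> - 1 \<longrightarrow> fls_nth G k = 0)"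
proof -
  obtain F where F: "has_q_expansion 1 g F" "\<And>k. k < - 1 \<Longrightarrow> fls_nth F k = 0"
    using assms by (auto simp: ordge_def)
  have 1: "has_q_expansion 1 (g - mconst (fls_nth F 0)) (F - fls_const (fls_nth F 0))"
    by (intro has_q_expansion_minus has_q_expansion_mconst F) auto
  have 2: "cev [:fls_nth F 0:] x + cev 0 x * y = mconst (fls_nth F 0)"
    by (simp add: cev_pCons)
  have 3: "\<forall>k<1. k \<noteq> - 1 \<longrightarrow> fls_nth (F - fls_const (fls_nth F 0)) k = 0"
    using F(2) by auto
  show ?thesis
    using 1 3 unfolding 2[symmetric] by blast
qed

text \<open>\<open>x^k\<close> has a pole of order 2 k and \<open>x^j y\<close> one of order 2 j +
  3, so every order except 1 is the order of a monomial. The remainder may therefore keep a term in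
  q^(-1).\<close>

lemma reduce_mod_xy:
  "g \<in> Rplus \<Longrightarrow> ordge (- int n) g \<Longrightarrow>
     \<exists>p r. \<exists>G. has_q_expansion 1 (g - (cev p x + cev r x * y)) G \<and> (\<forall>k<1. k \<noteq> - 1 \<longrightarrow> fls_nth G k = 0)"
proof (induction n arbitrary: g)
  case 0
  thus ?case
    by (intro reduce_mod_const) (auto intro: ordge_mono)
next
  case (Suc n)
  show ?case
  proof (cases "n = 0")
    case True
    thus ?thesis
      using Suc.prems by (intro reduce_mod_const) auto
  next
    case False
    obtain u where u: "u \<in> Rplus" "has_lead (- int (Suc n)) 1 u"
      "\<And>a. \<exists>p r. mconst a * u = cev p x + cev r x * y"
    proof (cases "even (Suc n)")
      case True
      then obtain k where k: "Suc n = 2 * k" by blast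
      show ?thesis
      proof (rule that[of "x ^ k"])
        show "has_lead (- int (Suc n)) 1 (x ^ k)"
          using has_lead_power[OF xl, of k] k by (simp add: mult.commute)
        fix a show "\<exists>p r. mconst a * x ^ k = cev p x + cev r x * y"
          by (intro exI[of _ "Polynomial.monom a k"] exI[of _ 0]) (simp add: cev_monom)
      qed (intro Rplus_power xR)
    next
      case odd: False
      then obtain k where k: "Suc n = 2 * k + 1" by (elim oddE)
      then obtain j where j: "k = Suc j" using False by (cases k) auto
      show ?thesis
      proof (rule that[of "x ^ j * y"])
        show "has_lead (- int (Suc n)) 1 (x ^ j * y)"
          using has_lead_times[OF has_lead_power[OF xl, of j] yl] k j by (simp add: algebra_simps)
        fix a show "\<exists>p r. mconst a * (x ^ j * y) = cev p x + cev r x * y"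
          by (intro exI[of _ 0] exI[of _ "Polynomial.monom a j"]) (simp add: cev_monom)
      qed (intro Rplus_times Rplus_power xR yR)
    qed
    obtain a where a: "ordge (- int (Suc n) + 1) (g - mconst a * u)"
      using ordge_reduce[OF Suc.prems(2) u(2)] by blast
    have "g - mconst a * u \<in> Rplus"
      by (intro Rplus_minus Rplus_times Rplus_mconst Suc.prems u)
    from Suc.IH[OF this] a obtain p r G where G: "has_q_expansion 1 (g - mconst a * u - (cev p x + cev r x * y)) G"
       "\<forall>k<1. k \<noteq> - 1 \<longrightarrow> fls_nth G k = 0" by auto
    obtain p' r' where pr: "mconst a * u = cev p' x + cev r' x * y"
      using u(3) by blast
    have "g - mconst a * u - (cev p x + cev r x * y) = g - (cev (p + p') x + cev (r + r') x * y)"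
      unfolding pr by (simp add: cev_add algebra_simps)
    thus ?thesis using G by metis
  qed
qed

lemma Rplus_ordge: "g \<in> Rplus \<Longrightarrow> \<exists>n. ordge (- int n) g"
proof -
  assume "g \<in> Rplus"
  then obtain F where F: "has_q_expansion 1 g F"
    using K60_expansion_1 Rplus_K60 by blast
  have "fls_nth F k = 0" if "k < - int (nat \<bar>fls_subdegree F\<bar>)" for k
    by (rule fls_eq0_below_subdegree) (use that in auto)
  thus ?thesis unfolding ordge_def using F by blast
qed

text \<open>The remainder of \<open>g\<close> may have a simple pole, and so may that of
  \<open>x g\<close>. A linear combination of the two remainders has none, hence vanishes. If
  \<alpha> is not 0, the coefficient \<beta> - \<alpha> x of \<open>g\<close> in this relation is a
  nonzero polynomial in \<open>x\<close>, which is enough for a rational expression.\<close>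

lemma Rplus_relation:
  assumes g: "g \<in> Rplus"
  shows "\<exists>b p r. b \<noteq> 0 \<and> cev b x * g = cev p x + cev r x * y"
proof -
  have *: "\<exists>p r. \<exists>G. has_q_expansion 1 (u - (cev p x + cev r x * y)) G \<and> (\<forall>k<1. k \<noteq> - 1 \<longrightarrow> fls_nth G k = 0)"
    if "u \<in> Rplus" for u
    using Rplus_ordge[OF that] reduce_mod_xy[OF that] by blast
  obtain p r G where G: "has_q_expansion 1 (g - (cev p x + cev r x * y)) G" "\<And>k. k < 1 \<Longrightarrow> k \<noteq> - 1 \<Longrightarrow> fls_nth G k = 0"
    using *[OF g] by blast
  have xg: "x * g \<in> Rplus"
    by (intro Rplus_times xR g)
  obtain p' r' G' where G': "has_q_expansion 1 (x * g - (cev p' x + cev r' x * y)) G'" "\<And>k. k < 1 \<Longrightarrow> k \<noteq> - 1 \<Longrightarrow> fls_nth G' k = 0"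
    using *[OF xg] by blast
  define \<alpha> where "\<alpha> = fls_nth G (- 1)"
  define \<beta> where "\<beta> = fls_nth G' (- 1)"
  have inR: "u - (cev p x + cev r x * y) \<in> Rplus" if "u \<in> Rplus" for u p r
    by (intro Rplus_minus Rplus_plus Rplus_times Rplus_cev xR yR that)
  show ?thesis
  proof (cases "\<alpha> = 0")
    case True
    have "fls_nth G k = 0" if "k < 1" for k
      using G(2)[OF that] True by (cases "k = - 1") (auto simp: \<alpha>_def)
    hence "ordge 1 (g - (cev p x + cev r x * y))"
      unfolding ordge_def using G(1) by blast
    hence "g - (cev p x + cev r x * y) = 0"
      by (intro Rplus_ordge_eq_0 inR g)
    thus ?thesis
      by (intro exI[of _ 1] exI[of _ p] exI[of _ r]) (simp add: cev_1)
  next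
    case False
    define e where "e = mconst \<beta> * (g - (cev p x + cev r x * y)) - mconst \<alpha> * (x * g - (cev p' x + cev r' x * y))"
    have "has_q_expansion 1 e (fls_const \<beta> * G - fls_const \<alpha> * G')"
      unfolding e_def by (intro has_q_expansion_minus has_q_expansion_times has_q_expansion_mconst G G') auto
    moreover have "fls_nth (fls_const \<beta> * G - fls_const \<alpha> * G') k = 0" if "k < 1" for k
      using G(2)[OF that] G'(2)[OF that] by (cases "k = - 1") (auto simp: \<alpha>_def \<beta>_def)
    ultimately have "ordge 1 e"
      unfolding ordge_def by blast
    moreover have "e \<in> Rplus"
      unfolding e_def by (intro Rplus_minus Rplus_times Rplus_mconst inR g xg)
    ultimately have "e = 0"
      by (rule Rplus_ordge_eq_0[rotated])
    hence "(mconst \<beta> - mconst \<alpha> * x) * g = (mconst \<beta> * cev p x - mconst \<alpha> * cev p' x) + (mconst \<beta> * cev r x - mconst \<alpha> * cev r' x) * y"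
      unfolding e_def by (simp add: algebra_simps)
    hence "cev [:\<beta>, - \<alpha>:] x * g = cev (Polynomial.smult \<beta> p + Polynomial.smult (- \<alpha>) p') x + cev (Polynomial.smult \<beta> r + Polynomial.smult (- \<alpha>) r') x * y"
      by (simp add: cev_pCons cev_add cev_minus cev_smult mconst_hom algebra_simps)
    moreover have "[:\<beta>, - \<alpha>:] \<noteq> 0"
      using False by simp
    ultimately show ?thesis
      by blast
  qed
qed

lemma invariant_relation:
  assumes "g \<in> K60" "pullback W0 g = g"
  shows "\<exists>b p r. b \<noteq> 0 \<and> cev b x * g = cev p x + cev r x * y"
proof -
  obtain b where b: "b \<noteq> 0" "cev b x * g \<in> Rplus"
    using denominator_in_Rplus[OF xR assms] by blast
  obtain b' p r where b': "b' \<noteq> 0" "cev b' x * (cev b x * g) = cev p x + cev r x * y"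
    using Rplus_relation[OF b(2)] by blast
  show ?thesis
    using b b' by (intro exI[of _ "b' * b"] exI[of _ p] exI[of _ r]) (simp add: cev_mult mult.assoc)
qed

end

section \<open>The \<open>q\<close>-expansions of eta quotients\<close>

definition euler_fps :: "complex fps"
  where "euler_fps = fps_expansion euler_phi 0"

lemma euler_phi_has_fps_expansion: "euler_phi has_fps_expansion euler_fps"
  unfolding euler_fps_def by (rule has_fps_expansion_fps_expansion[OF _ _ holomorphic_euler_phi]) auto

lemma euler_fps_0: "fps_nth euler_fps 0 = 1"
  using has_fps_expansion_imp_0_eq_fps_nth_0[OF euler_phi_has_fps_expansion] by simp

lemma qpoch_finite_split:
  assumes "norm q < 1"
  shows "qpoch a q = (\<Prod>n<N. 1 - a * q ^ n) * qpoch (a * q ^ N) q"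
proof (induction N)
  case (Suc N)
  have "qpoch (a * q ^ N) q = (1 - a * q ^ N) * qpoch (a * q ^ Suc N) q"
    using qpoch_rec[OF assms, of "a * q ^ N"] by (simp add: mult_ac)
  thus ?case
    using Suc by simp
qed simp

text \<open>With a = q^(N + 1) this controls the tail of Euler's product. The comparison is with
  exp(2 |a|), using exp s \<le> 1 + s + s^2 and s^2 \<le> s for s = 2 |a| \<le> 1.\<close>

lemma norm_qpoch_minus_1:
  fixes a q :: complex
  assumes "norm q \<le> 1 / 2" "norm a \<le> 1 / 2"
  shows "norm (qpoch a q - 1) \<le> 4 * norm a"
proof (rule LIMSEQ_le_const2)
  show "(\<lambda>M. norm ((\<Prod>n<M. 1 - a * q ^ n) - 1)) \<longlonglongrightarrow> norm (qpoch a q - 1)"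
    using assms by (intro tendsto_intros qpoch_LIMSEQ) auto
  have "norm ((\<Prod>n<M. 1 - a * q ^ n) - 1) \<le> 4 * norm a" for M
  proof -
    have geo: "(\<Sum>n<M. (1 / 2 :: real) ^ n) \<le> 2"
      by (simp add: geometric_sum)
    have "norm ((\<Prod>n<M. 1 + (- a * q ^ n)) - 1) \<le> (\<Prod>n<M. 1 + norm (- a * q ^ n)) - 1"
      by (rule norm_prod_minus1_le_prod_minus1)
    also have "(\<Prod>n<M. 1 + norm (- a * q ^ n)) \<le> (\<Prod>n<M. exp (norm a * (1 / 2) ^ n))"
    proof (rule prod_mono, intro conjI)
      fix n
      have "1 + norm (- a * q ^ n) \<le> 1 + norm a * (1 / 2) ^ n"
        using assms by (auto simp: norm_mult norm_power intro!: mult_left_mono power_mono)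
      also have "\<dots> \<le> exp (norm a * (1 / 2) ^ n)"
        by (rule exp_ge_add_one_self)
      finally show "1 + norm (- a * q ^ n) \<le> exp (norm a * (1 / 2) ^ n)" .
    qed auto
    also have "\<dots> = exp (norm a * (\<Sum>n<M. (1 / 2) ^ n))"
      by (simp add: exp_sum[symmetric] sum_distrib_left)
    also have "\<dots> \<le> exp (norm a * 2)"
      using geo by (simp add: mult_left_mono)
    also have "\<dots> \<le> 1 + 2 * (norm a * 2)"
    proof -
      have x: "0 \<le> norm a * 2" "norm a * 2 \<le> 1"
        using assms(2) by auto
      have "(norm a * 2)\<^sup>2 \<le> norm a * 2"
        unfolding power2_eq_square by (rule mult_left_le) (use x in auto)
      thus ?thesis
        using exp_bound[OF x] by linarith
    qed
    finally show ?thesis by simp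
  qed
  thus "\<exists>N. \<forall>n\<ge>N. norm ((\<Prod>i<n. 1 - a * q ^ i) - 1) \<le> 4 * norm a"
    by blast
qed

text \<open>Once the lower coefficients are known to vanish, g(q) / q^k tends to the k-th
  coefficient, and by the bound it tends to 0.\<close>

lemma fps_nth_eq_0_of_bound:
  fixes G :: "complex fps"
  assumes g: "g has_fps_expansion G" and bd: "eventually (\<lambda>q. norm (g q) \<le> C * norm q ^ Suc N) (at 0)" and k: "k \<le> N"
  shows "fps_nth G k = 0"
  using k
proof (induction k rule: less_induct)
  case (less k)
  define H where "H = Abs_fps (\<lambda>n. fps_nth G (n + k))"
  have G: "G = fps_X ^ k * H"
    using less by (intro fps_ext) (auto simp: H_def fps_X_power_mult_nth)
  have nth: "fps_shift k G = H"
    by (rule fps_ext) (simp add: H_def)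
  have "fps_conv_radius H > 0"
    using g unfolding nth[symmetric] by (simp add: has_fps_expansion_def)
  hence H: "eval_fps H has_fps_expansion H"
    by (simp add: has_fps_expansion_def)
  have "(\<lambda>q. q ^ k * eval_fps H q) has_fps_expansion G"
    unfolding G by (intro fps_expansion_intros H)
  hence "eventually (\<lambda>q. q ^ k * eval_fps H q = g q) (nhds 0)"
    using g by (auto simp: has_fps_expansion_def elim: eventually_elim2)
  hence "eventually (\<lambda>q. q ^ k * eval_fps H q = g q) (at 0)"
    by (simp add: eventually_nhds_conv_at)
  moreover have "eventually (\<lambda>q::complex. q \<noteq> 0) (at 0)"
    by (rule eventually_neq_at_within)
  ultimately have "eventually (\<lambda>q. norm (eval_fps H q) \<le> C * norm q ^ (Suc N - k)) (at 0)"
    using bd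
  proof eventually_elim
    case (elim q)
    have "norm q ^ k * norm (eval_fps H q) \<le> norm q ^ k * (C * norm q ^ (Suc N - k))"
      using elim(1,3) less.prems unfolding elim(1)[symmetric]
      by (simp add: norm_mult norm_power mult.left_commute power_add[symmetric] del: power_Suc)
    thus ?case using elim(2) by (simp add: mult_le_cancel_left_pos)
  qed
  moreover have "((\<lambda>q::complex. C * norm q ^ (Suc N - k)) \<longlongrightarrow> C * norm (0 :: complex) ^ (Suc N - k)) (at 0)"
    by (intro tendsto_intros)
  hence "((\<lambda>q::complex. C * norm q ^ (Suc N - k)) \<longlongrightarrow> 0) (at 0)"
    using less.prems by (simp add: zero_power)
  ultimately have "(eval_fps H \<longlongrightarrow> 0) (at 0)"
    by (rule Lim_null_comparison)
  moreover have "(eval_fps H \<longlongrightarrow> eval_fps H 0) (at 0)"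
    using has_fps_expansion_imp_continuous[OF H] by (simp add: continuous_within)
  ultimately have "eval_fps H 0 = 0"
    by (intro LIM_unique)
  thus ?case
    by (simp add: eval_fps_at_0 H_def)
qed

text \<open>The factors beyond the N-th multiply the finite product by 1 + O(q^(N + 1)), which
  cannot affect the coefficients up to q^N.\<close>

lemma euler_fps_nth:
  assumes "k \<le> N"
  shows "fps_nth euler_fps k = fps_nth (\<Prod>n<N. 1 - fps_X ^ Suc n) k"
proof -
  define P where "P = (\<lambda>q::complex. \<Prod>n<N. 1 - q ^ Suc n)"
  define PF :: "complex fps" where "PF = (\<Prod>n<N. 1 - fps_X ^ Suc n)"
  have P: "P has_fps_expansion PF"
    unfolding P_def PF_def by (intro fps_expansion_intros)
  have "(\<lambda>q. euler_phi q - P q) has_fps_expansion euler_fps - PF"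
    by (intro fps_expansion_intros P euler_phi_has_fps_expansion)
  moreover have "eventually (\<lambda>q. norm (euler_phi q - P q) \<le> 2 ^ N * 4 * norm q ^ Suc N) (at 0)"
  proof -
    have "eventually (\<lambda>q::complex. q \<in> ball 0 (1 / 2)) (at 0)"
      by (intro eventually_at_in_open') auto
    thus ?thesis
    proof eventually_elim
      case (elim q)
      have q: "norm q \<le> 1 / 2" "norm q < 1" using elim by auto
      have "norm q ^ Suc N \<le> (1 / 2) ^ Suc N"
        using q by (intro power_mono) auto
      also have "\<dots> \<le> (1 / 2) ^ 1"
        by (intro power_decreasing) auto
      finally have "norm (qpoch (q ^ Suc N) q - 1) \<le> 4 * norm (q ^ Suc N)"
        using q by (intro norm_qpoch_minus_1) (auto simp: norm_power norm_mult)
      moreover have "euler_phi q - P q = P q * (qpoch (q ^ Suc N) q - 1)"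
        using qpoch_finite_split[OF q(2), of q N] by (simp add: euler_phi_def P_def algebra_simps)
      moreover have "norm (P q) \<le> 2 ^ N"
      proof -
        have "norm (P q) \<le> (\<Prod>n<N. 2)"
          unfolding P_def prod_norm[symmetric]
        proof (intro prod_mono conjI)
          fix n
          have "norm q ^ Suc n \<le> 1" using q by (intro power_le_one) auto
          thus "norm (1 - q ^ Suc n) \<le> 2"
            using norm_triangle_ineq4[of 1 "q ^ Suc n"] by (simp add: norm_power norm_mult)
        qed auto
        thus ?thesis by simp
      qed
      ultimately show ?case
        by (simp add: norm_mult norm_power mult.assoc mult_mono)
    qed
  qed
  ultimately have "fps_nth (euler_fps - PF) k = 0"
    by (rule fps_nth_eq_0_of_bound) fact
  thus ?thesis by (simp add: PF_def)
qed

lemma euler_fps_int: "fps_nth euler_fps k \<in> \<int>"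
proof -
  have "fps_nth (\<Prod>n<N. 1 - fps_X ^ Suc n :: complex fps) k \<in> \<int>" for N k
    by (induction N arbitrary: k) (auto simp: algebra_simps fps_X_power_mult_right_nth fps_X_power_mult_nth simp del: power_Suc intro!: Ints_diff)
  thus ?thesis using euler_fps_nth[of k k] by simp
qed

text \<open>The sign of \<open>e\<close> selects Euler's series or its inverse, so only natural
  powers of series occur. The fractional power of q belonging to eta is left out here and collected
  in \<open>eta_quot_q\<close>.\<close>

definition eta_fps :: "nat \<Rightarrow> int \<Rightarrow> complex fps"
  where "eta_fps \<delta> e = fps_compose (if e \<ge> 0 then euler_fps else inverse euler_fps) (fps_X ^ \<delta>) ^ nat \<bar>e\<bar>"

definition quot_fps :: "(nat \<times> int) list \<Rightarrow> complex fps"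
  where "quot_fps r = prod_list (map (\<lambda>(\<delta>, e). eta_fps \<delta> e) r)"

lemma eta_fps_expansion:
  assumes "\<delta> > 0"
  shows "(\<lambda>q. euler_phi (q ^ \<delta>) powi e) has_fps_expansion eta_fps \<delta> e"
proof (cases "e \<ge> 0")
  case True
  have "(euler_phi \<circ> (\<lambda>q. q ^ \<delta>)) has_fps_expansion fps_compose euler_fps (fps_X ^ \<delta>)"
    using assms by (intro has_fps_expansion_compose euler_phi_has_fps_expansion fps_expansion_intros) auto
  hence "(\<lambda>q. (euler_phi \<circ> (\<lambda>q. q ^ \<delta>)) q ^ nat e) has_fps_expansion eta_fps \<delta> e"
    unfolding eta_fps_def using True by (simp add: o_def) (rule has_fps_expansion_power)
  thus ?thesis using True by (simp add: power_int_def)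
next
  case False
  have "((\<lambda>q. inverse (euler_phi q)) \<circ> (\<lambda>q. q ^ \<delta>)) has_fps_expansion fps_compose (inverse euler_fps) (fps_X ^ \<delta>)"
    using assms euler_fps_0 by (intro has_fps_expansion_compose has_fps_expansion_inverse euler_phi_has_fps_expansion fps_expansion_intros) auto
  hence "(\<lambda>q. ((\<lambda>q. inverse (euler_phi q)) \<circ> (\<lambda>q. q ^ \<delta>)) q ^ nat \<bar>e\<bar>) has_fps_expansion eta_fps \<delta> e"
    unfolding eta_fps_def using False by (simp add: o_def) (rule has_fps_expansion_power)
  thus ?thesis using False by (simp add: power_int_def)
qed

text \<open>Since gcd(0, \<delta>) = \<delta>, the value of \<open>eta_quot_ord\<close> at c = 0 is
  the sum of e \<delta> / 24, the exponent of q in front of the product.\<close>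

lemma eta_quot_q:
  "eta_quot r \<tau> = exp (2 * of_real pi * \<i> * \<tau> * of_real (eta_quot_ord r 0)) * (\<Prod>(\<delta>, e)\<leftarrow>r. euler_phi (to_q \<tau> ^ \<delta>) powi e)"
proof (induction r)
  case (Cons p r)
  obtain \<delta> e where p: "p = (\<delta>, e)" by force
  have 1: "eta_quot_ord ((\<delta>, e) # r) 0 = of_int e * of_nat \<delta> / 24 + eta_quot_ord r 0"
    by (cases "\<delta> = 0") (simp_all add: eta_quot_ord_def power2_eq_square)
  have "eta (of_nat \<delta> * \<tau>) powi e = exp (of_real pi * \<i> * (of_nat \<delta> * \<tau>) / 12) powi e * euler_phi (to_q \<tau> ^ \<delta>) powi e"
    by (simp add: eta_def power_int_mult_distrib to_q_power)
  also have "exp (of_real pi * \<i> * (of_nat \<delta> * \<tau>) / 12) powi e = exp (of_int e * (of_real pi * \<i> * (of_nat \<delta> * \<tau>) / 12))"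
    by (simp add: exp_power_int)
  also have "of_int e * (of_real pi * \<i> * (of_nat \<delta> * \<tau>) / 12) = 2 * of_real pi * \<i> * \<tau> * of_real (of_int e * of_nat \<delta> / 24)"
    by simp
  finally show ?case
    using Cons.IH unfolding p eta_quot_Cons 1 by (simp add: exp_add distrib_left mult_ac)
qed (simp add: eta_quot_ord_def)

lemma quot_fps_expansion:
  assumes "\<forall>\<delta>\<in>fst ` set r. \<delta> > 0"
  shows "(\<lambda>q. \<Prod>(\<delta>, e)\<leftarrow>r. euler_phi (q ^ \<delta>) powi e) has_fps_expansion quot_fps r"
  using assms
proof (induction r)
  case (Cons p r)
  obtain \<delta> e where p: "p = (\<delta>, e)" by force
  show ?case
    using Cons by (auto simp: p quot_fps_def intro!: has_fps_expansion_mult eta_fps_expansion)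
qed (auto simp: quot_fps_def)

lemma eta_quot_meromorphic: "\<forall>\<delta>\<in>fst ` set r. \<delta> > 0 \<Longrightarrow> eta_quot r meromorphic_on uhp"
  by (intro analytic_on_imp_meromorphic_on) (simp add: analytic_on_open[OF open_uhp] holomorphic_eta_quot)

lemma eta_quot_analytic_at:
  assumes "\<forall>\<delta>\<in>fst ` set r. \<delta> > 0" "Im z > 0"
  shows "eta_quot r analytic_on {z}"
  by (rule analytic_on_subset[of _ uhp]) (use assms in \<open>auto simp: analytic_on_open[OF open_uhp] holomorphic_eta_quot\<close>)

lemma eval_eta_quot:
  assumes "\<forall>\<delta>\<in>fst ` set r. \<delta> > 0" "Im z > 0"
  shows "eval_mero (mero_of (eta_quot r)) z = eta_quot r z"
  by (intro eval_mero_of_analytic eta_quot_meromorphic eta_quot_analytic_at assms)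

lemma eta_quot_q_expansion:
  assumes r: "\<forall>\<delta>\<in>fst ` set r. \<delta> > 0" and s: "eta_quot_ord r 0 = of_int s"
  shows "has_q_expansion 1 (mero_of (eta_quot r)) (fls_shift (- s) (fps_to_fls (quot_fps r)))"
proof -
  define g where "g = (\<lambda>q. \<Prod>(\<delta>, e)\<leftarrow>r. euler_phi (q ^ \<delta>) powi e)"
  have "g has_laurent_expansion fps_to_fls (quot_fps r)"
    unfolding g_def by (intro has_laurent_expansion_fps quot_fps_expansion r)
  hence "(\<lambda>q. g q * q powi s) has_laurent_expansion fls_shift (- s) (fps_to_fls (quot_fps r))"
    by (rule has_laurent_expansion_shift)
  hence F: "fls_conv_radius (fls_shift (- s) (fps_to_fls (quot_fps r))) > 0"
    "eventually (\<lambda>q. eval_fls (fls_shift (- s) (fps_to_fls (quot_fps r))) q = g q * q powi s) (at 0)"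
    by (auto simp: has_laurent_expansion_def)
  have "eventually (\<lambda>z. eval_fls (fls_shift (- s) (fps_to_fls (quot_fps r))) (exp (2 * of_real pi * \<i> * z / of_nat 1)) =
      g (exp (2 * of_real pi * \<i> * z / of_nat 1)) * exp (2 * of_real pi * \<i> * z / of_nat 1) powi s) (filtercomap Im at_top)"
    using eventually_compose_filterlim[OF F(2) filterlim_q[of 1]] by simp
  hence "eventually (\<lambda>z. eval_mero (mero_of (eta_quot r)) z = eval_fls (fls_shift (- s) (fps_to_fls (quot_fps r))) (exp (2 * of_real pi * \<i> * z / of_nat 1))) (filtercomap Im at_top)"
    using eventually_upper
  proof eventually_elim
    case (elim z)
    have "eval_mero (mero_of (eta_quot r)) z = exp (2 * of_real pi * \<i> * z * of_int s) * g (to_q z)"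
      using eval_eta_quot[OF r elim(2)] unfolding eta_quot_q s g_def by simp
    also have "exp (2 * of_real pi * \<i> * z * of_int s) = to_q z powi s"
      by (simp add: to_q_def exp_power_int mult_ac)
    finally show ?case
      unfolding elim(1) by (simp add: to_q_def mult.commute)
  qed
  thus ?thesis
    using F(1) unfolding has_q_expansion_def by blast
qed

section \<open>Computing with truncated integral expansions\<close>

definition starts :: "complex fps \<Rightarrow> int list \<Rightarrow> bool"
  where "starts A xs \<longleftrightarrow> (\<forall>i<length xs. fps_nth A i = of_int (xs ! i))"

definition tmul :: "int list \<Rightarrow> int list \<Rightarrow> int list"
  where "tmul xs ys = map (\<lambda>k. \<Sum>i\<leftarrow>[0..<Suc k]. xs ! i * ys ! (k - i)) [0..<length xs]"

definition spread :: "nat \<Rightarrow> int list \<Rightarrow> int list"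
  where "spread \<delta> xs = map (\<lambda>k. if \<delta> dvd k then xs ! (k div \<delta>) else 0) [0..<length xs]"

definition euler_step :: "nat \<Rightarrow> int list \<Rightarrow> int list"
  where "euler_step n xs = map (\<lambda>k. xs ! k - (if k \<ge> Suc n then xs ! (k - Suc n) else 0)) [0..<length xs]"

lemma length_tmul [simp]: "length (tmul xs ys) = length xs"
  by (simp add: tmul_def)

lemma length_spread [simp]: "length (spread \<delta> xs) = length xs"
  by (simp add: spread_def)

lemma length_euler_step [simp]: "length (euler_step n xs) = length xs"
  by (simp add: euler_step_def)

lemma nth_tmul: "k < length xs \<Longrightarrow> tmul xs ys ! k = (\<Sum>i=0..k. xs ! i * ys ! (k - i))"
  by (simp add: tmul_def interv_sum_list_conv_sum_set_nat atLeast0LessThan lessThan_Suc_atMost atLeast0AtMost del: upt_Suc)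

lemma starts_mult:
  assumes "starts A xs" "starts B ys" "length ys = length xs"
  shows "starts (A * B) (tmul xs ys)"
  using assms by (auto simp: starts_def fps_mult_nth nth_tmul intro!: sum.cong)

lemma starts_compose:
  assumes "starts A xs"
  shows "starts (fps_compose A (fps_X ^ \<delta>)) (spread \<delta> xs)"
  using assms le_less_trans[OF div_le_dividend] by (auto simp: starts_def spread_def fps_nth_compose_X_power)

lemma starts_1: "starts 1 (1 # replicate m 0)"
  by (auto simp: starts_def nth_Cons split: nat.splits)

text \<open>An inverse series is not computed but certified: a proposed list is multiplied back and
  the product compared with 1.\<close>

lemma starts_inverse:
  assumes A: "starts A xs" and zs: "tmul xs zs = 1 # replicate m 0" "length zs = length xs" and A0: "fps_nth A 0 \<noteq> 0"
  shows "starts (inverse A) zs"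
proof -
  define Z :: "complex fps" where "Z = Abs_fps (\<lambda>i. of_int (zs ! i))"
  have "starts Z zs" by (simp add: starts_def Z_def)
  from starts_mult[OF A this zs(2)] have AZ: "starts (A * Z) (1 # replicate m 0)"
    unfolding zs(1) .
  have m: "length xs = Suc m"
    using arg_cong[OF zs(1), of length] by simp
  have "fps_nth (inverse A) i = of_int (zs ! i)" if i: "i < length zs" for i
  proof -
    have "Z = inverse A * (A * Z)"
      using A0 by (simp add: mult.assoc[symmetric] inverse_mult_eq_1)
    hence "fps_nth Z i = (\<Sum>j=0..i. fps_nth (inverse A) j * fps_nth (A * Z) (i - j))"
      by (metis fps_mult_nth)
    also have "\<dots> = (\<Sum>j=0..i. if j = i then fps_nth (inverse A) j else 0)"
      using AZ i m zs(2) by (intro sum.cong) (auto simp: starts_def nth_Cons split: nat.splits)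
    also have "\<dots> = fps_nth (inverse A) i"
      by simp
    finally show ?thesis by (simp add: Z_def)
  qed
  thus ?thesis by (simp add: starts_def)
qed

lemma starts_euler_step:
  assumes "starts A xs"
  shows "starts (A * (1 - fps_X ^ Suc n)) (euler_step n xs)"
  using assms by (auto simp: starts_def euler_step_def algebra_simps fps_X_power_mult_nth fps_X_power_mult_right_nth simp del: power_Suc)

lemma starts_euler_prod: "starts (\<Prod>n<N. 1 - fps_X ^ Suc n) (fold euler_step [0..<N] (1 # replicate m 0))"
proof (induction N)
  case 0
  show ?case using starts_1[of m] by simp
next
  case (Suc N)
  from starts_euler_step[OF this, of N] show ?case by (simp add: mult.commute)
qed

text \<open>Euler's pentagonal number series and the partition numbers, from q^0 to q^10. For a pole
  of order 8 this window ends at q^2.\<close>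

definition euler_list :: "int list" where "euler_list = [1, -1, -1, 0, 0, 1, 0, 1, 0, 0, 0]"
definition part_list :: "int list" where "part_list = [1, 1, 2, 3, 5, 7, 11, 15, 22, 30, 42]"

lemma starts_euler_fps: "starts euler_fps euler_list"
proof -
  have "fold euler_step [0..<10] (1 # replicate 10 0) = euler_list"
    by code_simp
  hence "starts (\<Prod>n<10. 1 - fps_X ^ Suc n) euler_list"
    using starts_euler_prod[of 10 10] by metis
  thus ?thesis
    using euler_fps_nth[of _ 10] by (auto simp: starts_def euler_list_def)
qed

lemma starts_inverse_euler_fps: "starts (inverse euler_fps) part_list"
proof (rule starts_inverse[OF starts_euler_fps])
  show "tmul euler_list part_list = 1 # replicate 10 0"
    by code_simp
qed (simp_all add: euler_list_def part_list_def euler_fps_0)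

primrec eta_list :: "(nat \<times> int) list \<Rightarrow> int list" where
  "eta_list [] = 1 # replicate 10 0"
| "eta_list (p # r) = (tmul (spread (fst p) (if snd p \<ge> 0 then euler_list else part_list)) ^^ nat \<bar>snd p\<bar>) (eta_list r)"

lemma starts_quot_fps: "starts (quot_fps r) (eta_list r) \<and> length (eta_list r) = 11"
proof (induction r)
  case Nil
  show ?case using starts_1[of 10] by (simp add: quot_fps_def)
next
  case (Cons p r)
  obtain \<delta> e where p: "p = (\<delta>, e)" by force
  define B where "B = fps_compose (if e \<ge> 0 then euler_fps else inverse euler_fps) (fps_X ^ \<delta>)"
  define ys where "ys = spread \<delta> (if e \<ge> 0 then euler_list else part_list)"
  have ys: "length ys = 11" by (simp add: ys_def euler_list_def part_list_def)
  have B: "starts B ys"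
    unfolding B_def ys_def using starts_compose[OF starts_euler_fps] starts_compose[OF starts_inverse_euler_fps] by simp
  have "starts (B ^ n * quot_fps r) ((tmul ys ^^ n) (eta_list r)) \<and> length ((tmul ys ^^ n) (eta_list r)) = 11" for n
  proof (induction n)
    case 0
    thus ?case using Cons by simp
  next
    case (Suc n)
    thus ?case using starts_mult[OF B, of "B ^ n * quot_fps r"] ys by (simp add: mult.assoc)
  qed
  from this[of "nat \<bar>e\<bar>"] show ?case
    by (simp add: p B_def ys_def quot_fps_def eta_fps_def)
qed

section \<open>Rationality of the coefficients\<close>

lemma fps_inverse_Rats:
  fixes A :: "complex fps"
  assumes "\<And>k. fps_nth A k \<in> \<rat>" "fps_nth A 0 \<noteq> 0"
  shows "fps_nth (inverse A) k \<in> \<rat>"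
proof (induction k rule: less_induct)
  case (less k)
  have "fps_nth (inverse A * A) k = fps_nth (inverse A) k * fps_nth A 0 + (\<Sum>i<k. fps_nth (inverse A) i * fps_nth A (k - i))"
    by (simp add: fps_mult_nth atLeast0AtMost lessThan_Suc_atMost[symmetric])
  also have "inverse A * A = 1"
    using assms(2) by (rule inverse_mult_eq_1)
  finally have "fps_nth (inverse A) k = (fps_nth 1 k - (\<Sum>i<k. fps_nth (inverse A) i * fps_nth A (k - i))) / fps_nth A 0"
    using assms(2) by (simp add: field_simps)
  also have "\<dots> \<in> \<rat>"
    using assms(1) less by (intro Rats_divide Rats_diff Rats_sum Rats_mult) auto
  finally show ?case .
qed

lemma fps_mult_Rats:
  fixes A B :: "complex fps"
  assumes "\<And>k. fps_nth A k \<in> \<rat>" "\<And>k. fps_nth B k \<in> \<rat>"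
  shows "fps_nth (A * B) k \<in> \<rat>"
  using assms by (auto simp: fps_mult_nth intro!: Rats_sum Rats_mult)

lemma quot_fps_Rats: "fps_nth (quot_fps r) k \<in> \<rat>"
proof (induction r arbitrary: k)
  case Nil
  thus ?case by (simp add: quot_fps_def)
next
  case (Cons p r)
  obtain \<delta> e where p: "p = (\<delta>, e)" by force
  have E: "fps_nth euler_fps k \<in> \<rat>" for k
    using euler_fps_int[of k] Ints_subset_Rats by blast
  define B where "B = fps_compose (if e \<ge> 0 then euler_fps else inverse euler_fps) (fps_X ^ \<delta>)"
  have B: "fps_nth B k \<in> \<rat>" for k
    using E fps_inverse_Rats[OF E] euler_fps_0 by (auto simp: B_def fps_nth_compose_X_power)
  have "fps_nth (B ^ n) k \<in> \<rat>" for n k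
    by (induction n arbitrary: k) (use B in \<open>auto intro!: fps_mult_Rats\<close>)
  from fps_mult_Rats[OF this Cons.IH] show ?case
    by (simp add: p quot_fps_def eta_fps_def B_def)
qed

definition rational_expansion :: "mero_uhp \<Rightarrow> bool"
  where "rational_expansion f \<longleftrightarrow> (\<exists>F. has_q_expansion 1 f F \<and> (\<forall>n. fls_nth F n \<in> \<rat>))"

lemma rational_expansion_eta_quot:
  assumes "\<forall>\<delta>\<in>fst ` set r. \<delta> > 0" "eta_quot_ord r 0 = of_int s"
  shows "rational_expansion (mero_of (eta_quot r))"
  unfolding rational_expansion_def using eta_quot_q_expansion[OF assms] quot_fps_Rats
  by (intro exI[of _ "fls_shift (- s) (fps_to_fls (quot_fps r))"]) auto

lemma rational_expansion_mconst: "c \<in> \<rat> \<Longrightarrow> rational_expansion (mconst c)"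
  unfolding rational_expansion_def using has_q_expansion_mconst[of 1 c]
  by (intro exI[of _ "fls_const c"]) auto

lemma rational_expansion_plus: "rational_expansion f \<Longrightarrow> rational_expansion g \<Longrightarrow> rational_expansion (f + g)"
  unfolding rational_expansion_def using has_q_expansion_plus[of 1 f _ g]
  by (metis Rats_add fls_plus_nth zero_less_one)

lemma rational_expansion_minus: "rational_expansion f \<Longrightarrow> rational_expansion g \<Longrightarrow> rational_expansion (f - g)"
  unfolding rational_expansion_def using has_q_expansion_minus[of 1 f _ g]
  by (metis Rats_diff fls_minus_nth zero_less_one)

lemma rational_expansion_times:
  assumes "rational_expansion f" "rational_expansion g"
  shows "rational_expansion (f * g)"
proof -
  obtain F G where F: "has_q_expansion 1 f F" "\<And>n. fls_nth F n \<in> \<rat>" and G: "has_q_expansion 1 g G" "\<And>n. fls_nth G n \<in> \<rat>"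
    using assms by (auto simp: rational_expansion_def)
  have "has_q_expansion 1 (f * g) (F * G)"
    by (intro has_q_expansion_times F G) auto
  moreover have "fls_nth (F * G) n \<in> \<rat>" for n
    by (auto simp: fls_times_nth(1) intro!: Rats_sum Rats_mult F G)
  ultimately show ?thesis
    unfolding rational_expansion_def by blast
qed

lemma rational_expansion_inverse:
  assumes "rational_expansion f"
  shows "rational_expansion (inverse f)"
proof (cases "f = 0")
  case True
  thus ?thesis using assms by simp
next
  case False
  obtain F where F: "has_q_expansion 1 f F" "\<And>n. fls_nth F n \<in> \<rat>"
    using assms by (auto simp: rational_expansion_def)
  have "F \<noteq> 0"
    using has_q_expansion_0_iff[OF F(1)] False by simp
  have "fps_nth (inverse (fls_base_factor_to_fps F)) k \<in> \<rat>" for k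
    using F(2) \<open>F \<noteq> 0\<close> by (intro fps_inverse_Rats) auto
  hence "fls_nth (inverse F) n \<in> \<rat>" for n
    by (simp add: fls_inverse_def)
  thus ?thesis
    unfolding rational_expansion_def using has_q_expansion_inverse[OF F(1)] by auto
qed

text \<open>\<open>qs n f xs\<close>: the expansion of \<open>f\<close> begins with \<open>xs ! 0 * q ^ n + xs ! 1 * q ^ (n + 1) + \<dots>\<close>, to eleven terms.\<close>

definition qs :: "int \<Rightarrow> mero_uhp \<Rightarrow> int list \<Rightarrow> bool"
  where "qs n f xs \<longleftrightarrow> length xs = 11 \<and> (\<exists>A. has_q_expansion 1 f (fls_shift (- n) (fps_to_fls A)) \<and> starts A xs)"

lemma qsI: "has_q_expansion 1 f (fls_shift (- n) (fps_to_fls A)) \<Longrightarrow> starts A xs \<Longrightarrow> length xs = 11 \<Longrightarrow> qs n f xs"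
  unfolding qs_def by blast

lemma qs_times:
  assumes "qs n f xs" "qs m g ys"
  shows "qs (n + m) (f * g) (tmul xs ys)"
proof -
  obtain A B where A: "has_q_expansion 1 f (fls_shift (- n) (fps_to_fls A))" "starts A xs"
    and B: "has_q_expansion 1 g (fls_shift (- m) (fps_to_fls B))" "starts B ys" and l: "length xs = 11" "length ys = 11"
    using assms by (auto simp: qs_def)
  have "has_q_expansion 1 (f * g) (fls_shift (- n) (fps_to_fls A) * fls_shift (- m) (fps_to_fls B))"
    by (intro has_q_expansion_times A B) auto
  also have "fls_shift (- n) (fps_to_fls A) * fls_shift (- m) (fps_to_fls B) = fls_shift (- (n + m)) (fps_to_fls (A * B))"
    by (simp add: fls_times_both_shifted_simp fls_times_fps_to_fls)
  finally show ?thesis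
    by (rule qsI) (use starts_mult[OF A(2) B(2)] l in auto)
qed

lemma qs_plus:
  assumes "qs n f xs" "qs n g ys"
  shows "qs n (f + g) (map2 (+) xs ys)"
proof -
  obtain A B where A: "has_q_expansion 1 f (fls_shift (- n) (fps_to_fls A))" "starts A xs"
    and B: "has_q_expansion 1 g (fls_shift (- n) (fps_to_fls B))" "starts B ys" and l: "length xs = 11" "length ys = 11"
    using assms by (auto simp: qs_def)
  have "has_q_expansion 1 (f + g) (fls_shift (- n) (fps_to_fls A) + fls_shift (- n) (fps_to_fls B))"
    by (intro has_q_expansion_plus A B) auto
  also have "fls_shift (- n) (fps_to_fls A) + fls_shift (- n) (fps_to_fls B) = fls_shift (- n) (fps_to_fls (A + B))"
    by (intro fls_eqI) auto
  finally show ?thesis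
    by (rule qsI) (use A(2) B(2) l in \<open>auto simp: starts_def\<close>)
qed

lemma qs_const: "qs 0 (mconst (of_int c)) (c # replicate 10 0)"
proof -
  have "fls_const (of_int c) = fls_shift (- 0) (fps_to_fls (fps_const (of_int c :: complex)))"
    by simp
  with has_q_expansion_mconst[of 1 "of_int c"]
  have "has_q_expansion 1 (mconst (of_int c)) (fls_shift (- 0) (fps_to_fls (fps_const (of_int c))))"
    by metis
  moreover have "starts (fps_const (of_int c)) (c # replicate 10 0)"
    by (auto simp: starts_def nth_Cons split: nat.splits)
  moreover have "length (c # replicate 10 0) = 11"
    by simp
  ultimately show ?thesis
    by (rule qsI)
qed

lemma qs_scale:
  assumes "qs n f xs"
  shows "qs n (mconst (of_int c) * f) (map (times c) xs)"
proof -
  obtain A where A: "has_q_expansion 1 f (fls_shift (- n) (fps_to_fls A))" "starts A xs" and l: "length xs = 11"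
    using assms by (auto simp: qs_def)
  have "has_q_expansion 1 (mconst (of_int c) * f) (fls_const (of_int c) * fls_shift (- n) (fps_to_fls A))"
    by (intro has_q_expansion_times has_q_expansion_mconst A) auto
  also have "fls_const (of_int c) * fls_shift (- n) (fps_to_fls A) = fls_shift (- n) (fps_to_fls (fps_const (of_int c) * A))"
    by (intro fls_eqI) auto
  finally show ?thesis
    by (rule qsI) (use A(2) l in \<open>auto simp: starts_def\<close>)
qed

text \<open>Aligns expansions with different leading exponents so that their lists can be added. The
  last \<open>k\<close> known coefficients fall out of the window.\<close>

definition pad :: "nat \<Rightarrow> int list \<Rightarrow> int list"
  where "pad k xs = take 11 (replicate k 0 @ xs)"

lemma qs_pad:
  assumes "qs n f xs" "m = n - int k"
  shows "qs m f (pad k xs)"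
proof -
  obtain A where A: "has_q_expansion 1 f (fls_shift (- n) (fps_to_fls A))" "starts A xs" and l: "length xs = 11"
    using assms by (auto simp: qs_def)
  have "fls_shift (- n) (fps_to_fls A) = fls_shift (- m) (fps_to_fls (fps_X ^ k * A))"
    by (intro fls_eqI) (auto simp: assms(2) fps_X_power_mult_nth nat_less_iff intro!: arg_cong[of _ _ "fps_nth A"])
  moreover have "starts (fps_X ^ k * A) (pad k xs)"
    using A(2) l by (auto simp: starts_def pad_def fps_X_power_mult_nth nth_append)
  ultimately show ?thesis
    using A(1) l by (auto simp: qs_def pad_def)
qed

lemma qs_ordge:
  assumes "qs n f xs" "take k xs = replicate k 0" "k \<le> 11"
  shows "ordge (n + int k) f"
proof -
  obtain A where A: "has_q_expansion 1 f (fls_shift (- n) (fps_to_fls A))" "starts A xs" and l: "length xs = 11"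
    using assms by (auto simp: qs_def)
  have "fls_nth (fls_shift (- n) (fps_to_fls A)) i = 0" if "i < n + int k" for i
  proof (cases "i < n")
    case False
    hence i: "nat (i - n) < k" using that by auto
    have "xs ! nat (i - n) = 0"
      using i arg_cong[OF assms(2), of "\<lambda>ys. ys ! nat (i - n)"] by simp
    thus ?thesis using A(2) i l assms(3) False by (auto simp: starts_def)
  qed auto
  thus ?thesis unfolding ordge_def using A(1) by blast
qed

lemma qs_lead:
  assumes "qs n f (1 # xs)"
  shows "has_lead n 1 f"
proof -
  obtain A where A: "has_q_expansion 1 f (fls_shift (- n) (fps_to_fls A))" "starts A (1 # xs)"
    using assms by (auto simp: qs_def)
  have A0: "fps_nth A 0 = 1" using A(2) by (auto simp: starts_def)
  define F where "F = fls_shift (- n) (fps_to_fls A)"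
  have n: "fls_nth F n = 1" "\<And>k. k < n \<Longrightarrow> fls_nth F k = 0"
    using A0 by (auto simp: F_def)
  hence "fls_subdegree F = n"
    by (intro fls_subdegree_eqI) auto
  thus ?thesis
    unfolding has_lead_def using A(1) n(1) by (auto simp: F_def)
qed

section \<open>Eta quotients of level 60 as elements of the function field\<close>

lemma growth_eta_quot:
  fixes a b c d :: int
  assumes det: "a * d - b * c = 1" and r: "\<forall>\<delta>\<in>fst ` set r. \<delta> > 0" "sum_list (map snd r) = 0"
  shows "growth_le (- (2 * pi * eta_quot_ord r c)) (pullback (mat2 (of_int a) (of_int b) (of_int c) (of_int d)) (mero_of (eta_quot r)))"
proof -
  define M where "M = mat2 (of_int a) (of_int b) (of_int c) (of_int d)"
  have M: "det M > 0" unfolding M_def det_mat2 using det by (simp flip: of_int_mult of_int_diff)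
  obtain K where K: "K > 0" "((\<lambda>\<tau>. norm (eta_quot r ((of_int a * \<tau> + of_int b) / (of_int c * \<tau> + of_int d))) *
            exp (2 * pi * eta_quot_ord r c * Im \<tau>)) \<longlongrightarrow> K) (filtercomap Im at_top)"
    using norm_eta_quot_growth[OF det r] by blast
  have "eventually (\<lambda>\<tau>. norm (eta_quot r ((of_int a * \<tau> + of_int b) / (of_int c * \<tau> + of_int d))) *
            exp (2 * pi * eta_quot_ord r c * Im \<tau>) < K + 1) (filtercomap Im at_top)"
    using order_tendstoD(2)[OF K(2)] by simp
  then obtain Y where Y: "\<And>\<tau>. Im \<tau> \<ge> Y \<Longrightarrow> norm (eta_quot r ((of_int a * \<tau> + of_int b) / (of_int c * \<tau> + of_int d))) *
            exp (2 * pi * eta_quot_ord r c * Im \<tau>) < K + 1"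
    unfolding eventually_filtercomap_at_top_linorder by blast
  show ?thesis
    unfolding M_def[symmetric]
  proof (rule growth_leI[where Y = "max Y 0" and C = "K + 1"])
    fix z assume z: "Im z > max Y 0"
    hence z0: "Im z > 0" by simp
    have Mz: "Im (moebius_map M z) > 0" using moebius_in_uhp[OF M, of z] z0 by simp
    have "eval_mero (pullback M (mero_of (eta_quot r))) z = eta_quot r (moebius_map M z)"
      using eval_pullback[OF M, of z] eval_eta_quot[OF r(1) Mz] z0 by simp
    hence e: "eval_mero (pullback M (mero_of (eta_quot r))) z = eta_quot r ((of_int a * z + of_int b) / (of_int c * z + of_int d))"
      unfolding M_def moebius_mat2 by simp
    have "norm (eta_quot r ((of_int a * z + of_int b) / (of_int c * z + of_int d))) * exp (2 * pi * eta_quot_ord r c * Im z) \<le> K + 1"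
      using Y[of z] z by simp
    thus "norm (eval_mero (pullback M (mero_of (eta_quot r))) z) \<le> (K + 1) * exp (- (2 * pi * eta_quot_ord r c) * Im z)"
      unfolding e by (simp add: exp_minus field_simps)
  next
    show "eval_mero (pullback M (mero_of (eta_quot r))) analytic_on {z. Im z > max Y 0}"
    proof (subst analytic_on_analytic_at, intro ballI)
      fix z assume "z \<in> {z. Im z > max Y 0}"
      hence z: "Im z > 0" by simp
      have Mz: "Im (moebius_map M z) > 0" using moebius_in_uhp[OF M, of z] z by simp
      have "eval_mero (mero_of (eta_quot r)) analytic_on {moebius_map M z}"
        by (rule analytic_cong_uhp[of uhp _ "eta_quot r"]) (use Mz open_uhp in \<open>auto intro!: eval_eta_quot eta_quot_analytic_at r\<close>)
      thus "eval_mero (pullback M (mero_of (eta_quot r))) analytic_on {z}"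
        using z M by (intro pullback_analytic) auto
    qed
  qed
qed

text \<open>This is 1440 = 24 * 60 times the order at a cusp with denominator \<open>c\<close>: an
  integer that can be evaluated, and one that depends on \<open>c\<close> only through gcd(c,
  60).\<close>

definition ord60 :: "(nat \<times> int) list \<Rightarrow> int \<Rightarrow> int"
  where "ord60 r c = (\<Sum>(\<delta>, e)\<leftarrow>r. e * (gcd c (int \<delta>))\<^sup>2 * (60 div int \<delta>))"

lemma eta_quot_ord_ord60:
  assumes "fst ` set r \<subseteq> divisors60"
  shows "eta_quot_ord r c = of_int (ord60 r (gcd c 60)) / 1440"
  using assms
proof (induction r)
  case Nil
  show ?case by (simp add: eta_quot_ord_def ord60_def)
next
  case (Cons p r)
  obtain \<delta> e where p: "p = (\<delta>, e)" by force
  have \<delta>: "\<delta> \<in> divisors60" using Cons.prems by (simp add: p)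
  hence d: "int \<delta> dvd 60" by (auto simp: divisors60_def)
  have g: "gcd (gcd c 60) (int \<delta>) = gcd c (int \<delta>)"
    using gcd_proj2_if_dvd_int[OF d] by (simp add: gcd.assoc)
  have "1 / (24 * of_nat \<delta>) = (of_int (60 div int \<delta>) / 1440 :: real)"
    using \<delta> by (auto simp: divisors60_def)
  hence T: "of_int (e * (gcd c (int \<delta>))\<^sup>2) / (24 * of_nat \<delta>) = (of_int (e * (gcd c (int \<delta>))\<^sup>2 * (60 div int \<delta>)) / 1440 :: real)"
    unfolding of_int_mult[of "e * (gcd c (int \<delta>))\<^sup>2"] by (metis times_divide_eq_right mult.right_neutral)
  have r: "fst ` set r \<subseteq> divisors60" using Cons.prems by simp
  have "eta_quot_ord (p # r) c = of_int (e * (gcd c (int \<delta>))\<^sup>2) / (24 * of_nat \<delta>) + eta_quot_ord r c"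
    by (simp add: eta_quot_ord_def p)
  also have "\<dots> = of_int (e * (gcd c (int \<delta>))\<^sup>2 * (60 div int \<delta>)) / 1440 + of_int (ord60 r (gcd c 60)) / 1440"
    by (simp only: T Cons.IH[OF r])
  also have "\<dots> = of_int (e * (gcd c (int \<delta>))\<^sup>2 * (60 div int \<delta>) + ord60 r (gcd c 60)) / 1440"
    by (simp only: of_int_add add_divide_distrib)
  also have "e * (gcd c (int \<delta>))\<^sup>2 * (60 div int \<delta>) + ord60 r (gcd c 60) = ord60 (p # r) (gcd c 60)"
    by (simp add: ord60_def p g)
  finally show ?case .
qed

lemma gcd_60_cases: "gcd c (60 :: int) \<in> set [1, 2, 3, 4, 5, 6, 10, 12, 15, 20, 30, 60]"
proof -
  have eq: "filter (\<lambda>g. g dvd 60) [1..60 :: int] = [1, 2, 3, 4, 5, 6, 10, 12, 15, 20, 30, 60]"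
    by code_simp
  have "gcd c 60 \<le> 60"
    by (rule zdvd_imp_le) auto
  moreover have "1 \<le> gcd c 60"
    using gcd_pos_int[of c 60] by linarith
  ultimately have "gcd c (60 :: int) \<in> set (filter (\<lambda>g. g dvd 60) [1..60 :: int])"
    by simp
  thus ?thesis
    by (simp only: eq)
qed

lemma quot_divisors60: "fst ` set quotX \<subseteq> divisors60" "fst ` set quotY \<subseteq> divisors60" "fst ` set quotU \<subseteq> divisors60"
  by (auto simp: quotX_def quotY_def quotU_def divisors60_def)

lemma quot_weight: "sum_list (map snd quotX) = 0" "sum_list (map snd quotY) = 0" "sum_list (map snd quotU) = 0"
  by (simp_all add: quotX_def quotY_def quotU_def)

lemma eta_quot_K60:
  assumes r: "r \<in> {quotX, quotY, quotU}"
  shows "mero_of (eta_quot r) \<in> K60"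
proof -
  have pos: "\<forall>\<delta>\<in>fst ` set r. \<delta> > 0" and wt: "sum_list (map snd r) = 0"
    using r quot_weight divisors60_pos quot_divisors60 by blast+
  have "pullback M (mero_of (eta_quot r)) = mero_of (eta_quot r)" if M: "M \<in> Gamma0 60" for M
  proof (rule mero_eqI_uhp)
    fix z assume z: "Im z > 0"
    obtain a b c d :: int where M': "M = mat2 (of_int a) (of_int b) (of_int (int 60 * c)) (of_int d)" "a * d - b * (int 60 * c) = 1"
      using Gamma0_E[OF M] by metis
    have dM: "det M > 0" using M Gamma0_SL2Z SL2Z_det_pos by blast
    have Mz: "Im (moebius_map M z) > 0" using moebius_in_uhp[OF dM, of z] z by simp
    have "eval_mero (pullback M (mero_of (eta_quot r))) z = eta_quot r (moebius_map M z)"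
      using eval_pullback[OF dM, of z] eval_eta_quot[OF pos Mz] z by simp
    also have "moebius_map M z = (of_int a * z + of_int b) / (of_int (60 * c) * z + of_int d)"
      unfolding M' moebius_mat2 by simp
    also have "eta_quot r \<dots> = eta_quot r z"
      by (rule eta_quot_invariant[OF r z]) (use M' in simp)
    finally show "eval_mero (pullback M (mero_of (eta_quot r))) z = eval_mero (mero_of (eta_quot r)) z"
      using eval_eta_quot[OF pos z] by simp
  qed
  moreover have "\<exists>\<rho>. growth_le \<rho> (pullback M (mero_of (eta_quot r)))" if "M \<in> SL2Z" for M
    using SL2Z_E[OF that] growth_eta_quot[OF _ pos wt] by metis
  ultimately show ?thesis
    unfolding K60_iff by blast
qed

lemma eta_quot_analytic_uhp:
  assumes "\<forall>\<delta>\<in>fst ` set r. \<delta> > 0"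
  shows "eval_mero (mero_of (eta_quot r)) analytic_on uhp"
proof (subst analytic_on_analytic_at, intro ballI)
  fix z assume z: "z \<in> uhp"
  show "eval_mero (mero_of (eta_quot r)) analytic_on {z}"
    by (rule analytic_cong_uhp[of uhp _ "eta_quot r"]) (use z open_uhp in \<open>auto intro!: eval_eta_quot eta_quot_analytic_at assms\<close>)
qed

lemma pullback_W0_eta_quot:
  assumes r: "fst ` set r \<subseteq> divisors60" "sum_list (map snd r) = 0"
  obtains c where "pullback W0 (mero_of (eta_quot r)) = mconst c * mero_of (eta_quot (map (map_prod swap15 id) r))"
    "\<And>\<tau>. Im \<tau> > 0 \<Longrightarrow> eta_quot r ((15 * \<tau> - 4) / (60 * \<tau> - 15)) = c * eta_quot (map (map_prod swap15 id) r) \<tau>"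
proof -
  obtain c where c: "\<And>\<tau>. Im \<tau> > 0 \<Longrightarrow> eta_quot r ((15 * \<tau> - 4) / (60 * \<tau> - 15)) = c * eta_quot (map (map_prod swap15 id) r) \<tau>"
    using eta_quot_atkin_lehner[OF r] by blast
  have r': "fst ` set (map (map_prod swap15 id) r) \<subseteq> divisors60"
    using r(1) swap15_divisors60 by fastforce
  have "pullback W0 (mero_of (eta_quot r)) = mconst c * mero_of (eta_quot (map (map_prod swap15 id) r))"
  proof (rule mero_eqI_uhp)
    fix z assume z: "Im z > 0"
    have Mz: "Im (moebius_map W0 z) > 0" using moebius_in_uhp[OF det_W0, of z] z by simp
    have "eval_mero (pullback W0 (mero_of (eta_quot r))) z = c * eta_quot (map (map_prod swap15 id) r) z"
      using eval_pullback[OF det_W0, of z] eval_eta_quot[OF divisors60_pos[OF r(1)] Mz] z c[OF z] by (simp add: moebius_W0)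
    also have "\<dots> = eval_mero (mconst c) z * eval_mero (mero_of (eta_quot (map (map_prod swap15 id) r))) z"
      using eval_eta_quot[OF divisors60_pos[OF r'] z] z by (simp add: eval_mconst)
    also have "\<dots> = eval_mero (mconst c * mero_of (eta_quot (map (map_prod swap15 id) r))) z"
      using z by (intro eval_times_at[symmetric] mconst_analytic analytic_on_subset[OF eta_quot_analytic_uhp[OF divisors60_pos[OF r']]]) auto
    finally show "eval_mero (pullback W0 (mero_of (eta_quot r))) z = eval_mero (mconst c * mero_of (eta_quot (map (map_prod swap15 id) r))) z" .
  qed
  thus ?thesis using c that by blast
qed

lemma eta_quot_W0_invariant:
  assumes r: "r \<in> {quotX, quotY}"
  shows "pullback W0 (mero_of (eta_quot r)) = mero_of (eta_quot r)"
proof -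
  have d: "fst ` set r \<subseteq> divisors60" and wt: "sum_list (map snd r) = 0"
    using r quot_weight quot_divisors60 by blast+
  obtain c where c: "pullback W0 (mero_of (eta_quot r)) = mconst c * mero_of (eta_quot (map (map_prod swap15 id) r))"
    "\<And>\<tau>. Im \<tau> > 0 \<Longrightarrow> eta_quot r ((15 * \<tau> - 4) / (60 * \<tau> - 15)) = c * eta_quot (map (map_prod swap15 id) r) \<tau>"
    using pullback_W0_eta_quot[OF d wt] by metis
  have X: "map (map_prod swap15 id) quotX = [(10, 1), (6, 1), (60, -1), (4, -1)]"
    by code_simp
  have Y: "map (map_prod swap15 id) quotY = [(30, 1), (5, 1), (3, 1), (20, 1), (12, 1), (2, 1), (60, -2), (10, -1), (6, -1), (4, -2)]"
    by code_simp
  have eq: "eta_quot (map (map_prod swap15 id) r) = eta_quot r"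
  proof
    fix \<tau>
    show "eta_quot (map (map_prod swap15 id) r) \<tau> = eta_quot r \<tau>"
      using r unfolding insert_iff empty_iff
    proof (elim disjE)
      assume "r = quotX"
      thus ?thesis by (simp only: X) (simp add: quotX_def mult_ac)
    next
      assume "r = quotY"
      thus ?thesis by (simp only: Y) (simp add: quotY_def mult_ac)
    qed auto
  qed
  \<comment> \<open>The fixed point of \<open>w\<close> in the upper half-plane, a root of 60 z^2 -
    30 z + 4. The quotient does not vanish there, so evaluating the law at this point forces the
    constant to be 1.\<close>
  define \<tau> where "\<tau> = Complex (1 / 4) (sqrt 60 / 120)"
  have \<tau>: "Im \<tau> > 0" by (simp add: \<tau>_def)
  have "\<tau> * (60 * \<tau> - 15) = 15 * \<tau> - 4"
    by (simp add: \<tau>_def complex_eq_iff algebra_simps)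
  moreover have "60 * \<tau> - 15 \<noteq> 0"
    using \<tau> by (auto simp: complex_eq_iff)
  ultimately have "(15 * \<tau> - 4) / (60 * \<tau> - 15) = \<tau>"
    by (simp add: divide_eq_eq)
  hence "c = 1"
    using c(2)[OF \<tau>] eta_quot_nonzero[OF \<tau> divisors60_pos[OF d]] by (simp add: eq)
  thus ?thesis using c(1) by (simp add: eq)
qed

text \<open>The image of u under \<open>w\<close> up to a constant. It has order 0 at \<infinity>,
  so of the two cusps exchanged by \<open>w\<close> only \<infinity> is a pole of u.\<close>

definition quotV :: "(nat \<times> int) list"
  where "quotV = [(30, 1), (20, 6), (12, 2), (2, 3), (60, -2), (10, -3), (6, -1), (4, -6)]"

lemma swap_quotU: "map (map_prod swap15 id) quotU = quotV"
  by code_simp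

lemma quotV_simps: "fst ` set quotV \<subseteq> divisors60" "sum_list (map snd quotV) = 0"
  by (auto simp: quotV_def divisors60_def)

lemma ord60_nonneg:
  "\<forall>g\<in>set [1, 2, 3, 5, 6, 10, 12, 15, 20, 30]. ord60 quotX g \<ge> 0 \<and> ord60 quotY g \<ge> 0 \<and> ord60 quotU g \<ge> 0 \<and> ord60 quotV g \<ge> 0"
  by code_simp

lemma growth_0_eta_quot:
  fixes a b c d :: int
  assumes r: "r \<in> {quotX, quotY, quotU, quotV}" and "a * d - b * c = 1" "gcd c 60 \<notin> {4, 60}"
  shows "growth_le 0 (pullback (mat2 (of_int a) (of_int b) (of_int c) (of_int d)) (mero_of (eta_quot r)))"
proof -
  have d: "fst ` set r \<subseteq> divisors60" and wt: "sum_list (map snd r) = 0"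
    using r quot_weight quot_divisors60 quotV_simps by blast+
  have "gcd c 60 \<in> set [1, 2, 3, 5, 6, 10, 12, 15, 20, 30]"
    using gcd_60_cases[of c] assms(3) by auto
  hence "ord60 r (gcd c 60) \<ge> 0"
    using ord60_nonneg r by blast
  hence "eta_quot_ord r c \<ge> 0"
    by (simp add: eta_quot_ord_ord60[OF d])
  thus ?thesis
    by (intro growth_le_mono[OF growth_eta_quot[OF assms(2) divisors60_pos[OF d] wt]]) simp
qed

section \<open>The functions \<open>x\<close>, \<open>y\<close>, \<open>t\<close>\<close>

text \<open>With the bare eta quotient X = x + 1 the cubic would be X^3 - 2 X^2 + 1, and the shift
  by -1 removes its constant term. In \<open>gen_y\<close> the shift by 1 cancels the constant term
  of the expansion and with it any term linear in \<open>y\<close>.\<close>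

definition gen_x :: mero_uhp where "gen_x = mero_of (eta_quot quotX) + mconst (of_int (- 1))"
definition gen_y :: mero_uhp where "gen_y = mero_of (eta_quot quotY) + mconst (of_int 1)"
definition gen_u :: mero_uhp where "gen_u = mero_of (eta_quot quotU)"
definition gen_v :: mero_uhp where "gen_v = mero_of (eta_quot quotV)"
definition gen_t :: mero_uhp where "gen_t = gen_u - pullback W0 gen_u"

lemma eta_quot_Rplus:
  assumes "r \<in> {quotX, quotY}"
  shows "mero_of (eta_quot r) \<in> Rplus"
  unfolding Rplus_def
proof (intro CollectI conjI allI impI)
  show "mero_of (eta_quot r) \<in> K60" by (rule eta_quot_K60) (use assms in auto)
  show "pullback W0 (mero_of (eta_quot r)) = mero_of (eta_quot r)" by (rule eta_quot_W0_invariant[OF assms])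
  show "eval_mero (mero_of (eta_quot r)) analytic_on uhp"
    by (rule eta_quot_analytic_uhp) (use assms divisors60_pos quot_divisors60 in blast)
  show "growth_le 0 (pullback (mat2 (of_int a) (of_int b) (of_int c) (of_int d)) (mero_of (eta_quot r)))"
    if "a * d - b * c = 1" "gcd c 60 \<notin> {4, 60}" for a b c d :: int
    by (rule growth_0_eta_quot[OF _ that]) (use assms in auto)
qed

lemma gen_xy_Rplus: "gen_x \<in> Rplus" "gen_y \<in> Rplus"
  unfolding gen_x_def gen_y_def by (intro Rplus_plus Rplus_mconst eta_quot_Rplus; simp)+

lemma gen_u_K60: "gen_u \<in> K60"
  unfolding gen_u_def by (rule eta_quot_K60) simp

lemma qs_eta_quot:
  assumes "fst ` set r \<subseteq> divisors60" "eta_quot_ord r 0 = of_int s" "eta_list r = xs"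
  shows "qs s (mero_of (eta_quot r)) xs"
  using eta_quot_q_expansion[OF divisors60_pos[OF assms(1)] assms(2)] starts_quot_fps[of r] assms(3)
  by (intro qsI) auto

lemma eta_lists:
  "eta_list quotX = [1, 0, 0, 0, 1, 0, -1, 0, 2, 0, -2]"
  "eta_list quotY = [1, 0, -1, -1, 1, 0, -2, 0, 4, 0, -5]"
  "eta_list quotU = [1, 0, -1, 0, 1, 0, 1, 0, 0, 0, 0]"
  "eta_list quotV = [1, 0, -3, 0, 6, 0, -12, 0, 24, 0, -42]"
  by code_simp+

definition list_x :: "int list" where "list_x = [1, 0, -1, 0, 1, 0, -1, 0, 2, 0, -2]"
definition list_y :: "int list" where "list_y = [1, 0, -1, 0, 1, 0, -2, 0, 4, 0, -5]"

lemma ord60_at_infinity: "ord60 quotX 60 = -2880" "ord60 quotY 60 = -4320" "ord60 quotU 60 = -11520" "ord60 quotV 60 = 0"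
  by code_simp+

lemma qs_gens:
  "qs (- 2) gen_x list_x" "qs (- 3) gen_y list_y" "qs (- 8) gen_u (eta_list quotU)" "qs 0 gen_v (eta_list quotV)"
proof -
  have "qs (- 2) (mero_of (eta_quot quotX)) (eta_list quotX)" "qs (- 3) (mero_of (eta_quot quotY)) (eta_list quotY)"
    and uv: "qs (- 8) gen_u (eta_list quotU)" "qs 0 gen_v (eta_list quotV)"
    unfolding gen_u_def gen_v_def
    by (rule qs_eta_quot; simp add: quot_divisors60 quotV_simps eta_quot_ord_ord60 ord60_at_infinity)+
  hence "qs (- 2) gen_x (map2 (+) (eta_list quotX) (pad 2 ((- 1) # replicate 10 0)))"
    "qs (- 3) gen_y (map2 (+) (eta_list quotY) (pad 3 (1 # replicate 10 0)))"
    unfolding gen_x_def gen_y_def by (intro qs_plus qs_pad[OF qs_const]; simp)+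
  moreover have "map2 (+) (eta_list quotX) (pad 2 ((- 1) # replicate 10 0)) = list_x"
    "map2 (+) (eta_list quotY) (pad 3 (1 # replicate 10 0)) = list_y"
    unfolding eta_lists by code_simp+
  ultimately show "qs (- 2) gen_x list_x" "qs (- 3) gen_y list_y"
    by simp_all
  show "qs (- 8) gen_u (eta_list quotU)" "qs 0 gen_v (eta_list quotV)"
    by (rule uv)+
qed

lemma gen_xy_lead: "has_lead (- 2) 1 gen_x" "has_lead (- 3) 1 gen_y"
  by (rule qs_lead[OF qs_gens(1)[unfolded list_x_def]] qs_lead[OF qs_gens(2)[unfolded list_y_def]])+

lemma gen_xy_equation: "gen_y ^ 2 = gen_x ^ 3 + gen_x ^ 2 - gen_x"
proof -
  have s: "\<And>c f. mconst (of_int c) * f = mconst (of_int c) * f" by simp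
  define D where "D = gen_y * gen_y + mconst (of_int (- 1)) * (gen_x * (gen_x * gen_x)) +
     mconst (of_int (- 1)) * (gen_x * gen_x) + mconst (of_int 1) * gen_x"
  have 1: "qs (- 6) (gen_y * gen_y) (tmul list_y list_y)"
    using qs_times[OF qs_gens(2) qs_gens(2)] by simp
  have 2: "qs (- 4) (gen_x * gen_x) (tmul list_x list_x)"
    using qs_times[OF qs_gens(1) qs_gens(1)] by simp
  have 3: "qs (- 6) (gen_x * (gen_x * gen_x)) (tmul list_x (tmul list_x list_x))"
    using qs_times[OF qs_gens(1) 2] by simp
  have 4: "qs (- 6) (gen_x * gen_x) (pad 2 (tmul list_x list_x))"
    by (rule qs_pad[OF 2]) simp
  have 5: "qs (- 6) gen_x (pad 4 list_x)"
    by (rule qs_pad[OF qs_gens(1)]) simp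
  have "qs (- 6) D (map2 (+) (map2 (+) (map2 (+) (tmul list_y list_y) (map (times (- 1)) (tmul list_x (tmul list_x list_x))))
      (map (times (- 1)) (pad 2 (tmul list_x list_x)))) (map (times 1) (pad 4 list_x)))"
    unfolding D_def by (intro qs_plus qs_scale 1 3 4 5)
  moreover have "map2 (+) (map2 (+) (map2 (+) (tmul list_y list_y) (map (times (- 1)) (tmul list_x (tmul list_x list_x))))
      (map (times (- 1)) (pad 2 (tmul list_x list_x)))) (map (times 1) (pad 4 list_x)) = replicate 11 0"
    by code_simp
  ultimately have "qs (- 6) D (replicate 11 0)"
    by simp
  \<comment> \<open>The list covers the exponents -6 to 4, which includes all exponents up to 0 that
    \<open>Rplus_ordge_eq_0\<close> asks about.\<close>
  hence "ordge (- 6 + int 11) D"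
    by (rule qs_ordge) auto
  hence "ordge 1 D"
    by (rule ordge_mono) simp
  moreover have "D \<in> Rplus"
    unfolding D_def by (intro Rplus_plus Rplus_times Rplus_mconst gen_xy_Rplus)
  ultimately have "D = 0"
    by (intro Rplus_ordge_eq_0)
  thus ?thesis
    by (simp add: D_def mconst_hom power2_eq_square power3_eq_cube algebra_simps)
qed

lemma gen_u_W0: "\<exists>k. pullback W0 gen_u = mconst k * gen_v"
  using pullback_W0_eta_quot[OF quot_divisors60(3) quot_weight(3)] unfolding swap_quotU gen_u_def gen_v_def by metis

lemma gen_v_analytic: "eval_mero gen_v analytic_on uhp" "eval_mero gen_u analytic_on uhp"
  unfolding gen_v_def gen_u_def by (intro eta_quot_analytic_uhp divisors60_pos quotV_simps quot_divisors60)+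

text \<open>u is not invariant under \<open>w\<close>, but the elementary symmetric functions of u
  and w(u) are. Both factors are eta quotients up to a constant, so regularity at the remaining
  cusps is inherited from them.\<close>

lemma gen_u_sum_prod_Rplus:
  "gen_u + pullback W0 gen_u \<in> Rplus" "gen_u * pullback W0 gen_u \<in> Rplus"
proof -
  obtain k where k: "pullback W0 gen_u = mconst k * gen_v"
    using gen_u_W0 by blast
  have an: "eval_mero (mconst k * gen_v) analytic_on uhp"
    by (intro analytic_times mconst_analytic gen_v_analytic open_uhp) auto
  have gr: "growth_le 0 (pullback (mat2 (of_int a) (of_int b) (of_int c) (of_int d)) gen_u)"
      "growth_le 0 (pullback (mat2 (of_int a) (of_int b) (of_int c) (of_int d)) (mconst k * gen_v))"
      and dM: "det (mat2 (of_int a) (of_int b) (of_int c) (of_int d)) > 0"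
    if "a * d - b * c = 1" "gcd c 60 \<notin> {4, 60}" for a b c d :: int
  proof -
    show "growth_le 0 (pullback (mat2 (of_int a) (of_int b) (of_int c) (of_int d)) gen_u)"
      unfolding gen_u_def by (rule growth_0_eta_quot[OF _ that]) auto
    show dM: "det (mat2 (of_int a) (of_int b) (of_int c) (of_int d)) > 0"
      by (rule SL2Z_det_pos[OF SL2Z_I[OF that(1)]])
    have "growth_le 0 (pullback (mat2 (of_int a) (of_int b) (of_int c) (of_int d)) gen_v)"
      unfolding gen_v_def by (rule growth_0_eta_quot[OF _ that]) auto
    from growth_le_times[OF growth_le_mconst[of k] this]
    show "growth_le 0 (pullback (mat2 (of_int a) (of_int b) (of_int c) (of_int d)) (mconst k * gen_v))"
      by (simp add: pullback_times[OF dM] pullback_mconst[OF dM])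
  qed
  show "gen_u + pullback W0 gen_u \<in> Rplus"
    unfolding Rplus_def
  proof (intro CollectI conjI allI impI)
    show "gen_u + pullback W0 gen_u \<in> K60" by (intro K60_plus K60_W0 gen_u_K60)
    show "pullback W0 (gen_u + pullback W0 gen_u) = gen_u + pullback W0 gen_u"
      by (simp add: pullback_plus[OF det_W0] W0_W0)
    show "eval_mero (gen_u + pullback W0 gen_u) analytic_on uhp"
      unfolding k by (intro analytic_plus gen_v_analytic an open_uhp) auto
    fix a b c d :: int assume *: "a * d - b * c = 1" "gcd c 60 \<notin> {4, 60}"
    show "growth_le 0 (pullback (mat2 (of_int a) (of_int b) (of_int c) (of_int d)) (gen_u + pullback W0 gen_u))"
      unfolding k pullback_plus[OF dM[OF *]] by (intro growth_le_plus gr *)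
  qed
  show "gen_u * pullback W0 gen_u \<in> Rplus"
    unfolding Rplus_def
  proof (intro CollectI conjI allI impI)
    show "gen_u * pullback W0 gen_u \<in> K60" by (intro K60_times K60_W0 gen_u_K60)
    show "pullback W0 (gen_u * pullback W0 gen_u) = gen_u * pullback W0 gen_u"
      by (simp add: pullback_times[OF det_W0] W0_W0)
    show "eval_mero (gen_u * pullback W0 gen_u) analytic_on uhp"
      unfolding k by (intro analytic_times gen_v_analytic mconst_analytic open_uhp) auto
    fix a b c d :: int assume *: "a * d - b * c = 1" "gcd c 60 \<notin> {4, 60}"
    show "growth_le 0 (pullback (mat2 (of_int a) (of_int b) (of_int c) (of_int d)) (gen_u * pullback W0 gen_u))"
      unfolding k pullback_times[OF dM[OF *]] using growth_le_times[OF gr[OF *]] by (simp add: pullback_times[OF dM[OF *]])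
  qed
qed

lemma qs_gen_x_powers:
  "qs (- 4) (gen_x ^ 2) (tmul list_x list_x)" "qs (- 6) (gen_x ^ 3) (tmul list_x (tmul list_x list_x))"
  "qs (- 8) (gen_x ^ 4) (tmul (tmul list_x list_x) (tmul list_x list_x))"
proof -
  show 2: "qs (- 4) (gen_x ^ 2) (tmul list_x list_x)"
    using qs_times[OF qs_gens(1) qs_gens(1)] by (simp add: power2_eq_square)
  show "qs (- 6) (gen_x ^ 3) (tmul list_x (tmul list_x list_x))"
    using qs_times[OF qs_gens(1) 2] by (simp add: power2_eq_square power3_eq_cube mult.assoc)
  show "qs (- 8) (gen_x ^ 4) (tmul (tmul list_x list_x) (tmul list_x list_x))"
    using qs_times[OF 2 2] by (simp flip: power_add)
qed

text \<open>
  The constant in \<open>w(u) = \<kappa> v\<close> is read off the coefficient of \<open>q\<^sup>2\<close>: the function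
  \<open>u + \<kappa> v - (x\<^sup>4 + 3 x\<^sup>3 + 3 x - 6 + \<kappa>)\<close> vanishes, and its expansion begins with \<open>(15 - 3 \<kappa>) q\<^sup>2\<close>.
\<close>

lemma gen_u_sum:
  "pullback W0 gen_u = mconst 5 * gen_v"
  "gen_u + pullback W0 gen_u = gen_x ^ 4 + 3 * gen_x ^ 3 + 3 * gen_x - 1"
proof -
  obtain k where k: "pullback W0 gen_u = mconst k * gen_v"
    using gen_u_W0 by blast
  \<comment> \<open>The part of the relation with known integral coefficients. The constant 6 makes
    its expansion begin at q^2, as that of v - 1 does, so that the unknown multiple of v - 1 can be
    determined there.\<close>
  define D where "D = gen_u + mconst (of_int (- 1)) * gen_x ^ 4 + mconst (of_int (- 3)) * gen_x ^ 3 +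
     mconst (of_int (- 3)) * gen_x + mconst (of_int 6)"
  have "qs (- 8) D (map2 (+) (map2 (+) (map2 (+) (map2 (+) (eta_list quotU) (map (times (- 1)) (tmul (tmul list_x list_x) (tmul list_x list_x))))
      (map (times (- 3)) (pad 2 (tmul list_x (tmul list_x list_x))))) (map (times (- 3)) (pad 6 list_x))) (pad 8 (6 # replicate 10 0)))"
    unfolding D_def
    by (intro qs_plus qs_scale qs_gens qs_gen_x_powers qs_pad[OF qs_gen_x_powers(2)] qs_pad[OF qs_gens(1)] qs_pad[OF qs_const]; simp)
  moreover have "map2 (+) (map2 (+) (map2 (+) (map2 (+) (eta_list quotU) (map (times (- 1)) (tmul (tmul list_x list_x) (tmul list_x list_x))))
      (map (times (- 3)) (pad 2 (tmul list_x (tmul list_x list_x))))) (map (times (- 3)) (pad 6 list_x))) (pad 8 (6 # replicate 10 0)) =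
      replicate 10 0 @ [15]"
    unfolding eta_lists by code_simp
  ultimately have "qs (- 8) D (replicate 10 0 @ [15])"
    by simp
  then obtain A where A: "has_q_expansion 1 D (fls_shift 8 (fps_to_fls A))" "starts A (replicate 10 0 @ [15])"
    by (auto simp: qs_def)
  have A': "fps_nth A i = 0" if "i < 10" for i
    using A(2) that by (auto simp: starts_def nth_append)
  have A10: "fps_nth A 10 = 15"
    using A(2) by (auto simp: starts_def nth_append)
  have "qs 0 (gen_v + mconst (of_int (- 1))) (map2 (+) (eta_list quotV) ((- 1) # replicate 10 0))"
    by (intro qs_plus qs_gens qs_const)
  moreover have "map2 (+) (eta_list quotV) ((- 1) # replicate 10 0) = [0, 0, -3, 0, 6, 0, -12, 0, 24, 0, -42]"
    unfolding eta_lists by code_simp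
  ultimately obtain B where B: "has_q_expansion 1 (gen_v + mconst (of_int (- 1))) (fps_to_fls B)" "starts B [0, 0, -3, 0, 6, 0, -12, 0, 24, 0, -42]"
    by (auto simp: qs_def)
  have B': "fps_nth B 0 = 0" "fps_nth B 2 = - 3"
    using B(2) by (auto simp: starts_def)
  define E where "E = D + mconst k * (gen_v + mconst (of_int (- 1)))"
  define F where "F = fls_shift 8 (fps_to_fls A) + fls_const k * fps_to_fls B"
  have E: "has_q_expansion 1 E F"
    unfolding E_def F_def by (intro has_q_expansion_plus has_q_expansion_times has_q_expansion_mconst A B) auto
  have "fls_nth F i = 0" if "i < 1" for i
    using A'[of "nat (i + 8)"] that B'(1) by (cases "i = 0") (auto simp: F_def nat_less_iff)
  hence "ordge 1 E"
    unfolding ordge_def using E by blast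
  have E': "E = gen_u + pullback W0 gen_u - (gen_x ^ 4 + mconst 3 * gen_x ^ 3 + mconst 3 * gen_x - mconst 6 + mconst k)"
    by (simp add: E_def D_def k mconst_hom algebra_simps)
  have "E \<in> Rplus"
    unfolding E' by (intro Rplus_minus Rplus_plus Rplus_times Rplus_power Rplus_mconst gen_xy_Rplus gen_u_sum_prod_Rplus)
  with \<open>ordge 1 E\<close> have "E = 0"
    by (intro Rplus_ordge_eq_0)
  hence "F = 0"
    using has_q_expansion_0_iff[OF E] by simp
  hence "fls_nth F 2 = 0" by simp
  hence k5: "k = 5"
    using A10 B'(2) by (simp add: F_def)
  show "pullback W0 gen_u = mconst 5 * gen_v"
    using k k5 by simp
  show "gen_u + pullback W0 gen_u = gen_x ^ 4 + 3 * gen_x ^ 3 + 3 * gen_x - 1"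
    using \<open>E = 0\<close> unfolding E' k5 by (simp add: mconst_numeral)
qed

lemma gen_u_prod: "gen_u * pullback W0 gen_u = 5 * gen_x ^ 4"
proof -
  \<comment> \<open>In the product u v every exponent of eta is divisible by 4, in line with its
    being a fourth power. The factor 5 of w(u) = 5 v is put back at the end.\<close>
  define D where "D = gen_u * gen_v + mconst (of_int (- 1)) * gen_x ^ 4"
  have "qs (- 8) (gen_u * gen_v) (tmul (eta_list quotU) (eta_list quotV))"
    using qs_times[OF qs_gens(3,4)] by simp
  hence "qs (- 8) D (map2 (+) (tmul (eta_list quotU) (eta_list quotV)) (map (times (- 1)) (tmul (tmul list_x list_x) (tmul list_x list_x))))"
    unfolding D_def by (intro qs_plus qs_scale qs_gen_x_powers)
  moreover have "map2 (+) (tmul (eta_list quotU) (eta_list quotV)) (map (times (- 1)) (tmul (tmul list_x list_x) (tmul list_x list_x))) = replicate 11 0"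
    unfolding eta_lists by code_simp
  ultimately have "qs (- 8) D (replicate 11 0)"
    by simp
  hence "ordge (- 8 + int 11) D"
    by (rule qs_ordge) auto
  hence "ordge 1 D"
    by (rule ordge_mono) simp
  moreover have "D = mconst (1 / 5) * (gen_u * pullback W0 gen_u) + mconst (- 1) * gen_x ^ 4"
  proof -
    have "mconst (1 / 5) * (gen_u * pullback W0 gen_u) = (mconst (1 / 5) * mconst 5) * (gen_u * gen_v)"
      unfolding gen_u_sum(1) by (simp only: ac_simps)
    also have "mconst (1 / 5) * mconst 5 = 1"
      unfolding mconst_hom(2)[symmetric] by simp
    finally have e: "mconst (1 / 5) * (gen_u * pullback W0 gen_u) = gen_u * gen_v"
      unfolding mult_1_left .
    show ?thesis
      unfolding e D_def by simp
  qed
  hence "D \<in> Rplus"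
    by (simp only:) (intro Rplus_plus Rplus_times Rplus_mconst Rplus_power gen_xy_Rplus gen_u_sum_prod_Rplus)
  ultimately have "D = 0"
    by (intro Rplus_ordge_eq_0)
  hence "gen_u * gen_v = gen_x ^ 4"
    by (simp add: D_def mconst_hom)
  thus ?thesis
    unfolding gen_u_sum(1) by (simp add: mconst_numeral mult.left_commute)
qed

lemma gen_t_equation:
  "gen_t ^ 2 = (-1 + gen_x + gen_x ^ 2) * (-1 + 4 * gen_x + gen_x ^ 2) * (1 - gen_x + 2 * gen_x ^ 2 + gen_x ^ 3 + gen_x ^ 4)"
proof -
  have "gen_t ^ 2 = (gen_u + pullback W0 gen_u) ^ 2 - 4 * (gen_u * pullback W0 gen_u)"
    by (simp add: gen_t_def power2_eq_square algebra_simps)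
  also have "\<dots> = (gen_x ^ 4 + 3 * gen_x ^ 3 + 3 * gen_x - 1) ^ 2 - 20 * gen_x ^ 4"
    unfolding gen_u_sum(2) gen_u_prod by simp
  \<comment> \<open>With s = x - 1/x the sum u + w(u) is x^2 (x + 1/x) (s + 3), and the difference
    becomes x^4 ((s^2 + 4) (s + 3)^2 - 20) = x^4 (s + 1) (s + 4) (s^2 + s + 4). The last three
    factors, multiplied by x, x and x^2, are the ones stated.\<close>
  also have "\<dots> = (-1 + gen_x + gen_x ^ 2) * (-1 + 4 * gen_x + gen_x ^ 2) * (1 - gen_x + 2 * gen_x ^ 2 + gen_x ^ 3 + gen_x ^ 4)"
    by (simp add: algebra_simps power2_eq_square power3_eq_cube power4_eq_xxxx)
  finally show ?thesis .
qed

lemma gen_t_W0: "pullback W0 gen_t = - gen_t"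
  by (simp add: gen_t_def pullback_minus[OF det_W0] W0_W0)

lemma gen_t_K60: "gen_t \<in> K60"
  unfolding gen_t_def by (intro K60_minus K60_W0 gen_u_K60)

text \<open>For t this rests on the constant in w(u) = 5 v being rational: the involution itself is
  only known to be defined over \<complex> at this point.\<close>

lemma gens_rational: "rational_expansion gen_x" "rational_expansion gen_y" "rational_expansion gen_t"
proof -
  have r: "rational_expansion (mero_of (eta_quot quotX))" "rational_expansion (mero_of (eta_quot quotY))"
    "rational_expansion gen_u" "rational_expansion gen_v"
    unfolding gen_u_def gen_v_def
    by (rule rational_expansion_eta_quot[where s = "- 2"] rational_expansion_eta_quot[where s = "- 3"]
          rational_expansion_eta_quot[where s = "- 8"] rational_expansion_eta_quot[where s = 0],
        rule divisors60_pos, simp add: quot_divisors60 quotV_simps,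
        simp add: quot_divisors60 quotV_simps eta_quot_ord_ord60 ord60_at_infinity; fail)+
  show "rational_expansion gen_x" "rational_expansion gen_y"
    unfolding gen_x_def gen_y_def by (intro rational_expansion_plus rational_expansion_mconst r; simp)+
  show "rational_expansion gen_t"
    unfolding gen_t_def gen_u_sum(1) by (intro rational_expansion_minus rational_expansion_times rational_expansion_mconst r; simp)
qed

lemma has_lead_unique: "has_lead n c f \<Longrightarrow> has_lead m d f \<Longrightarrow> n = m"
  using has_q_expansion_unique[of 1 f] unfolding has_lead_def by (metis zero_less_one)

text \<open>u has a pole of order 8 at \<infinity> while w(u) is finite and nonzero there, so they
  cannot coincide.\<close>

lemma gen_t_nonzero: "gen_t \<noteq> 0"
proof
  assume "gen_t = 0"
  hence u: "gen_u = mconst 5 * gen_v"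
    by (simp add: gen_t_def gen_u_sum(1))
  obtain A where "has_q_expansion 1 gen_v (fls_shift (- 0) (fps_to_fls A))" "starts A (eta_list quotV)"
    using qs_gens(4) by (auto simp: qs_def)
  hence "has_lead 0 1 gen_v"
    using qs_gens(4) unfolding eta_lists by (intro qs_lead)
  from has_lead_times[OF has_lead_mconst[of 5] this] have 0: "has_lead 0 5 gen_u"
    using u by simp
  have "has_lead (- 8) 1 gen_u"
    using qs_gens(3) unfolding eta_lists by (rule qs_lead)
  from has_lead_unique[OF this 0] show False
    by simp
qed

section \<open>Descent to \<open>\<rat>\<close>\<close>

lemma rational_linear_functional:
  assumes "c \<noteq> (0 :: complex)"
  obtains \<phi> :: "complex \<Rightarrow> rat" where "\<And>a b. \<phi> (a + b) = \<phi> a + \<phi> b" "\<And>r a. \<phi> (of_rat r * a) = r * \<phi> a" "\<phi> c = 1"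
proof -
  interpret V: vector_space_pair "\<lambda>(r :: rat) (c :: complex). of_rat r * c" "times :: rat \<Rightarrow> rat \<Rightarrow> rat"
    by unfold_locales (simp_all add: algebra_simps of_rat_add of_rat_mult)
  have "V.vs1.independent {c}"
    using assms by simp
  from V.linear_independent_extend[OF this, of "\<lambda>_. 1"] obtain \<phi> where \<phi>: "Vector_Spaces.linear (\<lambda>(r :: rat) (c :: complex). of_rat r * c) times \<phi>" "\<phi> c = 1"
    by auto
  interpret L: Vector_Spaces.linear "\<lambda>(r :: rat) (c :: complex). of_rat r * c" "times :: rat \<Rightarrow> rat \<Rightarrow> rat" \<phi>
    by (rule \<phi>(1))
  show ?thesis
    by (rule that[of \<phi>]) (simp_all add: L.add L.scale \<phi>(2))
qed

definition rconst :: "rat \<Rightarrow> mero_uhp"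
  where "rconst r = mconst (of_rat r)"

lemma rhom_rconst: "rhom rconst"
  by (simp add: rhom_def rconst_def of_rat_add of_rat_mult mconst_hom)

abbreviation qev :: "rat poly \<Rightarrow> mero_uhp \<Rightarrow> mero_uhp"
  where "qev \<equiv> hev rconst"

definition expansion_image :: "(complex \<Rightarrow> rat) \<Rightarrow> mero_uhp \<Rightarrow> mero_uhp \<Rightarrow> bool"
  where "expansion_image \<phi> f g \<longleftrightarrow> (\<exists>F G. has_q_expansion 1 f F \<and> has_q_expansion 1 g G \<and> (\<forall>n. fls_nth G n = of_rat (\<phi> (fls_nth F n))))"

context
  fixes \<phi> :: "complex \<Rightarrow> rat"
  assumes \<phi>: "\<And>a b. \<phi> (a + b) = \<phi> a + \<phi> b" "\<And>r a. \<phi> (of_rat r * a) = r * \<phi> a"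
begin

lemma expansion_image_plus:
  assumes "expansion_image \<phi> f g" "expansion_image \<phi> f' g'"
  shows "expansion_image \<phi> (f + f') (g + g')"
proof -
  obtain F G F' G' where F: "has_q_expansion 1 f F" "has_q_expansion 1 g G" "\<And>n. fls_nth G n = of_rat (\<phi> (fls_nth F n))"
    and F': "has_q_expansion 1 f' F'" "has_q_expansion 1 g' G'" "\<And>n. fls_nth G' n = of_rat (\<phi> (fls_nth F' n))"
    using assms by (auto simp: expansion_image_def)
  have "has_q_expansion 1 (f + f') (F + F')" "has_q_expansion 1 (g + g') (G + G')"
    by (intro has_q_expansion_plus F F'; simp)+
  moreover have "fls_nth (G + G') n = of_rat (\<phi> (fls_nth (F + F') n))" for n
    by (simp add: F F' \<phi> of_rat_add)
  ultimately show ?thesis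
    unfolding expansion_image_def by blast
qed

lemma expansion_image_unique:
  assumes "expansion_image \<phi> f g" "expansion_image \<phi> f g'"
  shows "g = g'"
proof -
  obtain F G F' G' where F: "has_q_expansion 1 f F" "has_q_expansion 1 g G" "\<And>n. fls_nth G n = of_rat (\<phi> (fls_nth F n))"
    and F': "has_q_expansion 1 f F'" "has_q_expansion 1 g' G'" "\<And>n. fls_nth G' n = of_rat (\<phi> (fls_nth F' n))"
    using assms by (auto simp: expansion_image_def)
  have "F = F'" by (rule has_q_expansion_unique[OF F(1) F'(1)]) simp
  hence GG: "G = G'" by (intro fls_eqI) (simp add: F F')
  have "has_q_expansion 1 (g - g') (G - G')"
    by (intro has_q_expansion_minus F F') simp
  thus ?thesis
    using has_q_expansion_0_iff[of 1 "g - g'"] GG by simp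
qed

text \<open>\<phi> is not multiplicative, but it commutes with multiplication by a series with
  rational coefficients. The extra factor \<open>g\<close> varies in the induction so that powers of
  \<open>x\<close> can be absorbed into it.\<close>

lemma expansion_image_hev:
  assumes "rational_expansion x" "rational_expansion g"
  shows "expansion_image \<phi> (cev p x * g) (qev (map_poly \<phi> p) x * g)"
  using assms(2)
proof (induction p arbitrary: g)
  case 0
  have 0: "\<phi> 0 = 0" using \<phi>(2)[of 0 0] by simp
  show ?case
    using has_q_expansion_mconst[of 1 0] by (auto simp: expansion_image_def 0 intro!: exI[of _ 0])
next
  case (pCons a p)
  have 0: "\<phi> 0 = 0" using \<phi>(2)[of 0 0] by simp
  obtain G where G: "has_q_expansion 1 g G" "\<And>n. fls_nth G n \<in> \<rat>"
    using pCons.prems by (auto simp: rational_expansion_def)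
  have "has_q_expansion 1 (mconst a * g) (fls_const a * G)" "has_q_expansion 1 (rconst (\<phi> a) * g) (fls_const (of_rat (\<phi> a)) * G)"
    unfolding rconst_def by (intro has_q_expansion_times has_q_expansion_mconst G; simp)+
  moreover have "fls_nth (fls_const (of_rat (\<phi> a)) * G) n = of_rat (\<phi> (fls_nth (fls_const a * G) n))" for n
  proof -
    obtain r where r: "fls_nth G n = of_rat r" using G(2)[of n] by (auto elim: Rats_cases)
    show ?thesis using \<phi>(2)[of r a] by (simp add: r of_rat_mult mult.commute)
  qed
  ultimately have 1: "expansion_image \<phi> (mconst a * g) (rconst (\<phi> a) * g)"
    unfolding expansion_image_def by blast
  have 2: "expansion_image \<phi> (cev p x * (x * g)) (qev (map_poly \<phi> p) x * (x * g))"
    by (intro pCons.IH rational_expansion_times assms pCons.prems)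
  have e1: "cev (pCons a p) x * g = mconst a * g + cev p x * (x * g)"
    by (simp add: cev_pCons algebra_simps)
  have e2: "qev (map_poly \<phi> (pCons a p)) x * g = rconst (\<phi> a) * g + qev (map_poly \<phi> p) x * (x * g)"
    by (simp add: map_poly_pCons 0 hev_pCons[OF rhom_rconst] algebra_simps)
  show ?case
    unfolding e1 e2 by (intro expansion_image_plus 1 2)
qed

end

lemma has_lead_add:
  assumes "has_lead n c f" "ordge (n + 1) g"
  shows "has_lead n c (g + f)"
proof -
  obtain F G where F: "has_q_expansion 1 f F" "fls_subdegree F = n" "fls_nth F n = c" "c \<noteq> 0"
    and G: "has_q_expansion 1 g G" "\<And>k. k < n + 1 \<Longrightarrow> fls_nth G k = 0"
    using assms by (auto simp: has_lead_def ordge_def)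
  have 1: "fls_nth (G + F) n = c" using F G by simp
  have 2: "fls_nth (G + F) k = 0" if "k < n" for k using that F(2) G(2)[of k] by simp
  have "fls_subdegree (G + F) = n"
    using 1 2 F(4) by (intro fls_subdegree_eqI) auto
  moreover have "has_q_expansion 1 (g + f) (G + F)"
    by (intro has_q_expansion_plus F G) auto
  ultimately show ?thesis
    unfolding has_lead_def using 1 F(4) by blast
qed

lemma has_lead_qev:
  assumes x: "has_lead (- 2) 1 x" and "p \<noteq> 0"
  shows "\<exists>c. has_lead (- 2 * int (Polynomial.degree p)) c (qev p x)"
  using assms(2)
proof (induction p)
  case (pCons a p)
  show ?case
  proof (cases "p = 0")
    case True
    hence "a \<noteq> 0" using pCons by auto
    hence "has_lead 0 (of_rat a) (rconst a)"
      using has_lead_mconst[of "of_rat a"] by (simp add: rconst_def)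
    thus ?thesis
      using True by (auto simp: hev_pCons[OF rhom_rconst])
  next
    case False
    then obtain c where c: "has_lead (- 2 * int (Polynomial.degree p)) c (qev p x)" using pCons by blast
    have "ordge 0 (rconst a)"
      unfolding ordge_def rconst_def using has_q_expansion_mconst[of 1 "of_rat a"]
      by (intro exI[of _ "fls_const (of_rat a)"]) auto
    hence "ordge (- 2 + (- 2 * int (Polynomial.degree p)) + 1) (rconst a)"
      by (rule ordge_mono) simp
    from has_lead_add[OF has_lead_times[OF x c] this] show ?thesis
      using False by (auto simp: hev_pCons[OF rhom_rconst])
  qed
qed simp

lemma qev_nonzero: "has_lead (- 2) 1 x \<Longrightarrow> p \<noteq> 0 \<Longrightarrow> qev p x \<noteq> 0"
  using has_lead_qev has_lead_nonzero by blast

text \<open>The pole order of the first summand is even and that of the second is odd, so they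
  cannot cancel.\<close>

lemma qev_independent:
  assumes x: "has_lead (- 2) 1 x" and y: "has_lead (- 3) 1 y" and eq: "qev a x + qev b x * y = 0"
  shows "a = 0 \<and> b = 0"
proof (cases "b = 0")
  case True
  thus ?thesis using eq qev_nonzero[OF x, of a] by auto
next
  case False
  then obtain c where c: "has_lead (- 2 * int (Polynomial.degree b)) c (qev b x)" using has_lead_qev[OF x] by blast
  note by' = has_lead_times[OF c y]
  have "a \<noteq> 0" using eq has_lead_nonzero[OF by'] by auto
  then obtain d where d: "has_lead (- 2 * int (Polynomial.degree a)) d (qev a x)" using has_lead_qev[OF x] by blast
  have "qev a x = mconst (- 1) * (qev b x * y)"
    using eq by (simp add: mconst_hom eq_neg_iff_add_eq_0)
  hence "has_lead (0 + (- 2 * int (Polynomial.degree b) + - 3)) (- 1 * (c * 1)) (qev a x)"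
    using has_lead_times[OF has_lead_mconst[of "- 1"] by'] by simp
  from has_lead_unique[OF this d] show ?thesis by presburger
qed

interpretation gens: xy_basis gen_x gen_y
  by unfold_locales (rule gen_xy_Rplus gen_xy_lead)+

lemma complex_relation:
  assumes f: "f \<in> K60"
  shows "\<exists>b p r p' r'. b \<noteq> 0 \<and> cev b gen_x * f = cev p gen_x + cev r gen_x * gen_y + (cev p' gen_x + cev r' gen_x * gen_y) * gen_t"
proof -
  define d :: "complex poly" where "d = [:- 1, 1, 1:] * [:- 1, 4, 1:] * [:1, - 1, 2, 1, 1:]"
  have d: "cev d gen_x = gen_t ^ 2"
    unfolding gen_t_equation d_def
    by (simp add: cev_mult cev_pCons mconst_hom mconst_numeral algebra_simps power2_eq_square power3_eq_cube power4_eq_xxxx del: mult_pCons_left mult_pCons_right)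
  have d0: "d \<noteq> 0" unfolding d_def by simp
  have "f + pullback W0 f \<in> K60" "pullback W0 (f + pullback W0 f) = f + pullback W0 f"
    by (intro K60_plus K60_W0 f, simp add: pullback_plus[OF det_W0] W0_W0)
  from gens.invariant_relation[OF this] obtain b1 p1 r1 where 1: "b1 \<noteq> 0"
    "cev b1 gen_x * (f + pullback W0 f) = cev p1 gen_x + cev r1 gen_x * gen_y" by blast
  have "(f - pullback W0 f) * gen_t \<in> K60" "pullback W0 ((f - pullback W0 f) * gen_t) = (f - pullback W0 f) * gen_t"
    by (intro K60_times K60_minus K60_W0 f gen_t_K60)
       (simp add: pullback_times[OF det_W0] pullback_minus[OF det_W0] W0_W0 gen_t_W0 algebra_simps)
  from gens.invariant_relation[OF this] obtain b2 p2 r2 where 2: "b2 \<noteq> 0"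
    "cev b2 gen_x * ((f - pullback W0 f) * gen_t) = cev p2 gen_x + cev r2 gen_x * gen_y" by blast
  \<comment> \<open>2 f is the sum of f + w(f) and f - w(f). The second, anti-invariant summand is
    made invariant by the factor t, and a further factor t turns this into multiplication by t^2 =
    d(x).\<close>
  have "cev (Polynomial.smult 2 (b1 * b2 * d)) gen_x * f =
     cev b2 gen_x * gen_t ^ 2 * (cev b1 gen_x * (f + pullback W0 f)) + cev b1 gen_x * gen_t * (cev b2 gen_x * ((f - pullback W0 f) * gen_t))"
    unfolding cev_smult cev_mult d mconst_numeral by (simp add: algebra_simps power2_eq_square)
  also have "\<dots> = cev (b2 * d * p1) gen_x + cev (b2 * d * r1) gen_x * gen_y + (cev (b1 * p2) gen_x + cev (b1 * r2) gen_x * gen_y) * gen_t"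
    unfolding 1(2) 2(2) cev_mult d by (simp add: algebra_simps power2_eq_square)
  finally have "cev (Polynomial.smult 2 (b1 * b2 * d)) gen_x * f = \<dots>" .
  moreover have "Polynomial.smult 2 (b1 * b2 * d) \<noteq> 0"
    using 1(1) 2(1) d0 by simp
  ultimately show ?thesis
    by blast
qed

lemma function_field_iff: "f \<in> function_field_X0 60 \<longleftrightarrow> f \<in> K60 \<and> rational_expansion f"
  by (simp add: function_field_X0_def rational_expansion_def)

lemma rational_relation:
  assumes "f \<in> function_field_X0 60"
  shows "\<exists>b p r p' r'. b \<noteq> 0 \<and> qev b gen_x * f = qev p gen_x + qev r gen_x * gen_y + (qev p' gen_x + qev r' gen_x * gen_y) * gen_t"
proof -
  have f: "f \<in> K60" "rational_expansion f"
    using assms by (auto simp: function_field_iff)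
  obtain b p r p' r' where b: "b \<noteq> 0" "cev b gen_x * f = cev p gen_x + cev r gen_x * gen_y + (cev p' gen_x + cev r' gen_x * gen_y) * gen_t"
    using complex_relation[OF f(1)] by blast
  obtain \<phi> :: "complex \<Rightarrow> rat" where \<phi>: "\<And>a b. \<phi> (a + b) = \<phi> a + \<phi> b" "\<And>r a. \<phi> (of_rat r * a) = r * \<phi> a" "\<phi> (Polynomial.lead_coeff b) = 1"
    by (rule rational_linear_functional[of "Polynomial.lead_coeff b"]) (use b(1) in simp, rule that)
  have \<phi>0: "\<phi> 0 = 0" using \<phi>(2)[of 0 0] by simp
  note im = expansion_image_hev[of \<phi>, OF \<phi>(1,2) gens_rational(1)]
  have r1: "rational_expansion 1" using rational_expansion_mconst[of 1] by simp
  have yt: "rational_expansion (gen_y * gen_t)" by (intro rational_expansion_times gens_rational)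
  have "cev b gen_x * f = ((cev p gen_x * 1 + cev r gen_x * gen_y) + cev p' gen_x * gen_t) + cev r' gen_x * (gen_y * gen_t)"
    unfolding b(2) by (simp add: algebra_simps)
  moreover have "expansion_image \<phi> (((cev p gen_x * 1 + cev r gen_x * gen_y) + cev p' gen_x * gen_t) + cev r' gen_x * (gen_y * gen_t))
     (((qev (map_poly \<phi> p) gen_x * 1 + qev (map_poly \<phi> r) gen_x * gen_y) + qev (map_poly \<phi> p') gen_x * gen_t) + qev (map_poly \<phi> r') gen_x * (gen_y * gen_t))"
    by (intro expansion_image_plus[of \<phi>, OF \<phi>(1,2)] im r1 gens_rational yt)
  ultimately have "qev (map_poly \<phi> b) gen_x * f = ((qev (map_poly \<phi> p) gen_x * 1 + qev (map_poly \<phi> r) gen_x * gen_y) + qev (map_poly \<phi> p') gen_x * gen_t) + qev (map_poly \<phi> r') gen_x * (gen_y * gen_t)"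
    using im[OF f(2), of b] expansion_image_unique[of \<phi>, OF \<phi>(1,2)] by metis
  hence "qev (map_poly \<phi> b) gen_x * f = qev (map_poly \<phi> p) gen_x + qev (map_poly \<phi> r) gen_x * gen_y + (qev (map_poly \<phi> p') gen_x + qev (map_poly \<phi> r') gen_x * gen_y) * gen_t"
    by (simp add: algebra_simps)
  \<comment> \<open>This is why \<phi> was normalised to 1 at the leading coefficient of the
    denominator.\<close>
  moreover have "map_poly \<phi> b \<noteq> 0"
    using \<phi>(3) \<phi>0 by (metis coeff_0 coeff_map_poly zero_neq_one)
  ultimately show ?thesis
    by blast
qed

section \<open>Generated subfields and the coordinate ring\<close>

lemma ring_of_type_algebra_simps [simp]:
  "carrier ring_of_type_algebra = UNIV" "x \<oplus>\<^bsub>ring_of_type_algebra\<^esub> y = x + y" "x \<otimes>\<^bsub>ring_of_type_algebra\<^esub> y = x * y"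
  "\<zero>\<^bsub>ring_of_type_algebra\<^esub> = 0" "\<one>\<^bsub>ring_of_type_algebra\<^esub> = 1"
  by (simp_all add: ring_of_type_algebra_def)

lemma a_inv_ring_of_type_algebra [simp]:
  fixes x :: "'a :: comm_ring_1"
  shows "\<ominus>\<^bsub>ring_of_type_algebra\<^esub> x = - x"
proof -
  interpret R: Ring.ring "ring_of_type_algebra :: 'a ring"
    by (rule ring_from_type_algebra)
  show ?thesis
    by (rule R.minus_equality) auto
qed

lemma m_inv_ring_of_type_algebra:
  fixes x :: "'a :: field"
  assumes "x \<noteq> 0"
  shows "inv\<^bsub>ring_of_type_algebra\<^esub> x = inverse x"
proof -
  interpret F: Ring.field "ring_of_type_algebra :: 'a ring"
    by (rule field_from_type_algebra)
  show ?thesis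
    by (rule F.comm_inv_char) (use assms in auto)
qed

lemma field_gen_incl: "a \<in> S \<Longrightarrow> a \<in> field_gen S"
  unfolding field_gen_def by (rule generate_field.incl)

lemma field_gen_plus: "a \<in> field_gen S \<Longrightarrow> b \<in> field_gen S \<Longrightarrow> a + b \<in> field_gen S"
  using generate_field.eng_add[of a ring_of_type_algebra S b] by (simp add: field_gen_def)

lemma field_gen_times: "a \<in> field_gen S \<Longrightarrow> b \<in> field_gen S \<Longrightarrow> a * b \<in> field_gen S"
  using generate_field.eng_mult[of a ring_of_type_algebra S b] by (simp add: field_gen_def)

lemma field_gen_uminus: "a \<in> field_gen S \<Longrightarrow> - a \<in> field_gen S"
  using generate_field.a_inv[of a ring_of_type_algebra S] by (simp add: field_gen_def)

lemma field_gen_1: "1 \<in> field_gen S"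
  using generate_field.one[of ring_of_type_algebra S] by (simp add: field_gen_def)

lemma field_gen_0: "0 \<in> field_gen S"
  using field_gen_plus[OF field_gen_1 field_gen_uminus[OF field_gen_1]] by simp

lemma field_gen_inverse: "a \<in> field_gen S \<Longrightarrow> inverse a \<in> field_gen S"
  using generate_field.m_inv[of a ring_of_type_algebra S] field_gen_0
  by (cases "a = 0") (auto simp: field_gen_def m_inv_ring_of_type_algebra)

lemma field_gen_least:
  fixes S :: "'a :: field set"
  assumes "S \<subseteq> A" "1 \<in> A" "\<And>a b. a \<in> A \<Longrightarrow> b \<in> A \<Longrightarrow> a + b \<in> A" "\<And>a b. a \<in> A \<Longrightarrow> b \<in> A \<Longrightarrow> a * b \<in> A"
    "\<And>a. a \<in> A \<Longrightarrow> - a \<in> A" "\<And>a. a \<in> A \<Longrightarrow> inverse a \<in> A"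
  shows "field_gen S \<subseteq> A"
proof
  fix a assume "a \<in> field_gen S"
  thus "a \<in> A"
    unfolding field_gen_def
    by (induction rule: generate_field.induct) (use assms in \<open>auto simp: m_inv_ring_of_type_algebra\<close>)
qed

lemma rconst_field_gen: "rconst r \<in> field_gen S"
proof -
  have nat: "of_nat n \<in> field_gen S" for n
    by (induction n) (auto intro: field_gen_0 field_gen_1 field_gen_plus)
  have int: "of_int k \<in> field_gen S" for k
  proof (cases k)
    case (nonneg n)
    thus ?thesis using nat[of n] by simp
  next
    case (neg n)
    thus ?thesis using field_gen_uminus[OF nat[of "Suc n"]] by simp
  qed
  obtain a b where r: "r = of_int a / of_int b" "b > 0"
    using quotient_of_div[of r] quotient_of_denom_pos[of r] by (metis prod.exhaust)
  have "rconst r = of_int a * inverse (of_int b)"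
    unfolding r(1) rconst_def by (simp add: divide_inverse of_rat_mult of_rat_inverse mconst_hom mconst_of_int)
  thus ?thesis
    using field_gen_times[OF int field_gen_inverse[OF int]] by simp
qed

lemma qev_field_gen:
  assumes "x \<in> field_gen S"
  shows "qev p x \<in> field_gen S"
  by (induction p) (auto simp: hev_pCons[OF rhom_rconst] intro!: field_gen_plus field_gen_times rconst_field_gen assms field_gen_0)

lemma function_field_closed:
  assumes "f \<in> function_field_X0 60" "g \<in> function_field_X0 60"
  shows "f + g \<in> function_field_X0 60" "f * g \<in> function_field_X0 60" "- f \<in> function_field_X0 60" "inverse f \<in> function_field_X0 60"
proof -
  have m: "- f = mconst (- 1) * f" by (simp add: mconst_hom)
  have "rational_expansion (mconst (- 1))" by (rule rational_expansion_mconst) simp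
  thus "- f \<in> function_field_X0 60"
    using assms unfolding function_field_iff m by (auto intro: K60_times K60_mconst rational_expansion_times)
qed (use assms in \<open>auto simp: function_field_iff intro: K60_plus K60_times K60_inverse rational_expansion_plus rational_expansion_times rational_expansion_inverse\<close>)

lemma function_field_rconst: "rconst r \<in> function_field_X0 60"
  unfolding function_field_iff rconst_def by (auto intro: K60_mconst rational_expansion_mconst)

lemma function_field_gens: "gen_x \<in> function_field_X0 60" "gen_y \<in> function_field_X0 60" "gen_t \<in> function_field_X0 60"
  using gens_rational gen_t_K60 gen_xy_Rplus Rplus_K60 by (auto simp: function_field_iff)

lemma quotient_representation:
  assumes f: "f \<in> function_field_X0 60"
  shows "\<exists>b p r p' r'. b \<noteq> 0 \<and> qev b gen_x \<noteq> 0 \<and>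
     f = (qev p gen_x + qev r gen_x * gen_y + (qev p' gen_x + qev r' gen_x * gen_y) * gen_t) / qev b gen_x"
proof -
  obtain b p r p' r' where b: "b \<noteq> 0" "qev b gen_x * f = qev p gen_x + qev r gen_x * gen_y + (qev p' gen_x + qev r' gen_x * gen_y) * gen_t"
    using rational_relation[OF f] by blast
  have "qev b gen_x \<noteq> 0" by (rule qev_nonzero[OF gen_xy_lead(1) b(1)])
  thus ?thesis using b by (metis nonzero_mult_div_cancel_left)
qed

lemma function_field_eq: "function_field_X0 60 = field_gen {gen_x, gen_y, gen_t}"
proof
  show "field_gen {gen_x, gen_y, gen_t} \<subseteq> function_field_X0 60"
    using function_field_rconst[of 1]
    by (intro field_gen_least) (auto simp: function_field_gens rconst_def intro: function_field_closed)
  show "function_field_X0 60 \<subseteq> field_gen {gen_x, gen_y, gen_t}"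
  proof
    fix f assume "f \<in> function_field_X0 60"
    then obtain b p r p' r' where f: "f = (qev p gen_x + qev r gen_x * gen_y + (qev p' gen_x + qev r' gen_x * gen_y) * gen_t) / qev b gen_x"
      using quotient_representation by blast
    have g: "gen_x \<in> field_gen {gen_x, gen_y, gen_t}" "gen_y \<in> field_gen {gen_x, gen_y, gen_t}" "gen_t \<in> field_gen {gen_x, gen_y, gen_t}"
      by (auto intro: field_gen_incl)
    show "f \<in> field_gen {gen_x, gen_y, gen_t}"
      unfolding f divide_inverse
      by (intro field_gen_plus field_gen_times field_gen_inverse qev_field_gen g)
  qed
qed

lemma qev_W0: "pullback W0 (qev p gen_x) = qev p gen_x"
proof -
  have "pullback W0 gen_x = gen_x" using gen_xy_Rplus(1) by (simp add: Rplus_def)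
  thus ?thesis
    by (induction p) (simp_all add: hev_pCons[OF rhom_rconst] pullback_plus[OF det_W0] pullback_times[OF det_W0] rconst_def pullback_mconst[OF det_W0] pullback_0[OF det_W0])
qed

lemma gen_y_W0: "pullback W0 gen_y = gen_y"
  using gen_xy_Rplus(2) by (simp add: Rplus_def)

lemma double_mero_eq_0: "u + u = (0 :: mero_uhp) \<Longrightarrow> u = 0"
proof -
  assume "u + u = 0"
  hence "mconst 2 * u = 0" by (simp add: mconst_numeral)
  moreover have "mconst 2 \<noteq> 0" using mconst_eq_iff[of 2 0] by simp
  ultimately show "u = 0" by simp
qed

lemma invariant_field_eq: "{f \<in> function_field_X0 60. atkin_lehner 60 15 f = f} = field_gen {gen_x, gen_y}"
proof
  have al: "atkin_lehner 60 15 f = pullback W0 f" if "f \<in> function_field_X0 60" for f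
    by (rule atkin_lehner_W0) (use that in \<open>simp add: function_field_iff\<close>)
  let ?A = "{f \<in> function_field_X0 60. pullback W0 f = f}"
  have A: "{f \<in> function_field_X0 60. atkin_lehner 60 15 f = f} = ?A"
    using al by auto
  have xW: "pullback W0 gen_x = gen_x" using gen_xy_Rplus(1) by (simp add: Rplus_def)
  show "field_gen {gen_x, gen_y} \<subseteq> {f \<in> function_field_X0 60. atkin_lehner 60 15 f = f}"
    unfolding A using function_field_rconst[of 1]
    by (intro field_gen_least)
       (auto simp: function_field_gens rconst_def xW gen_y_W0 pullback_plus[OF det_W0] pullback_times[OF det_W0]
          pullback_uminus[OF det_W0] pullback_inverse[OF det_W0] pullback_1[OF det_W0] intro: function_field_closed)
  show "{f \<in> function_field_X0 60. atkin_lehner 60 15 f = f} \<subseteq> field_gen {gen_x, gen_y}"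
    unfolding A
  proof safe
    fix f assume f: "f \<in> function_field_X0 60" "pullback W0 f = f"
    obtain b p r p' r' where b: "qev b gen_x \<noteq> 0" "f = (qev p gen_x + qev r gen_x * gen_y + (qev p' gen_x + qev r' gen_x * gen_y) * gen_t) / qev b gen_x"
      using quotient_representation[OF f(1)] by blast
    have e: "f * qev b gen_x = qev p gen_x + qev r gen_x * gen_y + (qev p' gen_x + qev r' gen_x * gen_y) * gen_t"
      using b by simp
    have "pullback W0 (f * qev b gen_x) = f * qev b gen_x"
      by (simp add: pullback_times[OF det_W0] f(2) qev_W0)
    \<comment> \<open>\<open>w\<close> fixes the denominator and reverses the sign of the part with
      t, so invariance of \<open>f\<close> makes twice that part equal to 0.\<close>
    hence "(qev p' gen_x + qev r' gen_x * gen_y) * gen_t + (qev p' gen_x + qev r' gen_x * gen_y) * gen_t = 0"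
      unfolding e by (simp add: pullback_plus[OF det_W0] pullback_times[OF det_W0] qev_W0 gen_y_W0 gen_t_W0 algebra_simps)
    hence "(qev p' gen_x + qev r' gen_x * gen_y) * gen_t = 0"
      by (rule double_mero_eq_0)
    hence f': "f = (qev p gen_x + qev r gen_x * gen_y) * inverse (qev b gen_x)"
      using b(2) by (simp add: divide_inverse)
    have g: "gen_x \<in> field_gen {gen_x, gen_y}" "gen_y \<in> field_gen {gen_x, gen_y}"
      by (auto intro: field_gen_incl)
    show "f \<in> field_gen {gen_x, gen_y}"
      unfolding f' by (intro field_gen_plus field_gen_times field_gen_inverse qev_field_gen g)
  qed
qed

section \<open>The ideal of relations between the three generators\<close>

definition ev3 :: "rat poly poly poly \<Rightarrow> mero_uhp"
  where "ev3 p = hev (\<lambda>p. hev (\<lambda>p. qev p gen_x) p gen_y) p gen_t"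

lemmas rhom1 = rhom_hev[OF rhom_rconst, of gen_x]
lemmas rhom2 = rhom_hev[OF rhom1, of gen_y]
lemmas rhom_ev3 = rhom_hev[OF rhom2, of gen_t, folded ev3_def]

lemma ev3_gens: "ev3 indetX = gen_x" "ev3 indetY = gen_y" "ev3 indetT = gen_t" "ev3 [:[:a:]:] = qev a gen_x"
  by (simp_all add: ev3_def hev_1[OF rhom_rconst] hev_1[OF rhom1] hev_pCons[OF rhom2] hev_pCons[OF rhom1] hev_pCons[OF rhom_rconst] rconst_def)

definition eqsXYT :: "rat poly poly poly set"
  where "eqsXYT = {indetY^2 - (indetX^3 + indetX^2 - indetX),
       indetT^2 - (-1 + indetX + indetX^2) * (-1 + 4 * indetX + indetX^2) *
                (1 - indetX + 2 * indetX^2 + indetX^3 + indetX^4)}"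

lemma ev3_simps: "ev3 (a + b) = ev3 a + ev3 b" "ev3 (a * b) = ev3 a * ev3 b" "ev3 (a - b) = ev3 a - ev3 b" "ev3 (- a) = - ev3 a"
  "ev3 (a ^ n) = ev3 a ^ n" "ev3 1 = 1" "ev3 0 = 0" "ev3 (numeral k) = numeral k"
  by (simp_all add: rhom_simps[OF rhom_ev3] rhom_minus[OF rhom_ev3] rhom_uminus[OF rhom_ev3] rhom_power[OF rhom_ev3] rhom_numeral[OF rhom_ev3])

lemma ev3_function_field: "ev3 p \<in> function_field_X0 60"
proof -
  have 0: "0 \<in> function_field_X0 60" using function_field_rconst[of 0] by (simp add: rconst_def)
  have 1: "qev p gen_x \<in> function_field_X0 60" for p
    by (induction p) (auto simp: hev_pCons[OF rhom_rconst] 0 intro!: function_field_closed(1,2) function_field_rconst function_field_gens)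
  have 2: "hev (\<lambda>p. qev p gen_x) p gen_y \<in> function_field_X0 60" for p
    by (induction p) (auto simp: hev_pCons[OF rhom1] 0 intro!: function_field_closed(1,2) 1 function_field_gens)
  show ?thesis unfolding ev3_def
    by (induction p) (auto simp: hev_pCons[OF rhom2] 0 intro!: function_field_closed(1,2) 2 function_field_gens)
qed

text \<open>The two equations are monic quadratics in Y and in T over \<rat>[X]. Division by them
  leaves a combination of 1, Y, T and Y T with coefficients in \<rat>[X]. The set of polynomials
  with such a remainder is closed under addition and under multiplication by Y and by T.\<close>

lemma normal_form:
  assumes I: "\<And>u v. u \<in> I \<Longrightarrow> v \<in> I \<Longrightarrow> u + v \<in> I" "\<And>u v. u \<in> I \<Longrightarrow> v * u \<in> I" "eqsXYT \<subseteq> I"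
  shows "\<exists>a b c d. p - ([:[:a:]:] + [:[:b:]:] * indetY + ([:[:c:]:] + [:[:d:]:] * indetY) * indetT) \<in> I"
proof -
  define nf :: "rat poly \<Rightarrow> rat poly \<Rightarrow> rat poly \<Rightarrow> rat poly \<Rightarrow> rat poly poly poly"
    where "nf a b c d = [:[:a:]:] + [:[:b:]:] * indetY + ([:[:c:]:] + [:[:d:]:] * indetY) * indetT" for a b c d
  define P where "P p \<longleftrightarrow> (\<exists>a b c d. p - nf a b c d \<in> I)" for p
  define gX :: "rat poly" where "gX = [:0, 1:] ^ 3 + [:0, 1:] ^ 2 - [:0, 1:]"
  define hX :: "rat poly" where "hX = (-1 + [:0, 1:] + [:0, 1:] ^ 2) * (-1 + 4 * [:0, 1:] + [:0, 1:] ^ 2) * (1 - [:0, 1:] + 2 * [:0, 1:] ^ 2 + [:0, 1:] ^ 3 + [:0, 1:] ^ 4)"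
  have lift: "[:[:a + b:]:] = [:[:a:]:] + [:[:b:]:]" "[:[:a * b:]:] = [:[:a:]:] * [:[:b:]:]" "[:[:a - b:]:] = [:[:a:]:] - [:[:b:]:]"
    "[:[:- a:]:] = - [:[:a:]:]" for a b :: "rat poly"
    by simp_all
  have lift1: "[:[:1:]:] = (1 :: rat poly poly poly)" by (simp add: one_pCons)
  have liftn: "[:[:numeral k:]:] = (numeral k :: rat poly poly poly)" for k
    by (simp add: numeral_poly)
  have liftp: "[:[:a ^ n:]:] = [:[:a:]:] ^ n" for a :: "rat poly" and n
    by (induction n) (simp_all add: lift1 lift(2))
  have gY: "indetY ^ 2 - [:[:gX:]:] \<in> I"
    using I(3) unfolding eqsXYT_def gX_def lift liftp by blast
  have hT: "indetT ^ 2 - [:[:hX:]:] \<in> I"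
    using I(3) unfolding eqsXYT_def hX_def lift liftp lift1 liftn by blast
  have I0: "0 \<in> I" using I(2)[OF gY, of 0] by simp
  have Padd: "P (u + v)" if u: "P u" and v: "P v" for u v
  proof -
    obtain a b c d where 1: "u - nf a b c d \<in> I" using u by (auto simp: P_def)
    obtain a' b' c' d' where 2: "v - nf a' b' c' d' \<in> I" using v by (auto simp: P_def)
    have "u + v - nf (a + a') (b + b') (c + c') (d + d') = (u - nf a b c d) + (v - nf a' b' c' d')"
      unfolding nf_def lift by (simp only: algebra_simps)
    thus ?thesis unfolding P_def using I(1)[OF 1 2] by metis
  qed
  have PY: "P (indetY * u)" if u: "P u" for u
  proof -
    obtain a b c d where 1: "u - nf a b c d \<in> I" using u by (auto simp: P_def)
    have "indetY * u - nf (b * gX) a (d * gX) c = indetY * (u - nf a b c d) + ([:[:b:]:] + [:[:d:]:] * indetT) * (indetY ^ 2 - [:[:gX:]:])"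
      unfolding nf_def lift power2_eq_square by (simp only: algebra_simps)
    thus ?thesis unfolding P_def using I(1)[OF I(2)[OF 1] I(2)[OF gY]] by metis
  qed
  have PT: "P (indetT * u)" if u: "P u" for u
  proof -
    obtain a b c d where 1: "u - nf a b c d \<in> I" using u by (auto simp: P_def)
    have "indetT * u - nf (c * hX) (d * hX) a b = indetT * (u - nf a b c d) + ([:[:c:]:] + [:[:d:]:] * indetY) * (indetT ^ 2 - [:[:hX:]:])"
      unfolding nf_def lift power2_eq_square by (simp only: algebra_simps)
    thus ?thesis unfolding P_def using I(1)[OF I(2)[OF 1] I(2)[OF hT]] by metis
  qed
  have P1: "P [:[:a:]:]" for a
    unfolding P_def nf_def by (rule exI[of _ a], rule exI[of _ 0], rule exI[of _ 0], rule exI[of _ 0]) (simp add: I0)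
  have P2: "P [:u:]" for u
  proof (induction u)
    case 0
    show ?case using P1[of 0] by simp
  next
    case (pCons a u)
    have "[:pCons a u:] = [:[:a:]:] + indetY * [:u:]" by simp
    thus ?case using Padd[OF P1 PY[OF pCons(2)]] by metis
  qed
  have "P p"
  proof (induction p)
    case 0
    show ?case using P1[of 0] by simp
  next
    case (pCons u p)
    have "pCons u p = [:u:] + indetT * p" by simp
    thus ?case using Padd[OF P2 PT[OF pCons(2)]] by metis
  qed
  thus ?thesis unfolding P_def nf_def .
qed

lemma genideal_eqsXYT: "genideal QXYT eqsXYT = {p. ev3 p = 0}"
proof
  interpret Q: cring QXYT by (rule cring_from_type_algebra)
  interpret F: Ring.field "ring_of_type_algebra :: mero_uhp ring" by (rule field_from_type_algebra)
  interpret H: ring_hom_ring QXYT "ring_of_type_algebra :: mero_uhp ring" ev3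
    by (rule ring_hom_ringI2[OF Q.ring_axioms F.ring_axioms]) (auto simp: ring_hom_def ev3_simps)
  have "ideal {p. ev3 p = 0} QXYT"
    using H.kernel_is_ideal unfolding a_kernel_def' by simp
  moreover have "eqsXYT \<subseteq> {p. ev3 p = 0}"
    unfolding eqsXYT_def
    by (simp only: ev3_simps ev3_gens(1-3) gen_xy_equation gen_t_equation insert_subset empty_subsetI mem_Collect_eq diff_self simp_thms)
  ultimately show "genideal QXYT eqsXYT \<subseteq> {p. ev3 p = 0}"
    by (rule Q.genideal_minimal)
  interpret I: ideal "genideal QXYT eqsXYT" QXYT
    by (rule Q.genideal_ideal) simp
  show "{p. ev3 p = 0} \<subseteq> genideal QXYT eqsXYT"
  proof
    fix p assume "p \<in> {p. ev3 p = 0}"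
    hence p: "ev3 p = 0" by simp
    have "\<exists>a b c d. p - ([:[:a:]:] + [:[:b:]:] * indetY + ([:[:c:]:] + [:[:d:]:] * indetY) * indetT) \<in> genideal QXYT eqsXYT"
    proof (rule normal_form)
      show "u + v \<in> genideal QXYT eqsXYT" if "u \<in> genideal QXYT eqsXYT" "v \<in> genideal QXYT eqsXYT" for u v
        using I.a_closed[OF that] by simp
      show "v * u \<in> genideal QXYT eqsXYT" if "u \<in> genideal QXYT eqsXYT" for u v
        using I.I_l_closed[OF that, of v] by simp
      show "eqsXYT \<subseteq> genideal QXYT eqsXYT"
        by (rule Q.genideal_self) simp
    qed
    then obtain a b c d where abcd: "p - ([:[:a:]:] + [:[:b:]:] * indetY + ([:[:c:]:] + [:[:d:]:] * indetY) * indetT) \<in> genideal QXYT eqsXYT"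
      by blast
    with \<open>genideal QXYT eqsXYT \<subseteq> {p. ev3 p = 0}\<close>
    have "ev3 (p - ([:[:a:]:] + [:[:b:]:] * indetY + ([:[:c:]:] + [:[:d:]:] * indetY) * indetT)) = 0"
      by blast
    hence 1: "qev a gen_x + qev b gen_x * gen_y + (qev c gen_x + qev d gen_x * gen_y) * gen_t = 0"
      unfolding ev3_simps ev3_gens p by (simp only: diff_0 neg_equal_0_iff_equal)
    \<comment> \<open>Comparison with the image under \<open>w\<close> separates the parts with and
      without t. After division by t, each part falls to \<open>qev_independent\<close>.\<close>
    hence "pullback W0 (qev a gen_x + qev b gen_x * gen_y + (qev c gen_x + qev d gen_x * gen_y) * gen_t) = pullback W0 0"
      by simp
    hence 2: "qev a gen_x + qev b gen_x * gen_y - (qev c gen_x + qev d gen_x * gen_y) * gen_t = 0"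
      by (simp add: pullback_plus[OF det_W0] pullback_times[OF det_W0] qev_W0 gen_y_W0 gen_t_W0 pullback_0[OF det_W0])
    have "(qev a gen_x + qev b gen_x * gen_y) + (qev a gen_x + qev b gen_x * gen_y) = 0"
      using arg_cong2[OF 1 2, of "(+)"] by simp
    hence 3: "qev a gen_x + qev b gen_x * gen_y = 0"
      by (rule double_mero_eq_0)
    hence 4: "qev c gen_x + qev d gen_x * gen_y = 0"
      using 1 gen_t_nonzero by simp
    have "a = 0" "b = 0" "c = 0" "d = 0"
      using qev_independent[OF gen_xy_lead 3] qev_independent[OF gen_xy_lead 4] by auto
    thus "p \<in> genideal QXYT eqsXYT"
      using abcd by simp
  qed
qed

text \<open>The ideal of the equations is the kernel of a map into a field, so it is prime without
  any factorisation argument, and the quotient embeds by the first isomorphism theorem. That all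
  functions are fractions is \<open>quotient_representation\<close>.\<close>

lemma equations_for_function_field:
  "equations_for eqsXYT (function_field_X0 60) gen_x gen_y gen_t"
proof -
  define S where "S = (ring_of_type_algebra :: mero_uhp ring)\<lparr>carrier := function_field_X0 60\<rparr>"
  define I where "I = genideal QXYT eqsXYT"
  interpret Q: cring QXYT by (rule cring_from_type_algebra)
  interpret F: Ring.field "ring_of_type_algebra :: mero_uhp ring" by (rule field_from_type_algebra)
  have "subring (function_field_X0 60) (ring_of_type_algebra :: mero_uhp ring)"
    using function_field_rconst[of 1] by (intro F.subringI) (auto simp: rconst_def intro: function_field_closed)
  hence S: "ring S" unfolding S_def by (rule F.subring_is_ring)
  have hom: "ring_hom_ring QXYT S ev3"
    by (rule ring_hom_ringI2[OF Q.ring_axioms S])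
       (auto simp: ring_hom_def S_def ev3_simps ev3_function_field)
  interpret H: ring_hom_ring QXYT S ev3 by (rule hom)
  have K: "a_kernel QXYT S ev3 = I"
    unfolding I_def genideal_eqsXYT a_kernel_def' S_def by simp
  have I_iff: "p \<in> I \<longleftrightarrow> ev3 p = 0" for p
    unfolding I_def genideal_eqsXYT by simp
  have "primeideal I QXYT"
  proof (rule primeidealI)
    show "ideal I QXYT" unfolding I_def by (rule Q.genideal_ideal) simp
    show "cring QXYT" by (rule Q.cring_axioms)
    show "carrier QXYT \<noteq> I" using I_iff[of 1] by (auto simp: ev3_simps)
    show "a \<in> I \<or> b \<in> I" if "a \<otimes>\<^bsub>QXYT\<^esub> b \<in> I" for a b
      using that by (simp add: I_iff ev3_simps)
  qed
  hence dom: "domain (coordinate_ring eqsXYT)"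
    unfolding coordinate_ring_def I_def by (rule primeideal.quotient_is_domain)
  \<comment> \<open>\<open>ev3\<close> is constant on each coset of the kernel, so its image of a
    coset is a singleton.\<close>
  define \<phi> where "\<phi> = (\<lambda>C. the_elem (ev3 ` C))"
  have \<phi>: "\<phi> (I +>\<^bsub>QXYT\<^esub> p) = ev3 p" for p
    using H.the_elem_simp[of p] unfolding K \<phi>_def by simp
  have cr: "coordinate_ring eqsXYT = QXYT Quot I"
    by (simp add: coordinate_ring_def I_def)
  have \<phi>_hom: "\<phi> \<in> ring_hom (coordinate_ring eqsXYT) S"
    using H.the_elem_hom unfolding K cr \<phi>_def .
  have \<phi>_inj: "inj_on \<phi> (carrier (coordinate_ring eqsXYT))"
    using H.the_elem_inj unfolding K cr \<phi>_def by (intro inj_onI) blast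
  have mem: "I +>\<^bsub>QXYT\<^esub> p \<in> carrier (coordinate_ring eqsXYT)" for p
    unfolding cr FactRing_def A_RCOSETS_def' by auto
  have frac: "function_field_X0 60 = {\<phi> a / \<phi> b | a b. a \<in> carrier (coordinate_ring eqsXYT) \<and> b \<in> carrier (coordinate_ring eqsXYT) \<and> \<phi> b \<noteq> 0}"
  proof (intro equalityI subsetI)
    fix f assume "f \<in> function_field_X0 60"
    then obtain b p r p' r' where b: "qev b gen_x \<noteq> 0" "f = (qev p gen_x + qev r gen_x * gen_y + (qev p' gen_x + qev r' gen_x * gen_y) * gen_t) / qev b gen_x"
      using quotient_representation by blast
    define n where "n = [:[:p:]:] + [:[:r:]:] * indetY + ([:[:p':]:] + [:[:r':]:] * indetY) * indetT"
    have n: "ev3 n = qev p gen_x + qev r gen_x * gen_y + (qev p' gen_x + qev r' gen_x * gen_y) * gen_t"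
      unfolding n_def ev3_simps ev3_gens ..
    have "f = \<phi> (I +>\<^bsub>QXYT\<^esub> n) / \<phi> (I +>\<^bsub>QXYT\<^esub> [:[:b:]:])"
      unfolding \<phi> n ev3_gens by (rule b(2))
    moreover have "\<phi> (I +>\<^bsub>QXYT\<^esub> [:[:b:]:]) \<noteq> 0"
      unfolding \<phi> ev3_gens by (rule b(1))
    ultimately show "f \<in> {\<phi> a / \<phi> b | a b. a \<in> carrier (coordinate_ring eqsXYT) \<and> b \<in> carrier (coordinate_ring eqsXYT) \<and> \<phi> b \<noteq> 0}"
      using mem by blast
  next
    fix f assume "f \<in> {\<phi> a / \<phi> b | a b. a \<in> carrier (coordinate_ring eqsXYT) \<and> b \<in> carrier (coordinate_ring eqsXYT) \<and> \<phi> b \<noteq> 0}"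
    then obtain a b where ab: "f = \<phi> a / \<phi> b" "a \<in> carrier (coordinate_ring eqsXYT)" "b \<in> carrier (coordinate_ring eqsXYT)"
      by blast
    have "\<phi> a \<in> function_field_X0 60" "\<phi> b \<in> function_field_X0 60"
      using ring_hom_closed[OF \<phi>_hom ab(2)] ring_hom_closed[OF \<phi>_hom ab(3)] by (simp_all add: S_def)
    thus "f \<in> function_field_X0 60"
      unfolding ab(1) divide_inverse by (intro function_field_closed(2) function_field_closed(4))
  qed
  show ?thesis
    unfolding equations_for_def
  proof (intro conjI bexI[of _ \<phi>])
    show "\<phi> \<in> ring_hom (coordinate_ring eqsXYT) (ring_of_type_algebra\<lparr>carrier := function_field_X0 60\<rparr>)"
      using \<phi>_hom unfolding S_def .
  qed (use dom \<phi>_inj frac \<phi> ev3_gens in \<open>simp_all add: I_def\<close>)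
qed

theorem mainTheorem14:
  shows "\<exists>x y t. x \<in> function_field_X0 60 \<and> y \<in> function_field_X0 60 \<and> t \<in> function_field_X0 60 \<and>
    function_field_X0 60 = field_gen {x, y, t} \<and>
    {f \<in> function_field_X0 60. atkin_lehner 60 15 f = f} = field_gen {x, y} \<and>
    atkin_lehner 60 15 t = - t \<and>
    y^2 = x^3 + x^2 - x \<and>
    t^2 = (-1 + x + x^2) * (-1 + 4 * x + x^2) * (1 - x + 2 * x^2 + x^3 + x^4) \<and>
    equations_for
      {indetY^2 - (indetX^3 + indetX^2 - indetX),
       indetT^2 - (-1 + indetX + indetX^2) * (-1 + 4 * indetX + indetX^2) *
                (1 - indetX + 2 * indetX^2 + indetX^3 + indetX^4)}
      (function_field_X0 60) x y t"
proof (intro exI conjI)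
  show "atkin_lehner 60 15 gen_t = - gen_t"
    using atkin_lehner_W0[OF gen_t_K60] gen_t_W0 by simp
  show "equations_for
      {indetY^2 - (indetX^3 + indetX^2 - indetX),
       indetT^2 - (-1 + indetX + indetX^2) * (-1 + 4 * indetX + indetX^2) *
                (1 - indetX + 2 * indetX^2 + indetX^3 + indetX^4)}
      (function_field_X0 60) gen_x gen_y gen_t"
    using equations_for_function_field unfolding eqsXYT_def .
qed (fact function_field_gens function_field_eq invariant_field_eq gen_xy_equation gen_t_equation)+

end
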